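(* Assume that $\boldsymbol\mu$ satisfies the exponential moment condition, strong irreducibility, the contracting property, has zero upper Lyapunov exponent, and satisfies the uniform positivity condition (all defined in the context). 1. For any $x\in\mathbb X$ and $y>0$ the limit $$V(x,y)=\lim_{n\to+\infty}\mathbb E_x\left(y+S_n;\tau_y>n\right)$$ exists and satisfies $V(x,y)>0$. Moreover, for any $x\in\mathbb X$ the function $V(x,\cdot)$ is increasing on $(0,\infty)$ (that is, $0<y\le y'$ implies $V(x,y)\le V(x,y')$); there exist constants $a>0$ and $c>0$ such that for any $x\in\mathbb X$ and $y>0$, $\max(0,y-a)\le V(x,y)\le c(1+y)$; and for any $x\in\mathbb X$, $\lim_{y\to+\infty}V(x,y)/y=1$. 2. For any $x\in\mathbb X$ and $y>0$, $$\mathbb E_x\left(V(X_1,y+S_1);\tau_y>1\right)=V(x,y).$$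
   Context: Let $d\ge1$, $\mathbb V=\mathbb R^d$ with the Euclidean norm $\|\cdot\|$, $\mathbb G=GL(d,\mathbb R)$ with the operator norm, and $N(g)=\max\{\|g\|,\|g^{-1}\|\}$. $\mathbb P(\mathbb V)$ is the projective space; for $v\in\mathbb V\setminus\{0\}$, $\overline v=\mathbb Rv$, and $g\cdot\overline v=\overline{gv}$. Let $\boldsymbol\mu$ be a Borel probability measure on $\mathbb G$ and $\Gamma_{\boldsymbol\mu}$ the smallest closed semigroup containing its support. Put $\rho(g,\overline v)=\log\frac{\|gv\|}{\|v\|}$. Conditions on $\boldsymbol\mu$: - Exponential moment condition: there is $\delta_0>0$ with $\int_{\mathbb G}N(g)^{\delta_0}\boldsymbol\mu(dg)<+\infty$. - Strong irreducibility: no finite union of proper nonzero subspaces of $\mathbb V$ is invariant under all elements of $\Gamma_{\boldsymbol\mu}$. - Contracting property: $\Gamma_{\boldsymbol\mu}$ contains a sequence $(h_n)$ such that $\|h_n\|^{-1}h_n$ converges to a rank $1$ matrix. - Zero upper Lyapunov exponent: $\gamma_{\boldsymbol\mu}=\int\int\rho(g,\overline v)\,\boldsymbol\mu(dg)\,\boldsymbol\nu(d\overline v)=0$, where $\boldsymbol\nu$ is the $\boldsymbol\mu$-invariant probability measure on $\mathbb P(\mathbb V)$ (i.e. $\boldsymbol\mu*\boldsymbol\nu=\boldsymbol\nu$), which is unique under the previous three conditions. - Uniform positivity condition: there is $\delta>0$ with $\inf_{s\in\mathbb S^{d-1}}\boldsymbol\mu(\{g:\log\|gs\|>\delta\})>0$.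 Markov chain: $\mathbb X=\mathbb G\times\mathbb P(\mathbb V)$; $(g_n)_{n\ge1}$ are i.i.d. with law $\boldsymbol\mu$. For $X_0=x=(g,\overline v)\in\mathbb X$ set $X_1=(g_1,g\cdot\overline v)$ and $X_{n+1}=(g_{n+1},g_n\cdots g_1g\cdot\overline v)$, $n\ge1$. $\mathbb P_x,\mathbb E_x$ denote the law and expectation of the chain started at $x$. $S_0=0$, $S_n=\sum_{k=1}^n\rho(X_k)$, and for $y>0$, $\tau_y=\min\{n\ge1:y+S_n\le0\}$. Notation: $\mathbb E(Z;A)=\mathbb E(Z1_A)$. *)

theory Defs
  imports "HOL-Probability.Probability"
begin

type_synonym 'n mat = "real ^ 'n ^ 'n"

text \<open>A line \<open>\<real>v\<close> is represented by the set \<open>span {v}\<close>.\<close>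
type_synonym 'n line = "(real ^ 'n) set"

definition GL :: "'n::finite mat set" where
  "GL = {A. invertible A}"

text \<open>The type class norm on matrices is the Euclidean norm of the entries, hence the explicit
  operator norm.\<close>
definition opnorm :: "'n::finite mat \<Rightarrow> real" where
  "opnorm A = onorm ((*v) A)"

definition matN :: "'n::finite mat \<Rightarrow> real" where
  "matN A = max (opnorm A) (opnorm (matrix_inv A))"

definition proj_space :: "'n::finite line set" where
  "proj_space = {span {v} |v. v \<noteq> 0}"

text \<open>Borel sigma-algebra of the quotient topology induced by \<open>v \<mapsto> span {v}\<close> on nonzero vectors.\<close>
definition proj_borel :: "'n::finite line measure" where
  "proj_borel =
     sigma proj_space {U. U \<subseteq> proj_space \<and> open {v. v \<noteq> 0 \<and> span {v} \<in> U}}"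

definition act :: "'n::finite mat \<Rightarrow> 'n line \<Rightarrow> 'n line" where
  "act A l = (*v) A ` l"

definition rho :: "'n::finite mat \<times> 'n line \<Rightarrow> real" where
  "rho = (\<lambda>(A, l). THE r. \<forall>v\<in>l - {0}. r = ln (norm (A *v v) / norm v))"

lemma act_span: "act A (span {v}) = span {A *v v}"
  using linear_span_image[OF matrix_vector_mul_linear, of A "{v}"] by (simp add: act_def)

lemma rho_span:
  fixes v :: "real ^ 'n::finite"
  assumes "v \<noteq> 0"
  shows "rho (A, span {v}) = ln (norm (A *v v) / norm v)"
proof -
  have *: "norm (A *v w) / norm w = norm (A *v v) / norm v" if w: "w \<in> span {v} - {0}" for w
  proof -
    obtain c where c: "w = c *\<^sub>R v"
      using w by (auto simp: span_singleton)
    moreover have "c \<noteq> 0"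
      using w c by auto
    ultimately show ?thesis
      by (simp add: matrix_vector_mult_scaleR)
  qed
  have "v \<in> span {v} - {0}"
    using assms by (simp add: span_base)
  then show ?thesis
    unfolding rho_def prod.case using * by (intro the_equality) (metis, metis)
qed

definition borel_prob_on_GL :: "'n::finite mat measure \<Rightarrow> bool" where
  "borel_prob_on_GL \<mu> \<longleftrightarrow> prob_space \<mu> \<and> sets \<mu> = sets (restrict_space borel GL)"

definition supp :: "'n::finite mat measure \<Rightarrow> 'n mat set" where
  "supp \<mu> = {A \<in> GL. \<forall>U. open U \<and> A \<in> U \<longrightarrow> measure \<mu> (U \<inter> GL) > 0}"

text \<open>Closedness is relative to \<open>GL\<close>, not to the space of all matrices.\<close>
definition Gamma :: "'n::finite mat measure \<Rightarrow> 'n mat set" where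
  "Gamma \<mu> =
     (\<lambda>T. closedin (top_of_set GL) T \<and> (\<forall>A\<in>T. \<forall>B\<in>T. A ** B \<in> T)) hull (supp \<mu>)"

definition exponential_moment :: "'n::finite mat measure \<Rightarrow> bool" where
  "exponential_moment \<mu> \<longleftrightarrow>
     (\<exists>\<delta>\<^sub>0>0. (\<integral>\<^sup>+ A. ennreal (matN A powr \<delta>\<^sub>0) \<partial>\<mu>) < \<infinity>)"

definition strongly_irreducible :: "'n::finite mat measure \<Rightarrow> bool" where
  "strongly_irreducible \<mu> \<longleftrightarrow>
     \<not> (\<exists>\<W> :: (real ^ 'n) set set.
          finite \<W> \<and> \<W> \<noteq> {} \<and>
          (\<forall>W\<in>\<W>. subspace W \<and> W \<noteq> {0} \<and> W \<noteq> UNIV) \<and>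
          (\<forall>A\<in>Gamma \<mu>. (*v) A ` (\<Union>\<W>) \<subseteq> \<Union>\<W>))"

definition contracting :: "'n::finite mat measure \<Rightarrow> bool" where
  "contracting \<mu> \<longleftrightarrow>
     (\<exists>h L. (\<forall>k::nat. h k \<in> Gamma \<mu>) \<and> rank L = 1 \<and>
        (\<lambda>k. inverse (opnorm (h k)) *\<^sub>R h k) \<longlonglongrightarrow> L)"

text \<open>\<open>\<nu>\<close> is a probability measure with \<open>\<mu> * \<nu> = \<nu>\<close>.\<close>
definition invariant_prob :: "'n::finite mat measure \<Rightarrow> 'n line measure \<Rightarrow> bool" where
  "invariant_prob \<mu> \<nu> \<longleftrightarrow>
     prob_space \<nu> \<and> sets \<nu> = sets proj_borel \<and>
     distr (\<mu> \<Otimes>\<^sub>M \<nu>) proj_borel (\<lambda>(A, l). act A l) = \<nu>"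

definition lyapunov :: "'n::finite mat measure \<Rightarrow> 'n line measure \<Rightarrow> real" where
  "lyapunov \<mu> \<nu> = (\<integral>l. (\<integral>A. rho (A, l) \<partial>\<mu>) \<partial>\<nu>)"

definition uniformly_positive :: "'n::finite mat measure \<Rightarrow> bool" where
  "uniformly_positive \<mu> \<longleftrightarrow>
     (\<exists>\<delta>>0. (INF s\<in>sphere (0 :: real ^ 'n) 1.
               measure \<mu> {A \<in> space \<mu>. ln (norm (A *v s)) > \<delta>}) > 0)"

definition iid_with_law :: "'w measure \<Rightarrow> (nat \<Rightarrow> 'w \<Rightarrow> 'n::finite mat) \<Rightarrow> 'n mat measure \<Rightarrow> bool" where
  "iid_with_law M g \<mu> \<longleftrightarrow>
     prob_space M \<and> prob_space.indep_vars M (\<lambda>_. \<mu>) g {1..} \<and>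
     (\<forall>n\<ge>1. distr M \<mu> (g n) = \<mu>)"

definition state_space :: "('n::finite mat \<times> 'n line) set" where
  "state_space = GL \<times> proj_space"

text \<open>\<open>left_prod h n\<close> is \<open>h\<^sub>n \<cdots> h\<^sub>1\<close>.\<close>
primrec left_prod :: "(nat \<Rightarrow> 'n::finite mat) \<Rightarrow> nat \<Rightarrow> 'n mat" where
  "left_prod h 0 = mat 1"
| "left_prod h (Suc n) = h (Suc n) ** left_prod h n"

text \<open>In \<open>chain\<close>, \<open>walk\<close> and \<open>exit_time\<close>, \<open>h\<close> is one realization of the sequence
  \<open>g\<^sub>1, g\<^sub>2, \<dots>\<close>; the value \<open>h 0\<close> is never used.\<close>
primrec chain :: "(nat \<Rightarrow> 'n::finite mat) \<Rightarrow> 'n mat \<times> 'n line \<Rightarrow> nat \<Rightarrow> 'n mat \<times> 'n line" where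
  "chain h x 0 = x"
| "chain h x (Suc n) = (h (Suc n), act (left_prod h n ** fst x) (snd x))"

definition walk :: "(nat \<Rightarrow> 'n::finite mat) \<Rightarrow> 'n mat \<times> 'n line \<Rightarrow> nat \<Rightarrow> real" where
  "walk h x n = (\<Sum>k=1..n. rho (chain h x k))"

text \<open>The infimum of the empty set is \<open>\<infinity>\<close>.\<close>
definition exit_time :: "(nat \<Rightarrow> 'n::finite mat) \<Rightarrow> 'n mat \<times> 'n line \<Rightarrow> real \<Rightarrow> enat" where
  "exit_time h x y = (INF n\<in>{n. n \<ge> 1 \<and> y + walk h x n \<le> 0}. enat n)"

definition survives ::
  "'w measure \<Rightarrow> (nat \<Rightarrow> 'w \<Rightarrow> 'n::finite mat) \<Rightarrow> 'n mat \<times> 'n line \<Rightarrow> real \<Rightarrow> nat \<Rightarrow> 'w set" where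
  "survives M g x y n = {\<omega> \<in> space M. exit_time (\<lambda>k. g k \<omega>) x y > enat n}"

text \<open>\<open>E\<^sub>x (y + S\<^sub>n; \<tau>\<^sub>y > n)\<close>\<close>
definition killed_expectation ::
  "'w measure \<Rightarrow> (nat \<Rightarrow> 'w \<Rightarrow> 'n::finite mat) \<Rightarrow> 'n mat \<times> 'n line \<Rightarrow> real \<Rightarrow> nat \<Rightarrow> real" where
  "killed_expectation M g x y n =
     (LINT \<omega>:survives M g x y n|M. y + walk (\<lambda>k. g k \<omega>) x n)"

definition V ::
  "'w measure \<Rightarrow> (nat \<Rightarrow> 'w \<Rightarrow> 'n::finite mat) \<Rightarrow> 'n mat \<times> 'n line \<Rightarrow> real \<Rightarrow> real" where
  "V M g x y = lim (killed_expectation M g x y)"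

end

theory Submission
  imports Defs
begin

text \<open>The killed walk is compared with a martingale. Let \<open>S\<^sub>n(u) = ln (norm (A\<^sub>n \<cdots> A\<^sub>1 u) / norm u)\<close> for a
  vector \<open>u\<close>. Its mean \<open>mean n u\<close> is bounded in \<open>n\<close> and \<open>u\<close> (\<open>mean_bounded\<close>), so that \<open>S\<^sub>n\<close> is a
  martingale up to a bounded error, also after every stopping time. Hence the killed expectation at
  time \<open>n\<close> equals \<open>y\<close> plus the mean overshoot below \<open>0\<close> of the paths that have exited by then, up to a
  bounded error; if that overshoot has a mean bounded in \<open>y\<close>, then the killed expectations stay at a
  bounded distance from \<open>y\<close>, and they are a Cauchy sequence, because both the error after time \<open>N\<close> and the
  overshoots after time \<open>N\<close> are small for large \<open>N\<close>. The limit inherits the bounds and the one-step identity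
  (dominated convergence), and is positive, because uniform positivity leads the walk from any height
  to one at which the lower bound is positive.

  Two estimates carry this. The first is the bound on \<open>mean\<close>. Under the stationary measure the mean is
  \<open>n\<close> times the Lyapunov exponent, that is \<open>0\<close>; so it is enough to bound the oscillation of \<open>mean n\<close>. It is
  at most the sum over \<open>k\<close> of the mean of a power of the distance of the images of two lines at time \<open>k\<close>
  (\<open>sum_pdist_powr\<close>). As the distance of the images is quartered after a fixed time with probability
  \<open>1 / 2\<close> (\<open>pdist_contracts\<close>), the Markov property bounds the number of times which it spends at a given
  scale. That contraction follows in turn from the decay of the distance of the product to the rank one
  matrices (\<open>sum_rratio_powr\<close>), which has the same form: the number of times spent at a given scale has
  bounded expectation. Here the reason is a bounded martingale. The stationary mean of a function of the
  line \<open>A x\<close>, as a function of the matrix \<open>A\<close>, is harmonic, and the squared increments of a bounded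
  martingale have a bounded sum. For functions that resolve the scale at which \<open>A\<close> differs from rank one,
  the increment cannot be small: right multiplication by elements of the semigroup close to rank
  one changes the mean by a fixed amount (\<open>variation_lower_bound\<close>). Strong irreducibility enters through
  Furstenberg's argument (\<open>invariant_finite_family\<close>), which shows that the stationary measure charges no
  hyperplane and that the image of a fixed vector is almost surely not negligible compared with the norm of the
  product.

  The second estimate is the bound on the overshoot (\<open>overshoot_bound\<close>). A jump over the height \<open>z\<close> has
  a probability exponentially small in \<open>z\<close> by the moment condition, so the expected number of times
  that the surviving walk spends below \<open>z\<close> has to grow slower than exponentially. It is of order \<open>z\<^sup>2\<close>
  (\<open>green_bound\<close>): whatever its position below \<open>z\<close>, the walk exits within time of order \<open>z\<^sup>2\<close> with a fixed
  probability. For this the variance has to grow linearly and the fourth moment at most quadratically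
  (\<open>variance_grows\<close>, \<open>centred_Sn_moment\<close>).

  Independent matrices are modelled on the space of streams, where the Markov property is the invariance
  of the law under the replacement of the tail by an independent stream, and lines are represented by
  vectors; the last two parts translate back.\<close>

section \<open>Operator norm and bivectors\<close>

lemma norm_mult_vec_le: "norm (A *v x) \<le> opnorm A * norm x" for A :: "'n::finite mat"
  unfolding opnorm_def by (rule onorm) (simp add: matrix_vector_mul_bounded_linear)

lemma opnorm_nonneg [simp]: "0 \<le> opnorm (A :: 'n::finite mat)"
  unfolding opnorm_def by (rule onorm_pos_le) (simp add: matrix_vector_mul_bounded_linear)

lemma opnorm_le: "(\<And>x. norm (A *v x) \<le> b * norm x) \<Longrightarrow> opnorm A \<le> b" for A :: "'n::finite mat"
  unfolding opnorm_def by (rule onorm_le)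

lemma opnorm_add_le: "opnorm (A + B) \<le> opnorm A + opnorm B" for A :: "'n::finite mat"
proof (rule opnorm_le)
  fix x
  have "norm ((A + B) *v x) \<le> norm (A *v x) + norm (B *v x)"
    by (simp add: matrix_vector_mult_add_rdistrib norm_triangle_ineq)
  also have "\<dots> \<le> (opnorm A + opnorm B) * norm x"
    using norm_mult_vec_le[of A x] norm_mult_vec_le[of B x] by (simp add: algebra_simps)
  finally show "norm ((A + B) *v x) \<le> (opnorm A + opnorm B) * norm x" .
qed

lemma norm_mult_vec_le_norm: "norm (A *v x) \<le> norm A * norm x" for A :: "'n::finite mat"
proof -
  have "norm (A *v x) = L2_set (\<lambda>i. \<bar>A $ i \<bullet> x\<bar>) UNIV"
    by (simp add: norm_vec_def matrix_vector_mul_component)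
  also have "\<dots> \<le> L2_set (\<lambda>i. norm (A $ i) * norm x) UNIV"
    by (intro L2_set_mono Cauchy_Schwarz_ineq2) auto
  also have "\<dots> = norm A * norm x"
    by (simp add: norm_vec_def L2_set_left_distrib)
  finally show ?thesis .
qed

lemma opnorm_le_norm: "opnorm A \<le> norm A" for A :: "'n::finite mat"
  by (intro opnorm_le norm_mult_vec_le_norm)

lemma continuous_opnorm: "continuous_on UNIV (opnorm :: 'n::finite mat \<Rightarrow> real)"
proof -
  have *: "opnorm A - opnorm B \<le> norm (A - B)" for A B :: "'n mat"
    using opnorm_add_le[of "A - B" B] opnorm_le_norm[of "A - B"] by simp
  have "\<bar>opnorm A - opnorm B\<bar> \<le> norm (A - B)" for A B :: "'n mat"
    using *[of A B] *[of B A] by (simp add: norm_minus_commute)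
  then have "dist (opnorm A) (opnorm B) \<le> 1 * dist A B" for A B :: "'n mat"
    by (simp add: dist_norm)
  then have "1-lipschitz_on UNIV (opnorm :: 'n mat \<Rightarrow> real)"
    by (intro lipschitz_onI) auto
  then show ?thesis
    by (rule lipschitz_on_continuous_on)
qed

lemma borel_measurable_opnorm [measurable]: "opnorm \<in> borel_measurable borel"
  by (intro borel_measurable_continuous_onI continuous_opnorm)

lemma opnorm_mult_le: "opnorm (A ** B) \<le> opnorm A * opnorm B" for A :: "'n::finite mat"
proof (rule opnorm_le)
  fix x
  have "norm ((A ** B) *v x) \<le> opnorm A * norm (B *v x)"
    by (simp add: norm_mult_vec_le matrix_vector_mul_assoc [symmetric])
  also have "\<dots> \<le> opnorm A * (opnorm B * norm x)"
    by (intro mult_left_mono norm_mult_vec_le) auto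
  finally show "norm ((A ** B) *v x) \<le> opnorm A * opnorm B * norm x" by simp
qed

lemma vec_expand: "(A :: 'n::finite mat) *v x = (\<Sum>j\<in>UNIV. x $ j *\<^sub>R (A *v axis j 1))"
proof -
  have "A *v x = A *v (\<Sum>j\<in>UNIV. x $ j *s axis j 1)"
    by (simp add: basis_expansion)
  also have "\<dots> = (\<Sum>j\<in>UNIV. x $ j *\<^sub>R (A *v axis j 1))"
    by (simp add: vec.linear_sum[OF matrix_vector_mul_linear_gen] scalar_mult_eq_scaleR
        matrix_vector_mult_scaleR)
  finally show ?thesis .
qed

text \<open>The norms of the columns give a norm equivalent to the operator norm; the constant only has to depend
  on the dimension.\<close>
lemma exists_axis_opnorm_le:
  fixes A :: "'n::finite mat"
  obtains i where "opnorm A \<le> CARD('n) * norm (A *v axis i 1)"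
proof -
  define f where "f = (\<lambda>j::'n. norm (A *v axis j 1))"
  have "Max (range f) \<in> range f" by (rule Max_in) auto
  then obtain i where "Max (range f) = f i" by blast
  moreover have "f j \<le> Max (range f)" for j by (rule Max_ge) auto
  ultimately have i: "norm (A *v axis j 1) \<le> norm (A *v axis i 1)" for j by (auto simp: f_def)
  have "opnorm A \<le> CARD('n) * norm (A *v axis i 1)"
  proof (rule opnorm_le)
    fix x :: "real ^ 'n"
    have "norm (A *v x) \<le> (\<Sum>j\<in>UNIV. norm (x $ j *\<^sub>R (A *v axis j 1)))"
      by (subst vec_expand) (rule norm_sum)
    also have "\<dots> \<le> (\<Sum>j\<in>(UNIV::'n set). norm x * norm (A *v axis i 1))"
      by (intro sum_mono) (auto intro!: mult_mono i component_le_norm_cart)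
    finally show "norm (A *v x) \<le> CARD('n) * norm (A *v axis i 1) * norm x"
      by (simp add: mult_ac)
  qed
  then show ?thesis by (rule that)
qed

lemma matrix_inv_mult:
  assumes "(A :: 'n::finite mat) \<in> GL"
  shows "A ** matrix_inv A = mat 1" "matrix_inv A ** A = mat 1"
proof -
  have "\<exists>B. A ** B = mat 1 \<and> B ** A = mat 1"
    using assms by (auto simp: GL_def invertible_def)
  then have "A ** matrix_inv A = mat 1 \<and> matrix_inv A ** A = mat 1"
    unfolding matrix_inv_def by (rule someI_ex)
  then show "A ** matrix_inv A = mat 1" "matrix_inv A ** A = mat 1" by auto
qed

lemma matrix_inv_vec:
  assumes "(A :: 'n::finite mat) \<in> GL"
  shows "A *v (matrix_inv A *v x) = x" "matrix_inv A *v (A *v x) = x"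
  using matrix_inv_mult[OF assms] by (simp_all add: matrix_vector_mul_assoc)

lemma GL_mult: "A \<in> GL \<Longrightarrow> B \<in> GL \<Longrightarrow> A ** B \<in> GL" for A :: "'n::finite mat"
  by (simp add: GL_def invertible_mult)

lemma mat_1_GL [simp]: "mat 1 \<in> (GL :: 'n::finite mat set)"
  by (auto simp: GL_def invertible_def)

lemma GL_inv: "A \<in> GL \<Longrightarrow> matrix_inv A \<in> GL" for A :: "'n::finite mat"
  using matrix_inv_mult[of A] by (auto simp: GL_def invertible_def)

lemma GL_inj: "A \<in> GL \<Longrightarrow> A *v x = A *v y \<longleftrightarrow> x = y" for A :: "'n::finite mat"
  by (metis matrix_inv_vec(2))

lemma GL_eq_0_iff [simp]: "A \<in> GL \<Longrightarrow> A *v x = 0 \<longleftrightarrow> x = 0" for A :: "'n::finite mat"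
  using GL_inj[of A x 0] by simp

lemma matN_bounds:
  assumes A: "(A :: 'n::finite mat) \<in> GL"
  shows "norm (A *v x) \<le> matN A * norm x" "norm x \<le> matN A * norm (A *v x)"
    and matN_ge_1: "1 \<le> matN A"
proof -
  show 1: "norm (A *v x) \<le> matN A * norm x" for x
    by (rule order_trans[OF norm_mult_vec_le mult_right_mono]) (auto simp: matN_def)
  show 2: "norm x \<le> matN A * norm (A *v x)" for x
  proof -
    have "norm x = norm (matrix_inv A *v (A *v x))" by (simp add: matrix_inv_vec[OF A])
    also have "\<dots> \<le> opnorm (matrix_inv A) * norm (A *v x)" by (rule norm_mult_vec_le)
    also have "\<dots> \<le> matN A * norm (A *v x)" by (rule mult_right_mono) (auto simp: matN_def)
    finally show ?thesis .
  qed
  have N0: "0 \<le> matN A" by (simp add: matN_def le_max_iff_disj)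
  obtain i :: 'n where True by simp
  let ?x = "axis i 1 :: real ^ 'n"
  have "1 \<le> matN A * norm (A *v ?x)" using 2[of ?x] by simp
  also have "\<dots> \<le> matN A * matN A" using 1[of ?x] N0 by (intro mult_left_mono) auto
  finally show "1 \<le> matN A"
    using N0 by (metis abs_le_square_iff abs_of_nonneg one_power2 power2_eq_square zero_le_one abs_1)
qed

lemma opnorm_pos: "A \<in> GL \<Longrightarrow> 0 < opnorm A" for A :: "'n::finite mat"
proof -
  assume A: "A \<in> GL"
  obtain i :: 'n where True by simp
  have "0 < norm (A *v axis i 1)" using A by (simp add: axis_eq_0_iff)
  then show ?thesis using norm_mult_vec_le[of A "axis i 1"] by (simp only: norm_axis_1 mult_1_right)
qed

lemma continuous_det: "continuous_on S (det :: 'n::finite mat \<Rightarrow> real)"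
  unfolding det_def by (intro continuous_intros)

lemma matrix_inv_component:
  assumes "(A :: 'n::finite mat) \<in> GL"
  shows "matrix_inv A $ k $ l = det (\<chi> i j. if j = k then axis l 1 $ i else A $ i $ j) / det A"
proof -
  have d: "det A \<noteq> 0" using assms by (simp add: GL_def invertible_det_nz)
  have "A *v (matrix_inv A *v axis l 1) = axis l 1" using assms by (rule matrix_inv_vec)
  then have "matrix_inv A *v axis l 1 = (\<chi> k. det(\<chi> i j. if j=k then axis l 1 $i else A$i$j) / det A)"
    using cramer[OF d] by blast
  then have "(matrix_inv A *v axis l 1) $ k = det(\<chi> i j. if j=k then axis l 1 $i else A$i$j) / det A"
    by simp
  then show ?thesis by (simp add: matrix_vector_mult_basis column_def)
qed

text \<open>By Cramer's rule the entries of the inverse are quotients of polynomials.\<close>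
lemma continuous_on_matrix_inv: "continuous_on GL (matrix_inv :: 'n::finite mat \<Rightarrow> 'n mat)"
proof -
  have c: "continuous_on GL (\<lambda>A::'n mat. det (\<chi> i j. if j = k then axis l 1 $ i else A $ i $ j))" for k l :: 'n
    unfolding det_def
  proof (rule continuous_on_sum, rule continuous_on_mult[OF continuous_on_const], rule continuous_on_prod)
    fix p :: "'n \<Rightarrow> 'n" and i
    show "continuous_on GL (\<lambda>A::'n mat. (\<chi> i j. if j = k then axis l 1 $ i else A $ i $ j) $ i $ p i)"
      by (cases "p i = k") (auto intro!: continuous_intros)
  qed
  have "continuous_on GL (\<lambda>A. \<chi> k l. det (\<chi> i j. if j = k then axis l 1 $ i else (A::'n mat) $ i $ j) / det A)"
    by (intro continuous_on_vec_lambda continuous_on_divide continuous_det c)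
      (auto simp: GL_def invertible_det_nz)
  then show ?thesis
    by (rule continuous_on_eq) (simp add: matrix_inv_component vec_eq_iff)
qed

lemma continuous_on_matN: "continuous_on GL (matN :: 'n::finite mat \<Rightarrow> real)"
  unfolding matN_def
  by (intro continuous_on_max continuous_on_subset[OF continuous_opnorm] subset_UNIV
      continuous_on_compose2[OF continuous_opnorm continuous_on_matrix_inv])

lemma norm_diff_le: "A \<in> GL \<Longrightarrow> norm (A *v x - A *v y) \<le> matN A * norm (x - y)" for A :: "'n::finite mat"
  by (metis matN_bounds(1) matrix_vector_mult_diff_distrib)

text \<open>The bivector \<open>x \<and> y\<close> as an antisymmetric matrix.\<close>
definition wedge :: "real ^ 'n \<Rightarrow> real ^ 'n \<Rightarrow> real ^ 'n ^ 'n::finite" where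
  "wedge x y = (\<chi> i j. x $ i * y $ j - x $ j * y $ i)"

lemma wedge_simps:
  "wedge (x + x') y = wedge x y + wedge x' y"
  "wedge x (y + y') = wedge x y + wedge x y'"
  "wedge (c *\<^sub>R x) y = c *\<^sub>R wedge x y"
  "wedge x (c *\<^sub>R y) = c *\<^sub>R wedge x y"
  "wedge 0 y = 0" "wedge x 0 = 0" "wedge x x = 0"
  by (simp_all add: wedge_def vec_eq_iff algebra_simps)

lemma wedge_diff: "wedge (x - x') y = wedge x y - wedge x' y" "wedge x (y - y') = wedge x y - wedge x y'"
  by (simp_all add: wedge_def vec_eq_iff algebra_simps)

lemma linear_wedge: "linear (\<lambda>x. wedge x y)" "linear (wedge x)"
  by (auto intro!: linearI simp: wedge_simps)

lemma norm_wedge_commute: "norm (wedge x y) = norm (wedge y x)"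
proof -
  have "wedge x y = - wedge y x" by (simp add: wedge_def vec_eq_iff)
  then show ?thesis by simp
qed

text \<open>Lagrange's identity.\<close>
lemma norm_wedge_sq: "(norm (wedge x y))\<^sup>2 = 2 * ((norm x)\<^sup>2 * (norm y)\<^sup>2 - (x \<bullet> y)\<^sup>2)"
proof -
  have "(norm (wedge x y))\<^sup>2 = (\<Sum>i\<in>UNIV. \<Sum>j\<in>UNIV. (x $ i * y $ j - x $ j * y $ i)\<^sup>2)"
    unfolding power2_norm_eq_inner inner_vec_def wedge_def by (simp add: power2_eq_square)
  also have "\<dots> = (\<Sum>i\<in>UNIV. \<Sum>j\<in>UNIV. (x $ i * x $ i) * (y $ j * y $ j) + (x $ j * x $ j) * (y $ i * y $ i)
       - 2 * ((x $ i * y $ i) * (x $ j * y $ j)))"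
    by (intro sum.cong refl) (simp add: power2_eq_square algebra_simps)
  also have "\<dots> = (\<Sum>i\<in>UNIV. \<Sum>j\<in>UNIV. (x $ i * x $ i) * (y $ j * y $ j)) +
      (\<Sum>i\<in>UNIV. \<Sum>j\<in>UNIV. (x $ j * x $ j) * (y $ i * y $ i))
      - (\<Sum>i\<in>UNIV. \<Sum>j\<in>UNIV. 2 * ((x $ i * y $ i) * (x $ j * y $ j)))"
    by (simp add: sum.distrib sum_subtractf)
  also have "\<dots> = (x \<bullet> x) * (y \<bullet> y) + (x \<bullet> x) * (y \<bullet> y) - 2 * ((x \<bullet> y) * (x \<bullet> y))"
  proof -
    have 1: "(\<Sum>i\<in>UNIV. \<Sum>j\<in>UNIV. (x $ j * x $ j) * (y $ i * y $ i)) = (x \<bullet> x) * (y \<bullet> y)"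
      unfolding inner_vec_def inner_real_def sum_product by (subst sum.swap) simp
    show ?thesis
      unfolding 1 unfolding inner_vec_def inner_real_def sum_product by (simp add: sum_distrib_left)
  qed
  finally show ?thesis
    unfolding power2_norm_eq_inner by (simp add: power2_eq_square)
qed

lemma norm_wedge_le: "norm (wedge x y) \<le> 2 * norm x * norm y"
proof (rule power2_le_imp_le)
  have "0 \<le> (norm x)\<^sup>2 * (norm y)\<^sup>2" "0 \<le> (x \<bullet> y)\<^sup>2" by (intro mult_nonneg_nonneg zero_le_power2)+
  then show "(norm (wedge x y))\<^sup>2 \<le> (2 * norm x * norm y)\<^sup>2"
    unfolding norm_wedge_sq power_mult_distrib by (simp add: algebra_simps)
qed simp

text \<open>After division by the three lengths this is the triangle inequality, up to a factor, for the sine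
  distance between lines. It is proved by splitting \<open>y\<close> and \<open>z\<close> into multiples of \<open>x\<close> and orthogonal parts.\<close>
lemma norm_wedge_triangle:
  "norm x * norm (wedge y z) \<le> norm y * norm (wedge x z) + 5 * norm z * norm (wedge x y)"
proof (cases "x = 0")
  case True
  then show ?thesis by (simp add: wedge_simps)
next
  case False
  define Y where "Y = (norm x)\<^sup>2 *\<^sub>R y - (x \<bullet> y) *\<^sub>R x"
  define Z where "Z = (norm x)\<^sup>2 *\<^sub>R z - (x \<bullet> z) *\<^sub>R x"
  have nn: "norm ((norm x)\<^sup>2 *\<^sub>R y - (x \<bullet> y) *\<^sub>R x) \<le> norm x * norm (wedge x y)" for y
  proof (rule power2_le_imp_le)
    have "(norm ((norm x)\<^sup>2 *\<^sub>R y - (x \<bullet> y) *\<^sub>R x))\<^sup>2 = (norm x)\<^sup>2 * ((norm x)\<^sup>2 * (norm y)\<^sup>2 - (x \<bullet> y)\<^sup>2)"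
      unfolding power2_norm_eq_inner
      by (simp add: inner_diff_left inner_diff_right inner_commute power2_eq_square algebra_simps)
    also have "\<dots> \<le> (norm x)\<^sup>2 * (norm (wedge x y))\<^sup>2"
      unfolding norm_wedge_sq using Cauchy_Schwarz_ineq[of x y]
      by (intro mult_left_mono) (auto simp: power2_norm_eq_inner)
    finally show "(norm ((norm x)\<^sup>2 *\<^sub>R y - (x \<bullet> y) *\<^sub>R x))\<^sup>2 \<le> (norm x * norm (wedge x y))\<^sup>2"
      by (simp add: power_mult_distrib)
  qed simp
  have Yn: "norm Y \<le> norm x * norm (wedge x y)" unfolding Y_def by (rule nn)
  have Zn: "norm Z \<le> 2 * (norm x)\<^sup>2 * norm z"
  proof -
    have "norm Z \<le> norm x * norm (wedge x z)" unfolding Z_def by (rule nn)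
    also have "\<dots> \<le> norm x * (2 * norm x * norm z)" by (intro mult_left_mono norm_wedge_le) auto
    finally show ?thesis by (simp add: power2_eq_square mult_ac)
  qed
  let ?n = "norm x"
  have "?n ^ 4 *\<^sub>R wedge y z = wedge (?n\<^sup>2 *\<^sub>R y) (?n\<^sup>2 *\<^sub>R z)"
    by (simp add: wedge_simps power2_eq_square power4_eq_xxxx)
  also have "\<dots> = wedge (Y + (x \<bullet> y) *\<^sub>R x) (Z + (x \<bullet> z) *\<^sub>R x)"
    by (simp add: Y_def Z_def)
  also have "\<dots> = wedge Y Z + (x \<bullet> z) *\<^sub>R wedge Y x + (x \<bullet> y) *\<^sub>R wedge x Z"
    by (simp add: wedge_simps)
  finally have "?n ^ 4 * norm (wedge y z) = norm (wedge Y Z + (x \<bullet> z) *\<^sub>R wedge Y x + (x \<bullet> y) *\<^sub>R wedge x Z)"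
    by (metis norm_scaleR abs_of_nonneg norm_ge_zero zero_le_power)
  also have "\<dots> \<le> norm (wedge Y Z) + \<bar>x \<bullet> z\<bar> * norm (wedge Y x) + \<bar>x \<bullet> y\<bar> * norm (wedge x Z)"
    by (intro order_trans[OF norm_triangle_ineq] add_mono order_trans[OF norm_triangle_ineq]) auto
  also have "\<dots> \<le> 2 * (?n * norm (wedge x y)) * (2 * ?n\<^sup>2 * norm z)
      + (?n * norm z) * (?n\<^sup>2 * norm (wedge x y)) + (?n * norm y) * (?n\<^sup>2 * norm (wedge x z))"
  proof (intro add_mono)
    have "norm (wedge Y Z) \<le> 2 * norm Y * norm Z" by (rule norm_wedge_le)
    also have "\<dots> \<le> 2 * (?n * norm (wedge x y)) * (2 * ?n\<^sup>2 * norm z)"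
      by (intro mult_mono Yn Zn) auto
    finally show "norm (wedge Y Z) \<le> 2 * (?n * norm (wedge x y)) * (2 * ?n\<^sup>2 * norm z)" .
    have "wedge Y x = ?n\<^sup>2 *\<^sub>R wedge y x" "wedge x Z = ?n\<^sup>2 *\<^sub>R wedge x z"
      by (simp_all add: Y_def Z_def wedge_diff wedge_simps)
    then have e: "norm (wedge Y x) = ?n\<^sup>2 * norm (wedge x y)" "norm (wedge x Z) = ?n\<^sup>2 * norm (wedge x z)"
      by (simp_all add: norm_wedge_commute)
    show "\<bar>x \<bullet> z\<bar> * norm (wedge Y x) \<le> (?n * norm z) * (?n\<^sup>2 * norm (wedge x y))"
      unfolding e by (intro mult_right_mono Cauchy_Schwarz_ineq2) auto
    show "\<bar>x \<bullet> y\<bar> * norm (wedge x Z) \<le> (?n * norm y) * (?n\<^sup>2 * norm (wedge x z))"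
      unfolding e by (intro mult_right_mono Cauchy_Schwarz_ineq2) auto
  qed
  also have "\<dots> = ?n ^ 3 * (5 * norm z * norm (wedge x y) + norm y * norm (wedge x z))"
    by (simp add: power2_eq_square power3_eq_cube algebra_simps)
  finally have "?n ^ 3 * (?n * norm (wedge y z)) \<le> ?n ^ 3 * (5 * norm z * norm (wedge x y) + norm y * norm (wedge x z))"
    by (simp add: power4_eq_xxxx power3_eq_cube mult_ac)
  then have "?n * norm (wedge y z) \<le> 5 * norm z * norm (wedge x y) + norm y * norm (wedge x z)"
    using False by (subst (asm) mult_le_cancel_left_pos) auto
  then show ?thesis by simp
qed

text \<open>Equivalent to the norm of \<open>A\<close> on bivectors, that is to the product of its two largest singular values.\<close>
definition area :: "'n::finite mat \<Rightarrow> real" where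
  "area A = (\<Sum>k\<in>UNIV. \<Sum>l\<in>UNIV. norm (wedge (A *v axis k 1) (A *v axis l 1)))"

lemma area_nonneg [simp]: "0 \<le> area A"
  by (auto simp: area_def intro!: sum_nonneg)

lemma wedge_sum_left: "wedge (\<Sum>i\<in>I. f i) y = (\<Sum>i\<in>I. wedge (f i) y)"
  using linear_sum[OF linear_wedge(1)[of y], of f I] by (simp add: o_def)

lemma wedge_sum_right: "wedge x (\<Sum>i\<in>I. f i) = (\<Sum>i\<in>I. wedge x (f i))"
  using linear_sum[OF linear_wedge(2)[of x], of f I] by (simp add: o_def)

lemma norm_nth_le_vec: "norm (X $ k) \<le> norm X" for X :: "'n::finite mat"
  unfolding norm_vec_def[of X] by (rule member_le_L2_set) auto

text \<open>\<open>A x \<and> A y\<close> is a linear function of \<open>x \<and> y\<close>, and \<open>area A\<close> bounds it on the basis bivectors.\<close>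
lemma norm_wedge_image: "norm (wedge (A *v x) (A *v y)) \<le> area A * norm (wedge x y)"
  for A :: "'n::finite mat"
proof -
  let ?w = "\<lambda>k l. wedge (A *v axis k 1) (A *v axis l 1)"
  have e: "wedge (A *v x) (A *v y) = (\<Sum>k\<in>UNIV. \<Sum>l\<in>UNIV. (x $ k * y $ l) *\<^sub>R ?w k l)"
    by (subst (1 2) vec_expand, subst wedge_sum_left)
      (simp add: wedge_sum_right wedge_simps scaleR_sum_right mult.commute)
  have "(\<Sum>k\<in>UNIV. \<Sum>l\<in>UNIV. (x $ l * y $ k) *\<^sub>R ?w k l) = (\<Sum>l\<in>UNIV. \<Sum>k\<in>UNIV. (x $ l * y $ k) *\<^sub>R ?w k l)"
    by (rule sum.swap)
  also have "\<dots> = (\<Sum>l\<in>UNIV. \<Sum>k\<in>UNIV. - ((x $ l * y $ k) *\<^sub>R ?w l k))"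
    by (intro sum.cong refl) (simp add: wedge_def vec_eq_iff algebra_simps)
  finally have e2: "(\<Sum>k\<in>UNIV. \<Sum>l\<in>UNIV. (x $ l * y $ k) *\<^sub>R ?w k l) = - wedge (A *v x) (A *v y)"
    by (simp add: e sum_negf)
  have "2 *\<^sub>R wedge (A *v x) (A *v y) = (\<Sum>k\<in>UNIV. \<Sum>l\<in>UNIV. wedge x y $ k $ l *\<^sub>R ?w k l)"
  proof -
    have "2 *\<^sub>R wedge (A *v x) (A *v y) = (\<Sum>k\<in>UNIV. \<Sum>l\<in>UNIV. (x $ k * y $ l) *\<^sub>R ?w k l)
       - (\<Sum>k\<in>UNIV. \<Sum>l\<in>UNIV. (x $ l * y $ k) *\<^sub>R ?w k l)"
      unfolding e2 e[symmetric] by (simp add: scaleR_2)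
    then show ?thesis
      by (simp add: sum_subtractf[symmetric] scaleR_left_diff_distrib[symmetric] wedge_def)
  qed
  then have "2 * norm (wedge (A *v x) (A *v y)) = norm (\<Sum>k\<in>UNIV. \<Sum>l\<in>UNIV. wedge x y $ k $ l *\<^sub>R ?w k l)"
    by (metis norm_scaleR abs_numeral real_norm_def)
  also have "\<dots> \<le> (\<Sum>k\<in>UNIV. \<Sum>l\<in>UNIV. norm (wedge x y) * norm (?w k l))"
  proof (intro order_trans[OF norm_sum] sum_mono)
    fix k l
    have "\<bar>wedge x y $ k $ l\<bar> \<le> norm (wedge x y)"
      by (rule order_trans[OF component_le_norm_cart]) (rule norm_nth_le_vec)
    then show "norm (wedge x y $ k $ l *\<^sub>R ?w k l) \<le> norm (wedge x y) * norm (?w k l)"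
      by (simp add: mult_right_mono)
  qed
  also have "\<dots> = area A * norm (wedge x y)"
    by (simp add: area_def sum_distrib_left mult_ac)
  finally have "2 * norm (wedge (A *v x) (A *v y)) \<le> area A * norm (wedge x y)" .
  then show ?thesis using norm_ge_zero[of "wedge (A *v x) (A *v y)"] by linarith
qed

lemma area_le: "area A \<le> 2 * (real CARD('n))\<^sup>2 * (opnorm A)\<^sup>2" for A :: "'n::finite mat"
proof -
  have n: "norm (A *v axis k 1) \<le> opnorm A" for k
    using norm_mult_vec_le[of A "axis k 1"] by simp
  have "area A \<le> (\<Sum>k\<in>(UNIV::'n set). \<Sum>l\<in>(UNIV::'n set). 2 * opnorm A * opnorm A)"
    unfolding area_def
    by (intro sum_mono order_trans[OF norm_wedge_le] mult_mono n) auto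
  then show ?thesis by (simp add: power2_eq_square mult_ac)
qed

text \<open>Up to the factor \<open>\<surd>2\<close> the sine of the angle between two lines.\<close>
definition pdist :: "real ^ 'n::finite \<Rightarrow> real ^ 'n \<Rightarrow> real" where
  "pdist x y = norm (wedge x y) / (norm x * norm y)"

lemma pdist_nonneg [simp]: "0 \<le> pdist x y" by (simp add: pdist_def)

lemma pdist_le: "pdist x y \<le> 2"
  using norm_wedge_le[of x y]
  by (cases "x = 0 \<or> y = 0") (auto simp: pdist_def divide_le_eq mult_ac)

lemma pdist_scale: "c \<noteq> 0 \<Longrightarrow> pdist (c *\<^sub>R x) y = pdist x y" "c \<noteq> 0 \<Longrightarrow> pdist x (c *\<^sub>R y) = pdist x y"
  by (simp_all add: pdist_def wedge_simps)

lemma pdist_sq: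
  assumes "x \<noteq> 0" "y \<noteq> 0"
  shows "(pdist x y)\<^sup>2 = 2 * (1 - ((x \<bullet> y) / (norm x * norm y))\<^sup>2)"
  using assms by (simp add: pdist_def power_divide norm_wedge_sq power_mult_distrib divide_simps)

text \<open>Unit vectors on two close lines are close after the choice of a sign, because
  \<open>2 (1 - \<bar>c\<bar>) \<le> 2 (1 - c\<^sup>2)\<close> for the cosine \<open>c\<close> of their angle.\<close>
lemma exists_sign_norm_diff_le_pdist:
  assumes "norm x = 1" "norm y = 1"
  obtains s :: real where "\<bar>s\<bar> = 1" "norm (x - s *\<^sub>R y) \<le> pdist x y"
proof
  define s :: real where "s = (if x \<bullet> y \<ge> 0 then 1 else -1)"
  have s: "s * (x \<bullet> y) = \<bar>x \<bullet> y\<bar>" "s * s = 1" by (auto simp: s_def)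
  show "\<bar>s\<bar> = 1" by (simp add: s_def)
  have c: "\<bar>x \<bullet> y\<bar> \<le> 1" using Cauchy_Schwarz_ineq2[of x y] assms by simp
  have nz: "x \<noteq> 0" "y \<noteq> 0" using assms by auto
  show "norm (x - s *\<^sub>R y) \<le> pdist x y"
  proof (rule power2_le_imp_le)
    have "(norm (x - s *\<^sub>R y))\<^sup>2 = (norm x)\<^sup>2 + s * s * (norm y)\<^sup>2 - 2 * (s * (x \<bullet> y))"
      unfolding power2_norm_eq_inner by (simp add: inner_diff_left inner_diff_right inner_commute)
    also have "\<dots> = 2 * (1 - \<bar>x \<bullet> y\<bar>)" using assms s by simp
    also have "\<dots> \<le> 2 * (1 - \<bar>x \<bullet> y\<bar>) * (1 + \<bar>x \<bullet> y\<bar>)" using c by (simp add: mult_le_cancel_left1)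
    also have "\<dots> = (pdist x y)\<^sup>2"
    proof -
      have "\<bar>x \<bullet> y\<bar> * \<bar>x \<bullet> y\<bar> = (x \<bullet> y)\<^sup>2" by (simp add: power2_eq_square flip: abs_mult)
      then show ?thesis using assms unfolding pdist_sq[OF nz] by (simp add: ring_distribs mult.assoc)
    qed
    finally show "(norm (x - s *\<^sub>R y))\<^sup>2 \<le> (pdist x y)\<^sup>2" .
  qed simp
qed

lemma norm_ratio_diff_le:
  fixes A :: "'n::finite mat"
  assumes A: "A \<in> GL" and "x \<noteq> 0" "y \<noteq> 0"
  shows "\<bar>norm (A *v x) / norm x - norm (A *v y) / norm y\<bar> \<le> matN A * pdist x y"
proof -
  define x' y' where "x' = (1 / norm x) *\<^sub>R x" and "y' = (1 / norm y) *\<^sub>R y"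
  have "norm x' = 1" "norm y' = 1" using assms by (simp_all add: x'_def y'_def)
  then obtain s :: real where s: "\<bar>s\<bar> = 1" "norm (x' - s *\<^sub>R y') \<le> pdist x' y'"
    by (rule exists_sign_norm_diff_le_pdist)
  have p: "pdist x' y' = pdist x y" using assms by (simp add: x'_def y'_def pdist_scale)
  have "norm (A *v x) / norm x = norm (A *v x')" "norm (A *v y) / norm y = norm (A *v (s *\<^sub>R y'))"
    using s(1) by (simp_all add: x'_def y'_def matrix_vector_mult_scaleR)
  then have "\<bar>norm (A *v x) / norm x - norm (A *v y) / norm y\<bar> \<le> norm (A *v x' - A *v (s *\<^sub>R y'))"
    by (simp add: norm_triangle_ineq3)
  also have "\<dots> \<le> matN A * norm (x' - s *\<^sub>R y')" by (rule norm_diff_le[OF A])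
  also have "\<dots> \<le> matN A * pdist x y"
    using s(2) p matN_ge_1[OF A] by (intro mult_left_mono) auto
  finally show ?thesis .
qed

lemma norm_ratio_bounds:
  fixes A :: "'n::finite mat"
  assumes A: "A \<in> GL" and "x \<noteq> 0"
  shows "norm (A *v x) / norm x \<le> matN A" "1 / matN A \<le> norm (A *v x) / norm x"
    "\<bar>ln (norm (A *v x) / norm x)\<bar> \<le> ln (matN A)" "0 < norm (A *v x) / norm x"
proof -
  have N: "1 \<le> matN A" by (rule matN_ge_1[OF A])
  have n: "0 < norm x" "0 < norm (A *v x)" using assms by simp_all
  show 1: "norm (A *v x) / norm x \<le> matN A" using matN_bounds(1)[OF A, of x] n by (simp add: field_simps)
  show 2: "1 / matN A \<le> norm (A *v x) / norm x" using matN_bounds(2)[OF A, of x] n N by (simp add: field_simps)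
  show "0 < norm (A *v x) / norm x" using n by simp
  then have "ln (norm (A *v x) / norm x) \<le> ln (matN A)" "ln (1 / matN A) \<le> ln (norm (A *v x) / norm x)"
    using 1 2 N by (simp_all only: ln_le_cancel_iff zero_less_divide_1_iff)
  moreover have "ln (1 / matN A) = - ln (matN A)" using N by (simp add: ln_div)
  ultimately show "\<bar>ln (norm (A *v x) / norm x)\<bar> \<le> ln (matN A)" by simp
qed

lemma ln_diff_le: "\<bar>ln a - ln b\<bar> \<le> \<bar>a - b\<bar> / m" if "m > 0" "a \<ge> m" "b \<ge> m" for a b m :: real
proof -
  have *: "ln a - ln b \<le> \<bar>a - b\<bar> / m" if "m > 0" "a \<ge> m" "b \<ge> m" for a b :: real
  proof -
    have "ln a - ln b = ln (a / b)" using that by (simp add: ln_div)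
    also have "\<dots> \<le> a / b - 1" using that by (intro ln_le_minus_one) simp
    also have "\<dots> = (a - b) / b" using that by (simp add: field_simps)
    also have "\<dots> \<le> \<bar>a - b\<bar> / m" using that by (intro frac_le) auto
    finally show ?thesis .
  qed
  show ?thesis using *[of a b] *[of b a] that by (simp add: abs_minus_commute abs_le_iff)
qed

lemma ln_norm_ratio_diff_le:
  fixes A :: "'n::finite mat"
  assumes A: "A \<in> GL" and "x \<noteq> 0" "y \<noteq> 0"
  shows "\<bar>ln (norm (A *v x) / norm x) - ln (norm (A *v y) / norm y)\<bar> \<le> (matN A)\<^sup>2 * pdist x y"
proof -
  have N: "1 \<le> matN A" by (rule matN_ge_1[OF A])
  have "\<bar>ln (norm (A *v x) / norm x) - ln (norm (A *v y) / norm y)\<bar> \<le>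
      \<bar>norm (A *v x) / norm x - norm (A *v y) / norm y\<bar> / (1 / matN A)"
    using N norm_ratio_bounds[OF A] assms by (intro ln_diff_le) auto
  also have "\<dots> \<le> matN A * pdist x y / (1 / matN A)"
    using N by (intro divide_right_mono norm_ratio_diff_le assms) auto
  finally show ?thesis by (simp add: power2_eq_square mult_ac)
qed

text \<open>Distance of \<open>A\<close> from rank one, relative to its size.\<close>
definition rratio :: "'n::finite mat \<Rightarrow> real" where
  "rratio A = area A / (opnorm A)\<^sup>2"

lemma rratio_nonneg [simp]: "0 \<le> rratio A" by (simp add: rratio_def)

lemma rratio_le: "rratio A \<le> 2 * (real CARD('n))\<^sup>2" for A :: "'n::finite mat"
  using area_le[of A] by (cases "opnorm A = 0") (auto simp: rratio_def divide_simps)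

lemma continuous_area: "continuous_on UNIV (area :: 'n::finite mat \<Rightarrow> real)"
  unfolding area_def wedge_def matrix_vector_mult_basis column_def vec_lambda_beta
  by (intro continuous_on_sum continuous_on_norm continuous_on_vec_lambda continuous_on_diff
      continuous_on_mult continuous_on_component continuous_on_id)

lemma borel_measurable_rratio [measurable]: "(rratio :: 'n::finite mat \<Rightarrow> real) \<in> borel_measurable borel"
proof -
  have [measurable]: "(area :: 'n mat \<Rightarrow> real) \<in> borel_measurable borel"
    by (intro borel_measurable_continuous_onI continuous_area)
  show ?thesis unfolding rratio_def by measurable
qed

text \<open>Lines whose directions are stretched by a fixed part of \<open>opnorm A\<close> are brought together by the factor
  \<open>rratio A\<close>: areas grow at most by the factor \<open>area A\<close>, but lengths by a fixed part of \<open>opnorm A\<close>.\<close>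
lemma pdist_image_le:
  fixes A :: "'n::finite mat"
  assumes A: "A \<in> GL" and "x \<noteq> 0" "y \<noteq> 0"
  shows "pdist (A *v x) (A *v y) * (norm (A *v x) / (opnorm A * norm x)) * (norm (A *v y) / (opnorm A * norm y))
    \<le> rratio A * pdist x y"
proof -
  have n: "norm x \<noteq> 0" "norm y \<noteq> 0" "norm (A *v x) \<noteq> 0" "norm (A *v y) \<noteq> 0" "opnorm A > 0"
    using assms opnorm_pos[OF A] by simp_all
  have "pdist (A *v x) (A *v y) * (norm (A *v x) / (opnorm A * norm x)) * (norm (A *v y) / (opnorm A * norm y)) =
     norm (wedge (A *v x) (A *v y)) / ((opnorm A)\<^sup>2 * norm x * norm y)"
    using n by (simp add: pdist_def field_simps power2_eq_square)
  also have "\<dots> \<le> area A * norm (wedge x y) / ((opnorm A)\<^sup>2 * norm x * norm y)"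
    by (intro divide_right_mono norm_wedge_image) auto
  also have "\<dots> = rratio A * pdist x y" using n by (simp add: rratio_def pdist_def)
  finally show ?thesis .
qed

text \<open>If \<open>A\<close> is close to rank one, then all vectors are stretched by \<open>B\<close> after \<open>A\<close> by nearly the
  same factor, so that the relative lengths of the image vectors change little from \<open>A\<close> to \<open>B ** A\<close>.\<close>
lemma relative_norm_step:
  fixes A B :: "'n::finite mat"
  assumes A: "A \<in> GL" and B: "B \<in> GL" and u: "norm u = 1"
  shows "\<bar>norm ((B ** A) *v u) / opnorm (B ** A) - norm (A *v u) / opnorm A\<bar>
    \<le> 4 * real CARD('n) * (matN B)\<^sup>2 * rratio A"
proof -
  let ?d = "real CARD('n)"
  obtain i :: 'n where i: "opnorm A \<le> ?d * norm (A *v axis i 1)" by (rule exists_axis_opnorm_le)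
  define v :: "real ^ 'n" where "v = axis i 1"
  define c where "c = norm (B *v (A *v v)) / norm (A *v v)"
  define e where "e = 2 * ?d * matN B * rratio A"
  have v1: "norm v = 1" by (simp add: v_def)
  have vn: "v \<noteq> 0" using v1 by auto
  have N: "1 \<le> matN B" by (rule matN_ge_1[OF B])
  have oA: "opnorm A > 0" "opnorm (B ** A) > 0" using opnorm_pos A B GL_mult by blast+
  have Avp: "norm (A *v v) > 0" using A vn by simp
  have e0: "e \<ge> 0" using N by (simp add: e_def)
  \<comment> \<open>\<open>c\<close> is the factor by which \<open>B\<close> stretches \<open>A v\<close>, and \<open>v\<close> is a direction in which \<open>A\<close> is large.\<close>
  have key: "\<bar>norm ((B ** A) *v w) - c * norm (A *v w)\<bar> \<le> e * opnorm A" if w: "norm w = 1" for w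
  proof -
    have wn: "w \<noteq> 0" using w by auto
    have "\<bar>norm (B *v (A *v w)) / norm (A *v w) - c\<bar> \<le> matN B * pdist (A *v w) (A *v v)"
      unfolding c_def using A wn vn by (intro norm_ratio_diff_le[OF B]) simp_all
    then have "\<bar>norm (B *v (A *v w)) / norm (A *v w) - c\<bar> * norm (A *v w) \<le> matN B * pdist (A *v w) (A *v v) * norm (A *v w)"
      by (rule mult_right_mono) simp
    moreover have "\<bar>norm (B *v (A *v w)) / norm (A *v w) - c\<bar> * norm (A *v w) = \<bar>norm (B *v (A *v w)) - c * norm (A *v w)\<bar>"
    proof -
      have "norm (A *v w) > 0" using A wn by simp
      then have "\<bar>norm (B *v (A *v w)) / norm (A *v w) - c\<bar> * norm (A *v w)
         = \<bar>(norm (B *v (A *v w)) / norm (A *v w) - c) * norm (A *v w)\<bar>"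
        by (simp only: abs_mult abs_norm_cancel)
      then show ?thesis using \<open>norm (A *v w) > 0\<close> by (simp add: left_diff_distrib)
    qed
    moreover have "matN B * pdist (A *v w) (A *v v) * norm (A *v w) = matN B * (norm (wedge (A *v w) (A *v v)) / norm (A *v v))"
      using A wn by (simp add: pdist_def)
    moreover have "norm (wedge (A *v w) (A *v v)) / norm (A *v v) \<le> 2 * area A / (opnorm A / ?d)"
    proof (rule frac_le)
      have "norm (wedge (A *v w) (A *v v)) \<le> area A * norm (wedge w v)" by (rule norm_wedge_image)
      also have "\<dots> \<le> area A * 2" using norm_wedge_le[of w v] w v1 by (intro mult_left_mono) auto
      finally show "norm (wedge (A *v w) (A *v v)) \<le> 2 * area A" by simp
      show "opnorm A / ?d \<le> norm (A *v v)" using i by (simp add: v_def field_simps)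
    qed (use oA in auto)
    moreover have "2 * area A / (opnorm A / ?d) = 2 * ?d * rratio A * opnorm A"
      using oA by (simp add: rratio_def power2_eq_square)
    ultimately have "\<bar>norm (B *v (A *v w)) - c * norm (A *v w)\<bar> \<le> matN B * (2 * ?d * rratio A * opnorm A)"
    proof -
      assume a: "\<bar>norm (B *v (A *v w)) / norm (A *v w) - c\<bar> * norm (A *v w) \<le> matN B * pdist (A *v w) (A *v v) * norm (A *v w)"
        and b: "\<bar>norm (B *v (A *v w)) / norm (A *v w) - c\<bar> * norm (A *v w) = \<bar>norm (B *v (A *v w)) - c * norm (A *v w)\<bar>"
        and c: "matN B * pdist (A *v w) (A *v v) * norm (A *v w) = matN B * (norm (wedge (A *v w) (A *v v)) / norm (A *v v))"
        and d: "norm (wedge (A *v w) (A *v v)) / norm (A *v v) \<le> 2 * area A / (opnorm A / ?d)"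
        and e: "2 * area A / (opnorm A / ?d) = 2 * ?d * rratio A * opnorm A"
      have "matN B * (norm (wedge (A *v w) (A *v v)) / norm (A *v v)) \<le> matN B * (2 * ?d * rratio A * opnorm A)"
        using d N unfolding e by (intro mult_left_mono) linarith+
      then show ?thesis using a unfolding b c by linarith
    qed
    then show ?thesis by (simp add: e_def mult_ac matrix_vector_mul_assoc)
  qed
  have key': "\<bar>norm ((B ** A) *v w) - c * norm (A *v w)\<bar> \<le> e * opnorm A * norm w" for w
  proof (cases "w = 0")
    case False
    let ?w = "(1 / norm w) *\<^sub>R w"
    have "\<bar>norm ((B ** A) *v ?w) - c * norm (A *v ?w)\<bar> \<le> e * opnorm A" using False by (intro key) simp
    then have "\<bar>norm ((B ** A) *v ?w) - c * norm (A *v ?w)\<bar> * norm w \<le> e * opnorm A * norm w"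
      by (rule mult_right_mono) simp
    moreover have "\<bar>norm ((B ** A) *v ?w) - c * norm (A *v ?w)\<bar> * norm w = \<bar>(norm ((B ** A) *v ?w) - c * norm (A *v ?w)) * norm w\<bar>"
      by (simp add: abs_mult)
    moreover have "(norm ((B ** A) *v ?w) - c * norm (A *v ?w)) * norm w = norm ((B ** A) *v w) - c * norm (A *v w)"
      using False by (simp add: matrix_vector_mult_scaleR field_simps)
    ultimately show ?thesis by simp
  qed simp
  have c0: "c \<ge> 0" by (simp add: c_def)
  have up: "opnorm (B ** A) \<le> (c + e) * opnorm A"
  proof (rule opnorm_le)
    fix w
    have "norm ((B ** A) *v w) \<le> c * norm (A *v w) + e * opnorm A * norm w" using key'[of w] by linarith
    also have "\<dots> \<le> c * (opnorm A * norm w) + e * opnorm A * norm w"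
      using mult_left_mono[OF norm_mult_vec_le[of A w] c0] by linarith
    finally show "norm ((B ** A) *v w) \<le> (c + e) * opnorm A * norm w" by (simp add: algebra_simps)
  qed
  have cpos: "c > 0" using A B vn Avp by (simp add: c_def)
  have lo: "c * opnorm A \<le> opnorm (B ** A) + e * opnorm A"
  proof -
    have "opnorm A \<le> (opnorm (B ** A) + e * opnorm A) / c"
    proof (rule opnorm_le)
      fix w
      have "c * norm (A *v w) \<le> norm ((B ** A) *v w) + e * opnorm A * norm w" using key'[of w] by linarith
      also have "\<dots> \<le> (opnorm (B ** A) + e * opnorm A) * norm w"
        using norm_mult_vec_le[of "B ** A" w] by (simp add: algebra_simps)
      finally show "norm (A *v w) \<le> (opnorm (B ** A) + e * opnorm A) / c * norm w"
        using cpos by (simp add: field_simps)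
    qed
    then show ?thesis using cpos by (simp add: field_simps)
  qed
  let ?p = "norm (A *v u) / opnorm A"
  have p: "0 \<le> ?p" "?p \<le> 1" using oA norm_mult_vec_le[of A u] u by (simp_all add: divide_le_eq)
  have pe: "norm (A *v u) = ?p * opnorm A" using oA by simp
  have "\<bar>opnorm (B ** A) - c * opnorm A\<bar> \<le> e * opnorm A" using up lo by (simp add: algebra_simps abs_le_iff)
  then have "?p * \<bar>opnorm (B ** A) - c * opnorm A\<bar> \<le> 1 * (e * opnorm A)" using p by (intro mult_mono) auto
  then have "\<bar>?p * opnorm (B ** A) - c * norm (A *v u)\<bar> \<le> e * opnorm A"
  proof -
    have "?p * \<bar>opnorm (B ** A) - c * opnorm A\<bar> = \<bar>?p * (opnorm (B ** A) - c * opnorm A)\<bar>"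
      using p(1) by (simp only: abs_mult abs_of_nonneg)
    also have "?p * (opnorm (B ** A) - c * opnorm A) = ?p * opnorm (B ** A) - c * norm (A *v u)"
      using oA by (simp add: right_diff_distrib)
    finally show ?thesis using \<open>?p * \<bar>opnorm (B ** A) - c * opnorm A\<bar> \<le> 1 * (e * opnorm A)\<close> by linarith
  qed
  with key[OF u] have d: "\<bar>norm ((B ** A) *v u) - ?p * opnorm (B ** A)\<bar> \<le> 2 * e * opnorm A" by linarith
  have "opnorm A \<le> matN B * opnorm (B ** A)"
  proof (rule opnorm_le)
    fix w
    have "norm (A *v w) \<le> matN B * norm ((B ** A) *v w)"
      using matN_bounds(2)[OF B, of "A *v w"] by (simp add: matrix_vector_mul_assoc)
    also have "\<dots> \<le> matN B * (opnorm (B ** A) * norm w)"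
      using N by (intro mult_left_mono norm_mult_vec_le) auto
    finally show "norm (A *v w) \<le> matN B * opnorm (B ** A) * norm w" by simp
  qed
  with d have "\<bar>norm ((B ** A) *v u) - ?p * opnorm (B ** A)\<bar> \<le> 2 * e * (matN B * opnorm (B ** A))"
    using mult_left_mono[of "opnorm A" "matN B * opnorm (B ** A)" "2 * e"] e0 by linarith
  moreover have "\<bar>norm ((B ** A) *v u) / opnorm (B ** A) - ?p\<bar> = \<bar>norm ((B ** A) *v u) - ?p * opnorm (B ** A)\<bar> / opnorm (B ** A)"
  proof -
    have "norm ((B ** A) *v u) / opnorm (B ** A) - ?p = (norm ((B ** A) *v u) - ?p * opnorm (B ** A)) / opnorm (B ** A)"
      using oA by (simp add: diff_divide_distrib)
    then show ?thesis using oA by (simp add: abs_divide)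
  qed
  ultimately have "\<bar>norm ((B ** A) *v u) / opnorm (B ** A) - ?p\<bar> \<le> 2 * e * matN B"
    using oA by (simp add: divide_le_eq mult_ac)
  then show ?thesis by (simp add: e_def power2_eq_square mult_ac)
qed

section \<open>Left products of independent matrices\<close>

lemma borel_measurable_matrix_vector_mult [measurable (raw)]:
  fixes f :: "'a \<Rightarrow> 'n::finite mat"
  assumes "f \<in> borel_measurable M" "g \<in> borel_measurable M"
  shows "(\<lambda>x. f x *v g x) \<in> borel_measurable M"
proof (rule borel_measurable_continuous_Pair[OF assms])
  show "continuous_on UNIV (\<lambda>x :: 'n mat \<times> (real ^ 'n). fst x *v snd x)"
    unfolding matrix_vector_mult_def
    by (intro continuous_on_vec_lambda continuous_on_sum continuous_on_mult continuous_on_component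
        continuous_on_fst continuous_on_snd continuous_on_id)
qed

lemma borel_measurable_matrix_mult [measurable (raw)]:
  fixes f g :: "'a \<Rightarrow> 'n::finite mat"
  assumes "f \<in> borel_measurable M" "g \<in> borel_measurable M"
  shows "(\<lambda>x. f x ** g x) \<in> borel_measurable M"
proof (rule borel_measurable_continuous_Pair[OF assms])
  show "continuous_on UNIV (\<lambda>x :: 'n mat \<times> 'n mat. fst x ** snd x)"
    unfolding matrix_matrix_mult_def
    by (intro continuous_on_vec_lambda continuous_on_sum continuous_on_mult continuous_on_component
        continuous_on_fst continuous_on_snd continuous_on_id)
qed

locale gl_walk = prob_space \<mu> for \<mu> :: "'n::finite mat measure" +
  assumes sets_mu: "sets \<mu> = sets (restrict_space borel GL)"
begin

lemma space_mu: "space \<mu> = GL"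
  using sets_eq_imp_space_eq[OF sets_mu] by (simp add: space_restrict_space)

lemma borel_mu [measurable]: "(\<lambda>x. x) \<in> borel_measurable \<mu>"
  unfolding measurable_cong_sets[OF sets_mu refl] by (rule measurable_restrict_space1) simp

lemma continuous_on_GL_measurable: "continuous_on GL f \<Longrightarrow> f \<in> borel_measurable \<mu>"
  unfolding measurable_cong_sets[OF sets_mu refl] by (rule borel_measurable_continuous_on_restrict)

lemma matN_measurable [measurable]: "matN \<in> borel_measurable \<mu>"
  by (rule continuous_on_GL_measurable[OF continuous_on_matN])

abbreviation S :: "'n mat stream measure" where "S \<equiv> stream_space \<mu>"

sublocale S: prob_space S by (rule prob_space_stream_space)
sublocale muS: pair_prob_space \<mu> S ..
sublocale SS: pair_prob_space S S ..

lemma snth_GL: "\<omega> \<in> space S \<Longrightarrow> \<omega> !! n \<in> GL"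
  by (simp add: space_stream_space space_mu snth_in)

lemma Stream_space: "x \<in> GL \<Longrightarrow> \<omega> \<in> space S \<Longrightarrow> x ## \<omega> \<in> space S"
  by (simp add: space_stream_space space_mu)

lemma shift_space: "\<omega> \<in> space S \<Longrightarrow> \<omega>' \<in> space S \<Longrightarrow> stake m \<omega> @- \<omega>' \<in> space S"
  unfolding space_stream_space space_mu
  by (auto simp: streams_iff_sset set_conv_nth stake_nth snth_in)

end

text \<open>The matrices of a stream are numbered from \<open>0\<close>, so \<open>lprod n \<omega>\<close> is the product of the first \<open>n\<close> ones,
  the latest on the left.\<close>
primrec lprod :: "nat \<Rightarrow> 'n::finite mat stream \<Rightarrow> 'n mat" where
  "lprod 0 \<omega> = mat 1"
| "lprod (Suc n) \<omega> = (\<omega> !! n) ** lprod n \<omega>"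

lemma lprod_Stream: "lprod (Suc n) (x ## \<omega>) = lprod n \<omega> ** x"
  by (induction n) (simp_all add: matrix_mul_assoc)

lemma lprod_shift: "lprod (m + n) (stake m \<omega> @- \<omega>') = lprod n \<omega>' ** lprod m \<omega>"
proof (induction m arbitrary: \<omega>)
  case (Suc m)
  have "lprod (Suc m + n) (stake (Suc m) \<omega> @- \<omega>') = lprod (m + n) (stake m (stl \<omega>) @- \<omega>') ** shd \<omega>"
    by (simp only: add_Suc lprod_Stream stake.simps shift.simps)
  also have "\<dots> = lprod n \<omega>' ** (lprod m (stl \<omega>) ** shd \<omega>)" by (simp add: Suc matrix_mul_assoc)
  also have "lprod m (stl \<omega>) ** shd \<omega> = lprod (Suc m) (shd \<omega> ## stl \<omega>)" by (simp only: lprod_Stream)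
  finally show ?case by (simp only: stream.collapse)
qed simp

lemma snth_shift: "k < m \<Longrightarrow> (stake m \<omega> @- \<omega>') !! k = \<omega> !! k" "(stake m \<omega> @- \<omega>') !! (m + k) = \<omega>' !! k"
  by (simp_all add: shift_snth_less stake_nth shift_snth_ge)

lemma lprod_shift_le: "k \<le> m \<Longrightarrow> lprod k (stake m \<omega> @- \<omega>') = lprod k \<omega>"
  by (induction k) (simp_all add: snth_shift)

context gl_walk
begin

lemma lprod_measurable [measurable]: "lprod n \<in> borel_measurable S"
  by (induction n) (simp_all add: lprod.simps[abs_def])

lemma lprod_GL: "\<omega> \<in> space S \<Longrightarrow> lprod n \<omega> \<in> GL"
  by (induction n) (simp_all add: GL_mult snth_GL)

lemma nn_integral_snth:
  assumes [measurable]: "f \<in> borel_measurable \<mu>"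
  shows "(\<integral>\<^sup>+\<omega>. f (\<omega> !! n) \<partial>S) = (\<integral>\<^sup>+x. f x \<partial>\<mu>)"
proof (induction n)
  case 0
  show ?case by (subst nn_integral_stream_space) (auto simp: S.emeasure_space_1)
next
  case (Suc n)
  then show ?case by (subst nn_integral_stream_space) (auto simp: emeasure_space_1)
qed

text \<open>The Markov property at time \<open>m\<close>: the law of the stream does not change if its tail is replaced by an
  independent stream.\<close>
lemma nn_integral_shift:
  assumes "f \<in> borel_measurable S"
  shows "(\<integral>\<^sup>+\<omega>. f \<omega> \<partial>S) = (\<integral>\<^sup>+\<omega>. \<integral>\<^sup>+\<omega>'. f (stake m \<omega> @- \<omega>') \<partial>S \<partial>S)"
  using assms
proof (induction m arbitrary: f)
  case 0
  then show ?case by (simp add: S.emeasure_space_1)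
next
  case (Suc m)
  note [measurable] = Suc.prems
  have "(\<integral>\<^sup>+\<omega>. \<integral>\<^sup>+\<omega>'. f (stake (Suc m) \<omega> @- \<omega>') \<partial>S \<partial>S) =
    (\<integral>\<^sup>+x. \<integral>\<^sup>+\<omega>. \<integral>\<^sup>+\<omega>'. f (stake (Suc m) (x ## \<omega>) @- \<omega>') \<partial>S \<partial>S \<partial>\<mu>)"
    by (rule nn_integral_stream_space) measurable
  also have "\<dots> = (\<integral>\<^sup>+x. \<integral>\<^sup>+\<omega>. \<integral>\<^sup>+\<omega>'. f (x ## (stake m \<omega> @- \<omega>')) \<partial>S \<partial>S \<partial>\<mu>)"
    by simp
  also have "\<dots> = (\<integral>\<^sup>+x. \<integral>\<^sup>+\<omega>. f (x ## \<omega>) \<partial>S \<partial>\<mu>)"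
  proof (rule nn_integral_cong)
    fix x assume [measurable]: "x \<in> space \<mu>"
    show "(\<integral>\<^sup>+\<omega>. \<integral>\<^sup>+\<omega>'. f (x ## (stake m \<omega> @- \<omega>')) \<partial>S \<partial>S) = (\<integral>\<^sup>+\<omega>. f (x ## \<omega>) \<partial>S)"
      by (rule Suc.IH[symmetric]) measurable
  qed
  also have "\<dots> = (\<integral>\<^sup>+\<omega>. f \<omega> \<partial>S)"
    by (rule nn_integral_stream_space[symmetric]) measurable
  finally show ?case by simp
qed

lemma distr_shift: "distr (S \<Otimes>\<^sub>M S) S (\<lambda>p. stake m (fst p) @- snd p) = S"
proof (rule measure_eqI)
  fix A assume "A \<in> sets (distr (S \<Otimes>\<^sub>M S) S (\<lambda>p. stake m (fst p) @- snd p))"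
  then have A[measurable]: "A \<in> sets S" by simp
  have "emeasure (distr (S \<Otimes>\<^sub>M S) S (\<lambda>p. stake m (fst p) @- snd p)) A
     = (\<integral>\<^sup>+\<omega>. indicator A \<omega> \<partial>distr (S \<Otimes>\<^sub>M S) S (\<lambda>p. stake m (fst p) @- snd p))"
    by simp
  also have "\<dots> = (\<integral>\<^sup>+p. indicator A (stake m (fst p) @- snd p) \<partial>(S \<Otimes>\<^sub>M S))"
    by (subst nn_integral_distr) auto
  also have "\<dots> = (\<integral>\<^sup>+\<omega>. \<integral>\<^sup>+\<omega>'. indicator A (stake m \<omega> @- \<omega>') \<partial>S \<partial>S)"
    by (subst S.nn_integral_fst[symmetric]) auto
  also have "\<dots> = (\<integral>\<^sup>+\<omega>. indicator A \<omega> \<partial>S)"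
    by (rule nn_integral_shift[symmetric]) simp
  finally show "emeasure (distr (S \<Otimes>\<^sub>M S) S (\<lambda>p. stake m (fst p) @- snd p)) A = emeasure S A" by simp
qed simp

lemma distr_Stream: "distr (\<mu> \<Otimes>\<^sub>M S) S (\<lambda>p. fst p ## snd p) = S"
proof (rule measure_eqI)
  fix A assume "A \<in> sets (distr (\<mu> \<Otimes>\<^sub>M S) S (\<lambda>p. fst p ## snd p))"
  then have A[measurable]: "A \<in> sets S" by simp
  have "emeasure (distr (\<mu> \<Otimes>\<^sub>M S) S (\<lambda>p. fst p ## snd p)) A
     = (\<integral>\<^sup>+\<omega>. indicator A \<omega> \<partial>distr (\<mu> \<Otimes>\<^sub>M S) S (\<lambda>p. fst p ## snd p))"
    by simp
  also have "\<dots> = (\<integral>\<^sup>+p. indicator A (fst p ## snd p) \<partial>(\<mu> \<Otimes>\<^sub>M S))"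
    by (subst nn_integral_distr) auto
  also have "\<dots> = (\<integral>\<^sup>+x. \<integral>\<^sup>+\<omega>. indicator A (x ## \<omega>) \<partial>S \<partial>\<mu>)"
    by (subst S.nn_integral_fst[symmetric]) auto
  also have "\<dots> = (\<integral>\<^sup>+\<omega>. indicator A \<omega> \<partial>S)"
    by (rule nn_integral_stream_space[symmetric]) simp
  finally show "emeasure (distr (\<mu> \<Otimes>\<^sub>M S) S (\<lambda>p. fst p ## snd p)) A = emeasure S A" by simp
qed simp

lemma integral_shift:
  fixes f :: "'n mat stream \<Rightarrow> real"
  assumes f: "integrable S f"
  shows "(\<integral>\<omega>. f \<omega> \<partial>S) = (\<integral>\<omega>. \<integral>\<omega>'. f (stake m \<omega> @- \<omega>') \<partial>S \<partial>S)"
    and "integrable S (\<lambda>\<omega>. \<integral>\<omega>'. f (stake m \<omega> @- \<omega>') \<partial>S)"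
    and "AE \<omega> in S. integrable S (\<lambda>\<omega>'. f (stake m \<omega> @- \<omega>'))"
proof -
  have [measurable]: "f \<in> borel_measurable S" using f by auto
  have i: "integrable (S \<Otimes>\<^sub>M S) (\<lambda>p. f (stake m (fst p) @- snd p))"
    using f by (subst (asm) distr_shift[of m, symmetric]) (simp add: integrable_distr_eq)
  have "(\<integral>\<omega>. f \<omega> \<partial>S) = (\<integral>p. f (stake m (fst p) @- snd p) \<partial>(S \<Otimes>\<^sub>M S))"
    by (subst distr_shift[of m, symmetric]) (simp add: integral_distr)
  also have "\<dots> = (\<integral>\<omega>. \<integral>\<omega>'. f (stake m \<omega> @- \<omega>') \<partial>S \<partial>S)"
    using SS.integral_fst'[OF i] by simp
  finally show "(\<integral>\<omega>. f \<omega> \<partial>S) = (\<integral>\<omega>. \<integral>\<omega>'. f (stake m \<omega> @- \<omega>') \<partial>S \<partial>S)" .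
  show "integrable S (\<lambda>\<omega>. \<integral>\<omega>'. f (stake m \<omega> @- \<omega>') \<partial>S)" using SS.integrable_fst'[OF i] by simp
  show "AE \<omega> in S. integrable S (\<lambda>\<omega>'. f (stake m \<omega> @- \<omega>'))" using SS.AE_integrable_fst'[OF i] by simp
qed

lemma integral_Stream:
  fixes f :: "'n mat stream \<Rightarrow> real"
  assumes f: "integrable S f"
  shows "(\<integral>\<omega>. f \<omega> \<partial>S) = (\<integral>x. \<integral>\<omega>. f (x ## \<omega>) \<partial>S \<partial>\<mu>)"
    and "integrable \<mu> (\<lambda>x. \<integral>\<omega>. f (x ## \<omega>) \<partial>S)"
    and "AE x in \<mu>. integrable S (\<lambda>\<omega>. f (x ## \<omega>))"
proof -
  have [measurable]: "f \<in> borel_measurable S" using f by auto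
  have i: "integrable (\<mu> \<Otimes>\<^sub>M S) (\<lambda>p. f (fst p ## snd p))"
    using f by (subst (asm) distr_Stream[symmetric]) (simp add: integrable_distr_eq)
  have "(\<integral>\<omega>. f \<omega> \<partial>S) = (\<integral>p. f (fst p ## snd p) \<partial>(\<mu> \<Otimes>\<^sub>M S))"
    by (subst distr_Stream[symmetric]) (simp add: integral_distr)
  also have "\<dots> = (\<integral>x. \<integral>\<omega>. f (x ## \<omega>) \<partial>S \<partial>\<mu>)"
    using muS.integral_fst'[OF i] by simp
  finally show "(\<integral>\<omega>. f \<omega> \<partial>S) = (\<integral>x. \<integral>\<omega>. f (x ## \<omega>) \<partial>S \<partial>\<mu>)" .
  show "integrable \<mu> (\<lambda>x. \<integral>\<omega>. f (x ## \<omega>) \<partial>S)" using muS.integrable_fst'[OF i] by simp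
  show "AE x in \<mu>. integrable S (\<lambda>\<omega>. f (x ## \<omega>))" using muS.AE_integrable_fst'[OF i] by simp
qed

text \<open>The Markov property as it is used below: an event \<open>A\<close> decided at time \<open>m\<close>, followed by an event
  which has probability at least \<open>p\<close> whatever happened before.\<close>
lemma prob_shift_ge:
  assumes A[measurable]: "A \<in> sets S" and B[measurable]: "B \<in> sets S"
    and dec: "\<And>\<omega> \<omega>'. \<omega> \<in> A \<Longrightarrow> \<omega>' \<in> space S \<Longrightarrow> stake m \<omega> @- \<omega>' \<in> A"
    and p: "\<And>\<omega>. \<omega> \<in> A \<Longrightarrow> p \<le> S.prob {\<omega>' \<in> space S. stake m \<omega> @- \<omega>' \<in> B}" and p0: "0 \<le> p"
  shows "p * S.prob A \<le> S.prob (A \<inter> B)"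
proof -
  have "ennreal (p * S.prob A) = (\<integral>\<^sup>+\<omega>. ennreal p * indicator A \<omega> \<partial>S)"
    using p0 by (simp add: nn_integral_cmult S.emeasure_eq_measure ennreal_mult)
  also have "\<dots> \<le> (\<integral>\<^sup>+\<omega>. \<integral>\<^sup>+\<omega>'. indicator (A \<inter> B) (stake m \<omega> @- \<omega>') \<partial>S \<partial>S)"
  proof (rule nn_integral_mono)
    fix \<omega> assume w: "\<omega> \<in> space S"
    show "ennreal p * indicator A \<omega> \<le> (\<integral>\<^sup>+\<omega>'. indicator (A \<inter> B) (stake m \<omega> @- \<omega>') \<partial>S)"
    proof (cases "\<omega> \<in> A")
      case True
      have [measurable]: "(\<lambda>\<omega>'. stake m \<omega> @- \<omega>') \<in> measurable S S"
        using w by (intro measurable_shift) auto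
      have "ennreal p \<le> emeasure S {\<omega>' \<in> space S. stake m \<omega> @- \<omega>' \<in> B}"
        using p[OF True] by (simp add: S.emeasure_eq_measure)
      also have "\<dots> = (\<integral>\<^sup>+\<omega>'. indicator {\<omega>' \<in> space S. stake m \<omega> @- \<omega>' \<in> B} \<omega>' \<partial>S)"
        by (rule nn_integral_indicator[symmetric]) measurable
      also have "\<dots> \<le> (\<integral>\<^sup>+\<omega>'. indicator (A \<inter> B) (stake m \<omega> @- \<omega>') \<partial>S)"
        using dec[OF True] by (intro nn_integral_mono) (auto split: split_indicator)
      finally show ?thesis using True by simp
    qed simp
  qed
  also have "\<dots> = (\<integral>\<^sup>+\<omega>. indicator (A \<inter> B) \<omega> \<partial>S)"
    by (rule nn_integral_shift[symmetric]) measurable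
  also have "\<dots> = ennreal (S.prob (A \<inter> B))" by (simp add: S.emeasure_eq_measure)
  finally show ?thesis by simp
qed

text \<open>If after every time \<open>k\<close> at which \<open>A k\<close> happens there is a chance \<open>p\<close> that no \<open>A l\<close> with
  \<open>l \<ge> k + m\<close> happens, then on average at most \<open>m / p\<close> of the \<open>A k\<close> happen: the \<open>k\<close> which are followed
  by such a silence lie within distance \<open>m\<close> of each other.\<close>
lemma expected_visits_le:
  fixes A :: "nat \<Rightarrow> 'n mat stream set" and m T :: nat
  assumes A[measurable]: "\<And>k. A k \<in> sets S"
    and B: "\<And>k. k < T \<Longrightarrow> p * S.prob (A k) \<le> S.prob (A k \<inter> - (\<Union>l\<in>{k + m..<T}. A l))"
    and p: "0 < p"
  shows "(\<Sum>k<T. S.prob (A k)) \<le> m / p"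
proof -
  define B where "B k = A k \<inter> - (\<Union>l\<in>{k + m..<T}. A l)" for k
  have "B k = A k - (\<Union>l\<in>{k + m..<T}. A l)" for k unfolding B_def by auto
  then have [measurable]: "B k \<in> sets S" for k
    by (auto intro!: sets.Diff sets.finite_UN A)
  have cnt: "(\<Sum>k<T. indicator (B k) \<omega>) \<le> real m" for \<omega>
  proof -
    let ?K = "{k. k < T \<and> \<omega> \<in> B k}"
    have "(\<Sum>k<T. indicator (B k) \<omega>) = real (card ?K)"
      by (simp add: indicator_def sum.If_cases Int_def lessThan_def)
    also have "card ?K \<le> m"
    proof (cases "?K = {}")
      case False
      define a where "a = Min ?K"
      have fin: "finite ?K" by simp
      have a: "a \<in> ?K" unfolding a_def by (rule Min_in[OF fin False])
      have "?K \<subseteq> {a..<a + m}"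
      proof
        fix k assume k: "k \<in> ?K"
        then have "a \<le> k" unfolding a_def by (intro Min_le fin)
        moreover have "k < a + m"
        proof (rule ccontr)
          assume "\<not> k < a + m"
          then have "k \<in> {a + m..<T}" using k by auto
          then have "\<omega> \<notin> A k" using a unfolding B_def by blast
          then show False using k unfolding B_def by blast
        qed
        ultimately show "k \<in> {a..<a + m}" by simp
      qed
      from card_mono[OF _ this] show ?thesis by simp
    qed (metis card.empty le0)
    finally show ?thesis by simp
  qed
  have "p * (\<Sum>k<T. S.prob (A k)) \<le> (\<Sum>k<T. S.prob (B k))"
    unfolding sum_distrib_left B_def by (intro sum_mono B) simp
  also have "\<dots> = (\<Sum>k<T. \<integral>\<omega>. indicator (B k) \<omega> \<partial>S)" by simp
  also have "\<dots> = (\<integral>\<omega>. (\<Sum>k<T. indicator (B k) \<omega>) \<partial>S)"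
    by (subst Bochner_Integration.integral_sum) (auto intro!: integrable_real_indicator simp: less_top[symmetric])
  also have "\<dots> \<le> (\<integral>\<omega>. real m \<partial>S)"
    using cnt by (intro integral_mono) (auto intro!: Bochner_Integration.integrable_sum integrable_real_indicator simp: less_top[symmetric])
  also have "\<dots> = m" by (simp add: S.prob_space)
  finally show ?thesis using p by (simp add: field_simps)
qed

section \<open>Invariant finite families of subspaces\<close>

text \<open>Furstenberg's device: a weight on a family of subspaces that is subinvariant on average and of which
  only finitely many can be large is maximal on a finite family, and that family is almost surely invariant.\<close>
lemma invariant_finite_family:
  fixes \<beta> :: "'a set \<Rightarrow> real" and F :: "'a set set"
  assumes nonneg: "\<And>W. W \<in> F \<Longrightarrow> 0 \<le> \<beta> W"
    and sums: "\<And>H. finite H \<Longrightarrow> H \<subseteq> F \<Longrightarrow> (\<Sum>W\<in>H. \<beta> W) \<le> 1"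
    and pos: "W0 \<in> F" "0 < \<beta> W0"
    and act: "\<And>A W. A \<in> GL \<Longrightarrow> W \<in> F \<Longrightarrow> \<tau> A W \<in> F"
    and meas: "\<And>W. W \<in> F \<Longrightarrow> (\<lambda>A. \<beta> (\<tau> A W)) \<in> borel_measurable \<mu>"
    and sub: "\<And>W. W \<in> F \<Longrightarrow> \<beta> W \<le> (\<integral>A. \<beta> (\<tau> A W) \<partial>\<mu>)"
  obtains H where "finite H" "H \<noteq> {}" "H \<subseteq> F" "AE A in \<mu>. \<forall>W\<in>H. \<tau> A W \<in> H"
proof -
  have b1: "\<beta> W \<le> 1" if "W \<in> F" for W using sums[of "{W}"] that by simp
  have fin: "finite {W\<in>F. t \<le> \<beta> W}" if t: "t > 0" for t
  proof (rule ccontr)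
    assume inf: "infinite {W\<in>F. t \<le> \<beta> W}"
    obtain n :: nat where n: "1 < n * t" using ex_less_of_nat_mult[OF t] by blast
    obtain H where H: "H \<subseteq> {W\<in>F. t \<le> \<beta> W}" "finite H" "card H = n"
      using infinite_arbitrarily_large[OF inf] by blast
    have "n * t = (\<Sum>W\<in>H. t)" using H by simp
    also have "\<dots> \<le> (\<Sum>W\<in>H. \<beta> W)" using H by (intro sum_mono) auto
    also have "\<dots> \<le> 1" using H by (intro sums) auto
    finally show False using n by simp
  qed
  define H0 where "H0 = {W\<in>F. \<beta> W0 \<le> \<beta> W}"
  have H0: "finite H0" "W0 \<in> H0" using fin[OF pos(2)] pos by (auto simp: H0_def)
  define mx where "mx = Max (\<beta> ` H0)"
  have mx_ge: "\<beta> W \<le> mx" if "W \<in> F" for W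
  proof (cases "\<beta> W0 \<le> \<beta> W")
    case True
    then show ?thesis unfolding mx_def using H0 that by (intro Max_ge) (auto simp: H0_def)
  next
    case False
    moreover have "\<beta> W0 \<le> mx" unfolding mx_def using H0 by (intro Max_ge) auto
    ultimately show ?thesis by simp
  qed
  define H where "H = {W\<in>F. \<beta> W = mx}"
  have mxp: "mx > 0" using mx_ge[OF pos(1)] pos by simp
  have "mx \<in> \<beta> ` H0" unfolding mx_def using H0 by (intro Max_in) auto
  then have ne: "H \<noteq> {}" by (auto simp: H_def H0_def)
  have finH: "finite H" using finite_subset[OF _ fin[OF mxp], of H] by (auto simp: H_def)
  have "AE A in \<mu>. \<tau> A W \<in> H" if W: "W \<in> H" for W
  proof -
    have WF: "W \<in> F" "\<beta> W = mx" using W by (auto simp: H_def)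
    note [measurable] = meas[OF WF(1)]
    have in_F: "A \<in> space \<mu> \<Longrightarrow> \<tau> A W \<in> F" for A using act WF by (simp add: space_mu)
    have int: "integrable \<mu> (\<lambda>A. \<beta> (\<tau> A W))"
      by (rule integrable_const_bound[where B=1]) (auto intro!: AE_I2 simp: abs_le_iff b1 in_F nonneg order_trans[OF _ nonneg])
    have "(\<integral>A. mx - \<beta> (\<tau> A W) \<partial>\<mu>) = mx - (\<integral>A. \<beta> (\<tau> A W) \<partial>\<mu>)"
      using int by (simp add: prob_space)
    also have "\<dots> \<le> 0" using sub[OF WF(1)] WF(2) by simp
    finally have le: "(\<integral>A. mx - \<beta> (\<tau> A W) \<partial>\<mu>) \<le> 0" .
    have nn: "AE A in \<mu>. 0 \<le> mx - \<beta> (\<tau> A W)" by (rule AE_I2) (simp add: mx_ge in_F)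
    then have "0 \<le> (\<integral>A. mx - \<beta> (\<tau> A W) \<partial>\<mu>)" by (rule integral_nonneg_AE)
    with le have "(\<integral>A. mx - \<beta> (\<tau> A W) \<partial>\<mu>) = 0" by simp
    then have "AE A in \<mu>. mx - \<beta> (\<tau> A W) = 0"
      using integral_nonneg_eq_0_iff_AE[OF _ nn] int by simp
    then show ?thesis using AE_space by eventually_elim (auto simp: H_def in_F)
  qed
  then have "AE A in \<mu>. \<forall>W\<in>H. \<tau> A W \<in> H" using finH by (simp add: AE_finite_all)
  then show ?thesis using that[of H] finH ne by (auto simp: H_def)
qed

text \<open>The matrices preserving the union of the family form a closed semigroup; as almost every matrix belongs
  to it, so does the support, and hence \<open>Gamma \<mu>\<close>.\<close>
lemma not_strongly_irreducibleI:
  fixes F :: "(real ^ 'n) set set"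
  assumes F: "finite F" "F \<noteq> {}" "\<And>W. W \<in> F \<Longrightarrow> subspace W" "\<And>W. W \<in> F \<Longrightarrow> W \<noteq> {0}" "\<And>W. W \<in> F \<Longrightarrow> W \<noteq> UNIV"
    and inv: "AE A in \<mu>. (*v) A ` (\<Union>F) \<subseteq> \<Union>F"
  shows "\<not> strongly_irreducible \<mu>"
proof -
  let ?X = "\<Union>F"
  define C where "C = {A. \<forall>x\<in>?X. A *v x \<in> ?X}"
  have clX: "closed ?X" by (intro closed_Union ballI closed_subspace F)
  have "closed C"
  proof -
    have "C = (\<Inter>x\<in>?X. (\<lambda>A. A *v x) -` ?X)" by (auto simp: C_def)
    moreover have "closed ((\<lambda>A :: 'n mat. A *v x) -` ?X)" for x
    proof (rule closed_vimage[OF clX])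
      show "continuous_on UNIV (\<lambda>A :: 'n mat. A *v x)"
        unfolding matrix_vector_mult_def
        by (intro continuous_on_vec_lambda continuous_on_sum continuous_on_mult continuous_on_component
            continuous_on_const continuous_on_id)
    qed
    ultimately show ?thesis by (auto intro: closed_INT)
  qed
  let ?T = "GL \<inter> C"
  have invC: "AE A in \<mu>. A \<in> C" using inv by eventually_elim (auto simp: C_def)
  have "supp \<mu> \<subseteq> ?T"
  proof
    fix A assume A: "A \<in> supp \<mu>"
    have "A \<in> C"
    proof (rule ccontr)
      assume "A \<notin> C"
      then have "measure \<mu> ((- C) \<inter> GL) > 0"
        using A \<open>closed C\<close> unfolding supp_def by (auto simp: open_Compl)
      moreover have "AE A in \<mu>. A \<notin> (- C) \<inter> GL" using invC by eventually_elim auto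
      then have "measure \<mu> ((- C) \<inter> GL) = 0"
        by (subst prob_eq_0) (auto simp: sets_mu sets_restrict_space \<open>closed C\<close>)
      ultimately show False by simp
    qed
    then show "A \<in> ?T" using A by (auto simp: supp_def)
  qed
  moreover have "closedin (top_of_set GL) ?T" using \<open>closed C\<close> by (rule closedin_closed_Int)
  moreover have "\<forall>A\<in>?T. \<forall>B\<in>?T. A ** B \<in> ?T"
  proof (intro ballI)
    fix A B assume "A \<in> ?T" "B \<in> ?T"
    then have AB: "A \<in> GL" "B \<in> GL" "A \<in> C" "B \<in> C" by simp_all
    have a: "A *v x \<in> ?X" if "x \<in> ?X" for x
      using AB(3)[unfolded C_def mem_Collect_eq] that by (rule bspec)
    have b: "B *v x \<in> ?X" if "x \<in> ?X" for x
      using AB(4)[unfolded C_def mem_Collect_eq] that by (rule bspec)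
    have "A ** B \<in> GL" using AB by (intro GL_mult)
    moreover have "A ** B \<in> C"
      unfolding C_def
      by (intro CollectI ballI, subst matrix_vector_mul_assoc[symmetric]) (rule a[OF b])
    ultimately show "A ** B \<in> ?T" by (rule IntI)
  qed
  ultimately have "Gamma \<mu> \<subseteq> ?T"
    unfolding Gamma_def by (intro hull_minimal) auto
  then have G: "\<forall>A\<in>Gamma \<mu>. (*v) A ` ?X \<subseteq> ?X"
  proof (intro ballI image_subsetI)
    fix A x assume "A \<in> Gamma \<mu>" and x: "x \<in> ?X"
    then have "A \<in> C" using \<open>Gamma \<mu> \<subseteq> ?T\<close> by (simp only: subset_iff Int_iff)
    then show "A *v x \<in> ?X" unfolding C_def mem_Collect_eq using x by (rule bspec)
  qed
  show ?thesis
    unfolding strongly_irreducible_def not_not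
    by (rule exI[of _ F]) (intro conjI ballI F G[rule_format])
qed

end

lemma (in prob_space) sum_prob_le_1:
  assumes "finite H" and E[measurable]: "\<And>i. i \<in> H \<Longrightarrow> E i \<in> events"
    and null: "\<And>i j. i \<in> H \<Longrightarrow> j \<in> H \<Longrightarrow> i \<noteq> j \<Longrightarrow> prob (E i \<inter> E j) = 0"
  shows "(\<Sum>i\<in>H. prob (E i)) \<le> 1"
proof -
  have "AE x in M. \<forall>i\<in>H. \<forall>j\<in>H. i \<noteq> j \<longrightarrow> x \<notin> E i \<inter> E j"
  proof (intro AE_finite_allI \<open>finite H\<close>)
    fix i j assume ij: "i \<in> H" "j \<in> H"
    show "AE x in M. i \<noteq> j \<longrightarrow> x \<notin> E i \<inter> E j"
    proof (cases "i = j")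
      case False
      then have "AE x in M. x \<notin> E i \<inter> E j"
        using null[OF ij] ij by (subst (asm) prob_eq_0) auto
      then show ?thesis by simp
    qed simp
  qed
  then have "AE x in M. (\<Sum>i\<in>H. indicator (E i) x) \<le> (1 :: real)"
  proof eventually_elim
    case (elim x)
    have "(\<Sum>i\<in>H. indicator (E i) x) = real (card {i\<in>H. x \<in> E i})"
      using \<open>finite H\<close> by (simp add: indicator_def sum.If_cases Int_def)
    also have "card {i\<in>H. x \<in> E i} \<le> 1"
      using elim \<open>finite H\<close> by (auto simp: card_le_Suc0_iff_eq)
    finally show ?case by simp
  qed
  then have "(\<integral>x. (\<Sum>i\<in>H. indicator (E i) x) \<partial>M) \<le> (\<integral>x. (1 :: real) \<partial>M)"
    by (intro integral_mono_AE)
      (auto intro!: Bochner_Integration.integrable_sum integrable_real_indicator simp: less_top[symmetric])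
  also have "(\<integral>x. (\<Sum>i\<in>H. indicator (E i) x) \<partial>M) = (\<Sum>i\<in>H. prob (E i))"
    by (subst Bochner_Integration.integral_sum) (auto intro!: integrable_real_indicator simp: less_top[symmetric])
  finally show ?thesis by (simp add: prob_space)
qed

section \<open>The stationary measure charges no hyperplane\<close>

text \<open>Only functions of lines matter, so the stationary measure on projective space is represented by
  the law of a vector on the random line; stationarity is then asserted for functions of degree zero only.\<close>
locale stationary_walk = gl_walk \<mu> for \<mu> :: "'n::finite mat measure" +
  fixes \<eta> :: "(real ^ 'n) measure"
  assumes eta_prob: "prob_space \<eta>" and sets_eta [measurable_cong, simp]: "sets \<eta> = sets borel"
    and eta_nz: "AE x in \<eta>. x \<noteq> 0"
    and eta_stationary: "\<And>f :: real ^ 'n \<Rightarrow> real. f \<in> borel_measurable borel \<Longrightarrow> (\<And>x. \<bar>f x\<bar> \<le> B) \<Longrightarrow>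
      (\<And>c x. c \<noteq> 0 \<Longrightarrow> f (c *\<^sub>R x) = f x) \<Longrightarrow> (\<integral>x. f x \<partial>\<eta>) = (\<integral>A. \<integral>x. f (A *v x) \<partial>\<eta> \<partial>\<mu>)"
    and SI: "strongly_irreducible \<mu>"
begin

sublocale eta: prob_space \<eta> by (rule eta_prob)
sublocale Seta: pair_prob_space S \<eta> ..
sublocale mueta: pair_prob_space \<mu> \<eta> ..

lemma space_eta [simp]: "space \<eta> = UNIV"
  using sets_eq_imp_space_eq[OF sets_eta] by simp

lemma eta_UNIV [simp]: "measure \<eta> UNIV = 1"
  using eta.prob_space by simp

lemma subspace_borel: "subspace W \<Longrightarrow> W \<in> sets borel" for W :: "(real ^ 'n) set"
  by (intro borel_closed closed_subspace)

lemma subspace_preimage: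
  fixes W :: "(real ^ 'n) set"
  assumes A: "A \<in> GL" and W: "subspace W"
  shows "subspace {x. A *v x \<in> W}" "dim {x. A *v x \<in> W} = dim W"
proof -
  have e: "{x. A *v x \<in> W} = (*v) (matrix_inv A) ` W"
  proof safe
    fix x assume "A *v x \<in> W"
    then show "x \<in> (*v) (matrix_inv A) ` W"
      by (intro image_eqI[of _ _ "A *v x"]) (simp_all add: matrix_inv_vec[OF A])
  qed (simp add: matrix_inv_vec[OF A])
  show "subspace {x. A *v x \<in> W}"
    unfolding e by (intro linear_subspace_image W matrix_vector_mul_linear)
  have "inj ((*v) (matrix_inv A))"
    by (rule injI) (metis GL_inj GL_inv A)
  then show "dim {x. A *v x \<in> W} = dim W"
    unfolding e by (intro dim_image_eq matrix_vector_mul_linear) (auto intro: inj_on_subset)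
qed

text \<open>Among the subspaces of positive measure let \<open>r\<close> be the least dimension. Two different ones of dimension
  \<open>r\<close> meet in a null set, so the measures of the subspaces of dimension \<open>r\<close> are summable, and by stationarity
  \<open>invariant_finite_family\<close> applies to them with the inverse action.\<close>
lemma eta_proper_subspace:
  assumes "subspace W" "W \<noteq> UNIV"
  shows "measure \<eta> W = 0"
proof (rule ccontr)
  assume "measure \<eta> W \<noteq> 0"
  then have W: "measure \<eta> W > 0" by (simp add: zero_less_measure_iff)
  define P where "P r \<longleftrightarrow> (\<exists>W. subspace W \<and> W \<noteq> UNIV \<and> dim W = r \<and> measure \<eta> W > 0)" for r
  define r where "r = (LEAST r. P r)"
  have Pr: "P r" unfolding r_def by (rule LeastI[of P "dim W"]) (use W assms in \<open>auto simp: P_def\<close>)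
  have small: "measure \<eta> W' = 0" if "subspace W'" "W' \<noteq> UNIV" "dim W' < r" for W'
    using not_less_Least[of "dim W'" P] that unfolding r_def P_def by (auto simp: zero_less_measure_iff)
  obtain W0 where W0: "subspace W0" "W0 \<noteq> UNIV" "dim W0 = r" "measure \<eta> W0 > 0" using Pr by (auto simp: P_def)
  have r_lt: "r < CARD('n)"
  proof -
    have "dim W0 \<noteq> dim (UNIV :: (real ^ 'n) set)"
      using subspace_dim_equal[of W0 UNIV] W0 by auto
    then show ?thesis using W0 dim_subset_UNIV[of W0] by simp
  qed
  have r_pos: "r > 0"
  proof (rule ccontr)
    assume "\<not> r > 0"
    then have "W0 \<subseteq> {0}" using W0 by simp
    then have "AE x in \<eta>. x \<notin> W0" using eta_nz by (auto elim: eventually_mono)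
    then have "measure \<eta> W0 = 0" using W0 by (subst eta.prob_eq_0) (auto intro: subspace_borel)
    then show False using W0 by simp
  qed
  let ?F = "{W :: (real ^ 'n) set. subspace W \<and> dim W = r}"
  define \<tau> where "\<tau> A W = {x. A *v x \<in> W}" for A :: "'n mat" and W
  have meas_eq: "(\<integral>x. indicator W (A *v x) \<partial>\<eta>) = measure \<eta> (\<tau> A W)" if [measurable]: "W \<in> sets borel" for A W
  proof -
    have [measurable]: "\<tau> A W \<in> sets \<eta>" unfolding \<tau>_def sets_eta by measurable
    have "(\<integral>x. indicat_real W (A *v x) \<partial>\<eta>) = (\<integral>x. indicator (\<tau> A W) x \<partial>\<eta>)"
      by (intro Bochner_Integration.integral_cong) (auto simp: \<tau>_def split: split_indicator)
    then show ?thesis by simp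
  qed
  have meas[measurable]: "W \<in> sets borel \<Longrightarrow> (\<lambda>A. measure \<eta> (\<tau> A W)) \<in> borel_measurable \<mu>" for W
  proof -
    assume [measurable]: "W \<in> sets borel"
    have "(\<lambda>A. \<integral>x. indicat_real W (A *v x) \<partial>\<eta>) \<in> borel_measurable \<mu>" by measurable
    then show ?thesis by (simp add: meas_eq)
  qed
  obtain H where H: "finite H" "H \<noteq> {}" "H \<subseteq> ?F" "AE A in \<mu>. \<forall>W\<in>H. \<tau> A W \<in> H"
  proof (rule invariant_finite_family[where \<beta> = "measure \<eta>" and F = ?F and \<tau> = \<tau> and ?W0.0 = W0])
    fix H assume H: "finite H" "H \<subseteq> ?F"
    show "(\<Sum>W\<in>H. measure \<eta> W) \<le> 1"
    proof (rule eta.sum_prob_le_1[where E="\<lambda>W. W"])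
      fix W W' assume a: "W \<in> H" "W' \<in> H" "W \<noteq> W'"
      then have b: "subspace W" "subspace W'" "dim W = r" "dim W' = r" using H by auto
      have "dim (W \<inter> W') < r"
      proof (rule ccontr)
        assume "\<not> dim (W \<inter> W') < r"
        then have "dim (W \<inter> W') \<ge> dim W" "dim (W \<inter> W') \<ge> dim W'" using b by simp_all
        then have "W \<inter> W' = W" and "W \<inter> W' = W'"
          using subspace_dim_equal[OF subspace_inter[OF b(1,2)] b(1) Int_lower1]
            subspace_dim_equal[OF subspace_inter[OF b(1,2)] b(2) Int_lower2] by blast+
        then show False using a by auto
      qed
      moreover have "W \<inter> W' \<noteq> UNIV" using b r_lt by auto
      ultimately show "measure \<eta> (W \<inter> W') = 0" using b by (intro small subspace_inter) auto
    qed (use H in \<open>auto intro: subspace_borel\<close>)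
  next
    fix W assume W: "W \<in> ?F"
    then have [measurable]: "W \<in> sets borel" by (auto intro: subspace_borel)
    show "(\<lambda>A. measure \<eta> (\<tau> A W)) \<in> borel_measurable \<mu>" by measurable
    have "measure \<eta> W = (\<integral>x. indicator W x \<partial>\<eta>)" by simp
    also have "\<dots> = (\<integral>A. \<integral>x. indicator W (A *v x) \<partial>\<eta> \<partial>\<mu>)"
    proof (rule eta_stationary[where B=1])
      fix c :: real and x :: "real ^ 'n" assume "c \<noteq> 0"
      then have "c *\<^sub>R x \<in> W \<longleftrightarrow> x \<in> W"
        using W by (auto simp: subspace_scale dest: subspace_scale[of W "c *\<^sub>R x" "1 / c"])
      then show "indicat_real W (c *\<^sub>R x) = indicat_real W x" by (simp add: indicator_def)
    qed (auto simp: indicator_def)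
    also have "\<dots> = (\<integral>A. measure \<eta> (\<tau> A W) \<partial>\<mu>)" by (simp add: meas_eq)
    finally show "measure \<eta> W \<le> (\<integral>A. measure \<eta> (\<tau> A W) \<partial>\<mu>)" by simp
  next
    fix A :: "'n mat" and W assume "A \<in> GL" "W \<in> ?F"
    then show "\<tau> A W \<in> ?F" using subspace_preimage[of A W] by (simp add: \<tau>_def)
  qed (use W0 in auto)
  have "AE A in \<mu>. (*v) A ` (\<Union>H) \<subseteq> \<Union>H"
    using H(4) AE_space
  proof eventually_elim
    case (elim A)
    then have A: "A \<in> GL" by (simp add: space_mu)
    have "inj_on (\<tau> A) H"
    proof (rule inj_onI)
      fix W W' assume "\<tau> A W = \<tau> A W'"
      moreover have "W = (*v) A ` \<tau> A W" for W
        using matrix_inv_vec(1)[OF A] by (auto simp: \<tau>_def image_iff) (metis matrix_inv_vec(1)[OF A])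
      ultimately show "W = W'" by metis
    qed
    then have "\<tau> A ` H = H" using elim H(1) by (intro endo_inj_surj) auto
    show ?case
    proof safe
      fix W x assume "W \<in> H" "x \<in> W"
      then obtain W' where "W' \<in> H" "W = \<tau> A W'" using \<open>\<tau> A ` H = H\<close> by blast
      then show "A *v x \<in> \<Union>H" using \<open>x \<in> W\<close> by (auto simp: \<tau>_def)
    qed
  qed
  then have "\<not> strongly_irreducible \<mu>"
  proof (rule not_strongly_irreducibleI[OF H(1,2), rotated 3])
    fix W assume "W \<in> H"
    then have W: "subspace W" "dim W = r" using H by auto
    then show "subspace W" "W \<noteq> {0}" "W \<noteq> UNIV" using r_pos r_lt by auto
  qed
  then show False using SI by simp
qed

text \<open>A uniform form of the preceding result: neighbourhoods of a hyperplane have small measure.\<close>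
lemma eta_near_hyperplane:
  assumes b: "b \<noteq> 0" and e: "0 < e"
  obtains t where "0 < t" "measure \<eta> {x. \<bar>b \<bullet> x\<bar> \<le> t * norm x} < e"
proof -
  let ?A = "\<lambda>n::nat. {x. \<bar>b \<bullet> x\<bar> \<le> (1 / Suc n) * norm x}"
  have "(\<lambda>n. measure \<eta> (?A n)) \<longlonglongrightarrow> measure \<eta> (\<Inter>n. ?A n)"
  proof (rule eta.finite_Lim_measure_decseq)
    show "range ?A \<subseteq> sets \<eta>" by auto
    show "decseq ?A"
    proof (rule decseq_SucI)
      fix n
      have "(1 / Suc (Suc n)) * norm x \<le> (1 / Suc n) * norm x" for x :: "real ^ 'n"
        by (intro mult_right_mono) (auto simp: field_simps)
      then show "?A (Suc n) \<subseteq> ?A n" using order_trans by fastforce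
    qed
  qed
  also have "(\<Inter>n. ?A n) = {x. b \<bullet> x = 0}"
  proof safe
    fix x assume x: "x \<in> (\<Inter>n. ?A n)"
    have "(\<lambda>n. (1 / Suc n) * norm x) \<longlonglongrightarrow> 0 * norm x"
      by (intro tendsto_mult tendsto_const LIMSEQ_Suc[OF lim_1_over_n])
    then have "\<bar>b \<bullet> x\<bar> \<le> 0 * norm x" using x by (intro LIMSEQ_le_const) auto
    then show "b \<bullet> x = 0" by simp
  qed auto
  also have "measure \<eta> {x. b \<bullet> x = 0} = 0"
  proof (rule eta_proper_subspace)
    show "subspace {x. b \<bullet> x = 0}" by (rule subspace_hyperplane)
    have "b \<notin> {x. b \<bullet> x = 0}" using b by simp
    then show "{x. b \<bullet> x = 0} \<noteq> UNIV" by blast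
  qed
  finally have "\<forall>\<^sub>F n in sequentially. measure \<eta> (?A n) < e" using e by (rule order_tendstoD)
  then obtain n where "measure \<eta> (?A n) < e" by (auto simp: eventually_sequentially)
  then show ?thesis by (intro that[of "1 / Suc n"]) auto
qed

section \<open>Tensor features and the bounded variation of the mean feature\<close>

text \<open>The coordinates of the tensor power \<open>x \<otimes> \<dots> \<otimes> x\<close> (\<open>2 L\<close> factors) of the unit vector in
  direction \<open>x\<close>; the scalar product of two feature vectors is \<open>cos\<^sup>2\<^sup>L\<close> of the angle, so that
  they distinguish lines at distance \<open>1 / \<surd>L\<close>.\<close>
definition feature :: "nat \<Rightarrow> (nat \<Rightarrow> 'n) \<Rightarrow> real ^ 'n \<Rightarrow> real" where
  "feature L i x = (\<Prod>k<2 * L. x $ i k / norm x)"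

definition idx :: "nat \<Rightarrow> (nat \<Rightarrow> 'n) set" where
  "idx L = PiE {..<2 * L} (\<lambda>_. UNIV)"

lemma finite_idx [simp]: "finite (idx L)" by (simp add: idx_def finite_PiE)

lemma feature_inner: "(\<Sum>i\<in>idx L. feature L i x * feature L i y) = ((x \<bullet> y) / (norm x * norm y)) ^ (2 * L)"
proof -
  have "(\<Sum>i\<in>idx L. feature L i x * feature L i y) = (\<Sum>i\<in>idx L. \<Prod>k<2 * L. (x $ i k * y $ i k) / (norm x * norm y))"
    by (simp add: feature_def prod.distrib[symmetric])
  also have "\<dots> = (\<Prod>k<2 * L. \<Sum>j\<in>UNIV. (x $ j * y $ j) / (norm x * norm y))"
    unfolding idx_def by (subst prod_sum_PiE) auto
  also have "\<dots> = ((x \<bullet> y) / (norm x * norm y)) ^ (2 * L)"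
    by (simp add: sum_divide_distrib[symmetric] inner_vec_def)
  finally show ?thesis .
qed

lemma feature_abs_le: "\<bar>feature L i x\<bar> \<le> 1"
  unfolding feature_def abs_prod
proof (rule prod_le_1)
  fix k
  show "0 \<le> \<bar>x $ i k / norm x\<bar> \<and> \<bar>x $ i k / norm x\<bar> \<le> 1"
    using component_le_norm_cart[of x "i k"] by (cases "x = 0") (auto simp: divide_le_eq)
qed

lemma feature_sq_le: "(\<Sum>i\<in>idx L. (feature L i x)\<^sup>2) \<le> 1"
proof -
  have "(\<Sum>i\<in>idx L. (feature L i x)\<^sup>2) = ((x \<bullet> x) / (norm x * norm x)) ^ (2 * L)"
    by (simp add: power2_eq_square feature_inner)
  also have "\<dots> \<le> 1" by (intro power_le_one) (auto simp: dot_square_norm power2_eq_square)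
  finally show ?thesis .
qed

lemma feature_scale: "c \<noteq> 0 \<Longrightarrow> feature L i (c *\<^sub>R x) = feature L i x"
proof -
  assume c: "c \<noteq> 0"
  have "feature L i (c *\<^sub>R x) = (\<Prod>k<2 * L. c / \<bar>c\<bar>) * feature L i x"
    unfolding feature_def prod.distrib[symmetric] by (intro prod.cong) auto
  also have "(\<Prod>k<2 * L. c / \<bar>c\<bar>) = 1" using c by (simp add: power_mult power_divide)
  finally show ?thesis by simp
qed

lemma feature_measurable [measurable]: "feature L i \<in> borel_measurable borel"
  unfolding feature_def[abs_def] by measurable

text \<open>As a function of \<open>A\<close> this is harmonic for multiplication by a random matrix on the right, by
  stationarity of \<open>\<eta>\<close>.\<close>
definition mean_feature :: "nat \<Rightarrow> (nat \<Rightarrow> 'n) \<Rightarrow> 'n mat \<Rightarrow> real" where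
  "mean_feature L i A = (\<integral>x. feature L i (A *v x) \<partial>\<eta>)"

lemma mean_feature_measurable [measurable]: "mean_feature L i \<in> borel_measurable borel"
  unfolding mean_feature_def[abs_def] by measurable

lemma integrable_feature: "integrable \<eta> (\<lambda>x. feature L i (A *v x))"
  by (rule eta.integrable_const_bound[where B=1]) (auto simp: feature_abs_le)

lemma mean_feature_abs_le: "\<bar>mean_feature L i A\<bar> \<le> 1"
proof -
  have "\<bar>mean_feature L i A\<bar> \<le> (\<integral>x. \<bar>feature L i (A *v x)\<bar> \<partial>\<eta>)"
    unfolding mean_feature_def by (rule integral_abs_bound)
  also have "\<dots> \<le> (\<integral>x. 1 \<partial>\<eta>)"
    by (intro integral_mono integrable_abs integrable_feature) (auto simp: feature_abs_le)
  finally show ?thesis by (simp add: eta.prob_space)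
qed

lemma integrable_mean_feature: "integrable S (\<lambda>\<omega>. mean_feature L i (A ** lprod m \<omega>))"
  by (rule S.integrable_const_bound[where B=1]) (auto simp: mean_feature_abs_le)

lemma mean_feature_harmonic1: "mean_feature L i A = (\<integral>B. mean_feature L i (A ** B) \<partial>\<mu>)"
  unfolding mean_feature_def
proof -
  have "(\<integral>x. feature L i (A *v x) \<partial>\<eta>) = (\<integral>B. \<integral>x. feature L i (A *v (B *v x)) \<partial>\<eta> \<partial>\<mu>)"
    by (rule eta_stationary[where B=1]) (auto simp: feature_abs_le matrix_vector_mult_scaleR feature_scale)
  then show "(\<integral>x. feature L i (A *v x) \<partial>\<eta>) = (\<integral>B. \<integral>x. feature L i ((A ** B) *v x) \<partial>\<eta> \<partial>\<mu>)"
    by (simp add: matrix_vector_mul_assoc)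
qed

lemma mean_feature_harmonic: "(\<integral>\<omega>. mean_feature L i (A ** lprod m \<omega>) \<partial>S) = mean_feature L i A"
proof (induction m)
  case 0
  then show ?case by (simp add: S.prob_space)
next
  case (Suc m)
  have "(\<integral>\<omega>. mean_feature L i (A ** lprod (Suc m) \<omega>) \<partial>S) = (\<integral>B. \<integral>\<omega>. mean_feature L i (A ** lprod (Suc m) (B ## \<omega>)) \<partial>S \<partial>\<mu>)"
    by (rule integral_Stream(1)[OF integrable_mean_feature])
  also have "\<dots> = (\<integral>\<omega>. \<integral>B. mean_feature L i ((A ** lprod m \<omega>) ** B) \<partial>\<mu> \<partial>S)"
    unfolding lprod_Stream
    by (subst muS.Fubini_integral[symmetric])
      (auto intro!: muS.P.integrable_const_bound[where B=1] simp: mean_feature_abs_le matrix_mul_assoc split: prod.split)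
  also have "\<dots> = (\<integral>\<omega>. mean_feature L i (A ** lprod m \<omega>) \<partial>S)"
    by (simp add: mean_feature_harmonic1[symmetric])
  finally show ?case using Suc by simp
qed

definition energy :: "nat \<Rightarrow> 'n mat \<Rightarrow> real" where
  "energy L A = (\<Sum>i\<in>idx L. (mean_feature L i A)\<^sup>2)"

definition variation :: "nat \<Rightarrow> nat \<Rightarrow> 'n mat \<Rightarrow> real" where
  "variation L m A = (\<integral>\<omega>. (\<Sum>i\<in>idx L. (mean_feature L i (A ** lprod m \<omega>) - mean_feature L i A)\<^sup>2) \<partial>S)"

lemma energy_measurable [measurable]: "energy L \<in> borel_measurable borel"
  unfolding energy_def[abs_def] by measurable

lemma variation_measurable [measurable]: "variation L m \<in> borel_measurable borel"
  unfolding variation_def[abs_def] by measurable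

lemma energy_nonneg: "0 \<le> energy L A" by (simp add: energy_def sum_nonneg)

lemma energy_le_1: "energy L A \<le> 1"
proof -
  have "(mean_feature L i A)\<^sup>2 \<le> (\<integral>x. (feature L i (A *v x))\<^sup>2 \<partial>\<eta>)" for i
  proof -
    have i2: "integrable \<eta> (\<lambda>x. (feature L i (A *v x))\<^sup>2)"
      by (rule eta.integrable_const_bound[where B=1]) (auto simp: feature_abs_le abs_square_le_1)
    have "0 \<le> (\<integral>x. (feature L i (A *v x) - mean_feature L i A)\<^sup>2 \<partial>\<eta>)" by (rule integral_nonneg_AE) simp
    also have "\<dots> = (\<integral>x. (feature L i (A *v x))\<^sup>2 - 2 * mean_feature L i A * feature L i (A *v x) + (mean_feature L i A)\<^sup>2 \<partial>\<eta>)"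
      by (simp add: power2_diff mult_ac algebra_simps)
    also have "\<dots> = (\<integral>x. (feature L i (A *v x))\<^sup>2 \<partial>\<eta>) - 2 * mean_feature L i A * mean_feature L i A + (mean_feature L i A)\<^sup>2"
      using i2 integrable_feature[of L i A] by (simp add: mean_feature_def eta.prob_space)
    finally show ?thesis by (simp add: power2_eq_square)
  qed
  then have "energy L A \<le> (\<Sum>i\<in>idx L. \<integral>x. (feature L i (A *v x))\<^sup>2 \<partial>\<eta>)"
    unfolding energy_def by (rule sum_mono)
  also have "\<dots> = (\<integral>x. (\<Sum>i\<in>idx L. (feature L i (A *v x))\<^sup>2) \<partial>\<eta>)"
    by (rule Bochner_Integration.integral_sum[symmetric])
      (rule eta.integrable_const_bound[where B=1], auto simp: feature_abs_le abs_square_le_1)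
  also have "\<dots> \<le> (\<integral>x. 1 \<partial>\<eta>)"
    by (intro integral_mono Bochner_Integration.integrable_sum feature_sq_le)
      (rule eta.integrable_const_bound[where B=1], auto simp: feature_abs_le abs_square_le_1)
  finally show ?thesis by (simp add: eta.prob_space)
qed

lemma integrable_energy: "integrable S (\<lambda>\<omega>. energy L (A ** lprod m \<omega>))" "integrable S (\<lambda>\<omega>. energy L (lprod m \<omega>))"
  by (rule S.integrable_const_bound[where B=1]; auto simp: energy_nonneg energy_le_1)+

lemma sq_diff_le_4: "\<bar>a\<bar> \<le> 1 \<Longrightarrow> \<bar>b\<bar> \<le> 1 \<Longrightarrow> (a - b)\<^sup>2 \<le> (4 :: real)"
  by (rule order_trans[OF power_mono_even[of 2 "a - b" "2"]]) auto

lemma variation_summand_integrable: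
  "integrable S (\<lambda>\<omega>. (mean_feature L i (A ** lprod m \<omega>) - mean_feature L i A)\<^sup>2)"
  by (rule S.integrable_const_bound[where B=4]) (auto intro!: sq_diff_le_4 mean_feature_abs_le)

lemma variation_eq_sum:
  "variation L m A = (\<Sum>i\<in>idx L. \<integral>\<omega>. (mean_feature L i (A ** lprod m \<omega>) - mean_feature L i A)\<^sup>2 \<partial>S)"
  unfolding variation_def by (rule Bochner_Integration.integral_sum[OF variation_summand_integrable])

lemma variation_nonneg: "0 \<le> variation L m A"
  unfolding variation_eq_sum by (intro sum_nonneg integral_nonneg_AE) simp

text \<open>Orthogonality of martingale increments.\<close>
lemma energy_step: "(\<integral>\<omega>. energy L (A ** lprod m \<omega>) \<partial>S) = energy L A + variation L m A"
proof -
  have sqi: "integrable S (\<lambda>\<omega>. (mean_feature L i (A ** lprod m \<omega>))\<^sup>2)" for i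
    by (rule S.integrable_const_bound[where B=1]) (auto simp: mean_feature_abs_le abs_square_le_1)
  have one: "(\<integral>\<omega>. (mean_feature L i (A ** lprod m \<omega>))\<^sup>2 \<partial>S) = (mean_feature L i A)\<^sup>2 +
      (\<integral>\<omega>. (mean_feature L i (A ** lprod m \<omega>) - mean_feature L i A)\<^sup>2 \<partial>S)" for i
  proof -
    let ?m = "mean_feature L i A"
    have "(\<integral>\<omega>. (mean_feature L i (A ** lprod m \<omega>) - ?m)\<^sup>2 \<partial>S) =
      (\<integral>\<omega>. (mean_feature L i (A ** lprod m \<omega>))\<^sup>2 - 2 * ?m * mean_feature L i (A ** lprod m \<omega>) + ?m\<^sup>2 \<partial>S)"
      by (simp add: power2_diff mult_ac algebra_simps)
    also have "\<dots> = (\<integral>\<omega>. (mean_feature L i (A ** lprod m \<omega>))\<^sup>2 \<partial>S) - 2 * ?m * ?m + ?m\<^sup>2"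
      using sqi[of i] integrable_mean_feature[of L i A m] by (simp add: mean_feature_harmonic S.prob_space)
    finally show ?thesis by (simp add: power2_eq_square)
  qed
  have "(\<integral>\<omega>. energy L (A ** lprod m \<omega>) \<partial>S) = (\<Sum>i\<in>idx L. \<integral>\<omega>. (mean_feature L i (A ** lprod m \<omega>))\<^sup>2 \<partial>S)"
    unfolding energy_def by (rule Bochner_Integration.integral_sum[OF sqi])
  also have "\<dots> = energy L A + variation L m A"
    by (simp add: one sum.distrib energy_def variation_eq_sum)
  finally show ?thesis .
qed

lemma variation_le_1: "variation L m A \<le> 1"
proof -
  have "(\<integral>\<omega>. energy L (A ** lprod m \<omega>) \<partial>S) \<le> (\<integral>\<omega>. 1 \<partial>S)"
    by (intro integral_mono integrable_energy) (auto simp: energy_le_1)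
  then show ?thesis using energy_step[of L A m] energy_nonneg[of L A] by (simp add: S.prob_space)
qed

text \<open>The next factor of \<open>lprod\<close> is on the left, while harmonicity concerns factors on the right; but the
  product of \<open>m + n\<close> independent matrices has the same law in either order of growth.\<close>
lemma energy_increment:
  "(\<integral>\<omega>. energy L (lprod (m + n) \<omega>) \<partial>S) = (\<integral>\<omega>. energy L (lprod n \<omega>) \<partial>S) + (\<integral>\<omega>. variation L m (lprod n \<omega>) \<partial>S)"
proof -
  have "(\<integral>\<omega>. energy L (lprod (m + n) \<omega>) \<partial>S) = (\<integral>\<omega>. \<integral>\<omega>'. energy L (lprod n \<omega>' ** lprod m \<omega>) \<partial>S \<partial>S)"
    by (subst integral_shift(1)[OF integrable_energy(2), of _ _ m]) (simp add: lprod_shift)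
  also have "\<dots> = (\<integral>\<omega>'. \<integral>\<omega>. energy L (lprod n \<omega>' ** lprod m \<omega>) \<partial>S \<partial>S)"
    by (rule SS.Fubini_integral[symmetric])
      (auto intro!: SS.P.integrable_const_bound[where B=1] simp: energy_nonneg energy_le_1 split: prod.split)
  also have "\<dots> = (\<integral>\<omega>'. energy L (lprod n \<omega>') + variation L m (lprod n \<omega>') \<partial>S)"
    by (simp add: energy_step)
  also have "\<dots> = (\<integral>\<omega>. energy L (lprod n \<omega>) \<partial>S) + (\<integral>\<omega>. variation L m (lprod n \<omega>) \<partial>S)"
    by (rule Bochner_Integration.integral_add[OF integrable_energy(2)])
      (rule S.integrable_const_bound[where B=1], auto simp: variation_nonneg variation_le_1)
  finally show ?thesis .
qed

lemma telescope_shift_le: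
  fixes e :: "nat \<Rightarrow> real"
  assumes "\<And>n. 0 \<le> e n" "\<And>n. e n \<le> 1"
  shows "(\<Sum>n<T. e (m + n) - e n) \<le> m"
proof (induction m)
  case (Suc m)
  have "(\<Sum>n<T. e (Suc m + n) - e n) = (\<Sum>n<T. e (m + n) - e n) + (\<Sum>n<T. e (m + Suc n) - e (m + n))"
    by (simp add: sum.distrib[symmetric])
  also have "(\<Sum>n<T. e (m + Suc n) - e (m + n)) = e (m + T) - e m"
    using sum_lessThan_telescope[of "\<lambda>n. e (m + n)" T] by simp
  also have "\<dots> \<le> 1" using assms(1)[of m] assms(2)[of "m + T"] by simp
  finally show ?case using Suc by simp
qed simp

text \<open>The energy is at most \<open>1\<close> and grows by the mean variation, uniformly in the resolution \<open>L\<close>.\<close>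
lemma sum_variation_le: "(\<Sum>n<T. \<integral>\<omega>. variation L m (lprod n \<omega>) \<partial>S) \<le> m"
proof -
  let ?e = "\<lambda>n. \<integral>\<omega>. energy L (lprod n \<omega>) \<partial>S"
  have "(\<Sum>n<T. \<integral>\<omega>. variation L m (lprod n \<omega>) \<partial>S) = (\<Sum>n<T. ?e (m + n) - ?e n)"
    by (intro sum.cong) (simp_all add: energy_increment)
  also have "\<dots> \<le> m"
  proof (rule telescope_shift_le)
    show "0 \<le> ?e n" for n by (rule integral_nonneg_AE) (simp add: energy_nonneg)
    show "?e n \<le> 1" for n
      using integral_mono[OF integrable_energy(2)[of L n], of "\<lambda>_. 1"] by (simp add: energy_le_1 S.prob_space)
  qed
  finally show ?thesis .
qed

end

section \<open>Elements of the semigroup are reached with positive probability\<close>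

context gl_walk
begin

lemma Gamma_GL: "A \<in> Gamma \<mu> \<Longrightarrow> A \<in> GL"
proof -
  have "Gamma \<mu> \<subseteq> GL" unfolding Gamma_def
    by (intro hull_minimal) (auto simp: supp_def GL_mult)
  then show "A \<in> Gamma \<mu> \<Longrightarrow> A \<in> GL" by (rule subsetD)
qed

lemma Gamma_mult:
  assumes "A \<in> Gamma \<mu>" "B \<in> Gamma \<mu>"
  shows "A ** B \<in> Gamma \<mu>"
  unfolding Gamma_def hull_def
proof (rule InterI)
  fix T assume T: "T \<in> {t. (closedin (top_of_set GL) t \<and> (\<forall>A\<in>t. \<forall>B\<in>t. A ** B \<in> t)) \<and> supp \<mu> \<subseteq> t}"
  have "A \<in> T" "B \<in> T"
    using InterD[OF assms(1)[unfolded Gamma_def hull_def] T] InterD[OF assms(2)[unfolded Gamma_def hull_def] T] by simp_all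
  then show "A ** B \<in> T" using T by simp
qed

definition reachable :: "'n mat set" where
  "reachable = {A. \<forall>U. open U \<longrightarrow> A \<in> U \<longrightarrow> (\<exists>m. S.prob {\<omega>\<in>space S. lprod m \<omega> \<in> U} > 0)}"

lemma reachableD:
  "A \<in> reachable \<Longrightarrow> open U \<Longrightarrow> A \<in> U \<Longrightarrow> \<exists>m. S.prob {\<omega>\<in>space S. lprod m \<omega> \<in> U} > 0"
  by (simp add: reachable_def)

lemma reachableI:
  "(\<And>U. open U \<Longrightarrow> A \<in> U \<Longrightarrow> \<exists>m. S.prob {\<omega>\<in>space S. lprod m \<omega> \<in> U} > 0) \<Longrightarrow> A \<in> reachable"
  by (simp add: reachable_def)

lemma lprod_event: "open U \<Longrightarrow> {\<omega>\<in>space S. lprod m \<omega> \<in> U} \<in> sets S"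
proof -
  assume "open U"
  then have [measurable]: "U \<in> sets borel" by simp
  show ?thesis by measurable
qed

lemma closed_reachable: "closed reachable"
  unfolding closed_def open_subopen[of "- reachable"]
proof
  fix A assume "A \<in> - reachable"
  then obtain U where U: "open U" "A \<in> U" "\<And>m. \<not> S.prob {\<omega>\<in>space S. lprod m \<omega> \<in> U} > 0"
    by (auto simp: reachable_def)
  have "U \<subseteq> - reachable"
  proof
    fix X assume "X \<in> U"
    then show "X \<in> - reachable" using reachableD[OF _ U(1), of X] U(3) by auto
  qed
  then show "\<exists>T. open T \<and> A \<in> T \<and> T \<subseteq> - reachable" using U(1,2) by (intro exI[of _ U] conjI)
qed

lemma reachable_mult:
  assumes A: "A \<in> reachable" and B: "B \<in> reachable"
  shows "A ** B \<in> reachable"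
proof -
  have "\<exists>m. S.prob {\<omega>\<in>space S. lprod m \<omega> \<in> U} > 0" if U: "open U" "A ** B \<in> U" for U
  proof -
    have "continuous_on UNIV (\<lambda>x :: 'n mat \<times> 'n mat. fst x ** snd x)"
      unfolding matrix_matrix_mult_def
      by (intro continuous_on_vec_lambda continuous_on_sum continuous_on_mult continuous_on_component
          continuous_on_fst continuous_on_snd continuous_on_id)
    then have o: "open ((\<lambda>x :: 'n mat \<times> 'n mat. fst x ** snd x) -` U)" (is "open ?V") by (rule open_vimage[OF U(1)])
    have "(A, B) \<in> ?V" using U by simp
    with o obtain UA UB where UAB: "open UA" "open UB" "(A, B) \<in> UA \<times> UB" "UA \<times> UB \<subseteq> ?V"
      by (rule open_prod_elim)
    have AB: "A \<in> UA" "B \<in> UB" using UAB(3) by auto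
    obtain n where n: "S.prob {\<omega>\<in>space S. lprod n \<omega> \<in> UA} > 0" using reachableD[OF A UAB(1) AB(1)] ..
    obtain m where m: "S.prob {\<omega>\<in>space S. lprod m \<omega> \<in> UB} > 0" using reachableD[OF B UAB(2) AB(2)] ..
    let ?p = "S.prob {\<omega>\<in>space S. lprod n \<omega> \<in> UA}"
    let ?A = "{\<omega>\<in>space S. lprod m \<omega> \<in> UB}" and ?B = "{\<omega>\<in>space S. lprod (m + n) \<omega> \<in> U}"
    have "?p * S.prob ?A \<le> S.prob (?A \<inter> ?B)"
    proof (rule prob_shift_ge[where m = m])
      fix \<omega> \<omega>' assume "\<omega> \<in> ?A" "\<omega>' \<in> space S"
      then show "stake m \<omega> @- \<omega>' \<in> ?A" by (simp add: shift_space lprod_shift_le)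
    next
      fix \<omega> assume w: "\<omega> \<in> ?A"
      have [measurable]: "(\<lambda>\<omega>'. stake m \<omega> @- \<omega>') \<in> measurable S S"
        using w by (intro measurable_shift) auto
      have [measurable]: "?B \<in> sets S" by (rule lprod_event[OF U(1)])
      show "?p \<le> S.prob {\<omega>'\<in>space S. stake m \<omega> @- \<omega>' \<in> ?B}"
      proof (rule S.finite_measure_mono)
        show "{\<omega>\<in>space S. lprod n \<omega> \<in> UA} \<subseteq> {\<omega>'\<in>space S. stake m \<omega> @- \<omega>' \<in> ?B}"
        proof safe
          fix \<omega>' assume w': "\<omega>' \<in> space S" "lprod n \<omega>' \<in> UA"
          have "(lprod n \<omega>', lprod m \<omega>) \<in> UA \<times> UB" using w w' by simp
          then have "(lprod n \<omega>', lprod m \<omega>) \<in> ?V" by (rule subsetD[OF UAB(4)])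
          then show "lprod (m + n) (stake m \<omega> @- \<omega>') \<in> U" by (simp add: lprod_shift)
          show "stake m \<omega> @- \<omega>' \<in> space S" using w w' by (simp add: shift_space)
        qed
      qed measurable
    qed (auto intro!: lprod_event UAB U)
    moreover have "?p * S.prob ?A > 0" using n m by simp
    ultimately have "S.prob (?A \<inter> ?B) > 0" by linarith
    also have "S.prob (?A \<inter> ?B) \<le> S.prob ?B"
      by (intro S.finite_measure_mono lprod_event U) auto
    finally show ?thesis by (rule exI)
  qed
  then show ?thesis by (rule reachableI)
qed

text \<open>The reachable matrices form a closed semigroup which contains the support.\<close>
lemma Gamma_reachable: "Gamma \<mu> \<subseteq> reachable"
proof -
  have "supp \<mu> \<subseteq> reachable"
  proof
    fix A assume A: "A \<in> supp \<mu>"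
    have "S.prob {\<omega>\<in>space S. lprod 1 \<omega> \<in> U} > 0" if U: "open U" "A \<in> U" for U
    proof -
      have [measurable]: "U \<in> sets borel" using U by simp
      have 0: "{\<omega>\<in>space S. lprod 1 \<omega> \<in> U} = {\<omega>\<in>space S. \<omega> !! 0 \<in> U}" by simp
      have 1: "U \<inter> GL \<in> sets \<mu>" unfolding sets_mu by (auto simp: sets_restrict_space)
      have "emeasure S {\<omega>\<in>space S. \<omega> !! 0 \<in> U} = (\<integral>\<^sup>+\<omega>. indicator (U \<inter> GL) (\<omega> !! 0) \<partial>S)"
      proof (subst nn_integral_indicator[symmetric])
        show "(\<integral>\<^sup>+\<omega>. indicator {\<omega>\<in>space S. \<omega> !! 0 \<in> U} \<omega> \<partial>S) = (\<integral>\<^sup>+\<omega>. indicator (U \<inter> GL) (\<omega> !! 0) \<partial>S)"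
        proof (rule nn_integral_cong)
          fix \<omega> assume "\<omega> \<in> space S"
          then show "indicator {\<omega>\<in>space S. \<omega> !! 0 \<in> U} \<omega> = (indicator (U \<inter> GL) (\<omega> !! 0) :: ennreal)"
            using snth_GL[of \<omega> 0] by (simp add: indicator_def del: snth.simps)
        qed
        show "{\<omega>\<in>space S. \<omega> !! 0 \<in> U} \<in> sets S" by measurable
      qed
      also have "\<dots> = emeasure \<mu> (U \<inter> GL)" using 1 by (subst nn_integral_snth) auto
      finally have "S.prob {\<omega>\<in>space S. \<omega> !! 0 \<in> U} = prob (U \<inter> GL)" by (simp add: measure_def)
      then show ?thesis using A U unfolding supp_def 0 by auto
    qed
    then show "A \<in> reachable" by (intro reachableI exI)
  qed
  then have "Gamma \<mu> \<subseteq> GL \<inter> reachable" unfolding Gamma_def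
  proof (intro hull_minimal conjI)
    show "closedin (top_of_set GL) (GL \<inter> reachable)" by (rule closedin_closed_Int[OF closed_reachable])
    show "\<forall>A\<in>GL \<inter> reachable. \<forall>B\<in>GL \<inter> reachable. A ** B \<in> GL \<inter> reachable"
      by (intro ballI IntI) (auto intro: GL_mult reachable_mult)
    show "supp \<mu> \<subseteq> GL \<inter> reachable" using \<open>supp \<mu> \<subseteq> reachable\<close> by (auto simp: supp_def)
  qed
  then show ?thesis by blast
qed

lemma Gamma_near:
  assumes "A \<in> Gamma \<mu>" "open U" "A \<in> U"
  obtains m where "S.prob {\<omega>\<in>space S. lprod m \<omega> \<in> U} > 0"
  using reachableD[OF subsetD[OF Gamma_reachable assms(1)] assms(2,3)] by (elim exE)

end

section \<open>Linear algebra of nearly rank-one matrices\<close>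

lemma rank_one_decomposition:
  fixes L :: "'n::finite mat"
  assumes "rank L = 1"
  obtains a b where "a \<noteq> 0" "b \<noteq> 0" "\<And>x. L *v x = (b \<bullet> x) *\<^sub>R a"
proof -
  have d: "dim (range ((*v) L)) = 1" using assms rank_dim_range[of L] by simp
  obtain B where B: "B \<subseteq> range ((*v) L)" "independent B" "range ((*v) L) \<subseteq> span B" "card B = 1"
    using basis_exists[of "range ((*v) L)"] d by metis
  obtain a where a: "B = {a}" using B(4) by (rule card_1_singletonE)
  have a0: "a \<noteq> 0" using B(2) a by (metis dependent_zero singletonI)
  define b where "b = (1 / (a \<bullet> a)) *\<^sub>R (a v* L)"
  have e: "L *v x = (b \<bullet> x) *\<^sub>R a" for x
  proof -
    have "L *v x \<in> span {a}" using B(3) a by auto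
    then obtain c where c: "L *v x = c *\<^sub>R a" by (auto simp: span_singleton)
    have "b \<bullet> x = (1 / (a \<bullet> a)) * (a \<bullet> (L *v x))" by (simp add: b_def dot_lmul_matrix)
    also have "\<dots> = c" using a0 by (simp add: c)
    finally show ?thesis using c by simp
  qed
  have "b \<noteq> 0"
  proof
    assume "b = 0"
    then have "range ((*v) L) \<subseteq> {0}" using e by auto
    then show False using d dim_eq_0[of "range ((*v) L)"] by simp
  qed
  show ?thesis by (rule that[OF a0 \<open>b \<noteq> 0\<close> e])
qed

text \<open>The basis vectors are combinations of elements of \<open>B\<close>, so \<open>A\<close> cannot be small on all of \<open>B\<close>. If it is large
  on \<open>v\<close>, then \<open>norm_wedge_triangle\<close> bounds the areas spanned by the images of two basis vectors by areas of
  which one side is \<open>A v\<close>, and the other side is expanded in \<open>B\<close> again.\<close>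
lemma spanning_set_stretch:
  fixes B :: "(real ^ 'n::finite) set"
  assumes B: "finite B" "span B = UNIV"
  obtains t c :: real where "0 < t" "0 < c"
    "\<And>A. A \<in> GL \<Longrightarrow> \<exists>v\<in>B. t * opnorm A \<le> norm (A *v v) \<and> (\<exists>w\<in>B. c * area A \<le> norm (wedge (A *v v) (A *v w)))"
proof -
  let ?d = "real CARD('n)"
  have "\<exists>u. axis i 1 = (\<Sum>v\<in>B. u v *\<^sub>R v)" for i :: 'n
  proof -
    have "axis i 1 \<in> range (\<lambda>u. \<Sum>v\<in>B. u v *\<^sub>R v)" using span_finite[OF B(1)] B(2) by simp
    then show ?thesis by (rule rangeE) (rule exI)
  qed
  then have "\<exists>c. \<forall>i::'n. axis i 1 = (\<Sum>v\<in>B. c i v *\<^sub>R v)" by (intro choice allI)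
  then obtain c where c': "\<forall>i::'n. axis i 1 = (\<Sum>v\<in>B. c i v *\<^sub>R v)" by (rule exE)
  note c = c'[rule_format]
  define C where "C = (\<Sum>i\<in>UNIV. \<Sum>v\<in>B. \<bar>c i v\<bar>)"
  have C0: "0 \<le> C" unfolding C_def by (intro sum_nonneg) auto
  have Ci: "(\<Sum>v\<in>B. \<bar>c i v\<bar>) \<le> C" for i
    unfolding C_def by (rule member_le_sum) (auto intro: sum_nonneg)
  have ax: "A *v axis i 1 = (\<Sum>v\<in>B. c i v *\<^sub>R (A *v v))" for A :: "'n mat" and i
    by (subst c) (simp add: linear_sum[OF matrix_vector_mul_linear] matrix_vector_mult_scaleR)
  have ax_le: "norm (f (A *v axis i 1)) \<le> C * m"
    if f: "linear f" and m: "\<And>v. v \<in> B \<Longrightarrow> norm (f (A *v v)) \<le> m" and m0: "0 \<le> m"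
    for A :: "'n mat" and i m and f :: "real ^ 'n \<Rightarrow> 'b :: real_normed_vector"
  proof -
    have "norm (f (A *v axis i 1)) \<le> (\<Sum>v\<in>B. norm (c i v *\<^sub>R f (A *v v)))"
      unfolding ax linear_sum[OF f] linear_scale[OF f] by (rule norm_sum)
    also have "\<dots> \<le> (\<Sum>v\<in>B. \<bar>c i v\<bar> * m)" by (intro sum_mono) (simp add: m mult_left_mono)
    also have "\<dots> \<le> C * m" unfolding sum_distrib_right[symmetric] by (intro mult_right_mono Ci m0)
    finally show ?thesis .
  qed
  define t where "t = 1 / (1 + ?d * C)"
  have tp: "0 < t" using C0 by (auto simp: t_def intro!: divide_pos_pos add_pos_nonneg)
  define k where "k = t / (1 + 6 * ?d\<^sup>2 * C)"
  have kp: "0 < k" unfolding k_def using C0 tp by (auto intro!: divide_pos_pos add_pos_nonneg)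
  have main: "\<exists>v\<in>B. t * opnorm A \<le> norm (A *v v) \<and> (\<exists>w\<in>B. k * area A \<le> norm (wedge (A *v v) (A *v w)))"
    if A: "A \<in> GL" for A
  proof -
    have o: "opnorm A > 0" by (rule opnorm_pos[OF A])
    obtain i :: 'n where i: "opnorm A \<le> ?d * norm (A *v axis i 1)" by (rule exists_axis_opnorm_le)
    have "\<exists>v\<in>B. t * opnorm A \<le> norm (A *v v)"
    proof (rule ccontr)
      assume "\<not> ?thesis"
      then have "norm (A *v axis i 1) \<le> C * (t * opnorm A)"
        using ax_le[of "\<lambda>x. x" A "t * opnorm A" i] tp o by (force simp: linear_id[unfolded id_def])
      then have "?d * norm (A *v axis i 1) \<le> ?d * (C * (t * opnorm A))" by (intro mult_left_mono) auto
      with i have "opnorm A \<le> ?d * (C * (t * opnorm A))" by linarith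
      also have "\<dots> = (?d * C * t) * opnorm A" by simp
      also have "?d * C * t < 1" using C0 by (simp add: t_def divide_less_eq add_pos_nonneg)
      finally show False using o by simp
    qed
    then obtain v where v: "v \<in> B" "t * opnorm A \<le> norm (A *v v)" by blast
    let ?x = "A *v v"
    have "\<exists>w\<in>B. k * area A \<le> norm (wedge ?x (A *v w))"
    proof (rule ccontr)
      assume n: "\<not> ?thesis"
      then have ap: "area A > 0" using v(1) area_nonneg[of A] by (force simp: le_less)
      have w: "norm (wedge ?x (A *v axis l 1)) \<le> C * (k * area A)" for l
        using ax_le[OF linear_wedge(2)[of ?x], of A "k * area A" l] n kp ap by force
      have axn: "norm (A *v axis l 1) \<le> opnorm A" for l using norm_mult_vec_le[of A "axis l 1"] by simp
      have kl: "norm (wedge (A *v axis p 1) (A *v axis l 1)) \<le> 6 * C * (k * area A) / t" for p l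
      proof -
        have "(t * opnorm A) * norm (wedge (A *v axis p 1) (A *v axis l 1)) \<le> norm ?x * norm (wedge (A *v axis p 1) (A *v axis l 1))"
          by (intro mult_right_mono v) auto
        also have "\<dots> \<le> norm (A *v axis p 1) * norm (wedge ?x (A *v axis l 1)) + 5 * norm (A *v axis l 1) * norm (wedge ?x (A *v axis p 1))"
          by (rule norm_wedge_triangle)
        also have "\<dots> \<le> opnorm A * (C * (k * area A)) + 5 * opnorm A * (C * (k * area A))"
          using o C0 kp ap by (intro add_mono mult_mono w axn) auto
        finally have "(t * opnorm A) * norm (wedge (A *v axis p 1) (A *v axis l 1)) \<le> (t * opnorm A) * (6 * C * (k * area A) / t)"
          using tp by (simp add: algebra_simps)
        then show ?thesis using tp o by (subst (asm) mult_le_cancel_left_pos) auto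
      qed
      have "area A \<le> (\<Sum>p\<in>(UNIV::'n set). \<Sum>l\<in>(UNIV::'n set). 6 * C * (k * area A) / t)"
        unfolding area_def[of A] by (intro sum_mono) (rule kl[unfolded area_def[of A]])
      also have "\<dots> = (6 * ?d\<^sup>2 * C * k / t) * area A" by (simp add: power2_eq_square)
      also have "6 * ?d\<^sup>2 * C * k / t < 1" using C0 tp by (simp add: k_def divide_less_eq add_pos_nonneg)
      finally show False using ap by simp
    qed
    then show ?thesis using v by blast
  qed
  show ?thesis by (rule that[OF tp kp main])
qed

section \<open>Decay of the distance to rank one\<close>

context stationary_walk
begin

lemma feature_inner_pdist:
  assumes "x \<noteq> 0" "y \<noteq> 0"
  shows "(\<Sum>i\<in>idx L. feature L i x * feature L i y) = (1 - (pdist x y)\<^sup>2 / 2) ^ L"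
proof -
  have "((x \<bullet> y) / (norm x * norm y))\<^sup>2 = 1 - (pdist x y)\<^sup>2 / 2"
  proof -
    have "q = 1 - p / 2" if "p = 2 * (1 - q)" for p q :: real using that by (simp add: field_simps)
    then show ?thesis using pdist_sq[OF assms] .
  qed
  then show ?thesis unfolding feature_inner power_mult by (simp only:)
qed

lemma pdist_sq_half_le_1:
  assumes "x \<noteq> 0" "y \<noteq> 0"
  shows "(pdist x y)\<^sup>2 / 2 \<le> 1"
  using pdist_sq[OF assms] by simp

text \<open>The features at resolution \<open>L\<close> vary by a fixed amount only over distances of order \<open>1 / \<surd>L\<close>, and by
  \<open>feature_inner_le\<close> below they do vary by a fixed amount over such distances.\<close>
lemma feature_dist_le:
  assumes "x \<noteq> 0" "y \<noteq> 0"
  shows "(\<Sum>i\<in>idx L. (feature L i x - feature L i y)\<^sup>2) \<le> L * (pdist x y)\<^sup>2"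
proof -
  let ?u = "(pdist x y)\<^sup>2 / 2"
  have "(\<Sum>i\<in>idx L. (feature L i x - feature L i y)\<^sup>2) =
      (\<Sum>i\<in>idx L. (feature L i x)\<^sup>2) + (\<Sum>i\<in>idx L. (feature L i y)\<^sup>2) - 2 * (\<Sum>i\<in>idx L. feature L i x * feature L i y)"
    by (simp add: power2_diff sum.distrib sum_subtractf sum_distrib_left mult_ac)
  also have "\<dots> \<le> 1 + 1 - 2 * (1 - ?u) ^ L"
    using feature_sq_le[of L x] feature_sq_le[of L y] by (simp add: feature_inner_pdist[OF assms])
  also have "\<dots> \<le> 2 - 2 * (1 - L * ?u)"
    using Bernoulli_inequality[of "- ?u" L] pdist_sq_half_le_1[OF assms] by simp
  finally show ?thesis by simp
qed

lemma feature_dist_le_4: "(\<Sum>i\<in>idx L. (feature L i x - feature L i y)\<^sup>2) \<le> 4"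
proof -
  have "(\<Sum>i\<in>idx L. (feature L i x - feature L i y)\<^sup>2) \<le> (\<Sum>i\<in>idx L. 2 * (feature L i x)\<^sup>2 + 2 * (feature L i y)\<^sup>2)"
  proof (rule sum_mono)
    fix i
    have "0 \<le> (feature L i x + feature L i y)\<^sup>2" by simp
    then show "(feature L i x - feature L i y)\<^sup>2 \<le> 2 * (feature L i x)\<^sup>2 + 2 * (feature L i y)\<^sup>2"
      by (simp add: power2_diff power2_sum)
  qed
  also have "\<dots> \<le> 2 * 1 + 2 * 1"
    unfolding sum.distrib sum_distrib_left[symmetric] by (intro add_mono mult_left_mono feature_sq_le) auto
  finally show ?thesis by simp
qed

lemma feature_inner_le:
  assumes "x \<noteq> 0" "y \<noteq> 0"
  shows "(\<Sum>i\<in>idx L. feature L i x * feature L i y) \<le> exp (- (L * (pdist x y)\<^sup>2 / 2))"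
proof -
  let ?u = "(pdist x y)\<^sup>2 / 2"
  have "(1 - ?u) ^ L \<le> exp (- ?u) ^ L"
    using exp_ge_add_one_self[of "- ?u"] pdist_sq_half_le_1[OF assms] by (intro power_mono) auto
  also have "\<dots> = exp (- (L * (pdist x y)\<^sup>2 / 2))" by (simp add: exp_of_nat_mult[symmetric])
  finally show ?thesis by (simp add: feature_inner_pdist[OF assms])
qed

lemma feature_inner_le_1: "(\<Sum>i\<in>idx L. feature L i x * feature L i y) \<le> 1"
proof (cases "x = 0 \<or> y = 0")
  case True
  then show ?thesis by (auto simp: feature_inner zero_power power_0_left)
next
  case False
  then have "(\<Sum>i\<in>idx L. feature L i x * feature L i y) \<le> exp (- (L * (pdist x y)\<^sup>2 / 2))"
    by (intro feature_inner_le) auto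
  also have "\<dots> \<le> 1" by simp
  finally show ?thesis .
qed

lemma feature_norm: "x \<noteq> 0 \<Longrightarrow> (\<Sum>i\<in>idx L. (feature L i x)\<^sup>2) = 1"
  by (simp add: power2_eq_square feature_inner dot_square_norm)

text \<open>By convexity the mean feature is at least as close to a given feature vector as the features of
  which it is the mean are on average.\<close>
lemma mean_feature_dist_le:
  "(\<Sum>i\<in>idx L. (mean_feature L i A - feature L i z)\<^sup>2)
    \<le> (\<integral>x. (\<Sum>i\<in>idx L. (feature L i (A *v x) - feature L i z)\<^sup>2) \<partial>\<eta>)"
proof -
  have i2: "integrable \<eta> (\<lambda>x. (feature L i (A *v x) - feature L i z)\<^sup>2)" for i
    by (rule eta.integrable_const_bound[where B=4]) (auto intro!: sq_diff_le_4 feature_abs_le)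
  have "(mean_feature L i A - feature L i z)\<^sup>2 \<le> (\<integral>x. (feature L i (A *v x) - feature L i z)\<^sup>2 \<partial>\<eta>)" for i
  proof -
    let ?f = "\<lambda>x. feature L i (A *v x) - feature L i z"
    let ?m = "mean_feature L i A - feature L i z"
    have m: "(\<integral>x. ?f x \<partial>\<eta>) = ?m"
      using integrable_feature[of L i A] by (simp add: mean_feature_def)
    have fi: "integrable \<eta> ?f" using integrable_feature[of L i A] by simp
    have mfi: "integrable \<eta> (\<lambda>x. 2 * ?m * ?f x)" by (rule integrable_mult_right) (rule fi)
    have "0 \<le> (\<integral>x. (?f x - ?m)\<^sup>2 \<partial>\<eta>)" by (rule integral_nonneg_AE) simp
    also have "\<dots> = (\<integral>x. (?f x)\<^sup>2 - 2 * ?m * ?f x + ?m\<^sup>2 \<partial>\<eta>)"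
    proof -
      have "(u - m)\<^sup>2 = u\<^sup>2 - 2 * m * u + m\<^sup>2" for u m :: real by (simp add: power2_diff)
      then show ?thesis by (simp only:)
    qed
    also have "\<dots> = (\<integral>x. (?f x)\<^sup>2 \<partial>\<eta>) - 2 * ?m * ?m + ?m\<^sup>2"
    proof -
      have "(\<integral>x. (?f x)\<^sup>2 - 2 * ?m * ?f x + ?m\<^sup>2 \<partial>\<eta>) = (\<integral>x. (?f x)\<^sup>2 - 2 * ?m * ?f x \<partial>\<eta>) + (\<integral>x. ?m\<^sup>2 \<partial>\<eta>)"
        using i2[of i] mfi by (intro Bochner_Integration.integral_add Bochner_Integration.integrable_diff eta.integrable_const)
      also have "(\<integral>x. (?f x)\<^sup>2 - 2 * ?m * ?f x \<partial>\<eta>) = (\<integral>x. (?f x)\<^sup>2 \<partial>\<eta>) - (\<integral>x. 2 * ?m * ?f x \<partial>\<eta>)"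
        using i2[of i] mfi by (intro Bochner_Integration.integral_diff)
      also have "(\<integral>x. 2 * ?m * ?f x \<partial>\<eta>) = 2 * ?m * ?m" by (subst integral_mult_right_zero) (simp only: m)
      also have "(\<integral>x. ?m\<^sup>2 \<partial>\<eta>) = ?m\<^sup>2" by simp
      finally show ?thesis .
    qed
    finally have 0: "0 \<le> (\<integral>x. (?f x)\<^sup>2 \<partial>\<eta>) - 2 * ?m * ?m + ?m\<^sup>2" .
    have "m\<^sup>2 \<le> e" if "0 \<le> e - 2 * m * m + m\<^sup>2" for e m :: real using that by (simp add: power2_eq_square)
    then show ?thesis using 0 .
  qed
  then have "(\<Sum>i\<in>idx L. (mean_feature L i A - feature L i z)\<^sup>2) \<le> (\<Sum>i\<in>idx L. \<integral>x. (feature L i (A *v x) - feature L i z)\<^sup>2 \<partial>\<eta>)"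
    by (rule sum_mono)
  also have "\<dots> = (\<integral>x. (\<Sum>i\<in>idx L. (feature L i (A *v x) - feature L i z)\<^sup>2) \<partial>\<eta>)"
    by (rule Bochner_Integration.integral_sum[OF i2, symmetric])
  finally show ?thesis .
qed

lemma mean_feature_inner:
  "(\<Sum>i\<in>idx L. mean_feature L i A * feature L i z) = (\<integral>x. (\<Sum>i\<in>idx L. feature L i (A *v x) * feature L i z) \<partial>\<eta>)"
  unfolding mean_feature_def
  by (subst Bochner_Integration.integral_sum) (auto intro: integrable_feature)

end

locale contracting_walk = stationary_walk \<mu> \<eta> for \<mu> :: "'n::finite mat measure" and \<eta> +
  assumes contr: "contracting \<mu>"
begin

lemma Gamma_orbit_spans:
  assumes a: "a \<noteq> 0"
  shows "span ((\<lambda>k. k *v a) ` Gamma \<mu>) = UNIV"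
proof (rule ccontr)
  let ?W = "span ((\<lambda>k. k *v a) ` Gamma \<mu>)"
  assume ne: "?W \<noteq> UNIV"
  obtain h where h: "h \<in> Gamma \<mu>" using contr unfolding contracting_def by blast
  then have "h *v a \<in> ?W" by (intro span_base imageI)
  moreover have "h *v a \<noteq> 0" using Gamma_GL[OF h] a by simp
  ultimately have n0: "?W \<noteq> {0}" by (metis singletonD)
  have inv: "(*v) A ` ?W \<subseteq> ?W" if A: "A \<in> Gamma \<mu>" for A
  proof -
    have "(*v) A ` ?W = span ((*v) A ` (\<lambda>k. k *v a) ` Gamma \<mu>)"
      by (rule linear_span_image[symmetric]) (rule matrix_vector_mul_linear)
    also have "\<dots> \<subseteq> ?W"
    proof (rule span_mono, clarify)
      fix k assume "k \<in> Gamma \<mu>"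
      then have "A ** k \<in> Gamma \<mu>" by (rule Gamma_mult[OF A])
      then show "A *v (k *v a) \<in> (\<lambda>k. k *v a) ` Gamma \<mu>"
        by (intro image_eqI[of _ _ "A ** k"]) (simp_all add: matrix_vector_mul_assoc)
    qed
    finally show ?thesis .
  qed
  have "\<not> strongly_irreducible \<mu>"
    unfolding strongly_irreducible_def not_not
    using n0 ne inv by (intro exI[of _ "{?W}"]) simp
  then show False using SI by simp
qed

text \<open>Let \<open>L x = (b \<bullet> x) a\<close> be the rank one limit of normalized elements of the semigroup. Multiplication
  on the left by \<open>k \<in> Gamma \<mu>\<close> keeps the linear form \<open>b\<close> and moves \<open>a\<close> to \<open>k a\<close>, and by irreducibility
  these images span the space.\<close>
lemma rank_one_elements:
  obtains b :: "real ^ 'n" and B where "b \<noteq> 0" "finite B" "span B = UNIV" "\<And>v. v \<in> B \<Longrightarrow> v \<noteq> 0"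
    "\<And>v \<kappa>. v \<in> B \<Longrightarrow> 0 < \<kappa> \<Longrightarrow> \<exists>U m. open U \<and> S.prob {\<omega>\<in>space S. lprod m \<omega> \<in> U} > 0 \<and>
      (\<forall>h\<in>U. \<exists>s>0. \<forall>x. norm (s *\<^sub>R (h *v x) - (b \<bullet> x) *\<^sub>R v) \<le> \<kappa> * norm x)"
proof -
  obtain h and L :: "'n mat" where h: "\<And>k::nat. h k \<in> Gamma \<mu>" "rank L = 1" "(\<lambda>k. inverse (opnorm (h k)) *\<^sub>R h k) \<longlonglongrightarrow> L"
    using contr unfolding contracting_def by blast
  obtain a b where ab: "a \<noteq> 0" "b \<noteq> 0" "\<And>x. L *v x = (b \<bullet> x) *\<^sub>R a"
    by (rule rank_one_decomposition[OF h(2)], rule that)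
  obtain B where B: "B \<subseteq> (\<lambda>k. k *v a) ` Gamma \<mu>" "independent B" "(\<lambda>k. k *v a) ` Gamma \<mu> \<subseteq> span B"
    by (rule maximal_independent_subset)
  have finB: "finite B" using B(2) by (rule finiteI_independent)
  have "span ((\<lambda>k. k *v a) ` Gamma \<mu>) \<subseteq> span B" by (rule span_minimal[OF B(3) subspace_span])
  then have spB: "span B = UNIV" using Gamma_orbit_spans[OF ab(1)] by auto
  show ?thesis
  proof (rule that[OF ab(2) finB spB])
    fix v assume "v \<in> B"
    then obtain k where k: "k \<in> Gamma \<mu>" "v = k *v a" using B(1) by auto
    then show "v \<noteq> 0" using Gamma_GL ab(1) by simp
    fix \<kappa> :: real assume kap: "0 < \<kappa>"
    have "(\<lambda>n. k ** (inverse (opnorm (h n)) *\<^sub>R h n)) \<longlonglongrightarrow> k ** L"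
    proof -
      have "continuous_on UNIV (\<lambda>X :: 'n mat. k ** X)"
        unfolding matrix_matrix_mult_def
        by (intro continuous_on_vec_lambda continuous_on_sum continuous_on_mult continuous_on_component
            continuous_on_const continuous_on_id)
      then have "isCont (\<lambda>X :: 'n mat. k ** X) L" by (simp add: continuous_on_eq_continuous_at)
      then show ?thesis using h(3) by (rule isCont_tendsto_compose)
    qed
    then have "\<forall>\<^sub>F n in sequentially. dist (k ** (inverse (opnorm (h n)) *\<^sub>R h n)) (k ** L) < \<kappa>"
      using kap by (rule tendstoD)
    then obtain n where n: "dist (k ** (inverse (opnorm (h n)) *\<^sub>R h n)) (k ** L) < \<kappa>"
      by (auto simp: eventually_sequentially)
    define s where "s = inverse (opnorm (h n))"
    have s: "s > 0" using opnorm_pos[OF Gamma_GL[OF h(1)[of n]]] by (simp add: s_def)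
    define U where "U = {X. dist (s *\<^sub>R X) (k ** L) < \<kappa>}"
    have oU: "open U" unfolding U_def by (intro open_Collect_less continuous_intros)
    have "k ** h n \<in> U"
    proof -
      have "k ** (s *\<^sub>R h n) = s *\<^sub>R (k ** h n)"
        by (simp add: matrix_matrix_mult_def vec_eq_iff sum_distrib_left mult_ac)
      then show ?thesis using n unfolding U_def s_def[symmetric] by simp
    qed
    with Gamma_near[OF Gamma_mult[OF k(1) h(1)[of n]] oU] obtain m where
      m: "S.prob {\<omega>\<in>space S. lprod m \<omega> \<in> U} > 0" by blast
    have "norm (s *\<^sub>R (X *v x) - (b \<bullet> x) *\<^sub>R v) \<le> \<kappa> * norm x" if "X \<in> U" for X x
    proof -
      have "(k ** L) *v x = (b \<bullet> x) *\<^sub>R v"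
        by (simp add: ab(3) k(2) matrix_vector_mult_scaleR flip: matrix_vector_mul_assoc)
      then have "s *\<^sub>R (X *v x) - (b \<bullet> x) *\<^sub>R v = (s *\<^sub>R X - k ** L) *v x"
        by (simp add: matrix_vector_mult_diff_rdistrib scaleR_matrix_vector_assoc)
      then have "norm (s *\<^sub>R (X *v x) - (b \<bullet> x) *\<^sub>R v) \<le> norm (s *\<^sub>R X - k ** L) * norm x"
        by (simp add: norm_mult_vec_le_norm)
      also have "\<dots> \<le> \<kappa> * norm x"
        using that by (intro mult_right_mono) (auto simp: U_def dist_norm)
      finally show ?thesis .
    qed
    then show "\<exists>U m. open U \<and> S.prob {\<omega>\<in>space S. lprod m \<omega> \<in> U} > 0 \<and>
        (\<forall>h\<in>U. \<exists>s>0. \<forall>x. norm (s *\<^sub>R (h *v x) - (b \<bullet> x) *\<^sub>R v) \<le> \<kappa> * norm x)"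
      using oU m s by (intro exI[of _ U] exI[of _ m] conjI ballI exI[of _ s] allI) auto
  qed
qed

lemma variation_ge:
  assumes U: "open U" and D: "\<And>h. h \<in> U \<Longrightarrow> \<delta> \<le> (\<Sum>i\<in>idx L. (mean_feature L i (A ** h) - mean_feature L i A)\<^sup>2)"
    and d0: "0 \<le> \<delta>"
  shows "\<delta> * S.prob {\<omega>\<in>space S. lprod m \<omega> \<in> U} \<le> variation L m A"
proof -
  have ev: "{\<omega>\<in>space S. lprod m \<omega> \<in> U} \<in> sets S" by (rule lprod_event[OF U])
  have "\<delta> * S.prob {\<omega>\<in>space S. lprod m \<omega> \<in> U} = (\<integral>\<omega>. \<delta> * indicator {\<omega>\<in>space S. lprod m \<omega> \<in> U} \<omega> \<partial>S)"
    using ev by simp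
  also have "\<dots> \<le> variation L m A"
    unfolding variation_def
  proof (rule integral_mono)
    show "integrable S (\<lambda>\<omega>. \<delta> * indicator {\<omega>\<in>space S. lprod m \<omega> \<in> U} \<omega>)"
      using ev by (intro integrable_mult_right integrable_real_indicator) (auto simp: less_top[symmetric])
    show "integrable S (\<lambda>\<omega>. \<Sum>i\<in>idx L. (mean_feature L i (A ** lprod m \<omega>) - mean_feature L i A)\<^sup>2)"
      by (intro Bochner_Integration.integrable_sum variation_summand_integrable)
    show "\<delta> * indicator {\<omega>\<in>space S. lprod m \<omega> \<in> U} \<omega>
        \<le> (\<Sum>i\<in>idx L. (mean_feature L i (A ** lprod m \<omega>) - mean_feature L i A)\<^sup>2)" for \<omega>
      using D[of "lprod m \<omega>"] by (auto simp: indicator_def intro: sum_nonneg)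
  qed
  finally show ?thesis .
qed

text \<open>Let the image of the unit ball under \<open>A\<close> have width \<open>r\<close> times its length, with \<open>L r\<^sup>2\<close> of order one.
  The semigroup contains elements \<open>h\<close> close to multiples of \<open>x \<mapsto> (f \<bullet> x) v\<close> for every \<open>v\<close> in a spanning
  set. If \<open>A\<close> stretches \<open>v\<close> well, then \<open>A ** h\<close> sends most lines close to \<open>A v\<close> at the scale \<open>r\<close>. For the
  elements \<open>h\<close> that belong in the same way to a suitable other \<open>w\<close> in the spanning set, it sends at
  least half of the lines away from \<open>A v\<close> at that scale. The features resolve this scale, so the mean feature changes by a fixed amount in one of the two cases.\<close>
lemma variation_lower_bound:
  obtains Ms :: "nat set" and c :: real where "finite Ms" "0 < c"
    "\<And>L A. A \<in> GL \<Longrightarrow> (2 * (real CARD('n))\<^sup>2)\<^sup>2 / 4 \<le> real L * (rratio A)\<^sup>2 \<Longrightarrow>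
      real L * (rratio A)\<^sup>2 \<le> (2 * (real CARD('n))\<^sup>2)\<^sup>2 \<Longrightarrow> c \<le> (\<Sum>m\<in>Ms. variation L m A)"
proof -
  define bb where "bb = 2 * (real CARD('n))\<^sup>2"
  have bb: "bb > 0" by (simp add: bb_def)
  obtain f :: "real ^ 'n" and B where f: "f \<noteq> 0" and B: "finite B" "span B = UNIV" "\<And>v. v \<in> B \<Longrightarrow> v \<noteq> 0"
    and near: "\<And>v \<kappa>. v \<in> B \<Longrightarrow> 0 < \<kappa> \<Longrightarrow> \<exists>U m. open U \<and> S.prob {\<omega>\<in>space S. lprod m \<omega> \<in> U} > 0 \<and>
      (\<forall>h\<in>U. \<exists>s>0. \<forall>x. norm (s *\<^sub>R (h *v x) - (f \<bullet> x) *\<^sub>R v) \<le> \<kappa> * norm x)"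
    by (rule rank_one_elements, rule that)
  obtain t k :: real where t: "0 < t" and k: "0 < k" and stretch:
    "\<And>A. A \<in> GL \<Longrightarrow> \<exists>v\<in>B. t * opnorm A \<le> norm (A *v v) \<and> (\<exists>w\<in>B. k * area A \<le> norm (wedge (A *v v) (A *v w)))"
    by (rule spanning_set_stretch[OF B(1,2)], rule that)
  have Bne: "B \<noteq> {}"
  proof
    assume "B = {}"
    then have "(UNIV :: (real ^ 'n) set) = {0}" using B(2) by simp
    then show False using f by blast
  qed
  define W where "W = 1 + (\<Sum>v\<in>B. norm v)"
  have W1: "1 \<le> W" by (simp add: W_def sum_nonneg)
  have vW: "norm v \<le> W" if "v \<in> B" for v
    using member_le_sum[OF that, of norm] B(1) by (simp add: W_def)
  define K where "K = norm f * W + 1"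
  have K: "K > 0" using W1 by (simp add: K_def add_nonneg_pos)
  obtain t2 where t2: "0 < t2" "measure \<eta> {x. \<bar>f \<bullet> x\<bar> \<le> t2 * norm x} < 1 / 2"
    by (rule eta_near_hyperplane[OF f half_gt_zero[OF zero_less_one]])
  \<comment> \<open>At a point outside the neighbourhood given by \<open>t2\<close> the image line under \<open>h \<in> U w\<close> has distance at least
    \<open>c2 * rratio A\<close> from \<open>A v\<close>, and \<open>c0\<close> is the resulting defect of the mean of the inner product of the features.
    The neighbourhood given by \<open>t1\<close> and the error \<open>\<kappa>\<close> are so small that the features of the images under
    \<open>h \<in> U v\<close> have a mean squared distance of at most \<open>c0\<^sup>2 / 6\<close> from those of \<open>A v\<close>.\<close>
  define c2 where "c2 = t2 * k / (2 * K * W)"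
  have c2: "c2 > 0" using t2 k K W1 by (simp add: c2_def)
  define c0 where "c0 = (1 - exp (- (c2\<^sup>2 * bb\<^sup>2 / 8))) / 2"
  have c0: "c0 > 0" "c0 \<le> 1 / 2" using c2 bb by (auto simp: c0_def)
  have "0 < c0\<^sup>2 / 48" using c0 by simp
  then obtain t1 where t1: "0 < t1" "measure \<eta> {x. \<bar>f \<bullet> x\<bar> \<le> t1 * norm x} < c0\<^sup>2 / 48"
    by (rule eta_near_hyperplane[OF f])
  define \<kappa> where "\<kappa> = Min {1, t2 * k / (4 * W), t1 * t / 2, c0 * t1 * t\<^sup>2 / (16 * W * bb)}"
  have kap0: "\<kappa> > 0" using t2 t1 k t W1 c0 bb by (simp add: \<kappa>_def)
  have "\<kappa> \<le> 1" "\<kappa> \<le> t2 * k / (4 * W)" "\<kappa> \<le> t1 * t / 2" "\<kappa> \<le> c0 * t1 * t\<^sup>2 / (16 * W * bb)"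
    unfolding \<kappa>_def by (rule Min_le; simp)+
  then have kap: "\<kappa> \<le> 1" "2 * \<kappa> * W \<le> t2 * k / 2" "\<kappa> \<le> t1 * t / 2" "4 * \<kappa> * W * bb / (t1 * t\<^sup>2) \<le> c0 / 4"
    using W1 bb t1 t by (simp_all add: field_simps)
  define Q where "Q v U m \<longleftrightarrow> open U \<and> S.prob {\<omega>\<in>space S. lprod m \<omega> \<in> U} > 0 \<and>
      (\<forall>h\<in>U. \<exists>s>0. \<forall>x. norm (s *\<^sub>R (h *v x) - (f \<bullet> x) *\<^sub>R v) \<le> \<kappa> * norm x)" for v U and m :: nat
  have "\<forall>v\<in>B. \<exists>Um. Q v (fst Um) (snd Um)"
    using near[OF _ kap0] by (simp add: Q_def)
  then have "\<exists>Um. \<forall>v\<in>B. Q v (fst (Um v)) (snd (Um v))" by (rule bchoice)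
  then obtain Um where Um': "\<forall>v\<in>B. Q v (fst (Um v)) (snd (Um v))" ..
  define U m where "U v = fst (Um v)" and "m v = snd (Um v)" for v
  have Um: "open (U v)" "S.prob {\<omega>\<in>space S. lprod (m v) \<omega> \<in> U v} > 0"
    "\<And>h. h \<in> U v \<Longrightarrow> \<exists>s>0. \<forall>x. norm (s *\<^sub>R (h *v x) - (f \<bullet> x) *\<^sub>R v) \<le> \<kappa> * norm x" if "v \<in> B" for v
    using bspec[OF Um' that] by (simp_all add: Q_def U_def m_def)
  define p where "p = Min ((\<lambda>v. S.prob {\<omega>\<in>space S. lprod (m v) \<omega> \<in> U v}) ` B)"
  have p: "p > 0" "\<And>v. v \<in> B \<Longrightarrow> p \<le> S.prob {\<omega>\<in>space S. lprod (m v) \<omega> \<in> U v}"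
    unfolding p_def using B(1) Bne Um(2) by auto
  show ?thesis
  proof (rule that[of "m ` B" "p * (c0\<^sup>2 / 12)"])
    show "finite (m ` B)" using B(1) by simp
    show "0 < p * (c0\<^sup>2 / 12)" using p c0 by simp
    fix L :: nat and A :: "'n mat"
    assume A: "A \<in> GL" and L1: "(2 * (real CARD('n))\<^sup>2)\<^sup>2 / 4 \<le> real L * (rratio A)\<^sup>2"
      and L2: "real L * (rratio A)\<^sup>2 \<le> (2 * (real CARD('n))\<^sup>2)\<^sup>2"
    let ?r = "rratio A" and ?o = "opnorm A" and ?a = "area A"
    have o: "?o > 0" by (rule opnorm_pos[OF A])
    have r: "?r * ?o\<^sup>2 = ?a" using o by (simp add: rratio_def)
    obtain v w where v: "v \<in> B" "t * ?o \<le> norm (A *v v)" and w: "w \<in> B" "k * ?a \<le> norm (wedge (A *v v) (A *v w))"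
      using stretch[OF A] by blast
    let ?F = "\<lambda>i. feature L i (A *v v)"
    have Av: "A *v v \<noteq> 0" using A B(3)[OF v(1)] by simp
    have mfm: "(\<lambda>x. \<Sum>i\<in>idx L. (feature L i ((A ** h) *v x) - ?F i)\<^sup>2) \<in> borel_measurable \<eta>" for h
      by measurable
    have scale_feat: "feature L i ((A ** h) *v x) = feature L i (A *v (s *\<^sub>R (h *v x)))" if "s > 0" for s h x i
      using that feature_scale[of s L i "A *v (h *v x)"] by (simp add: matrix_vector_mult_scaleR matrix_vector_mul_assoc)
    have claim1: "(\<Sum>i\<in>idx L. (mean_feature L i (A ** h) - ?F i)\<^sup>2) \<le> c0\<^sup>2 / 6" if h: "h \<in> U v" for h
    proof -
      obtain s where s: "s > 0" "\<And>x. norm (s *\<^sub>R (h *v x) - (f \<bullet> x) *\<^sub>R v) \<le> \<kappa> * norm x"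
        using Um(3)[OF v(1) h] by blast
      let ?bad = "{x. \<bar>f \<bullet> x\<bar> \<le> t1 * norm x}"
      have pt: "(\<Sum>i\<in>idx L. (feature L i ((A ** h) *v x) - ?F i)\<^sup>2) \<le> c0\<^sup>2 / 16 + 4 * indicator ?bad x" for x
      proof (cases "x \<in> ?bad")
        case True
        then show ?thesis using feature_dist_le_4[of L "(A ** h) *v x" "A *v v"] by (simp add: add_increasing)
      next
        case False
        then have fx: "t1 * norm x < \<bar>f \<bullet> x\<bar>" and x0: "norm x > 0" using t1 by (auto simp: not_le)
        define y where "y = s *\<^sub>R (h *v x)"
        define e where "e = y - (f \<bullet> x) *\<^sub>R v"
        have e: "norm e \<le> \<kappa> * norm x" using s(2)[of x] by (simp add: e_def y_def)
        have y: "y = (f \<bullet> x) *\<^sub>R v + e" by (simp add: e_def)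
        have Ay: "t1 * t / 2 * ?o * norm x \<le> norm (A *v y)"
        proof -
          have "t1 * norm x * (t * ?o) \<le> \<bar>f \<bullet> x\<bar> * norm (A *v v)"
            using fx v(2) t1 t o by (intro mult_mono) auto
          moreover have "norm (A *v e) \<le> ?o * (t1 * t / 2 * norm x)"
          proof -
            have "norm (A *v e) \<le> ?o * norm e" by (rule norm_mult_vec_le)
            also have "norm e \<le> t1 * t / 2 * norm x"
              using order_trans[OF e mult_right_mono[OF kap(3) norm_ge_zero]] .
            finally show ?thesis using o by simp
          qed
          moreover have "A *v y = (f \<bullet> x) *\<^sub>R (A *v v) + A *v e"
            by (simp add: y matrix_vector_right_distrib matrix_vector_mult_scaleR)
          then have "\<bar>f \<bullet> x\<bar> * norm (A *v v) - norm (A *v e) \<le> norm (A *v y)"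
            using norm_diff_ineq[of "(f \<bullet> x) *\<^sub>R (A *v v)" "A *v e"] by simp
          ultimately show ?thesis by (simp add: algebra_simps)
        qed
        have Ay0: "norm (A *v y) > 0"
          by (rule less_le_trans[OF _ Ay]) (use t1 t o x0 in simp)
        have wd: "norm (wedge (A *v y) (A *v v)) \<le> ?a * (2 * \<kappa> * norm x * W)"
        proof -
          have "wedge y v = wedge e v" by (simp add: y wedge_simps)
          then have "norm (wedge y v) \<le> 2 * norm e * norm v" using norm_wedge_le[of e v] by simp
          also have "\<dots> \<le> 2 * (\<kappa> * norm x) * W" using e vW[OF v(1)] kap0 by (intro mult_mono) auto
          finally have "?a * norm (wedge y v) \<le> ?a * (2 * \<kappa> * norm x * W)"
            by (intro mult_left_mono) auto
          then show ?thesis using norm_wedge_image[of A y v] by linarith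
        qed
        have "pdist (A *v y) (A *v v) \<le> ?a * (2 * \<kappa> * norm x * W) / ((t1 * t / 2 * ?o * norm x) * (t * ?o))"
          unfolding pdist_def using wd Ay v(2) t1 t o x0 kap0 W1
          by (intro frac_le mult_mono) (auto intro!: mult_nonneg_nonneg mult_pos_pos)
        also have "\<dots> = 4 * \<kappa> * W / (t1 * t\<^sup>2) * ?r"
          using t1 t o x0 r[symmetric] by (simp add: power2_eq_square field_simps)
        finally have pd: "pdist (A *v y) (A *v v) \<le> 4 * \<kappa> * W / (t1 * t\<^sup>2) * ?r" .
        have "(\<Sum>i\<in>idx L. (feature L i ((A ** h) *v x) - ?F i)\<^sup>2) = (\<Sum>i\<in>idx L. (feature L i (A *v y) - ?F i)\<^sup>2)"
          unfolding y_def by (simp only: scale_feat[OF s(1)])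
        also have "\<dots> \<le> L * (pdist (A *v y) (A *v v))\<^sup>2"
          using Ay0 Av by (intro feature_dist_le) auto
        also have "\<dots> \<le> L * (4 * \<kappa> * W / (t1 * t\<^sup>2) * ?r)\<^sup>2"
          using pd by (intro mult_left_mono power_mono) auto
        also have "\<dots> = (4 * \<kappa> * W / (t1 * t\<^sup>2))\<^sup>2 * (L * ?r\<^sup>2)" by (simp only: power_mult_distrib mult_ac)
        also have "\<dots> \<le> (4 * \<kappa> * W / (t1 * t\<^sup>2))\<^sup>2 * bb\<^sup>2"
          using L2 by (intro mult_left_mono) (auto simp: bb_def)
        also have "\<dots> = (4 * \<kappa> * W * bb / (t1 * t\<^sup>2))\<^sup>2" unfolding power_mult_distrib[symmetric] by simp
        also have "\<dots> \<le> (c0 / 4)\<^sup>2"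
          using kap(4) kap0 W1 bb t1 t by (intro power_mono) auto
        finally show ?thesis using False by (simp add: power_divide)
      qed
      have "(\<Sum>i\<in>idx L. (mean_feature L i (A ** h) - ?F i)\<^sup>2) \<le> (\<integral>x. (\<Sum>i\<in>idx L. (feature L i ((A ** h) *v x) - ?F i)\<^sup>2) \<partial>\<eta>)"
        by (rule mean_feature_dist_le)
      also have "\<dots> \<le> (\<integral>x. c0\<^sup>2 / 16 + 4 * indicator ?bad x \<partial>\<eta>)"
      proof (rule integral_mono)
        show "integrable \<eta> (\<lambda>x. \<Sum>i\<in>idx L. (feature L i ((A ** h) *v x) - ?F i)\<^sup>2)"
          by (intro eta.integrable_const_bound[where B=4] mfm) (auto simp: feature_dist_le_4 sum_nonneg)
        show "integrable \<eta> (\<lambda>x. c0\<^sup>2 / 16 + 4 * indicator ?bad x :: real)"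
          by (intro Bochner_Integration.integrable_add integrable_mult_right integrable_real_indicator)
            (auto simp: less_top[symmetric])
      qed (rule pt)
      also have "\<dots> = c0\<^sup>2 / 16 + 4 * measure \<eta> ?bad"
        by (subst Bochner_Integration.integral_add) (auto intro!: integrable_real_indicator simp: less_top[symmetric])
      also have "\<dots> \<le> c0\<^sup>2 / 6" using t1(2) zero_le_power2[of c0] by linarith
      finally show ?thesis .
    qed
    have claim2: "(\<Sum>i\<in>idx L. mean_feature L i (A ** h) * ?F i) \<le> 1 - c0" if h: "h \<in> U w" for h
    proof -
      obtain s where s: "s > 0" "\<And>x. norm (s *\<^sub>R (h *v x) - (f \<bullet> x) *\<^sub>R w) \<le> \<kappa> * norm x"
        using Um(3)[OF w(1) h] by blast
      let ?bad = "{x. \<bar>f \<bullet> x\<bar> \<le> t2 * norm x}"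
      have pt: "(\<Sum>i\<in>idx L. feature L i ((A ** h) *v x) * ?F i) \<le> (1 - 2 * c0) + 2 * c0 * indicator ?bad x" for x
      proof (cases "x \<in> ?bad")
        case True
        then show ?thesis using feature_inner_le_1[of L "(A ** h) *v x" "A *v v"] by simp
      next
        case False
        then have fx: "t2 * norm x < \<bar>f \<bullet> x\<bar>" and x0: "norm x > 0" using t2 by (auto simp: not_le)
        define y where "y = s *\<^sub>R (h *v x)"
        define e where "e = y - (f \<bullet> x) *\<^sub>R w"
        have e: "norm e \<le> \<kappa> * norm x" using s(2)[of x] by (simp add: e_def y_def)
        have y: "y = (f \<bullet> x) *\<^sub>R w + e" by (simp add: e_def)
        have wd: "t2 * k / 2 * ?a * norm x \<le> norm (wedge (A *v y) (A *v v))"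
        proof -
          have "t2 * norm x * (k * ?a) \<le> \<bar>f \<bullet> x\<bar> * norm (wedge (A *v w) (A *v v))"
            using fx w(2) t2 k by (intro mult_mono) (auto simp: norm_wedge_commute)
          moreover have "norm (wedge (A *v e) (A *v v)) \<le> ?a * (t2 * k / 2 * norm x)"
          proof -
            have "norm (wedge e v) \<le> 2 * norm e * norm v" by (rule norm_wedge_le)
            also have "\<dots> \<le> 2 * (\<kappa> * norm x) * W" using e vW[OF v(1)] kap0 by (intro mult_mono) auto
            also have "\<dots> = (2 * \<kappa> * W) * norm x" by simp
            also have "\<dots> \<le> t2 * k / 2 * norm x" by (intro mult_right_mono kap) auto
            finally have "?a * norm (wedge e v) \<le> ?a * (t2 * k / 2 * norm x)" by (intro mult_left_mono) auto
            then show ?thesis using norm_wedge_image[of A e v] by linarith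
          qed
          moreover have "wedge (A *v y) (A *v v) = (f \<bullet> x) *\<^sub>R wedge (A *v w) (A *v v) + wedge (A *v e) (A *v v)"
            by (simp add: y matrix_vector_right_distrib matrix_vector_mult_scaleR wedge_simps)
          then have "\<bar>f \<bullet> x\<bar> * norm (wedge (A *v w) (A *v v)) - norm (wedge (A *v e) (A *v v)) \<le> norm (wedge (A *v y) (A *v v))"
            using norm_diff_ineq[of "(f \<bullet> x) *\<^sub>R wedge (A *v w) (A *v v)" "wedge (A *v e) (A *v v)"] by simp
          ultimately show ?thesis by (simp add: algebra_simps)
        qed
        have yn: "norm y \<le> K * norm x"
        proof -
          have "norm y \<le> norm ((f \<bullet> x) *\<^sub>R w) + norm e" unfolding y by (rule norm_triangle_ineq)
          also have "\<dots> \<le> (norm f * norm x) * W + 1 * norm x"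
          proof (rule add_mono)
            show "norm ((f \<bullet> x) *\<^sub>R w) \<le> (norm f * norm x) * W"
              unfolding norm_scaleR using vW[OF w(1)] Cauchy_Schwarz_ineq2[of f x] by (intro mult_mono) auto
            show "norm e \<le> 1 * norm x" using order_trans[OF e mult_right_mono[OF kap(1) norm_ge_zero]] .
          qed
          finally show ?thesis by (simp add: K_def algebra_simps)
        qed
        have Ayn: "norm (A *v y) \<le> ?o * (K * norm x)"
          using norm_mult_vec_le[of A y] mult_left_mono[OF yn opnorm_nonneg[of A]] by linarith
        have Avn: "norm (A *v v) \<le> ?o * W"
          using norm_mult_vec_le[of A v] mult_left_mono[OF vW[OF v(1)] opnorm_nonneg[of A]] by linarith
        have a0: "?a > 0"
        proof -
          have "?r \<noteq> 0" using L1 bb by (auto simp: bb_def)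
          then show ?thesis using area_nonneg[of A] by (auto simp: rratio_def le_less)
        qed
        have "wedge (A *v y) (A *v v) \<noteq> 0"
        proof -
          have "0 < t2 * k / 2 * ?a * norm x" using t2 k a0 x0 by simp
          with wd show ?thesis by auto
        qed
        then have Ay0: "A *v y \<noteq> 0" by (auto simp: wedge_simps)
        have "c2 * ?r = (t2 * k / 2 * ?a * norm x) / ((?o * (K * norm x)) * (?o * W))"
          using o x0 K W1 r[symmetric] by (simp add: c2_def power2_eq_square field_simps)
        also have "\<dots> \<le> pdist (A *v y) (A *v v)"
          unfolding pdist_def using wd Ayn Avn Ay0 Av o K W1
          by (intro frac_le mult_mono) (auto intro!: mult_pos_pos)
        finally have pd: "c2 * ?r \<le> pdist (A *v y) (A *v v)" .
        have "c2\<^sup>2 * bb\<^sup>2 / 8 \<le> L * (pdist (A *v y) (A *v v))\<^sup>2 / 2"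
        proof -
          have "c2\<^sup>2 * (bb\<^sup>2 / 4) \<le> c2\<^sup>2 * (L * ?r\<^sup>2)" using L1 by (intro mult_left_mono) (auto simp: bb_def)
          also have "\<dots> = L * (c2 * ?r)\<^sup>2" by (simp add: power_mult_distrib)
          also have "\<dots> \<le> L * (pdist (A *v y) (A *v v))\<^sup>2" using pd c2 by (intro mult_left_mono power_mono) auto
          finally show ?thesis by (simp add: mult_ac)
        qed
        then have "exp (- (L * (pdist (A *v y) (A *v v))\<^sup>2 / 2)) \<le> exp (- (c2\<^sup>2 * bb\<^sup>2 / 8))" by simp
        moreover have "(\<Sum>i\<in>idx L. feature L i (A *v y) * ?F i) \<le> exp (- (L * (pdist (A *v y) (A *v v))\<^sup>2 / 2))"
          by (rule feature_inner_le[OF Ay0 Av])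
        moreover have "exp (- (c2\<^sup>2 * bb\<^sup>2 / 8)) = 1 - 2 * c0" by (simp add: c0_def field_simps)
        ultimately have "(\<Sum>i\<in>idx L. feature L i (A *v y) * ?F i) \<le> 1 - 2 * c0" by linarith
        then show ?thesis using False unfolding y_def by (simp add: scale_feat[OF s(1)])
      qed
      have "(\<Sum>i\<in>idx L. mean_feature L i (A ** h) * ?F i) = (\<integral>x. (\<Sum>i\<in>idx L. feature L i ((A ** h) *v x) * ?F i) \<partial>\<eta>)"
        by (rule mean_feature_inner)
      also have "\<dots> \<le> (\<integral>x. (1 - 2 * c0) + 2 * c0 * indicator ?bad x \<partial>\<eta>)"
      proof (rule integral_mono)
        show "integrable \<eta> (\<lambda>x. \<Sum>i\<in>idx L. feature L i ((A ** h) *v x) * ?F i)"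
          by (intro Bochner_Integration.integrable_sum integrable_mult_left integrable_feature)
        show "integrable \<eta> (\<lambda>x. (1 - 2 * c0) + 2 * c0 * indicator ?bad x :: real)"
          by (intro Bochner_Integration.integrable_add integrable_mult_right integrable_real_indicator eta.integrable_const)
            (auto simp: less_top[symmetric])
      qed (rule pt)
      also have "\<dots> = (1 - 2 * c0) + 2 * c0 * measure \<eta> ?bad"
        by (subst Bochner_Integration.integral_add) (auto intro!: integrable_real_indicator simp: less_top[symmetric])
      also have "\<dots> \<le> (1 - 2 * c0) + 2 * c0 * (1 / 2)" using t2(2) c0 by (intro add_left_mono mult_left_mono) auto
      finally show ?thesis by simp
    qed
    define D where "D h = (\<Sum>i\<in>idx L. (mean_feature L i (A ** h) - mean_feature L i A)\<^sup>2)" for h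
    \<comment> \<open>The mean features at \<open>A ** h\<close> and at \<open>A ** h'\<close> differ by a fixed amount, so one of them differs from
      the mean feature at \<open>A\<close>.\<close>
    have claim3: "c0\<^sup>2 / 6 \<le> D h + D h'" if h: "h \<in> U v" "h' \<in> U w" for h h'
    proof -
      let ?P = "\<lambda>i. mean_feature L i (A ** h)" and ?Q = "\<lambda>i. mean_feature L i (A ** h')" and ?R = "\<lambda>i. mean_feature L i A"
      have "c0 \<le> (\<Sum>i\<in>idx L. (?F i - ?Q i) * ?F i)"
        using claim2[OF h(2)] feature_norm[OF Av, of L] by (simp add: left_diff_distrib sum_subtractf power2_eq_square)
      then have "c0\<^sup>2 \<le> (\<Sum>i\<in>idx L. (?F i - ?Q i) * ?F i)\<^sup>2" using c0 by (intro power_mono) auto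
      also have "\<dots> \<le> (\<Sum>i\<in>idx L. (?F i - ?Q i)\<^sup>2) * (\<Sum>i\<in>idx L. (?F i)\<^sup>2)" by (rule Cauchy_Schwarz_ineq_sum)
      also have "\<dots> = (\<Sum>i\<in>idx L. (?F i - ?Q i)\<^sup>2)" by (simp add: feature_norm[OF Av])
      also have "\<dots> \<le> (\<Sum>i\<in>idx L. 3 * (?Q i - ?R i)\<^sup>2 + 3 * (?P i - ?R i)\<^sup>2 + 3 * (?P i - ?F i)\<^sup>2)"
      proof (rule sum_mono)
        fix i
        have *: "(a - b)\<^sup>2 \<le> 3 * (b - r)\<^sup>2 + 3 * (q - r)\<^sup>2 + 3 * (q - a)\<^sup>2" for a b q r :: real
        proof -
          define X Y Z where "X = b - r" and "Y = r - q" and "Z = q - a"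
          have "3 * X\<^sup>2 + 3 * Y\<^sup>2 + 3 * Z\<^sup>2 - (X + Y + Z)\<^sup>2 = (X - Y)\<^sup>2 + (Y - Z)\<^sup>2 + (X - Z)\<^sup>2"
            by (simp add: power2_eq_square algebra_simps)
          then have "(X + Y + Z)\<^sup>2 \<le> 3 * X\<^sup>2 + 3 * Y\<^sup>2 + 3 * Z\<^sup>2"
            using zero_le_power2[of "X - Y"] zero_le_power2[of "Y - Z"] zero_le_power2[of "X - Z"] by linarith
          moreover have "X + Y + Z = b - a" by (simp add: X_def Y_def Z_def)
          ultimately show ?thesis by (simp add: X_def Y_def Z_def power2_commute)
        qed
        show "(?F i - ?Q i)\<^sup>2 \<le> 3 * (?Q i - ?R i)\<^sup>2 + 3 * (?P i - ?R i)\<^sup>2 + 3 * (?P i - ?F i)\<^sup>2" by (rule *)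
      qed
      also have "\<dots> = 3 * D h' + 3 * D h + 3 * (\<Sum>i\<in>idx L. (?P i - ?F i)\<^sup>2)"
        by (simp add: D_def sum.distrib sum_distrib_left)
      also have "\<dots> \<le> 3 * D h' + 3 * D h + 3 * (c0\<^sup>2 / 6)" using claim1[OF h(1)] by simp
      finally show ?thesis by (simp add: field_simps)
    qed
    have "\<exists>u\<in>B. \<forall>h\<in>U u. c0\<^sup>2 / 12 \<le> D h"
    proof (rule ccontr)
      assume n: "\<not> ?thesis"
      obtain h where h: "h \<in> U v" "D h < c0\<^sup>2 / 12" using n v(1) by (auto simp: not_le)
      obtain h' where h': "h' \<in> U w" "D h' < c0\<^sup>2 / 12" using n w(1) by (auto simp: not_le)
      show False using claim3[OF h(1) h'(1)] h(2) h'(2) by simp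
    qed
    then obtain u where u: "u \<in> B" "\<And>h. h \<in> U u \<Longrightarrow> c0\<^sup>2 / 12 \<le> D h" by blast
    have "p * (c0\<^sup>2 / 12) \<le> (c0\<^sup>2 / 12) * S.prob {\<omega>\<in>space S. lprod (m u) \<omega> \<in> U u}"
      using mult_right_mono[OF p(2)[OF u(1)], of "c0\<^sup>2 / 12"] by (simp add: mult_ac)
    also have "\<dots> \<le> variation L (m u) A"
      using u(2) by (intro variation_ge Um(1)[OF u(1)]) (auto simp: D_def)
    also have "\<dots> \<le> (\<Sum>m\<in>m ` B. variation L m A)"
      using u(1) B(1) by (intro member_le_sum) (auto simp: variation_nonneg)
    finally show "p * (c0\<^sup>2 / 12) \<le> (\<Sum>m\<in>m ` B. variation L m A)" .
  qed
qed

end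

lemma dyadic_exists:
  fixes x b :: real
  assumes "0 < x" "x \<le> b"
  obtains j :: nat where "b / 2 ^ (j + 1) \<le> x" "x \<le> b / 2 ^ j"
proof -
  have "\<exists>j :: nat. b / 2 ^ (j + 1) \<le> x"
  proof -
    obtain n :: nat where "b / x < 2 ^ n" using real_arch_pow[of 2 "b / x"] by auto
    then have "b / 2 ^ n \<le> x" using assms by (simp add: field_simps)
    moreover have "b / 2 ^ (n + 1) \<le> b / 2 ^ n" using assms by (intro divide_left_mono) auto
    ultimately show ?thesis by (intro exI[of _ n]) simp
  qed
  then obtain k :: nat where k: "b / 2 ^ (k + 1) \<le> x" ..
  define j where "j = (LEAST j :: nat. b / 2 ^ (j + 1) \<le> x)"
  have 1: "b / 2 ^ (j + 1) \<le> x" unfolding j_def using k by (rule LeastI)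
  have 2: "x \<le> b / 2 ^ j"
  proof (cases j)
    case (Suc i)
    then have "\<not> b / 2 ^ (i + 1) \<le> x" using not_less_Least[of i "\<lambda>j. b / 2 ^ (j + 1) \<le> x"] by (simp add: j_def)
    then show ?thesis using Suc by simp
  qed (use assms in simp)
  show ?thesis by (rule that[OF 1 2])
qed

text \<open>Bounds on the expected number of times at which a sequence of random variables is of order \<open>2\<^sup>-\<^sup>j\<close>
  sum up to a bound on the moments of the sequence, summed over time.\<close>
lemma (in prob_space) dyadic_sum_bound:
  fixes X :: "nat \<Rightarrow> 'a \<Rightarrow> real"
  assumes X[measurable]: "\<And>n. X n \<in> borel_measurable M"
    and Xb: "\<And>n x. x \<in> space M \<Longrightarrow> 0 \<le> X n x" "\<And>n x. x \<in> space M \<Longrightarrow> X n x \<le> b" and eps: "0 < \<epsilon>"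
    and strip: "\<And>j. (\<Sum>n<T. prob {x\<in>space M. b / 2 ^ (j + 1) \<le> X n x \<and> X n x \<le> b / 2 ^ j}) \<le> C j"
    and summ: "summable (\<lambda>j. C j * (b / 2 ^ j) powr \<epsilon>)"
  shows "(\<Sum>n<T. \<integral>\<^sup>+x. ennreal (X n x powr \<epsilon>) \<partial>M) \<le> ennreal (\<Sum>j. C j * (b / 2 ^ j) powr \<epsilon>)"
proof -
  let ?E = "\<lambda>n j. {x\<in>space M. b / 2 ^ (j + 1) \<le> X n x \<and> X n x \<le> b / 2 ^ j}"
  let ?w = "\<lambda>j. (b / 2 ^ j) powr \<epsilon>"
  have C0: "0 \<le> C j" for j by (rule order_trans[OF _ strip[of j]]) (simp add: sum_nonneg)
  have pt: "ennreal (X n x powr \<epsilon>) \<le> (\<Sum>j. ennreal (?w j) * indicator (?E n j) x)" if x: "x \<in> space M" for n x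
  proof (cases "X n x = 0")
    case False
    then have "0 < X n x" using Xb(1)[OF x, of n] by simp
    then obtain j where j: "b / 2 ^ (j + 1) \<le> X n x" "X n x \<le> b / 2 ^ j"
      by (rule dyadic_exists[OF _ Xb(2)[OF x]])
    define g where "g j = ennreal (?w j) * indicator (?E n j) x" for j
    have "ennreal (X n x powr \<epsilon>) \<le> g j"
      using j x Xb(1)[OF x, of n] eps unfolding g_def by (auto intro!: ennreal_leI powr_mono2)
    also have "g j = sum g {j}" by simp
    also have "\<dots> \<le> suminf g" by (rule sum_le_suminf) (auto intro: summableI)
    finally show ?thesis unfolding g_def .
  qed simp
  have "(\<Sum>n<T. \<integral>\<^sup>+x. ennreal (X n x powr \<epsilon>) \<partial>M) \<le> (\<Sum>n<T. \<integral>\<^sup>+x. (\<Sum>j. ennreal (?w j) * indicator (?E n j) x) \<partial>M)"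
    by (intro sum_mono nn_integral_mono pt)
  also have "\<dots> = (\<Sum>n<T. \<Sum>j. ennreal (?w j) * ennreal (prob (?E n j)))"
  proof (rule sum.cong[OF refl])
    fix n
    have "(\<integral>\<^sup>+x. (\<Sum>j. ennreal (?w j) * indicator (?E n j) x) \<partial>M) = (\<Sum>j. \<integral>\<^sup>+x. ennreal (?w j) * indicator (?E n j) x \<partial>M)"
      by (rule nn_integral_suminf) measurable
    also have "\<dots> = (\<Sum>j. ennreal (?w j) * ennreal (prob (?E n j)))"
      by (intro suminf_cong) (simp add: nn_integral_cmult emeasure_eq_measure)
    finally show "(\<integral>\<^sup>+x. (\<Sum>j. ennreal (?w j) * indicator (?E n j) x) \<partial>M) = (\<Sum>j. ennreal (?w j) * ennreal (prob (?E n j)))" .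
  qed
  also have "\<dots> = (\<Sum>j. \<Sum>n<T. ennreal (?w j) * ennreal (prob (?E n j)))"
    by (rule suminf_sum[symmetric]) (rule summableI)
  also have "\<dots> = (\<Sum>j. ennreal ((\<Sum>n<T. prob (?E n j)) * ?w j))"
  proof (rule suminf_cong)
    fix j
    have "(\<Sum>n<T. ennreal (?w j) * ennreal (prob (?E n j))) = ennreal (\<Sum>n<T. ?w j * prob (?E n j))"
      by (subst sum_ennreal[symmetric]) (simp_all add: ennreal_mult)
    also have "(\<Sum>n<T. ?w j * prob (?E n j)) = (\<Sum>n<T. prob (?E n j)) * ?w j"
      by (simp add: sum_distrib_left[symmetric] mult.commute)
    finally show "(\<Sum>n<T. ennreal (?w j) * ennreal (prob (?E n j))) = ennreal ((\<Sum>n<T. prob (?E n j)) * ?w j)" .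
  qed
  also have "\<dots> \<le> (\<Sum>j. ennreal (C j * ?w j))"
  proof (rule suminf_le)
    fix j show "ennreal ((\<Sum>n<T. prob (?E n j)) * ?w j) \<le> ennreal (C j * ?w j)"
      by (intro ennreal_leI mult_right_mono strip) simp
  qed (auto intro: summableI)
  also have "\<dots> = ennreal (\<Sum>j. C j * ?w j)"
    by (rule suminf_ennreal2[OF _ summ]) (simp add: C0)
  finally show ?thesis .
qed

lemma summable_dyadic_powr:
  fixes b \<epsilon> C :: real
  assumes "0 < b" "0 < \<epsilon>"
  shows "summable (\<lambda>j. C * (b / 2 ^ j) powr \<epsilon>)"
proof -
  have "(b / 2 ^ j) powr \<epsilon> = b powr \<epsilon> * (2 powr (- \<epsilon>)) ^ j" for j :: nat
  proof -
    have "(b / 2 ^ j) powr \<epsilon> = b powr \<epsilon> / (2 powr real j) powr \<epsilon>"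
      using assms by (simp add: powr_divide powr_realpow)
    also have "(2 powr real j) powr \<epsilon> = (2 powr \<epsilon>) ^ j"
      by (simp add: powr_powr mult.commute flip: powr_realpow)
    finally show ?thesis by (simp add: powr_minus divide_inverse power_inverse)
  qed
  moreover have "summable (\<lambda>j. C * (b powr \<epsilon> * (2 powr (- \<epsilon>)) ^ j))"
  proof (intro summable_mult summable_geometric)
    have "(2::real) powr (- \<epsilon>) < 2 powr 0" using assms by (intro powr_less_mono) auto
    then show "norm ((2::real) powr (- \<epsilon>)) < 1" by simp
  qed
  ultimately show ?thesis by simp
qed

context contracting_walk
begin

text \<open>Whenever \<open>rratio (lprod n \<omega>)\<close> is of order \<open>2\<^sup>-\<^sup>j\<close>, the variation at the resolution \<open>L = 4\<^sup>j\<close> is bounded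
  below; as its sum over time is bounded uniformly in \<open>L\<close>, this happens a bounded number of times on average.\<close>
lemma sum_rratio_powr:
  assumes "0 < \<epsilon>"
  obtains C :: real where "0 \<le> C" "\<And>T. (\<Sum>n<T. \<integral>\<^sup>+\<omega>. ennreal (rratio (lprod n \<omega>) powr \<epsilon>) \<partial>S) \<le> ennreal C"
proof -
  obtain Ms :: "nat set" and c :: real where Ms: "finite Ms" "0 < c" and low:
    "\<And>L A. A \<in> GL \<Longrightarrow> (2 * (real CARD('n))\<^sup>2)\<^sup>2 / 4 \<le> real L * (rratio A)\<^sup>2 \<Longrightarrow>
      real L * (rratio A)\<^sup>2 \<le> (2 * (real CARD('n))\<^sup>2)\<^sup>2 \<Longrightarrow> c \<le> (\<Sum>m\<in>Ms. variation L m A)"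
    by (rule variation_lower_bound, rule that)
  define bb where "bb = 2 * (real CARD('n))\<^sup>2"
  have bb: "bb > 0" by (simp add: bb_def)
  define K where "K = real (\<Sum>Ms) / c"
  have vi: "integrable S (\<lambda>\<omega>. variation L m (lprod n \<omega>))" for L m n
    by (rule S.integrable_const_bound[where B=1]) (auto simp: variation_nonneg variation_le_1)
  have strip: "(\<Sum>n<T. S.prob {\<omega>\<in>space S. bb / 2 ^ (j + 1) \<le> rratio (lprod n \<omega>) \<and> rratio (lprod n \<omega>) \<le> bb / 2 ^ j}) \<le> K" for j T
  proof -
    let ?E = "\<lambda>n. {\<omega>\<in>space S. bb / 2 ^ (j + 1) \<le> rratio (lprod n \<omega>) \<and> rratio (lprod n \<omega>) \<le> bb / 2 ^ j}"
    let ?L = "4 ^ j :: nat"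
    have one: "c * S.prob (?E n) \<le> (\<Sum>m\<in>Ms. \<integral>\<omega>. variation ?L m (lprod n \<omega>) \<partial>S)" for n
    proof -
      have [measurable]: "?E n \<in> sets S" by measurable
      have "c * S.prob (?E n) = (\<integral>\<omega>. c * indicator (?E n) \<omega> \<partial>S)" by simp
      also have "\<dots> \<le> (\<integral>\<omega>. (\<Sum>m\<in>Ms. variation ?L m (lprod n \<omega>)) \<partial>S)"
      proof (rule integral_mono)
        show "integrable S (\<lambda>\<omega>. c * indicator (?E n) \<omega>)"
          by (intro integrable_mult_right integrable_real_indicator) (auto simp: less_top[symmetric])
        show "integrable S (\<lambda>\<omega>. \<Sum>m\<in>Ms. variation ?L m (lprod n \<omega>))"
          by (intro Bochner_Integration.integrable_sum vi)
        fix \<omega> assume w: "\<omega> \<in> space S"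
        show "c * indicator (?E n) \<omega> \<le> (\<Sum>m\<in>Ms. variation ?L m (lprod n \<omega>))"
        proof (cases "\<omega> \<in> ?E n")
          case True
          let ?r = "rratio (lprod n \<omega>)"
          have r: "bb / 2 ^ (j + 1) \<le> ?r" "?r \<le> bb / 2 ^ j" using True by auto
          have p: "((2::real) ^ j)\<^sup>2 = 4 ^ j" by (simp add: power2_eq_square flip: power_mult_distrib)
          have "(bb / 2 ^ (j + 1))\<^sup>2 \<le> ?r\<^sup>2" using r(1) bb by (intro power_mono) auto
          also have "(bb / 2 ^ (j + 1))\<^sup>2 = bb\<^sup>2 / (4 * 4 ^ j)" by (simp add: power_divide power_mult_distrib p)
          finally have "4 ^ j * (bb\<^sup>2 / (4 * 4 ^ j)) \<le> 4 ^ j * ?r\<^sup>2" by (intro mult_left_mono) auto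
          then have 1: "bb\<^sup>2 / 4 \<le> real ?L * ?r\<^sup>2" by simp
          have "?r\<^sup>2 \<le> (bb / 2 ^ j)\<^sup>2" using r(2) by (intro power_mono) auto
          also have "(bb / 2 ^ j)\<^sup>2 = bb\<^sup>2 / 4 ^ j" by (simp add: power_divide p)
          finally have "4 ^ j * ?r\<^sup>2 \<le> 4 ^ j * (bb\<^sup>2 / 4 ^ j)" by (intro mult_left_mono) auto
          then have 2: "real ?L * ?r\<^sup>2 \<le> bb\<^sup>2" by simp
          show ?thesis using low[OF lprod_GL[OF w], of ?L n] 1 2 True by (simp add: bb_def)
        qed (simp add: variation_nonneg sum_nonneg)
      qed
      also have "\<dots> = (\<Sum>m\<in>Ms. \<integral>\<omega>. variation ?L m (lprod n \<omega>) \<partial>S)"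
        by (rule Bochner_Integration.integral_sum[OF vi])
      finally show ?thesis .
    qed
    have "c * (\<Sum>n<T. S.prob (?E n)) \<le> (\<Sum>n<T. \<Sum>m\<in>Ms. \<integral>\<omega>. variation ?L m (lprod n \<omega>) \<partial>S)"
      unfolding sum_distrib_left by (rule sum_mono[OF one])
    also have "\<dots> = (\<Sum>m\<in>Ms. \<Sum>n<T. \<integral>\<omega>. variation ?L m (lprod n \<omega>) \<partial>S)" by (rule sum.swap)
    also have "\<dots> \<le> (\<Sum>m\<in>Ms. real m)" by (rule sum_mono[OF sum_variation_le])
    finally show ?thesis using Ms(2) by (simp add: K_def field_simps)
  qed
  have K0: "0 \<le> K" unfolding K_def using Ms by (intro divide_nonneg_pos of_nat_0_le_iff)
  show ?thesis
  proof (rule that)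
    show "0 \<le> (\<Sum>j. K * (bb / 2 ^ j) powr \<epsilon>)"
      by (intro suminf_nonneg summable_dyadic_powr bb assms) (simp add: K0)
    show "(\<Sum>n<T. \<integral>\<^sup>+\<omega>. ennreal (rratio (lprod n \<omega>) powr \<epsilon>) \<partial>S) \<le> ennreal (\<Sum>j. K * (bb / 2 ^ j) powr \<epsilon>)" for T
      by (rule S.dyadic_sum_bound[OF _ _ _ assms strip summable_dyadic_powr[OF bb assms]])
        (auto simp: bb_def intro: rratio_le)
  qed
qed

end

section \<open>Contraction of projective space\<close>

locale moment_walk = contracting_walk \<mu> \<eta> for \<mu> :: "'n::finite mat measure" and \<eta> +
  assumes expm: "exponential_moment \<mu>"
begin

lemma moment:
  obtains \<delta> C :: real where "0 < \<delta>" "\<delta> \<le> 1" "0 \<le> C" "\<And>\<epsilon>. 0 \<le> \<epsilon> \<Longrightarrow> \<epsilon> \<le> \<delta> \<Longrightarrow> (\<integral>\<^sup>+A. ennreal (matN A powr \<epsilon>) \<partial>\<mu>) \<le> ennreal C"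
proof -
  obtain d0 where d0: "0 < d0" "(\<integral>\<^sup>+A. ennreal (matN A powr d0) \<partial>\<mu>) < \<infinity>"
    using expm unfolding exponential_moment_def by blast
  define C where "C = enn2real (\<integral>\<^sup>+A. ennreal (matN A powr d0) \<partial>\<mu>)"
  have C: "(\<integral>\<^sup>+A. ennreal (matN A powr d0) \<partial>\<mu>) = ennreal C" using d0(2) by (simp add: C_def)
  show ?thesis
  proof (rule that[of "min d0 1" C])
    show "0 \<le> C" by (simp add: C_def)
    fix \<epsilon> assume e: "0 \<le> \<epsilon>" "\<epsilon> \<le> min d0 1"
    have "(\<integral>\<^sup>+A. ennreal (matN A powr \<epsilon>) \<partial>\<mu>) \<le> (\<integral>\<^sup>+A. ennreal (matN A powr d0) \<partial>\<mu>)"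
      using e by (intro nn_integral_mono ennreal_leI powr_mono) (auto simp: space_mu matN_ge_1)
    then show "(\<integral>\<^sup>+A. ennreal (matN A powr \<epsilon>) \<partial>\<mu>) \<le> ennreal C" by (simp add: C)
  qed (use d0 in auto)
qed

lemma nn_integral_indep:
  assumes [measurable]: "F \<in> borel_measurable \<mu>" "H \<in> borel_measurable S"
    and dec: "\<And>\<omega> \<omega>'. H (stake n \<omega> @- \<omega>') = H \<omega>"
  shows "(\<integral>\<^sup>+\<omega>. F (\<omega> !! n) * H \<omega> \<partial>S) = (\<integral>\<^sup>+A. F A \<partial>\<mu>) * (\<integral>\<^sup>+\<omega>. H \<omega> \<partial>S)"
proof -
  have "(\<integral>\<^sup>+\<omega>. F (\<omega> !! n) * H \<omega> \<partial>S) = (\<integral>\<^sup>+\<omega>. \<integral>\<^sup>+\<omega>'. F ((stake n \<omega> @- \<omega>') !! n) * H (stake n \<omega> @- \<omega>') \<partial>S \<partial>S)"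
    by (rule nn_integral_shift) measurable
  also have "\<dots> = (\<integral>\<^sup>+\<omega>. \<integral>\<^sup>+\<omega>'. F (\<omega>' !! 0) * H \<omega> \<partial>S \<partial>S)"
    using snth_shift(2)[of n _ _ 0] by (simp add: dec)
  also have "\<dots> = (\<integral>\<^sup>+\<omega>. (\<integral>\<^sup>+A. F A \<partial>\<mu>) * H \<omega> \<partial>S)"
    by (intro nn_integral_cong, subst nn_integral_multc) (auto simp del: snth.simps simp: nn_integral_snth)
  also have "\<dots> = (\<integral>\<^sup>+A. F A \<partial>\<mu>) * (\<integral>\<^sup>+\<omega>. H \<omega> \<partial>S)" by (rule nn_integral_cmult) measurable
  finally show ?thesis .
qed

text \<open>The contraction of \<open>u\<close> relative to the most expanded direction.\<close>
definition rel_norm :: "nat \<Rightarrow> real ^ 'n \<Rightarrow> 'n mat stream \<Rightarrow> real" where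
  "rel_norm n u \<omega> = norm (lprod n \<omega> *v u) / opnorm (lprod n \<omega>)"

lemma rel_norm_measurable [measurable]: "rel_norm n u \<in> borel_measurable S"
  unfolding rel_norm_def[abs_def] by measurable

lemma rel_norm_nonneg [simp]: "0 \<le> rel_norm n u \<omega>" by (simp add: rel_norm_def)

lemma rel_norm_le: "\<omega> \<in> space S \<Longrightarrow> rel_norm n u \<omega> \<le> norm u"
  using norm_mult_vec_le[of "lprod n \<omega>" u] opnorm_pos[OF lprod_GL[of \<omega> n]]
  by (simp add: rel_norm_def divide_le_eq mult.commute)

lemma rel_norm_triangle: "rel_norm n (u + v) \<omega> \<le> rel_norm n u \<omega> + rel_norm n v \<omega>"
  unfolding rel_norm_def matrix_vector_right_distrib add_divide_distrib[symmetric]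
  by (intro divide_right_mono norm_triangle_ineq) simp

lemma rel_norm_scale: "rel_norm n (c *\<^sub>R u) \<omega> = \<bar>c\<bar> * rel_norm n u \<omega>"
  by (simp add: rel_norm_def matrix_vector_mult_scaleR)

text \<open>A bound on the change of \<open>rel_norm\<close> from time \<open>n\<close> to \<open>n + 1\<close> which is summable in mean; the power
  \<open>\<epsilon>\<close> is what the moment condition can afford.\<close>
definition jump :: "real \<Rightarrow> nat \<Rightarrow> 'n mat stream \<Rightarrow> real" where
  "jump \<epsilon> n \<omega> = (4 * real CARD('n) * (matN (\<omega> !! n))\<^sup>2 * rratio (lprod n \<omega>)) powr \<epsilon>"

lemma jump_measurable [measurable]: "jump \<epsilon> n \<in> borel_measurable S"
  unfolding jump_def[abs_def] by measurable

lemma jump_nonneg [simp]: "0 \<le> jump \<epsilon> n \<omega>" by (simp add: jump_def)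

text \<open>The change is at most \<open>X\<close>, where \<open>jump \<epsilon> n \<omega> = X\<^sup>\<epsilon>\<close>, and at most \<open>1\<close>, and \<open>min X 1 \<le> X\<^sup>\<epsilon>\<close>.\<close>
lemma rel_norm_step:
  assumes w: "\<omega> \<in> space S" and u: "norm u = 1" and e: "0 < \<epsilon>" "\<epsilon> \<le> 1"
  shows "\<bar>rel_norm (Suc n) u \<omega> - rel_norm n u \<omega>\<bar> \<le> jump \<epsilon> n \<omega>"
proof -
  define X where "X = 4 * real CARD('n) * (matN (\<omega> !! n))\<^sup>2 * rratio (lprod n \<omega>)"
  have X0: "0 \<le> X" by (simp add: X_def)
  have 1: "\<bar>rel_norm (Suc n) u \<omega> - rel_norm n u \<omega>\<bar> \<le> X"
    unfolding X_def rel_norm_def lprod.simps by (rule relative_norm_step[OF lprod_GL[OF w] snth_GL[OF w] u])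
  have 2: "\<bar>rel_norm (Suc n) u \<omega> - rel_norm n u \<omega>\<bar> \<le> 1"
    using rel_norm_le[OF w, of "Suc n" u] rel_norm_le[OF w, of n u] rel_norm_nonneg[of "Suc n" u \<omega>] rel_norm_nonneg[of n u \<omega>] u
    unfolding abs_le_iff by linarith
  have "min X 1 \<le> X powr \<epsilon>"
  proof (cases "X \<le> 1")
    case True
    then have "X powr 1 \<le> X powr \<epsilon>" using e X0 by (intro powr_mono') auto
    then show ?thesis using X0 by simp
  next
    case False
    then have "1 \<le> X powr \<epsilon>" using e by (intro ge_one_powr_ge_zero) auto
    then show ?thesis by simp
  qed
  then show ?thesis using 1 2 unfolding jump_def X_def[symmetric] by linarith
qed

lemma rratio_le_jump:
  assumes w: "\<omega> \<in> space S" and e: "0 < \<epsilon>"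
  shows "rratio (lprod n \<omega>) powr \<epsilon> \<le> jump \<epsilon> n \<omega>"
  unfolding jump_def
proof (rule powr_mono2)
  have "1 * 1 \<le> 4 * real CARD('n) * (matN (\<omega> !! n))\<^sup>2"
  proof (rule mult_mono)
    have "1 \<le> real CARD('n)" using zero_less_card_finite[where 'a='n] by linarith
    then show "1 \<le> 4 * real CARD('n)" by linarith
    show "1 \<le> (matN (\<omega> !! n))\<^sup>2" using matN_ge_1[OF snth_GL[OF w]] by (rule one_le_power)
  qed auto
  then show "rratio (lprod n \<omega>) \<le> 4 * real CARD('n) * (matN (\<omega> !! n))\<^sup>2 * rratio (lprod n \<omega>)"
    using mult_right_mono[of 1 _ "rratio (lprod n \<omega>)"] by simp
qed (use e in auto)

text \<open>The factor \<open>matN (\<omega> !! n)\<close> is independent of \<open>lprod n \<omega>\<close>, so the moment condition and \<open>sum_rratio_powr\<close>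
  make the mean of the jumps summable.\<close>
lemma jump_tail:
  obtains \<epsilon> where "0 < \<epsilon>" "\<epsilon> \<le> 1" "\<And>\<kappa> q. 0 < \<kappa> \<Longrightarrow> 0 < q \<Longrightarrow>
    \<exists>n0. S.prob {\<omega>\<in>space S. \<not> (\<Sum>k. ennreal (jump \<epsilon> (k + n0) \<omega>)) \<le> ennreal \<kappa>} \<le> q"
proof -
  obtain \<delta> C where d: "0 < \<delta>" "\<delta> \<le> 1" "0 \<le> C" "\<And>\<epsilon>. 0 \<le> \<epsilon> \<Longrightarrow> \<epsilon> \<le> \<delta> \<Longrightarrow> (\<integral>\<^sup>+A. ennreal (matN A powr \<epsilon>) \<partial>\<mu>) \<le> ennreal C"
    by (rule moment, rule that)
  define \<epsilon> where "\<epsilon> = \<delta> / 2"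
  have e: "0 < \<epsilon>" "\<epsilon> \<le> 1" using d by (auto simp: \<epsilon>_def)
  obtain R where R: "0 \<le> R" "\<And>T. (\<Sum>n<T. \<integral>\<^sup>+\<omega>. ennreal (rratio (lprod n \<omega>) powr \<epsilon>) \<partial>S) \<le> ennreal R"
    by (rule sum_rratio_powr[OF e(1)], rule that)
  let ?c = "(4 * real CARD('n)) powr \<epsilon>"
  have je: "(\<integral>\<^sup>+\<omega>. ennreal (jump \<epsilon> n \<omega>) \<partial>S) \<le> ennreal (?c * C) * (\<integral>\<^sup>+\<omega>. ennreal (rratio (lprod n \<omega>) powr \<epsilon>) \<partial>S)" for n
  proof -
    have "(\<integral>\<^sup>+\<omega>. ennreal (jump \<epsilon> n \<omega>) \<partial>S) = (\<integral>\<^sup>+\<omega>. ennreal (matN (\<omega> !! n) powr \<delta>) * ennreal (?c * (rratio (lprod n \<omega>) powr \<epsilon>)) \<partial>S)"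
    proof (rule nn_integral_cong)
      fix \<omega> assume w: "\<omega> \<in> space S"
      let ?N = "matN (\<omega> !! n)"
      have N: "1 \<le> ?N" by (rule matN_ge_1[OF snth_GL[OF w]])
      have "(?N\<^sup>2) powr \<epsilon> = ?N powr \<delta>"
        using N by (simp add: \<epsilon>_def powr_powr flip: powr_numeral)
      then show "ennreal (jump \<epsilon> n \<omega>) = ennreal (?N powr \<delta>) * ennreal (?c * (rratio (lprod n \<omega>) powr \<epsilon>))"
        using N by (simp add: jump_def powr_mult ennreal_mult[symmetric] mult_ac)
    qed
    also have "\<dots> = (\<integral>\<^sup>+A. ennreal (matN A powr \<delta>) \<partial>\<mu>) * (\<integral>\<^sup>+\<omega>. ennreal (?c * (rratio (lprod n \<omega>) powr \<epsilon>)) \<partial>S)"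
      by (rule nn_integral_indep) (auto simp: lprod_shift_le)
    also have "\<dots> \<le> ennreal C * (\<integral>\<^sup>+\<omega>. ennreal (?c * (rratio (lprod n \<omega>) powr \<epsilon>)) \<partial>S)"
      using d by (intro mult_right_mono) auto
    also have "\<dots> = ennreal (?c * C) * (\<integral>\<^sup>+\<omega>. ennreal (rratio (lprod n \<omega>) powr \<epsilon>) \<partial>S)"
    proof -
      have "(\<integral>\<^sup>+\<omega>. ennreal (?c * (rratio (lprod n \<omega>) powr \<epsilon>)) \<partial>S) = ennreal ?c * (\<integral>\<^sup>+\<omega>. ennreal (rratio (lprod n \<omega>) powr \<epsilon>) \<partial>S)"
        by (simp only: ennreal_mult[OF powr_ge_zero powr_ge_zero], subst nn_integral_cmult) auto
      then show ?thesis using d(3) by (simp add: ennreal_mult mult_ac)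
    qed
    finally show ?thesis .
  qed
  have tot: "(\<Sum>n<T. \<integral>\<^sup>+\<omega>. ennreal (jump \<epsilon> n \<omega>) \<partial>S) \<le> ennreal (?c * C * R)" for T
  proof -
    have "(\<Sum>n<T. \<integral>\<^sup>+\<omega>. ennreal (jump \<epsilon> n \<omega>) \<partial>S) \<le> (\<Sum>n<T. ennreal (?c * C) * (\<integral>\<^sup>+\<omega>. ennreal (rratio (lprod n \<omega>) powr \<epsilon>) \<partial>S))"
      by (rule sum_mono[OF je])
    also have "\<dots> = ennreal (?c * C) * (\<Sum>n<T. \<integral>\<^sup>+\<omega>. ennreal (rratio (lprod n \<omega>) powr \<epsilon>) \<partial>S)"
      by (rule sum_distrib_left[symmetric])
    also have "\<dots> \<le> ennreal (?c * C) * ennreal R" by (intro mult_left_mono R) auto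
    also have "\<dots> = ennreal (?c * C * R)" using d R by (simp add: ennreal_mult)
    finally show ?thesis .
  qed
  define E where "E n = enn2real (\<integral>\<^sup>+\<omega>. ennreal (jump \<epsilon> n \<omega>) \<partial>S)" for n
  have E: "(\<integral>\<^sup>+\<omega>. ennreal (jump \<epsilon> n \<omega>) \<partial>S) = ennreal (E n)" for n
  proof -
    have "(\<integral>\<^sup>+\<omega>. ennreal (jump \<epsilon> n \<omega>) \<partial>S) \<le> (\<Sum>n<Suc n. \<integral>\<^sup>+\<omega>. ennreal (jump \<epsilon> n \<omega>) \<partial>S)" by simp
    also have "\<dots> \<le> ennreal (?c * C * R)" by (rule tot)
    also have "\<dots> < \<infinity>" by simp
    finally show ?thesis by (simp add: E_def)
  qed
  have E0: "0 \<le> E n" for n by (simp add: E_def)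
  have sE: "summable E"
  proof (rule summableI_nonneg_bounded[OF E0])
    fix T
    have "ennreal (\<Sum>n<T. E n) \<le> ennreal (?c * C * R)" using tot[of T] by (simp add: E E0)
    then show "(\<Sum>n<T. E n) \<le> ?c * C * R" using d R by (subst (asm) ennreal_le_iff) auto
  qed
  show ?thesis
  proof (rule that[OF e])
    fix \<kappa> q :: real assume kq: "0 < \<kappa>" "0 < q"
    obtain n0 where n0: "norm (\<Sum>i. E (i + n0)) < \<kappa> * q"
      using suminf_exist_split[OF _ sE, of "\<kappa> * q"] kq by auto
    let ?T = "\<lambda>\<omega>. \<Sum>k. ennreal (jump \<epsilon> (k + n0) \<omega>)"
    let ?B = "{\<omega>\<in>space S. \<not> ?T \<omega> \<le> ennreal \<kappa>}"
    have "ennreal (\<kappa> * S.prob ?B) = (\<integral>\<^sup>+\<omega>. ennreal \<kappa> * indicator ?B \<omega> \<partial>S)"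
      using kq by (simp add: nn_integral_cmult S.emeasure_eq_measure ennreal_mult)
    also have "\<dots> \<le> (\<integral>\<^sup>+\<omega>. ?T \<omega> \<partial>S)"
      by (intro nn_integral_mono) (auto split: split_indicator)
    also have "\<dots> = (\<Sum>k. \<integral>\<^sup>+\<omega>. ennreal (jump \<epsilon> (k + n0) \<omega>) \<partial>S)"
      by (rule nn_integral_suminf) measurable
    also have "\<dots> = ennreal (\<Sum>k. E (k + n0))"
      unfolding E by (rule suminf_ennreal2[OF E0]) (use sE in \<open>simp add: summable_iff_shift\<close>)
    also have "\<dots> \<le> ennreal (\<kappa> * q)" using n0 by (intro ennreal_leI) auto
    finally have "\<kappa> * S.prob ?B \<le> \<kappa> * q" using kq by (subst (asm) ennreal_le_iff) auto
    then have "S.prob ?B \<le> q" using kq by simp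
    then show "\<exists>n0. S.prob {\<omega>\<in>space S. \<not> (\<Sum>k. ennreal (jump \<epsilon> (k + n0) \<omega>)) \<le> ennreal \<kappa>} \<le> q"
      by (rule exI[of _ n0])
  qed
qed

lemma jump_le_tail:
  assumes "(\<Sum>k. ennreal (jump \<epsilon> (k + n0) \<omega>)) \<le> ennreal \<kappa>" "0 \<le> \<kappa>"
  shows "(\<Sum>k<j. jump \<epsilon> (k + n0) \<omega>) \<le> \<kappa>" and "n0 \<le> n \<Longrightarrow> jump \<epsilon> n \<omega> \<le> \<kappa>"
proof -
  show 1: "(\<Sum>k<j. jump \<epsilon> (k + n0) \<omega>) \<le> \<kappa>" for j
  proof -
    have "ennreal (\<Sum>k<j. jump \<epsilon> (k + n0) \<omega>) = (\<Sum>k<j. ennreal (jump \<epsilon> (k + n0) \<omega>))" by simp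
    also have "\<dots> \<le> (\<Sum>k. ennreal (jump \<epsilon> (k + n0) \<omega>))" by (rule sum_le_suminf) (auto intro: summableI)
    also have "\<dots> \<le> ennreal \<kappa>" by (rule assms)
    finally show ?thesis using assms(2) by simp
  qed
  assume n: "n0 \<le> n"
  have "jump \<epsilon> ((n - n0) + n0) \<omega> \<le> (\<Sum>k<Suc (n - n0). jump \<epsilon> (k + n0) \<omega>)"
    by (rule member_le_sum[of "n - n0" _ "\<lambda>k. jump \<epsilon> (k + n0) \<omega>"]) auto
  also have "\<dots> \<le> \<kappa>" by (rule 1)
  finally show "jump \<epsilon> n \<omega> \<le> \<kappa>" using n by simp
qed

lemma rel_norm_measurable_comp [measurable (raw)]:
  assumes [measurable]: "f \<in> measurable N S" "g \<in> borel_measurable N"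
  shows "(\<lambda>x. rel_norm n (g x) (f x)) \<in> borel_measurable N"
  unfolding rel_norm_def by measurable

definition vanish :: "real ^ 'n \<Rightarrow> 'n mat stream set" where
  "vanish u = {\<omega>\<in>space S. (\<lambda>n. rel_norm n u \<omega>) \<longlonglongrightarrow> 0}"

lemma rel_norm_tendsto_0_iff: "(\<lambda>n. rel_norm n u \<omega>) \<longlonglongrightarrow> 0 \<longleftrightarrow> (\<forall>j::nat. \<exists>N. \<forall>n\<ge>N. rel_norm n u \<omega> \<le> 1 / Suc j)"
proof
  assume l: "(\<lambda>n. rel_norm n u \<omega>) \<longlonglongrightarrow> 0"
  show "\<forall>j::nat. \<exists>N. \<forall>n\<ge>N. rel_norm n u \<omega> \<le> 1 / Suc j"
  proof
    fix j :: nat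
    have "\<forall>\<^sub>F n in sequentially. rel_norm n u \<omega> < 1 / Suc j" by (rule order_tendstoD(2)[OF l]) simp
    then show "\<exists>N. \<forall>n\<ge>N. rel_norm n u \<omega> \<le> 1 / Suc j" by (auto simp: eventually_sequentially intro: less_imp_le)
  qed
next
  assume r: "\<forall>j::nat. \<exists>N. \<forall>n\<ge>N. rel_norm n u \<omega> \<le> 1 / Suc j"
  show "(\<lambda>n. rel_norm n u \<omega>) \<longlonglongrightarrow> 0"
  proof (rule LIMSEQ_I)
    fix e :: real assume "0 < e"
    then obtain j :: nat where j: "1 / Suc j < e" using nat_approx_posE by blast
    obtain N where "\<forall>n\<ge>N. rel_norm n u \<omega> \<le> 1 / Suc j" using r by blast
    then show "\<exists>N. \<forall>n\<ge>N. norm (rel_norm n u \<omega> - 0) < e" using j by (intro exI[of _ N]) fastforce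
  qed
qed

lemma vanish_eq: "vanish u = {\<omega>\<in>space S. \<forall>j::nat. \<exists>N. \<forall>n\<ge>N. rel_norm n u \<omega> \<le> 1 / Suc j}"
  unfolding vanish_def rel_norm_tendsto_0_iff ..

lemma vanish_sets [measurable]: "vanish u \<in> sets S"
  unfolding vanish_eq by measurable

lemma subspace_vanish: "\<omega> \<in> space S \<Longrightarrow> subspace {u. \<omega> \<in> vanish u}"
proof (rule subspaceI)
  assume w: "\<omega> \<in> space S"
  show "0 \<in> {u. \<omega> \<in> vanish u}" using w by (simp add: vanish_def rel_norm_def)
  show "x + y \<in> {u. \<omega> \<in> vanish u}" if "x \<in> {u. \<omega> \<in> vanish u}" "y \<in> {u. \<omega> \<in> vanish u}" for x y
  proof -
    have "(\<lambda>n. rel_norm n x \<omega> + rel_norm n y \<omega>) \<longlonglongrightarrow> 0 + 0" using that by (intro tendsto_add) (auto simp: vanish_def)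
    then have "(\<lambda>n. rel_norm n (x + y) \<omega>) \<longlonglongrightarrow> 0"
      using tendsto_sandwich[of "\<lambda>_. 0" "\<lambda>n. rel_norm n (x + y) \<omega>" sequentially "\<lambda>n. rel_norm n x \<omega> + rel_norm n y \<omega>" 0]
      by (simp add: rel_norm_triangle)
    then show ?thesis using w by (simp add: vanish_def)
  qed
  show "c *\<^sub>R x \<in> {u. \<omega> \<in> vanish u}" if "x \<in> {u. \<omega> \<in> vanish u}" for c x
    using that w tendsto_mult_right_zero[of "\<lambda>n. rel_norm n x \<omega>" sequentially "\<bar>c\<bar>"] by (simp add: vanish_def rel_norm_scale)
qed

definition vanish_on :: "(real ^ 'n) set \<Rightarrow> 'n mat stream set" where
  "vanish_on W = {\<omega>\<in>space S. \<forall>w\<in>W. \<omega> \<in> vanish w}"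

lemma vanish_on_Int [simp]: "vanish_on W \<inter> space S = vanish_on W"
  by (auto simp: vanish_on_def)

lemma vanish_on_span: "vanish_on (span B) = vanish_on B"
proof -
  have "(\<forall>w\<in>span B. \<omega> \<in> vanish w) \<longleftrightarrow> (\<forall>w\<in>B. \<omega> \<in> vanish w)" if w: "\<omega> \<in> space S" for \<omega>
  proof
    assume "\<forall>w\<in>B. \<omega> \<in> vanish w"
    then have "span B \<subseteq> {u. \<omega> \<in> vanish u}" by (intro span_minimal subspace_vanish[OF w]) auto
    then show "\<forall>w\<in>span B. \<omega> \<in> vanish w" by auto
  qed (auto intro: span_base)
  then show ?thesis by (auto simp: vanish_on_def)
qed

lemma vanish_on_finite_sets: "finite B \<Longrightarrow> vanish_on B \<in> sets S"
  unfolding vanish_on_def by (rule sets.sets_Collect_finite_All) auto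

lemma subspace_finite_basis:
  fixes W :: "(real ^ 'n) set"
  assumes "subspace W"
  obtains B where "finite B" "span B = W"
proof -
  obtain B where "B \<subseteq> W" "independent B" "W \<subseteq> span B" by (rule maximal_independent_subset)
  then show ?thesis
    using that[of B] finiteI_independent[of B] span_minimal[of B W] assms by auto
qed

lemma vanish_on_sets: "subspace W \<Longrightarrow> vanish_on W \<in> sets S"
  by (metis subspace_finite_basis vanish_on_span vanish_on_finite_sets)

text \<open>The first matrix changes lengths and norms by bounded factors only.\<close>
lemma vanish_Stream:
  assumes A: "A \<in> GL" and w: "\<omega> \<in> space S"
  shows "A ## \<omega> \<in> vanish u \<longleftrightarrow> \<omega> \<in> vanish (A *v u)"
proof -
  let ?N = "matN A"
  have N: "?N \<ge> 1" by (rule matN_ge_1[OF A])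
  have o: "opnorm A \<le> ?N" "opnorm (matrix_inv A) \<le> ?N" by (simp_all add: matN_def)
  have up: "rel_norm (Suc n) u (A ## \<omega>) \<le> ?N * rel_norm n (A *v u) \<omega>"
    and lo: "rel_norm n (A *v u) \<omega> \<le> ?N * rel_norm (Suc n) u (A ## \<omega>)" for n
  proof -
    let ?G = "lprod n \<omega>"
    have G: "?G \<in> GL" "?G ** A \<in> GL" using A w by (auto intro: GL_mult lprod_GL)
    have p: "opnorm ?G > 0" "opnorm (?G ** A) > 0" using G by (auto intro: opnorm_pos)
    have "opnorm (?G ** A) \<le> opnorm ?G * opnorm A" by (rule opnorm_mult_le)
    also have "\<dots> \<le> opnorm ?G * ?N" by (intro mult_left_mono o) auto
    finally have 1: "opnorm (?G ** A) \<le> ?N * opnorm ?G" by (simp add: mult.commute)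
    have "opnorm ((?G ** A) ** matrix_inv A) \<le> opnorm (?G ** A) * opnorm (matrix_inv A)" by (rule opnorm_mult_le)
    also have "\<dots> \<le> opnorm (?G ** A) * ?N" by (intro mult_left_mono o) auto
    finally have 2: "opnorm ?G \<le> ?N * opnorm (?G ** A)"
      by (simp add: mult.commute matrix_mul_assoc[symmetric] matrix_inv_mult[OF A])
    have e: "rel_norm (Suc n) u (A ## \<omega>) = norm (?G *v (A *v u)) / opnorm (?G ** A)"
      by (simp add: rel_norm_def lprod_Stream matrix_vector_mul_assoc del: lprod.simps)
    show "rel_norm (Suc n) u (A ## \<omega>) \<le> ?N * rel_norm n (A *v u) \<omega>"
    proof -
      have "norm (?G *v (A *v u)) * opnorm ?G \<le> norm (?G *v (A *v u)) * (?N * opnorm (?G ** A))"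
        by (intro mult_left_mono 2) simp
      then show ?thesis unfolding e using p by (simp add: rel_norm_def field_simps)
    qed
    show "rel_norm n (A *v u) \<omega> \<le> ?N * rel_norm (Suc n) u (A ## \<omega>)"
    proof -
      have "norm (?G *v (A *v u)) * opnorm (?G ** A) \<le> norm (?G *v (A *v u)) * (?N * opnorm ?G)"
        by (intro mult_left_mono 1) simp
      then show ?thesis unfolding e using p by (simp add: rel_norm_def field_simps)
    qed
  qed
  have "(\<lambda>n. rel_norm n u (A ## \<omega>)) \<longlonglongrightarrow> 0 \<longleftrightarrow> (\<lambda>n. rel_norm (Suc n) u (A ## \<omega>)) \<longlonglongrightarrow> 0"
    by (rule filterlim_sequentially_Suc[symmetric])
  also have "\<dots> \<longleftrightarrow> (\<lambda>n. rel_norm n (A *v u) \<omega>) \<longlonglongrightarrow> 0"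
  proof
    assume "(\<lambda>n. rel_norm (Suc n) u (A ## \<omega>)) \<longlonglongrightarrow> 0"
    then have "(\<lambda>n. ?N * rel_norm (Suc n) u (A ## \<omega>)) \<longlonglongrightarrow> 0" by (rule tendsto_mult_right_zero)
    then show "(\<lambda>n. rel_norm n (A *v u) \<omega>) \<longlonglongrightarrow> 0"
      by (rule tendsto_sandwich[OF _ _ tendsto_const, rotated 2]) (auto simp: lo)
  next
    assume "(\<lambda>n. rel_norm n (A *v u) \<omega>) \<longlonglongrightarrow> 0"
    then have "(\<lambda>n. ?N * rel_norm n (A *v u) \<omega>) \<longlonglongrightarrow> 0" by (rule tendsto_mult_right_zero)
    then show "(\<lambda>n. rel_norm (Suc n) u (A ## \<omega>)) \<longlonglongrightarrow> 0"
      by (rule tendsto_sandwich[OF _ _ tendsto_const, rotated 2]) (auto simp: up)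
  qed
  finally show ?thesis using w A by (simp add: vanish_def Stream_space)
qed

text \<open>Some basis vector is always stretched by a fixed part of the norm.\<close>
lemma vanish_on_UNIV: "vanish_on UNIV = {}"
proof (rule ccontr)
  assume "vanish_on UNIV \<noteq> {}"
  then obtain \<omega> where w: "\<omega> \<in> space S" "\<And>u. (\<lambda>n. rel_norm n u \<omega>) \<longlonglongrightarrow> 0"
    by (auto simp: vanish_on_def vanish_def)
  have l: "(\<lambda>n. real CARD('n) * (\<Sum>i\<in>UNIV. rel_norm n (axis i 1) \<omega>)) \<longlonglongrightarrow> real CARD('n) * (\<Sum>i\<in>(UNIV::'n set). (0::real))"
    by (intro tendsto_mult tendsto_const tendsto_sum w)
  have b: "1 \<le> real CARD('n) * (\<Sum>i\<in>UNIV. rel_norm n (axis i 1) \<omega>)" for n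
  proof -
    let ?G = "lprod n \<omega>"
    have p: "opnorm ?G > 0" by (rule opnorm_pos[OF lprod_GL[OF w(1)]])
    obtain i where i: "opnorm ?G \<le> CARD('n) * norm (?G *v axis i 1)" by (rule exists_axis_opnorm_le)
    then have "1 \<le> CARD('n) * rel_norm n (axis i 1) \<omega>" using p by (simp add: rel_norm_def field_simps)
    also have "\<dots> \<le> CARD('n) * (\<Sum>i\<in>UNIV. rel_norm n (axis i 1) \<omega>)"
      by (intro mult_left_mono member_le_sum) auto
    finally show ?thesis .
  qed
  have "1 \<le> real CARD('n) * (\<Sum>i\<in>(UNIV::'n set). (0::real))"
    by (rule LIMSEQ_le_const[OF l]) (intro exI allI impI b)
  then show False by simp
qed

lemma vanish_on_image_measurable:
  assumes W: "subspace W"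
  shows "(\<lambda>A. S.prob (vanish_on ((*v) A ` W))) \<in> borel_measurable \<mu>"
proof -
  obtain B where B: "finite B" "span B = W" by (rule subspace_finite_basis[OF W])
  have e: "vanish_on ((*v) A ` W) = {\<omega>\<in>space S. \<forall>w\<in>B. \<forall>j::nat. \<exists>N. \<forall>n\<ge>N. rel_norm n (A *v w) \<omega> \<le> 1 / Suc j}" for A
  proof -
    have "(*v) A ` W = span ((*v) A ` B)"
      unfolding B(2)[symmetric] by (rule linear_span_image[symmetric]) (rule matrix_vector_mul_linear)
    then have "vanish_on ((*v) A ` W) = vanish_on ((*v) A ` B)" by (simp only: vanish_on_span)
    then show ?thesis by (auto simp: vanish_on_def vanish_eq)
  qed
  let ?P = "\<lambda>A \<omega>. \<forall>w\<in>B. \<forall>j::nat. \<exists>N. \<forall>n\<ge>N. rel_norm n (A *v w) \<omega> \<le> 1 / Suc j"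
  have [measurable]: "{p\<in>space (\<mu> \<Otimes>\<^sub>M S). ?P (fst p) (snd p)} \<in> sets (\<mu> \<Otimes>\<^sub>M S)"
    using B(1) by (intro sets.sets_Collect_finite_All) measurable
  have "(\<lambda>A. \<integral>\<omega>. indicat_real {p\<in>space (\<mu> \<Otimes>\<^sub>M S). ?P (fst p) (snd p)} (A, \<omega>) \<partial>S) \<in> borel_measurable \<mu>"
    by measurable
  moreover have "(\<integral>\<omega>. indicat_real {p\<in>space (\<mu> \<Otimes>\<^sub>M S). ?P (fst p) (snd p)} (A, \<omega>) \<partial>S) = S.prob (vanish_on ((*v) A ` W))"
    if "A \<in> space \<mu>" for A
  proof -
    have "(\<integral>\<omega>. indicat_real {p\<in>space (\<mu> \<Otimes>\<^sub>M S). ?P (fst p) (snd p)} (A, \<omega>) \<partial>S) = (\<integral>\<omega>. indicat_real (vanish_on ((*v) A ` W)) \<omega> \<partial>S)"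
      using that unfolding e by (intro Bochner_Integration.integral_cong) (auto simp: indicator_def space_pair_measure)
    also have "\<dots> = S.prob (vanish_on ((*v) A ` W))"
      by simp
    finally show ?thesis .
  qed
  ultimately show ?thesis by (simp cong: measurable_cong)
qed

text \<open>The vectors on which \<open>rel_norm\<close> vanishes in the limit form a random subspace. Let \<open>r\<close> be the largest dimension
  of a subspace that is contained in it with positive probability. Two different such subspaces of dimension
  \<open>r\<close> are almost surely not both contained in it, as otherwise their sum would be, so the probabilities
  are summable over the subspaces of dimension \<open>r\<close>, and \<open>invariant_finite_family\<close> applies.\<close>
lemma prob_vanish:
  assumes u: "u \<noteq> 0"
  shows "S.prob (vanish u) = 0"
proof (rule ccontr)
  assume "S.prob (vanish u) \<noteq> 0"
  then have pu: "S.prob (vanish u) > 0" by (simp add: zero_less_measure_iff)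
  define P where "P r \<longleftrightarrow> (\<exists>W. subspace W \<and> dim W = r \<and> S.prob (vanish_on W) > 0)" for r
  have P1: "P 1"
    unfolding P_def
  proof (intro exI conjI)
    show "subspace (span {u})" by (rule subspace_span)
    show "dim (span {u}) = 1" using u by simp
    have "vanish_on (span {u}) = vanish u" unfolding vanish_on_span by (auto simp: vanish_on_def vanish_def)
    then show "S.prob (vanish_on (span {u})) > 0" using pu by simp
  qed
  have Pb: "r \<le> CARD('n)" if "P r" for r
    using that dim_subset_UNIV[where 'a="real ^ 'n"] by (auto simp: P_def)
  define r where "r = (GREATEST r. P r)"
  have Pr: "P r" unfolding r_def by (rule GreatestI_nat[where P=P, OF P1 Pb])
  have r_max: "r' \<le> r" if "P r'" for r' unfolding r_def by (rule Greatest_le_nat[where P=P, OF that Pb])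
  have r1: "1 \<le> r" by (rule r_max[OF P1])
  obtain W0 where W0: "subspace W0" "dim W0 = r" "S.prob (vanish_on W0) > 0" using Pr by (auto simp: P_def)
  have r_lt: "r < CARD('n)"
  proof (rule ccontr)
    assume "\<not> r < CARD('n)"
    then have "W0 = UNIV" using W0 subspace_dim_equal[of W0 UNIV] by auto
    then show False using W0(3) by (simp add: vanish_on_UNIV)
  qed
  let ?F = "{W :: (real ^ 'n) set. subspace W \<and> dim W = r}"
  obtain H where H: "finite H" "H \<noteq> {}" "H \<subseteq> ?F" "AE A in \<mu>. \<forall>W\<in>H. (*v) A ` W \<in> H"
  proof (rule invariant_finite_family[where \<beta> = "\<lambda>W. S.prob (vanish_on W)" and F = ?F and \<tau> = "\<lambda>A W. (*v) A ` W" and ?W0.0 = W0])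
    fix H assume H: "finite H" "H \<subseteq> ?F"
    show "(\<Sum>W\<in>H. S.prob (vanish_on W)) \<le> 1"
    proof (rule S.sum_prob_le_1)
      fix W W' assume a: "W \<in> H" "W' \<in> H" "W \<noteq> W'"
      then have b: "subspace W" "subspace W'" "dim W = r" "dim W' = r" using H by auto
      define V where "V = {x + y |x y. x \<in> W \<and> y \<in> W'}"
      have V: "subspace V" unfolding V_def by (rule subspace_sums[OF b(1,2)])
      have WV: "W \<subseteq> V" "W' \<subseteq> V"
        unfolding V_def using subspace_0[OF b(1)] subspace_0[OF b(2)] by force+
      have "vanish_on W \<inter> vanish_on W' \<subseteq> vanish_on V"
      proof
        fix \<omega> assume "\<omega> \<in> vanish_on W \<inter> vanish_on W'"
        then have w: "\<omega> \<in> space S" "\<And>x. x \<in> W \<Longrightarrow> x \<in> {u. \<omega> \<in> vanish u}" "\<And>x. x \<in> W' \<Longrightarrow> x \<in> {u. \<omega> \<in> vanish u}"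
          by (auto simp: vanish_on_def)
        have "x + y \<in> {u. \<omega> \<in> vanish u}" if "x \<in> W" "y \<in> W'" for x y
          by (rule subspace_add[OF subspace_vanish[OF w(1)] w(2)[OF that(1)] w(3)[OF that(2)]])
        then show "\<omega> \<in> vanish_on V" using w(1) by (auto simp: vanish_on_def V_def)
      qed
      moreover have "S.prob (vanish_on V) = 0"
      proof (rule ccontr)
        assume "S.prob (vanish_on V) \<noteq> 0"
        then have "P (dim V)" unfolding P_def using V by (intro exI[of _ V]) (simp add: zero_less_measure_iff)
        then have "dim V \<le> r" by (rule r_max)
        then have "W = V" "W' = V"
          using subspace_dim_equal[OF b(1) V WV(1)] subspace_dim_equal[OF b(2) V WV(2)] b by auto
        then show False using a by simp
      qed
      ultimately have "S.prob (vanish_on W \<inter> vanish_on W') \<le> 0"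
        using S.finite_measure_mono[OF _ vanish_on_sets[OF V], of "vanish_on W \<inter> vanish_on W'"] by simp
      then show "S.prob (vanish_on W \<inter> vanish_on W') = 0" by (simp add: measure_le_0_iff)
    qed (use H in \<open>auto intro: vanish_on_sets\<close>)
  next
    fix W assume W: "W \<in> ?F"
    then have sW: "subspace W" by simp
    show "(\<lambda>A. S.prob (vanish_on ((*v) A ` W))) \<in> borel_measurable \<mu>" by (rule vanish_on_image_measurable[OF sW])
    have [measurable]: "vanish_on W \<in> sets S" by (rule vanish_on_sets[OF sW])
    have ii: "integrable S (indicat_real (vanish_on W))"
      by (intro integrable_real_indicator) (auto simp: less_top[symmetric])
    have "S.prob (vanish_on W) = (\<integral>\<omega>. indicat_real (vanish_on W) \<omega> \<partial>S)" by simp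
    also have "\<dots> = (\<integral>A. \<integral>\<omega>. indicat_real (vanish_on W) (A ## \<omega>) \<partial>S \<partial>\<mu>)"
      by (rule integral_Stream(1)[OF ii])
    also have "\<dots> = (\<integral>A. S.prob (vanish_on ((*v) A ` W)) \<partial>\<mu>)"
    proof (rule Bochner_Integration.integral_cong[OF refl])
      fix A assume "A \<in> space \<mu>"
      then have A: "A \<in> GL" by (simp add: space_mu)
      have "(\<integral>\<omega>. indicat_real (vanish_on W) (A ## \<omega>) \<partial>S) = (\<integral>\<omega>. indicat_real (vanish_on ((*v) A ` W)) \<omega> \<partial>S)"
        by (intro Bochner_Integration.integral_cong)
          (auto simp: indicator_def vanish_on_def vanish_Stream[OF A] Stream_space[OF A])
      also have "\<dots> = S.prob (vanish_on ((*v) A ` W))" by simp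
      finally show "(\<integral>\<omega>. indicat_real (vanish_on W) (A ## \<omega>) \<partial>S) = S.prob (vanish_on ((*v) A ` W))" .
    qed
    finally show "S.prob (vanish_on W) \<le> (\<integral>A. S.prob (vanish_on ((*v) A ` W)) \<partial>\<mu>)" by simp
  next
    fix A :: "'n mat" and W assume A: "A \<in> GL" and W: "W \<in> ?F"
    have "dim ((*v) A ` W) = dim W"
      by (intro dim_image_eq matrix_vector_mul_linear) (auto intro!: inj_onI simp: GL_inj[OF A])
    then show "(*v) A ` W \<in> ?F"
      using W linear_subspace_image[OF matrix_vector_mul_linear, of W A] by simp
  qed (use W0 in auto)
  have "AE A in \<mu>. (*v) A ` (\<Union>H) \<subseteq> \<Union>H"
    using H(4) by eventually_elim auto
  then have "\<not> strongly_irreducible \<mu>"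
  proof (rule not_strongly_irreducibleI[OF H(1,2), rotated 3])
    fix W assume "W \<in> H"
    then have W: "subspace W" "dim W = r" using H by auto
    then show "subspace W" "W \<noteq> {0}" "W \<noteq> UNIV" using r1 r_lt by auto
  qed
  then show False using SI by simp
qed

definition jump_tail_le :: "real \<Rightarrow> nat \<Rightarrow> real \<Rightarrow> 'n mat stream set" where
  "jump_tail_le \<epsilon> n0 \<kappa> = {\<omega>\<in>space S. (\<Sum>k. ennreal (jump \<epsilon> (k + n0) \<omega>)) \<le> ennreal \<kappa>}"

lemma jump_tail_le_sets [measurable]: "jump_tail_le \<epsilon> n0 \<kappa> \<in> sets S"
  unfolding jump_tail_le_def by measurable

lemma jump_tail_AE:
  obtains \<epsilon> where "0 < \<epsilon>" "\<epsilon> \<le> 1" "\<And>\<kappa> q. 0 < \<kappa> \<Longrightarrow> 0 < q \<Longrightarrow> \<exists>n0. S.prob (space S - jump_tail_le \<epsilon> n0 \<kappa>) \<le> q"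
    "AE \<omega> in S. \<forall>j::nat. \<exists>n0. \<omega> \<in> jump_tail_le \<epsilon> n0 (1 / Suc j)"
proof -
  obtain \<epsilon> where e: "0 < \<epsilon>" "\<epsilon> \<le> 1" and tail: "\<And>\<kappa> q. 0 < \<kappa> \<Longrightarrow> 0 < q \<Longrightarrow>
    \<exists>n0. S.prob {\<omega>\<in>space S. \<not> (\<Sum>k. ennreal (jump \<epsilon> (k + n0) \<omega>)) \<le> ennreal \<kappa>} \<le> q"
    by (rule jump_tail, rule that)
  have eq: "{\<omega>\<in>space S. \<not> (\<Sum>k. ennreal (jump \<epsilon> (k + n0) \<omega>)) \<le> ennreal \<kappa>} = space S - jump_tail_le \<epsilon> n0 \<kappa>" for n0 \<kappa>
    unfolding jump_tail_le_def by fast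
  note tail' = tail[unfolded eq]
  have "AE \<omega> in S. \<exists>n0. \<omega> \<in> jump_tail_le \<epsilon> n0 (1 / Suc j)" for j :: nat
  proof -
    let ?U = "\<Union>n0. jump_tail_le \<epsilon> n0 (1 / Suc j)"
    have mU: "?U \<in> sets S" by measurable
    have "S.prob (space S - ?U) \<le> 0 + c" if c: "0 < c" for c
    proof -
      obtain n0 where n0: "S.prob (space S - jump_tail_le \<epsilon> n0 (1 / Suc j)) \<le> c" using tail'[of "1 / Suc j", OF _ c] by auto
      have "S.prob (space S - ?U) \<le> S.prob (space S - jump_tail_le \<epsilon> n0 (1 / Suc j))"
        by (intro S.finite_measure_mono Diff_mono UN_upper order_refl UNIV_I) measurable
      then show ?thesis using n0 by linarith
    qed
    then have "S.prob (space S - ?U) \<le> 0" by (rule field_le_epsilon)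
    then have "S.prob ?U = 1" using S.prob_compl[OF mU] S.prob_le_1[of ?U] by linarith
    then have "AE \<omega> in S. \<omega> \<in> ?U" using mU by (subst (asm) S.prob_eq_1)
    then show ?thesis by simp
  qed
  then have "AE \<omega> in S. \<forall>j::nat. \<exists>n0. \<omega> \<in> jump_tail_le \<epsilon> n0 (1 / Suc j)"
    by (simp add: AE_all_countable)
  then show ?thesis using that[OF e tail'] by fast
qed

lemma rel_norm_increase_le:
  assumes w: "\<omega> \<in> jump_tail_le \<epsilon> n0 \<kappa>" and e: "0 < \<epsilon>" "\<epsilon> \<le> 1" and kap: "0 \<le> \<kappa>" and u: "norm u = 1" and mn: "n0 \<le> m" "m \<le> n"
  shows "rel_norm n u \<omega> \<le> rel_norm m u \<omega> + \<kappa>"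
proof -
  have ws: "\<omega> \<in> space S" and t: "(\<Sum>k. ennreal (jump \<epsilon> (k + n0) \<omega>)) \<le> ennreal \<kappa>"
    using w by (auto simp: jump_tail_le_def)
  have tm: "rel_norm (i + m) u \<omega> - rel_norm m u \<omega> \<le> (\<Sum>k<i. jump \<epsilon> (k + m) \<omega>)" for i
  proof (induction i)
    case (Suc i)
    then show ?case using rel_norm_step[OF ws u e, of "i + m"] by (simp add: abs_le_iff)
  qed simp
  have "(\<Sum>k<n - m. jump \<epsilon> (k + m) \<omega>) = (\<Sum>k\<in>{m - n0..<n - n0}. jump \<epsilon> (k + n0) \<omega>)"
    using mn by (intro sum.reindex_bij_witness[of _ "\<lambda>k. k - (m - n0)" "\<lambda>k. k + (m - n0)"]) auto
  also have "\<dots> \<le> (\<Sum>k<n - n0. jump \<epsilon> (k + n0) \<omega>)"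
    by (intro sum_mono2) auto
  also have "\<dots> \<le> \<kappa>" by (rule jump_le_tail(1)[OF t kap])
  finally show ?thesis using tm[of "n - m"] mn by simp
qed

text \<open>As the jumps are summable, \<open>rel_norm\<close> converges; almost surely the limit is not zero.\<close>
lemma AE_rel_norm_bounded_below:
  assumes u: "norm u = 1"
  shows "AE \<omega> in S. \<exists>k::nat. \<forall>n\<ge>k. 1 / Suc k \<le> rel_norm n u \<omega>"
proof -
  obtain \<epsilon> where e: "0 < \<epsilon>" "\<epsilon> \<le> 1" and t: "AE \<omega> in S. \<forall>j::nat. \<exists>n0. \<omega> \<in> jump_tail_le \<epsilon> n0 (1 / Suc j)"
    by (rule jump_tail_AE)
  have "u \<noteq> 0" using u by auto
  then have "S.prob (vanish u) = 0" by (rule prob_vanish)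
  then have "AE \<omega> in S. \<omega> \<notin> vanish u" by (subst (asm) S.prob_eq_0) auto
  then show ?thesis
    using t AE_space
  proof eventually_elim
    case (elim \<omega>)
    show ?case
    proof (rule ccontr)
      assume n: "\<not> ?case"
      have "\<exists>N. \<forall>n\<ge>N. rel_norm n u \<omega> \<le> 1 / Suc j" for j :: nat
      proof -
        let ?j = "2 * j + 1"
        obtain n0 where n0: "\<omega> \<in> jump_tail_le \<epsilon> n0 (1 / Suc ?j)" using elim(2) by blast
        have "\<not> (\<forall>n\<ge>max n0 ?j. 1 / Suc (max n0 ?j) \<le> rel_norm n u \<omega>)"
          by (rule notI) (rule notE[OF n exI])
        then obtain m where m: "max n0 ?j \<le> m" "rel_norm m u \<omega> < 1 / Suc (max n0 ?j)" by (auto simp: not_le)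
        have mj: "1 / real (Suc (max n0 ?j)) \<le> 1 / Suc ?j" by (simp add: frac_le)
        have "rel_norm n u \<omega> \<le> 1 / Suc j" if "n \<ge> m" for n
        proof -
          have "rel_norm n u \<omega> \<le> rel_norm m u \<omega> + 1 / Suc ?j"
            using m that by (intro rel_norm_increase_le[OF n0 e _ u]) auto
          then have "rel_norm n u \<omega> \<le> 1 / Suc ?j + 1 / Suc ?j" using m(2) mj by linarith
          also have "\<dots> = 1 / Suc j" by (simp add: field_simps)
          finally show ?thesis .
        qed
        then show ?thesis by (intro exI[of _ m] allI impI)
      qed
      then have "\<omega> \<in> vanish u" using elim(3) by (simp add: vanish_eq)
      then show False using elim(1) by contradiction
    qed
  qed
qed

text \<open>Uniformity over the unit sphere holds by compactness, because \<open>rel_norm n\<close> is 1-Lipschitz.\<close>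
lemma rel_norm_bounded_below:
  assumes q: "0 < q"
  obtains t n1 where "0 < t" "\<And>u. norm u = 1 \<Longrightarrow> S.prob {\<omega>\<in>space S. \<not> (\<forall>n\<ge>n1. t \<le> rel_norm n u \<omega>)} \<le> q"
proof -
  have loc: "\<exists>t>0. \<exists>n1. S.prob {\<omega>\<in>space S. \<not> (\<forall>n\<ge>n1. 2 * t \<le> rel_norm n u \<omega>)} \<le> q" if u: "norm u = 1" for u
  proof -
    define G where "G k = {\<omega>\<in>space S. \<not> (\<forall>n\<ge>k. 1 / Suc k \<le> rel_norm n u \<omega>)}" for k :: nat
    have mG: "G k \<in> sets S" for k unfolding G_def by measurable
    have "decseq G"
    proof (rule decseq_SucI)
      fix k
      have "1 / real (Suc (Suc k)) \<le> 1 / real (Suc k)" by (simp add: field_simps)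
      then have d: "r < 1 / real (Suc k)" if "r < 1 / real (Suc (Suc k))" for r using that by linarith
      show "G (Suc k) \<subseteq> G k"
      proof
        fix \<omega> assume "\<omega> \<in> G (Suc k)"
        then obtain n where "\<omega> \<in> space S" "Suc k \<le> n" "rel_norm n u \<omega> < 1 / real (Suc (Suc k))"
          unfolding G_def by (auto simp: not_le simp del: of_nat_Suc)
        then have "\<omega> \<in> space S" "k \<le> n" "\<not> 1 / real (Suc k) \<le> rel_norm n u \<omega>" using d by (simp_all only: not_le Suc_leD)
        then show "\<omega> \<in> G k" unfolding G_def mem_Collect_eq by fast
      qed
    qed
    then have lim: "(\<lambda>k. S.prob (G k)) \<longlonglongrightarrow> S.prob (\<Inter>k. G k)"
      by (intro S.finite_Lim_measure_decseq image_subsetI mG)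
    have "AE \<omega> in S. \<omega> \<notin> (\<Inter>k. G k)"
      using AE_rel_norm_bounded_below[OF u] by eventually_elim (auto simp: G_def)
    moreover have "(\<Inter>k. G k) \<in> sets S" using mG by (intro sets.countable_INT) auto
    ultimately have "S.prob (\<Inter>k. G k) = 0" by (subst S.prob_eq_0)
    then have "\<forall>\<^sub>F k in sequentially. S.prob (G k) < q" using q by (intro order_tendstoD(2)[OF lim]) simp
    then obtain k where k: "S.prob (G k) < q" by (auto simp: eventually_sequentially)
    define t0 where "t0 = 1 / (2 * real (Suc k))"
    have t0: "2 * t0 = 1 / real (Suc k)" "0 < t0" by (simp_all add: t0_def field_simps)
    have "S.prob {\<omega>\<in>space S. \<not> (\<forall>n\<ge>k. 2 * t0 \<le> rel_norm n u \<omega>)} \<le> q"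
      using k unfolding G_def t0(1) by (rule less_imp_le)
    then show ?thesis using t0(2) by (intro exI[of _ t0] conjI exI[of _ k])
  qed
  define Q where "Q u t k \<longleftrightarrow> 0 < t \<and> S.prob {\<omega>\<in>space S. \<not> (\<forall>n\<ge>k. 2 * t \<le> rel_norm n u \<omega>)} \<le> q" for u t k
  have "\<exists>p. Q u (fst p) (snd p)" if "u \<in> sphere 0 1" for u
  proof -
    from that obtain t k where "Q u t k" using loc[of u] unfolding Q_def by auto
    then show ?thesis by (intro exI[of _ "(t, k)"]) simp
  qed
  then have "\<forall>u\<in>sphere 0 1. \<exists>p. Q u (fst p) (snd p)" by (rule ballI)
  then have "\<exists>p. \<forall>u\<in>sphere 0 1. Q u (fst (p u)) (snd (p u))" by (rule bchoice)
  then obtain p where p: "\<forall>u\<in>sphere 0 1. Q u (fst (p u)) (snd (p u))" ..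
  define t n1 where "t u = fst (p u)" and "n1 u = snd (p u)" for u
  have tn: "0 < t u" "S.prob {\<omega>\<in>space S. \<not> (\<forall>n\<ge>n1 u. 2 * t u \<le> rel_norm n u \<omega>)} \<le> q" if "norm u = 1" for u
    using bspec[OF p, of u] that unfolding Q_def t_def n1_def by simp_all
  have "compact (sphere (0 :: real ^ 'n) 1)" by simp
  then obtain C where C: "C \<subseteq> sphere 0 1" "finite C" "sphere 0 1 \<subseteq> (\<Union>u\<in>C. ball u (t u))"
  proof (rule compactE_image[of _ "sphere 0 1" "\<lambda>u. ball u (t u)"])
    show "sphere 0 1 \<subseteq> (\<Union>u\<in>sphere 0 1. ball u (t u))" using tn(1) by force
  qed auto
  show ?thesis
  proof (rule that[of "Min (insert 1 (t ` C))" "Max (insert 0 (n1 ` C))"])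
    show "0 < Min (insert 1 (t ` C))" using C tn(1) by (subst Min_gr_iff) auto
    fix u :: "real ^ 'n" assume u: "norm u = 1"
    then obtain v where v: "v \<in> C" "dist v u < t v" using C(3) by fastforce
    have v1: "norm v = 1" using v C by auto
    have m: "Min (insert 1 (t ` C)) \<le> t v" "n1 v \<le> Max (insert 0 (n1 ` C))" using v C by auto
    have "S.prob {\<omega>\<in>space S. \<not> (\<forall>n\<ge>Max (insert 0 (n1 ` C)). Min (insert 1 (t ` C)) \<le> rel_norm n u \<omega>)}
      \<le> S.prob {\<omega>\<in>space S. \<not> (\<forall>n\<ge>n1 v. 2 * t v \<le> rel_norm n v \<omega>)}"
    proof (rule S.finite_measure_mono)
      show "{\<omega>\<in>space S. \<not> (\<forall>n\<ge>Max (insert 0 (n1 ` C)). Min (insert 1 (t ` C)) \<le> rel_norm n u \<omega>)}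
        \<subseteq> {\<omega>\<in>space S. \<not> (\<forall>n\<ge>n1 v. 2 * t v \<le> rel_norm n v \<omega>)}"
      proof safe
        fix \<omega> n assume w: "\<omega> \<in> space S" and n: "Max (insert 0 (n1 ` C)) \<le> n"
          and r: "\<not> Min (insert 1 (t ` C)) \<le> rel_norm n u \<omega>" and a: "\<forall>n\<ge>n1 v. 2 * t v \<le> rel_norm n v \<omega>"
        have "2 * t v \<le> rel_norm n v \<omega>" using a m(2) n by simp
        also have "\<dots> \<le> rel_norm n u \<omega> + rel_norm n (v - u) \<omega>" using rel_norm_triangle[of n u "v - u" \<omega>] by simp
        also have "rel_norm n (v - u) \<omega> \<le> t v" using rel_norm_le[OF w, of n "v - u"] v(2) by (simp add: dist_norm)
        finally show False using m(1) r by simp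
      qed
    qed measurable
    also have "\<dots> \<le> q" by (rule tn(2)[OF v1])
    finally show "S.prob {\<omega>\<in>space S. \<not> (\<forall>n\<ge>Max (insert 0 (n1 ` C)). Min (insert 1 (t ` C)) \<le> rel_norm n u \<omega>)} \<le> q" .
  qed
qed

lemma pdist_measurable [measurable (raw)]:
  fixes f g :: "'a \<Rightarrow> real ^ 'n"
  assumes [measurable]: "f \<in> borel_measurable M" "g \<in> borel_measurable M"
  shows "(\<lambda>x. pdist (f x) (g x)) \<in> borel_measurable M"
proof -
  have "continuous_on UNIV (\<lambda>p :: (real ^ 'n) \<times> (real ^ 'n). wedge (fst p) (snd p))"
    unfolding wedge_def
    by (intro continuous_on_vec_lambda continuous_on_diff continuous_on_mult continuous_on_component
        continuous_on_fst continuous_on_snd continuous_on_id)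
  from borel_measurable_continuous_Pair[OF assms this]
  have [measurable]: "(\<lambda>x. wedge (f x) (g x)) \<in> borel_measurable M" .
  show ?thesis unfolding pdist_def by measurable
qed

text \<open>Eventually \<open>rel_norm\<close> is at least \<open>t\<close> in both directions and \<open>rratio\<close> is at most \<open>t\<^sup>2 / 4\<close>, up to events of
  small probability; then \<open>pdist_image_le\<close> gives the factor \<open>1 / 4\<close>.\<close>
lemma pdist_contracts:
  obtains n0 where "\<And>u v. u \<noteq> 0 \<Longrightarrow> v \<noteq> 0 \<Longrightarrow>
    1 / 2 \<le> S.prob {\<omega>\<in>space S. \<forall>n\<ge>n0. pdist (lprod n \<omega> *v u) (lprod n \<omega> *v v) \<le> pdist u v / 4}"
proof -
  obtain t n1 where t: "0 < t" "\<And>u. norm u = 1 \<Longrightarrow> S.prob {\<omega>\<in>space S. \<not> (\<forall>n\<ge>n1. t \<le> rel_norm n u \<omega>)} \<le> 1 / 8"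
    by (rule rel_norm_bounded_below[of "1 / 8"], simp, rule that)
  obtain \<epsilon> where e: "0 < \<epsilon>" "\<epsilon> \<le> 1" and tail: "\<And>\<kappa> q. 0 < \<kappa> \<Longrightarrow> 0 < q \<Longrightarrow> \<exists>n0. S.prob (space S - jump_tail_le \<epsilon> n0 \<kappa>) \<le> q"
    by (rule jump_tail_AE, rule that)
  define \<kappa> where "\<kappa> = (t\<^sup>2 / 4) powr \<epsilon>"
  have kap: "\<kappa> > 0" using t by (simp add: \<kappa>_def)
  obtain n2 where n2: "S.prob (space S - jump_tail_le \<epsilon> n2 \<kappa>) \<le> 1 / 8"
    using tail[OF kap, of "1 / 8"] by auto
  define n0 where "n0 = max n1 n2"
  show ?thesis
  proof (rule that)
    fix u v :: "real ^ 'n" assume uv: "u \<noteq> 0" "v \<noteq> 0"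
    define u' v' where "u' = (1 / norm u) *\<^sub>R u" and "v' = (1 / norm v) *\<^sub>R v"
    have n1': "norm u' = 1" "norm v' = 1" using uv by (simp_all add: u'_def v'_def)
    let ?A = "space S - jump_tail_le \<epsilon> n2 \<kappa>"
    let ?B = "\<lambda>u. {\<omega>\<in>space S. \<not> (\<forall>n\<ge>n1. t \<le> rel_norm n u \<omega>)}"
    let ?G = "{\<omega>\<in>space S. \<forall>n\<ge>n0. pdist (lprod n \<omega> *v u) (lprod n \<omega> *v v) \<le> pdist u v / 4}"
    have ms: "?A \<in> sets S" "?B u' \<in> sets S" "?B v' \<in> sets S" "?G \<in> sets S" by measurable
    have "space S - ?G \<subseteq> ?A \<union> (?B u' \<union> ?B v')"
    proof (rule subsetI, rule ccontr)
      fix \<omega> assume w: "\<omega> \<in> space S - ?G" and n: "\<omega> \<notin> ?A \<union> (?B u' \<union> ?B v')"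
      then have ws: "\<omega> \<in> space S" by simp
      have a: "(\<Sum>k. ennreal (jump \<epsilon> (k + n2) \<omega>)) \<le> ennreal \<kappa>" "\<forall>n\<ge>n1. t \<le> rel_norm n u' \<omega>" "\<forall>n\<ge>n1. t \<le> rel_norm n v' \<omega>"
        using n ws by (auto simp: jump_tail_le_def)
      have "pdist (lprod n \<omega> *v u) (lprod n \<omega> *v v) \<le> pdist u v / 4" if nn: "n \<ge> n0" for n
      proof -
        let ?p = "pdist (lprod n \<omega> *v u) (lprod n \<omega> *v v)"
        have "rratio (lprod n \<omega>) powr \<epsilon> \<le> jump \<epsilon> n \<omega>" by (rule rratio_le_jump[OF ws e(1)])
        also have "\<dots> \<le> \<kappa>" using nn kap by (intro jump_le_tail(2)[OF a(1)]) (auto simp: n0_def)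
        finally have r: "rratio (lprod n \<omega>) \<le> t\<^sup>2 / 4"
          using powr_less_mono2[OF e(1), of "t\<^sup>2 / 4" "rratio (lprod n \<omega>)"] unfolding \<kappa>_def
          by (metis not_le zero_le_divide_iff zero_le_numeral zero_le_power2)
        have l: "t \<le> rel_norm n u' \<omega>" "t \<le> rel_norm n v' \<omega>" using a nn by (auto simp: n0_def)
        have "?p * (t * t) \<le> ?p * (rel_norm n u' \<omega> * rel_norm n v' \<omega>)"
          using l t(1) by (intro mult_left_mono mult_mono) auto
        also have "\<dots> \<le> rratio (lprod n \<omega>) * pdist u v"
          using pdist_image_le[OF lprod_GL[OF ws] uv, of n] uv
          by (simp add: rel_norm_def u'_def v'_def matrix_vector_mult_scaleR field_simps)
        also have "\<dots> \<le> t\<^sup>2 / 4 * pdist u v" by (intro mult_right_mono r) simp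
        finally have "(t * t) * ?p \<le> (t * t) * (pdist u v / 4)" by (simp add: power2_eq_square mult_ac)
        then show ?thesis using t(1) by (subst (asm) mult_le_cancel_left_pos) auto
      qed
      then show False using w ws by simp
    qed
    then have "S.prob (space S - ?G) \<le> S.prob (?A \<union> (?B u' \<union> ?B v'))"
      using ms by (intro S.finite_measure_mono) auto
    also have "\<dots> \<le> S.prob ?A + S.prob (?B u' \<union> ?B v')" using ms by (intro measure_Un_le) auto
    also have "\<dots> \<le> S.prob ?A + (S.prob (?B u') + S.prob (?B v'))"
      using ms by (intro add_left_mono measure_Un_le) auto
    also have "\<dots> \<le> 1 / 8 + (1 / 8 + 1 / 8)" by (intro add_mono n2 t(2) n1')
    finally have "S.prob (space S - ?G) \<le> 1 / 2" by simp
    moreover have "S.prob (space S - ?G) = 1 - S.prob ?G" using ms by (intro S.prob_compl)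
    ultimately show "1 / 2 \<le> S.prob ?G" by simp
  qed
qed

text \<open>After a visit to a dyadic scale there is a chance \<open>1 / 2\<close> that the distance is quartered for ever after the
  time \<open>n0\<close>, so that the scale is not visited again; thus \<open>expected_visits_le\<close> applies to every scale.\<close>
lemma sum_pdist_powr:
  assumes e: "0 < \<epsilon>"
  obtains C :: real where "0 \<le> C" "\<And>u v T. u \<noteq> 0 \<Longrightarrow> v \<noteq> 0 \<Longrightarrow>
    (\<Sum>n<T. \<integral>\<^sup>+\<omega>. ennreal (pdist (lprod n \<omega> *v u) (lprod n \<omega> *v v) powr \<epsilon>) \<partial>S) \<le> ennreal C"
proof -
  obtain n0 where n0: "\<And>u v. u \<noteq> 0 \<Longrightarrow> v \<noteq> 0 \<Longrightarrow>
    1 / 2 \<le> S.prob {\<omega>\<in>space S. \<forall>n\<ge>n0. pdist (lprod n \<omega> *v u) (lprod n \<omega> *v v) \<le> pdist u v / 4}"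
    by (rule pdist_contracts, rule that)
  define K where "K = real n0 / (1 / 2)"
  show ?thesis
  proof (rule that)
    show "0 \<le> (\<Sum>j. K * (2 / 2 ^ j) powr \<epsilon>)"
      by (intro suminf_nonneg summable_dyadic_powr e) (auto simp: K_def)
    fix u v :: "real ^ 'n" and T assume uv: "u \<noteq> 0" "v \<noteq> 0"
    show "(\<Sum>n<T. \<integral>\<^sup>+\<omega>. ennreal (pdist (lprod n \<omega> *v u) (lprod n \<omega> *v v) powr \<epsilon>) \<partial>S) \<le> ennreal (\<Sum>j. K * (2 / 2 ^ j) powr \<epsilon>)"
    proof (rule S.dyadic_sum_bound[OF _ _ _ e _ summable_dyadic_powr[OF _ e]])
      fix j
      let ?d = "\<lambda>n \<omega>. pdist (lprod n \<omega> *v u) (lprod n \<omega> *v v)"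
      let ?A = "\<lambda>n. {\<omega>\<in>space S. 2 / 2 ^ (j + 1) \<le> ?d n \<omega> \<and> ?d n \<omega> \<le> 2 / 2 ^ j}"
      show "(\<Sum>n<T. S.prob (?A n)) \<le> K"
        unfolding K_def
      proof (rule expected_visits_le)
        show "?A k \<in> sets S" for k by measurable
        fix k assume "k < T"
        let ?B = "- (\<Union>l\<in>{k + n0..<T}. ?A l) \<inter> space S"
        have mB: "?B \<in> sets S"
        proof -
          have "(\<Union>l\<in>{k + n0..<T}. ?A l) \<in> sets S" by (intro sets.finite_UN) (auto, measurable)
          then have "space S - (\<Union>l\<in>{k + n0..<T}. ?A l) \<in> sets S" by (rule sets.compl_sets)
          then show ?thesis by (simp add: Diff_eq Int_commute)
        qed
        have "1 / 2 * S.prob (?A k) \<le> S.prob (?A k \<inter> ?B)"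
        proof (rule prob_shift_ge[where m=k])
          show "?A k \<in> sets S" by measurable
          show "?B \<in> sets S" by (rule mB)
          fix \<omega> assume wA: "\<omega> \<in> ?A k"
          then have w: "\<omega> \<in> space S" by simp
          show "stake k \<omega> @- \<omega>' \<in> ?A k" if "\<omega>' \<in> space S" for \<omega>'
            using wA that by (simp add: lprod_shift_le shift_space)
          have [measurable]: "(\<lambda>\<omega>'. stake k \<omega> @- \<omega>') \<in> measurable S S"
            using w by (intro measurable_shift) auto
          let ?u = "lprod k \<omega> *v u" and ?v = "lprod k \<omega> *v v"
          have "?u \<noteq> 0" "?v \<noteq> 0" using uv lprod_GL[OF w] by auto
          then have "1 / 2 \<le> S.prob {\<omega>'\<in>space S. \<forall>n\<ge>n0. pdist (lprod n \<omega>' *v ?u) (lprod n \<omega>' *v ?v) \<le> pdist ?u ?v / 4}"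
            by (rule n0)
          also have "\<dots> \<le> S.prob {\<omega>'\<in>space S. stake k \<omega> @- \<omega>' \<in> ?B}"
          proof (rule S.finite_measure_mono)
            show "{\<omega>'\<in>space S. stake k \<omega> @- \<omega>' \<in> ?B} \<in> sets S"
              using mB by measurable
            show "{\<omega>'\<in>space S. \<forall>n\<ge>n0. pdist (lprod n \<omega>' *v ?u) (lprod n \<omega>' *v ?v) \<le> pdist ?u ?v / 4}
              \<subseteq> {\<omega>'\<in>space S. stake k \<omega> @- \<omega>' \<in> ?B}"
            proof safe
              fix \<omega>' assume w': "\<omega>' \<in> space S" and c: "\<forall>n\<ge>n0. pdist (lprod n \<omega>' *v ?u) (lprod n \<omega>' *v ?v) \<le> pdist ?u ?v / 4"
              show "stake k \<omega> @- \<omega>' \<in> space S" using w w' by (rule shift_space)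
              fix l assume l: "l \<in> {k + n0..<T}" and b: "2 / 2 ^ (j + 1) \<le> ?d l (stake k \<omega> @- \<omega>')"
              define i where "i = l - k"
              have li: "l = k + i" "i \<ge> n0" using l by (auto simp: i_def)
              have "?d l (stake k \<omega> @- \<omega>') = pdist (lprod i \<omega>' *v ?u) (lprod i \<omega>' *v ?v)"
                by (simp add: li lprod_shift matrix_vector_mul_assoc)
              also have "\<dots> \<le> pdist ?u ?v / 4" using c li by blast
              also have "\<dots> \<le> (2 / 2 ^ j) / 4" using wA by simp
              also have "\<dots> < 2 / 2 ^ (j + 1)" by (simp add: field_simps)
              finally show False using b by simp
            qed
          qed
          finally show "1 / 2 \<le> S.prob {\<omega>'\<in>space S. stake k \<omega> @- \<omega>' \<in> ?B}" .
        qed simp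
        also have "?A k \<inter> ?B = ?A k \<inter> - (\<Union>l\<in>{k + n0..<T}. ?A l)" by blast
        finally show "1 / 2 * S.prob (?A k) \<le> S.prob (?A k \<inter> - (\<Union>l\<in>{k + n0..<T}. ?A l))" .
      qed simp
    qed (auto simp: pdist_le)
  qed
qed

end

section \<open>The additive cocycle has bounded mean\<close>

lemma ln_le_powr: "1 \<le> x \<Longrightarrow> 0 < e \<Longrightarrow> ln x \<le> x powr e / e" for x e :: real
  using ln_le_minus_one[of "x powr e"] by (simp add: ln_powr field_simps)

locale centered_walk = moment_walk \<mu> \<eta> for \<mu> :: "'n::finite mat measure" and \<eta> +
  assumes lyap0: "(\<integral>x. \<integral>A. ln (norm (A *v x) / norm x) \<partial>\<mu> \<partial>\<eta>) = 0"
    and unifpos: "uniformly_positive \<mu>"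
begin

definition Sn :: "real ^ 'n \<Rightarrow> nat \<Rightarrow> 'n mat stream \<Rightarrow> real" where
  "Sn u n \<omega> = ln (norm (lprod n \<omega> *v u) / norm u)"

lemma Sn_measurable [measurable (raw)]:
  assumes [measurable]: "f \<in> measurable N S" "g \<in> borel_measurable N"
  shows "(\<lambda>x. Sn (g x) n (f x)) \<in> borel_measurable N"
  unfolding Sn_def by measurable

lemma lprod_nz: "\<omega> \<in> space S \<Longrightarrow> u \<noteq> 0 \<Longrightarrow> lprod n \<omega> *v u \<noteq> 0"
  using lprod_GL[of \<omega> n] by simp

lemma Sn_0 [simp]: "u \<noteq> 0 \<Longrightarrow> Sn u 0 \<omega> = 0" by (simp add: Sn_def)

lemma Sn_scale: "c \<noteq> 0 \<Longrightarrow> Sn (c *\<^sub>R u) n \<omega> = Sn u n \<omega>"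
  by (simp add: Sn_def matrix_vector_mult_scaleR)

lemma ln_ratio_mult:
  fixes a b c :: "'a::real_normed_vector"
  assumes "a \<noteq> 0" "b \<noteq> 0" "c \<noteq> 0"
  shows "ln (norm a / norm b) + ln (norm c / norm a) = ln (norm c / norm b)"
  using assms by (simp add: ln_div)

lemma Sn_shift:
  assumes "\<omega> \<in> space S" "\<omega>' \<in> space S" "u \<noteq> 0"
  shows "Sn u (m + n) (stake m \<omega> @- \<omega>') = Sn u m \<omega> + Sn (lprod m \<omega> *v u) n \<omega>'"
  using lprod_nz[OF assms(1,3), of m] lprod_nz[OF assms(2), of "lprod m \<omega> *v u" n] assms(3)
  unfolding Sn_def by (subst ln_ratio_mult) (simp_all add: lprod_shift matrix_vector_mul_assoc)

lemma Sn_shift_le: "k \<le> m \<Longrightarrow> Sn u k (stake m \<omega> @- \<omega>') = Sn u k \<omega>"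
  by (simp add: Sn_def lprod_shift_le)

lemma Sn_Stream:
  assumes "A \<in> GL" "\<omega> \<in> space S" "u \<noteq> 0"
  shows "Sn u (Suc n) (A ## \<omega>) = ln (norm (A *v u) / norm u) + Sn (A *v u) n \<omega>"
proof -
  have "A *v u \<noteq> 0" using assms by simp
  then show ?thesis
    using lprod_nz[OF assms(2), of "A *v u" n] assms(3)
    unfolding Sn_def lprod_Stream by (subst ln_ratio_mult) (simp_all add: matrix_vector_mul_assoc)
qed

lemma Sn_Suc:
  assumes "\<omega> \<in> space S" "u \<noteq> 0"
  shows "Sn u (Suc n) \<omega> = Sn u n \<omega> + ln (norm ((\<omega> !! n) *v (lprod n \<omega> *v u)) / norm (lprod n \<omega> *v u))"
proof -
  have "(\<omega> !! n) *v (lprod n \<omega> *v u) \<noteq> 0" using lprod_nz[OF assms] snth_GL[OF assms(1)] by simp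
  then show ?thesis
    using lprod_nz[OF assms, of n] assms(2)
    unfolding Sn_def lprod.simps by (subst ln_ratio_mult) (simp_all add: matrix_vector_mul_assoc)
qed

lemma lnN_nonneg: "A \<in> GL \<Longrightarrow> 0 \<le> ln (matN A)" for A :: "'n mat"
  using matN_ge_1[of A] by simp

lemma Sn_abs_le:
  assumes "\<omega> \<in> space S" "u \<noteq> 0"
  shows "\<bar>Sn u n \<omega>\<bar> \<le> (\<Sum>k<n. ln (matN (\<omega> !! k)))"
proof (induction n)
  case (Suc n)
  have "\<bar>ln (norm ((\<omega> !! n) *v (lprod n \<omega> *v u)) / norm (lprod n \<omega> *v u))\<bar> \<le> ln (matN (\<omega> !! n))"
    by (rule norm_ratio_bounds(3)[OF snth_GL[OF assms(1)] lprod_nz[OF assms]])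
  then show ?case using Suc unfolding Sn_Suc[OF assms] by simp
qed (use assms in simp)

text \<open>An exponent for which the moment is finite; with \<open>moment_exp \<le> 1\<close> the powers of distances that occur
  below have exponents at most \<open>1\<close>.\<close>
definition moment_exp :: real where
  "moment_exp = (SOME \<delta>. 0 < \<delta> \<and> \<delta> \<le> 1 \<and> integrable \<mu> (\<lambda>A. matN A powr \<delta>))"

lemma moment_exp: "0 < moment_exp" "moment_exp \<le> 1" and integrable_moment_exp: "integrable \<mu> (\<lambda>A. matN A powr moment_exp)"
proof -
  obtain \<delta> C :: real where d: "0 < \<delta>" "\<delta> \<le> 1" "0 \<le> C" "\<And>\<epsilon>. 0 \<le> \<epsilon> \<Longrightarrow> \<epsilon> \<le> \<delta> \<Longrightarrow> (\<integral>\<^sup>+A. ennreal (matN A powr \<epsilon>) \<partial>\<mu>) \<le> ennreal C"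
    by (rule moment, rule that)
  have "integrable \<mu> (\<lambda>A. matN A powr \<delta>)"
  proof (rule integrableI_bounded)
    have "(\<integral>\<^sup>+A. ennreal (norm (matN A powr \<delta>)) \<partial>\<mu>) \<le> ennreal C" using d(4)[of \<delta>] d(1) by simp
    also have "\<dots> < \<infinity>" by simp
    finally show "(\<integral>\<^sup>+A. ennreal (norm (matN A powr \<delta>)) \<partial>\<mu>) < \<infinity>" .
  qed measurable
  then have "\<exists>\<delta>. 0 < \<delta> \<and> \<delta> \<le> 1 \<and> integrable \<mu> (\<lambda>A. matN A powr \<delta>)" using d by blast
  from someI_ex[OF this] show "0 < moment_exp" "moment_exp \<le> 1" "integrable \<mu> (\<lambda>A. matN A powr moment_exp)"
    unfolding moment_exp_def by blast+
qed

lemma integrable_lnN: "integrable \<mu> (\<lambda>A. ln (matN A))"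
  by (rule Bochner_Integration.integrable_bound[of _ "\<lambda>A. matN A powr moment_exp / moment_exp"])
    (auto simp: space_mu matN_ge_1 moment_exp lnN_nonneg less_imp_le[OF moment_exp(1)] intro!: AE_I2 ln_le_powr integrable_divide integrable_moment_exp)

lemma integrable_snth:
  fixes f :: "'n mat \<Rightarrow> real"
  assumes f: "integrable \<mu> f"
  shows "integrable S (\<lambda>\<omega>. f (\<omega> !! n))" "(\<integral>\<omega>. f (\<omega> !! n) \<partial>S) = (\<integral>A. f A \<partial>\<mu>)"
proof -
  have [measurable]: "f \<in> borel_measurable \<mu>" using f by auto
  have d: "distr S \<mu> (\<lambda>\<omega>. \<omega> !! n) = \<mu>"
  proof (rule measure_eqI)
    fix X assume "X \<in> sets (distr S \<mu> (\<lambda>\<omega>. \<omega> !! n))"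
    then have [measurable]: "X \<in> sets \<mu>" by simp
    have "emeasure (distr S \<mu> (\<lambda>\<omega>. \<omega> !! n)) X = (\<integral>\<^sup>+A. indicator X A \<partial>distr S \<mu> (\<lambda>\<omega>. \<omega> !! n))" by simp
    also have "\<dots> = (\<integral>\<^sup>+\<omega>. indicator X (\<omega> !! n) \<partial>S)" by (subst nn_integral_distr) auto
    also have "\<dots> = emeasure \<mu> X" by (subst nn_integral_snth) auto
    finally show "emeasure (distr S \<mu> (\<lambda>\<omega>. \<omega> !! n)) X = emeasure \<mu> X" .
  qed simp
  show "integrable S (\<lambda>\<omega>. f (\<omega> !! n))" using f by (subst (asm) d[symmetric]) (simp add: integrable_distr_eq)
  show "(\<integral>\<omega>. f (\<omega> !! n) \<partial>S) = (\<integral>A. f A \<partial>\<mu>)"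
    by (subst (2) d[symmetric]) (simp add: integral_distr)
qed

lemma integrable_Sn: "u \<noteq> 0 \<Longrightarrow> integrable S (Sn u n)"
  by (rule Bochner_Integration.integrable_bound[of _ "\<lambda>\<omega>. \<Sum>k<n. ln (matN (\<omega> !! k))"])
    (auto intro!: AE_I2 Bochner_Integration.integrable_sum integrable_snth integrable_lnN order_trans[OF Sn_abs_le])

text \<open>Interpolation between the Lipschitz bound, whose constant \<open>N\<^sup>2\<close> has no finite mean in general, and the
  trivial bound \<open>2 ln N\<close>, where \<open>N = matN A\<close>.\<close>
lemma log_norm_ratio_diff_le:
  fixes A :: "'n mat"
  assumes A: "A \<in> GL" and xy: "x \<noteq> 0" "y \<noteq> 0" and e: "0 < e" "e \<le> 1"
  shows "\<bar>ln (norm (A *v x) / norm x) - ln (norm (A *v y) / norm y)\<bar> \<le> (2 / e + 1) * (matN A powr (3 * e) * pdist x y powr e)"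
proof -
  let ?D = "\<bar>ln (norm (A *v x) / norm x) - ln (norm (A *v y) / norm y)\<bar>" and ?N = "matN A" and ?p = "pdist x y"
  have N: "1 \<le> ?N" by (rule matN_ge_1[OF A])
  have D1: "?D \<le> ?N\<^sup>2 * ?p" by (rule ln_norm_ratio_diff_le[OF A xy])
  have D2: "?D \<le> 2 * ln ?N" using norm_ratio_bounds(3)[OF A xy(1)] norm_ratio_bounds(3)[OF A xy(2)] by linarith
  show ?thesis
  proof (cases "?p = 0")
    case True
    then show ?thesis using D1 by simp
  next
    case False
    then have p: "0 < ?p" using pdist_nonneg[of x y] by linarith
    have sq: "(?N\<^sup>2 * ?p) powr e = ?N powr (2 * e) * ?p powr e"
      using N p by (simp add: powr_mult powr_powr flip: powr_numeral)
    have N3: "?N powr (3 * e) = ?N powr e * ?N powr (2 * e)" by (simp flip: powr_add)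
    have Ne: "1 \<le> ?N powr e" using N e by (intro ge_one_powr_ge_zero) auto
    let ?R = "?N powr (3 * e) * ?p powr e"
    have R0: "0 \<le> ?R" by simp
    have "?D \<le> 1 * ?R \<or> ?D \<le> (2 / e) * ?R"
    proof (cases "?N\<^sup>2 * ?p \<le> 1")
      case True
      have "?D \<le> (?N\<^sup>2 * ?p) powr 1" using D1 N p by simp
      also have "\<dots> \<le> (?N\<^sup>2 * ?p) powr e" using True e N p by (intro powr_mono') auto
      also have "\<dots> \<le> ?N powr e * ((?N\<^sup>2 * ?p) powr e)" using Ne by (simp add: mult_le_cancel_right1)
      also have "\<dots> = ?R" unfolding sq N3 by simp
      finally show ?thesis by simp
    next
      case False
      then have "1 \<le> (?N\<^sup>2 * ?p) powr e" using e by (intro ge_one_powr_ge_zero) auto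
      have "?D \<le> 2 * (?N powr e / e)" using D2 ln_le_powr[OF N e(1)] by linarith
      also have "\<dots> = (2 / e) * (?N powr e * 1)" by simp
      also have "\<dots> \<le> (2 / e) * (?N powr e * ((?N\<^sup>2 * ?p) powr e))"
        using \<open>1 \<le> (?N\<^sup>2 * ?p) powr e\<close> e by (intro mult_left_mono) auto
      also have "\<dots> = (2 / e) * ?R" unfolding sq N3 by simp
      finally show ?thesis by simp
    qed
    moreover have "1 * ?R \<le> (2 / e + 1) * ?R" "(2 / e) * ?R \<le> (2 / e + 1) * ?R"
      using R0 e by (intro mult_right_mono; simp)+
    ultimately show ?thesis by linarith
  qed
qed

definition mean :: "nat \<Rightarrow> real ^ 'n \<Rightarrow> real" where
  "mean n u = (\<integral>\<omega>. Sn u n \<omega> \<partial>S)"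

lemma mean_measurable [measurable]: "mean n \<in> borel_measurable borel"
  unfolding mean_def[abs_def] by measurable

lemma mean_scale: "c \<noteq> 0 \<Longrightarrow> mean n (c *\<^sub>R u) = mean n u"
  by (simp add: mean_def Sn_scale)

lemma mean_0 [simp]: "u \<noteq> 0 \<Longrightarrow> mean 0 u = 0" by (simp add: mean_def)

text \<open>The increments of the walks from two lines differ by at most a power of the distance of the image lines,
  times a factor that is independent of it and has finite mean; the sum over time is bounded by \<open>sum_pdist_powr\<close>.\<close>
lemma mean_osc:
  obtains C where "0 \<le> C" "\<And>n u v. u \<noteq> 0 \<Longrightarrow> v \<noteq> 0 \<Longrightarrow> \<bar>mean n u - mean n v\<bar> \<le> C"
proof -
  define e where "e = moment_exp / 3"
  have e: "0 < e" "e \<le> 1" "3 * e = moment_exp" using moment_exp by (auto simp: e_def)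
  obtain C where C: "0 \<le> C" "\<And>u v T. u \<noteq> 0 \<Longrightarrow> v \<noteq> 0 \<Longrightarrow>
    (\<Sum>n<T. \<integral>\<^sup>+\<omega>. ennreal (pdist (lprod n \<omega> *v u) (lprod n \<omega> *v v) powr e) \<partial>S) \<le> ennreal C"
    by (rule sum_pdist_powr[OF e(1)], rule that)
  define M where "M = (\<integral>A. matN A powr moment_exp \<partial>\<mu>)"
  have M0: "0 \<le> M" unfolding M_def by (rule integral_nonneg_AE) simp
  have M: "(\<integral>\<^sup>+A. ennreal (matN A powr moment_exp) \<partial>\<mu>) = ennreal M"
    unfolding M_def by (rule nn_integral_eq_integral[OF integrable_moment_exp]) simp
  let ?k = "2 / e + 1"
  have k0: "0 \<le> ?k" using e by simp
  show ?thesis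
  proof (rule that[of "?k * M * C"])
    show "0 \<le> ?k * M * C" using k0 M0 C by simp
    fix n and u v :: "real ^ 'n" assume uv: "u \<noteq> 0" "v \<noteq> 0"
    let ?d = "\<lambda>k \<omega>. pdist (lprod k \<omega> *v u) (lprod k \<omega> *v v)"
    have pt: "\<bar>Sn u n \<omega> - Sn v n \<omega>\<bar> \<le> (\<Sum>k<n. ?k * (matN (\<omega> !! k) powr moment_exp * ?d k \<omega> powr e))" if w: "\<omega> \<in> space S" for \<omega>
    proof (induction n)
      case (Suc n)
      show ?case
        using Suc log_norm_ratio_diff_le[OF snth_GL[OF w, of n] lprod_nz[OF w uv(1), of n] lprod_nz[OF w uv(2), of n] e(1,2)]
        unfolding Sn_Suc[OF w uv(1)] Sn_Suc[OF w uv(2)] e(3) by simp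
    qed (use uv in simp)
    have iu: "integrable S (\<lambda>\<omega>. Sn u n \<omega> - Sn v n \<omega>)" using integrable_Sn uv by simp
    have "ennreal \<bar>mean n u - mean n v\<bar> = ennreal \<bar>\<integral>\<omega>. Sn u n \<omega> - Sn v n \<omega> \<partial>S\<bar>"
      unfolding mean_def using integrable_Sn uv by simp
    also have "\<dots> \<le> ennreal (\<integral>\<omega>. \<bar>Sn u n \<omega> - Sn v n \<omega>\<bar> \<partial>S)" by (intro ennreal_leI integral_abs_bound)
    also have "\<dots> = (\<integral>\<^sup>+\<omega>. ennreal \<bar>Sn u n \<omega> - Sn v n \<omega>\<bar> \<partial>S)"
      using iu by (intro nn_integral_eq_integral[symmetric] integrable_abs) auto
    also have "\<dots> \<le> (\<integral>\<^sup>+\<omega>. (\<Sum>k<n. ennreal ?k * (ennreal (matN (\<omega> !! k) powr moment_exp) * ennreal (?d k \<omega> powr e))) \<partial>S)"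
    proof (rule nn_integral_mono)
      fix \<omega> assume w: "\<omega> \<in> space S"
      have "ennreal \<bar>Sn u n \<omega> - Sn v n \<omega>\<bar> \<le> ennreal (\<Sum>k<n. ?k * (matN (\<omega> !! k) powr moment_exp * ?d k \<omega> powr e))"
        by (intro ennreal_leI pt w)
      also have "\<dots> = (\<Sum>k<n. ennreal (?k * (matN (\<omega> !! k) powr moment_exp * ?d k \<omega> powr e)))"
        using k0 by (intro sum_ennreal[symmetric] mult_nonneg_nonneg) auto
      also have "\<dots> = (\<Sum>k<n. ennreal ?k * (ennreal (matN (\<omega> !! k) powr moment_exp) * ennreal (?d k \<omega> powr e)))"
        using k0 by (intro sum.cong refl) (simp only: ennreal_mult powr_ge_zero mult_nonneg_nonneg)
      finally show "ennreal \<bar>Sn u n \<omega> - Sn v n \<omega>\<bar> \<le> (\<Sum>k<n. ennreal ?k * (ennreal (matN (\<omega> !! k) powr moment_exp) * ennreal (?d k \<omega> powr e)))" .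
    qed
    also have "\<dots> = (\<Sum>k<n. \<integral>\<^sup>+\<omega>. ennreal ?k * (ennreal (matN (\<omega> !! k) powr moment_exp) * ennreal (?d k \<omega> powr e)) \<partial>S)"
      by (rule nn_integral_sum) measurable
    also have "\<dots> = (\<Sum>k<n. ennreal ?k * (ennreal M * (\<integral>\<^sup>+\<omega>. ennreal (?d k \<omega> powr e) \<partial>S)))"
    proof (rule sum.cong[OF refl])
      fix k
      have "(\<integral>\<^sup>+\<omega>. ennreal ?k * (ennreal (matN (\<omega> !! k) powr moment_exp) * ennreal (?d k \<omega> powr e)) \<partial>S)
        = ennreal ?k * (\<integral>\<^sup>+\<omega>. ennreal (matN (\<omega> !! k) powr moment_exp) * ennreal (?d k \<omega> powr e) \<partial>S)"
        by (rule nn_integral_cmult) measurable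
      also have "(\<integral>\<^sup>+\<omega>. ennreal (matN (\<omega> !! k) powr moment_exp) * ennreal (?d k \<omega> powr e) \<partial>S) = ennreal M * (\<integral>\<^sup>+\<omega>. ennreal (?d k \<omega> powr e) \<partial>S)"
        unfolding M[symmetric] by (rule nn_integral_indep) (measurable, simp add: lprod_shift_le)
      finally show "(\<integral>\<^sup>+\<omega>. ennreal ?k * (ennreal (matN (\<omega> !! k) powr moment_exp) * ennreal (?d k \<omega> powr e)) \<partial>S)
        = ennreal ?k * (ennreal M * (\<integral>\<^sup>+\<omega>. ennreal (?d k \<omega> powr e) \<partial>S))" .
    qed
    also have "\<dots> = ennreal ?k * (ennreal M * (\<Sum>k<n. \<integral>\<^sup>+\<omega>. ennreal (?d k \<omega> powr e) \<partial>S))"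
      by (simp only: sum_distrib_left)
    also have "\<dots> \<le> ennreal ?k * (ennreal M * ennreal C)" by (intro mult_left_mono C uv) auto
    also have "\<dots> = ennreal (?k * M * C)" using k0 M0 C by (simp add: ennreal_mult mult.assoc)
    finally show "\<bar>mean n u - mean n v\<bar> \<le> ?k * M * C" using k0 M0 C by (subst (asm) ennreal_le_iff) auto
  qed
qed

lemma mean_Suc:
  assumes u: "u \<noteq> 0"
  shows "mean (Suc n) u = (\<integral>A. ln (norm (A *v u) / norm u) + mean n (A *v u) \<partial>\<mu>)"
proof -
  have "mean (Suc n) u = (\<integral>A. \<integral>\<omega>. Sn u (Suc n) (A ## \<omega>) \<partial>S \<partial>\<mu>)"
    unfolding mean_def by (rule integral_Stream(1)[OF integrable_Sn[OF u]])
  also have "\<dots> = (\<integral>A. ln (norm (A *v u) / norm u) + mean n (A *v u) \<partial>\<mu>)"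
  proof (rule Bochner_Integration.integral_cong[OF refl])
    fix A assume "A \<in> space \<mu>"
    then have A: "A \<in> GL" by (simp add: space_mu)
    have "(\<integral>\<omega>. Sn u (Suc n) (A ## \<omega>) \<partial>S) = (\<integral>\<omega>. ln (norm (A *v u) / norm u) + Sn (A *v u) n \<omega> \<partial>S)"
      by (intro Bochner_Integration.integral_cong refl) (simp add: Sn_Stream[OF A _ u])
    also have "\<dots> = ln (norm (A *v u) / norm u) + mean n (A *v u)"
      using integrable_Sn[of "A *v u" n] A u by (simp add: mean_def S.prob_space)
    finally show "(\<integral>\<omega>. Sn u (Suc n) (A ## \<omega>) \<partial>S) = ln (norm (A *v u) / norm u) + mean n (A *v u)" .
  qed
  finally show ?thesis .
qed

lemma mean_crude: "u \<noteq> 0 \<Longrightarrow> \<bar>mean n u\<bar> \<le> n * (\<integral>A. ln (matN A) \<partial>\<mu>)"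
proof -
  assume u: "u \<noteq> 0"
  have i: "integrable S (\<lambda>\<omega>. \<Sum>k<n. ln (matN (\<omega> !! k)))"
    by (intro Bochner_Integration.integrable_sum integrable_snth integrable_lnN)
  have "\<bar>mean n u\<bar> \<le> (\<integral>\<omega>. \<bar>Sn u n \<omega>\<bar> \<partial>S)" unfolding mean_def by (rule integral_abs_bound)
  also have "\<dots> \<le> (\<integral>\<omega>. (\<Sum>k<n. ln (matN (\<omega> !! k))) \<partial>S)"
    by (intro integral_mono integrable_abs integrable_Sn u i Sn_abs_le) auto
  also have "\<dots> = n * (\<integral>A. ln (matN A) \<partial>\<mu>)"
    by (subst Bochner_Integration.integral_sum) (auto simp: integrable_snth[OF integrable_lnN] simp del: snth.simps)
  finally show ?thesis .
qed

lemma integrable_log_ratio: "u \<noteq> 0 \<Longrightarrow> integrable \<mu> (\<lambda>A. ln (norm (A *v u) / norm u))"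
  by (rule Bochner_Integration.integrable_bound[OF integrable_lnN])
    (auto intro!: AE_I2 order_trans[OF norm_ratio_bounds(3)] simp: space_mu)

text \<open>By stationarity the mean is \<open>n\<close> times the Lyapunov exponent.\<close>
lemma mean_stationary: "(\<integral>x. mean n x \<partial>\<eta>) = 0"
proof (induction n)
  case 0
  have "(\<integral>x. mean 0 x \<partial>\<eta>) = (\<integral>x. 0 \<partial>\<eta>)"
    by (rule integral_cong_AE) (use eta_nz in \<open>auto elim: eventually_mono\<close>)
  then show ?case by simp
next
  case (Suc n)
  define c where "c = n * (\<integral>A. ln (matN A) \<partial>\<mu>)"
  \<comment> \<open>\<open>eta_stationary\<close> asks for a function that is bounded everywhere, while \<open>mean n 0\<close> is not controlled.\<close>
  define f where "f x = (if x = 0 then 0 else mean n x)" for x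
  have [measurable]: "f \<in> borel_measurable borel" unfolding f_def by measurable
  have "0 \<le> (\<integral>A. ln (matN A) \<partial>\<mu>)"
    by (rule integral_nonneg_AE) (auto simp: space_mu lnN_nonneg intro!: AE_I2)
  then have c0: "0 \<le> c" unfolding c_def by (rule mult_nonneg_nonneg[OF of_nat_0_le_iff])
  have fb: "\<bar>f x\<bar> \<le> c" for x
  proof (cases "x = 0")
    case True
    then have "\<bar>f x\<bar> = 0" by (simp add: f_def)
    then show ?thesis using c0 by linarith
  next
    case False
    then show ?thesis using mean_crude[of x n] by (simp add: f_def c_def)
  qed
  have fs: "f (a *\<^sub>R x) = f x" if "a \<noteq> 0" for a x using that by (simp add: f_def mean_scale)
  have i1: "integrable \<eta> (\<lambda>x. \<integral>A. ln (norm (A *v x) / norm x) \<partial>\<mu>)"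
  proof (rule Bochner_Integration.integrable_bound[of _ "\<lambda>_. \<integral>A. ln (matN A) \<partial>\<mu>"])
    show "AE x in \<eta>. norm (\<integral>A. ln (norm (A *v x) / norm x) \<partial>\<mu>) \<le> norm (\<integral>A. ln (matN A) \<partial>\<mu>)"
      using eta_nz
    proof eventually_elim
      case (elim x)
      have "\<bar>\<integral>A. ln (norm (A *v x) / norm x) \<partial>\<mu>\<bar> \<le> (\<integral>A. \<bar>ln (norm (A *v x) / norm x)\<bar> \<partial>\<mu>)" by (rule integral_abs_bound)
      also have "\<dots> \<le> (\<integral>A. ln (matN A) \<partial>\<mu>)"
        using norm_ratio_bounds(3)[OF _ elim] by (intro integral_mono integrable_abs integrable_log_ratio elim integrable_lnN) (auto simp: space_mu)
      finally show ?case by simp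
    qed
  qed auto
  have i2: "integrable \<eta> (\<lambda>x. \<integral>A. f (A *v x) \<partial>\<mu>)"
  proof (rule eta.integrable_const_bound[where B="c"])
    have "norm (\<integral>A. f (A *v x) \<partial>\<mu>) \<le> c" for x
    proof -
      have "norm (\<integral>A. f (A *v x) \<partial>\<mu>) \<le> (\<integral>A. \<bar>f (A *v x)\<bar> \<partial>\<mu>)" using integral_abs_bound by simp
      also have "\<dots> \<le> (\<integral>A. c \<partial>\<mu>)"
        by (intro integral_mono integrable_abs integrable_const_bound[where B="c"]) (auto simp: fb c0)
      finally show ?thesis by (simp add: prob_space)
    qed
    then show "AE x in \<eta>. norm (\<integral>A. f (A *v x) \<partial>\<mu>) \<le> c" by simp
  qed measurable
  have "(\<integral>x. mean (Suc n) x \<partial>\<eta>) = (\<integral>x. (\<integral>A. ln (norm (A *v x) / norm x) \<partial>\<mu>) + (\<integral>A. f (A *v x) \<partial>\<mu>) \<partial>\<eta>)"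
  proof (rule integral_cong_AE)
    show "AE x in \<eta>. mean (Suc n) x = (\<integral>A. ln (norm (A *v x) / norm x) \<partial>\<mu>) + (\<integral>A. f (A *v x) \<partial>\<mu>)"
      using eta_nz
    proof eventually_elim
      case (elim x)
      have "mean (Suc n) x = (\<integral>A. ln (norm (A *v x) / norm x) + f (A *v x) \<partial>\<mu>)"
        unfolding mean_Suc[OF elim] using elim
        by (intro Bochner_Integration.integral_cong refl) (simp add: f_def space_mu)
      also have "\<dots> = (\<integral>A. ln (norm (A *v x) / norm x) \<partial>\<mu>) + (\<integral>A. f (A *v x) \<partial>\<mu>)"
        by (intro Bochner_Integration.integral_add integrable_log_ratio elim integrable_const_bound[where B="c"]) (auto simp: fb c0)
      finally show ?case .
    qed
  qed measurable
  also have "\<dots> = (\<integral>x. \<integral>A. ln (norm (A *v x) / norm x) \<partial>\<mu> \<partial>\<eta>) + (\<integral>x. \<integral>A. f (A *v x) \<partial>\<mu> \<partial>\<eta>)"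
    by (rule Bochner_Integration.integral_add[OF i1 i2])
  also have "(\<integral>x. \<integral>A. f (A *v x) \<partial>\<mu> \<partial>\<eta>) = (\<integral>A. \<integral>x. f (A *v x) \<partial>\<eta> \<partial>\<mu>)"
    by (rule mueta.Fubini_integral)
      (auto intro!: mueta.P.integrable_const_bound[where B="c"] simp: fb c0 split: prod.split)
  also have "\<dots> = (\<integral>x. f x \<partial>\<eta>)"
    by (rule eta_stationary[symmetric, where B="c"]) (auto simp: fb fs)
  also have "\<dots> = (\<integral>x. mean n x \<partial>\<eta>)"
  proof (rule integral_cong_AE)
    show "AE x in \<eta>. f x = mean n x" using eta_nz by eventually_elim (simp add: f_def)
  qed measurable
  finally show ?case using Suc lyap0 by simp
qed

text \<open>Neither stationarity nor the vanishing exponent say anything about a fixed starting line;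
  the bound on the oscillation transfers them.\<close>
lemma mean_bounded:
  obtains C where "0 < C" "\<And>n u. u \<noteq> 0 \<Longrightarrow> \<bar>mean n u\<bar> \<le> C"
proof -
  obtain C where C: "0 \<le> C" "\<And>n u v. u \<noteq> 0 \<Longrightarrow> v \<noteq> 0 \<Longrightarrow> \<bar>mean n u - mean n v\<bar> \<le> C"
    by (rule mean_osc, rule that)
  show ?thesis
  proof (rule that[of "C + 1"])
    show "0 < C + 1" using C by simp
    fix n :: nat and u :: "real ^ 'n" assume u: "u \<noteq> 0"
    let ?c = "n * (\<integral>A. ln (matN A) \<partial>\<mu>)"
    have mi: "integrable \<eta> (mean n)"
      by (rule eta.integrable_const_bound[where B="?c"]) (use eta_nz mean_crude in \<open>auto elim!: eventually_mono\<close>)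
    have "mean n u = (\<integral>x. mean n u - mean n x \<partial>\<eta>)"
      using mi by (simp add: mean_stationary)
    also have "\<bar>\<dots>\<bar> \<le> (\<integral>x. \<bar>mean n u - mean n x\<bar> \<partial>\<eta>)" by (rule integral_abs_bound)
    also have "\<dots> \<le> (\<integral>x. C \<partial>\<eta>)"
      using mi by (intro integral_mono_AE integrable_abs) (use eta_nz C(2)[OF u] in \<open>auto elim!: eventually_mono\<close>)
    finally show "\<bar>mean n u\<bar> \<le> C + 1" by simp
  qed
qed

definition mean_bound :: real where
  "mean_bound = (SOME C. 0 < C \<and> (\<forall>n u. u \<noteq> 0 \<longrightarrow> \<bar>mean n u\<bar> \<le> C))"

lemma mean_bound: "0 < mean_bound" "u \<noteq> 0 \<Longrightarrow> \<bar>mean n u\<bar> \<le> mean_bound"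
proof -
  have "\<exists>C. 0 < C \<and> (\<forall>n u. u \<noteq> 0 \<longrightarrow> \<bar>mean n u\<bar> \<le> C)" using mean_bounded by metis
  from someI_ex[OF this] show "0 < mean_bound" "u \<noteq> 0 \<Longrightarrow> \<bar>mean n u\<bar> \<le> mean_bound" unfolding mean_bound_def by blast+
qed

end

section \<open>Fluctuations of the walk\<close>

lemma exp_le_quadratic: "exp x \<le> 1 + x + x\<^sup>2 * exp \<bar>x\<bar>" for x :: real
proof -
  obtain t where t: "\<bar>t\<bar> \<le> \<bar>x\<bar>" "exp x = (\<Sum>m<2. x ^ m / fact m) + exp t / fact 2 * x ^ 2"
    using Maclaurin_exp_le[of x 2] by blast
  have "exp t / 2 * x\<^sup>2 \<le> exp \<bar>x\<bar> * x\<^sup>2"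
  proof (rule mult_right_mono)
    have "exp t \<le> exp \<bar>x\<bar>" using t(1) by simp
    then show "exp t / 2 \<le> exp \<bar>x\<bar>" using exp_gt_zero[of t] by linarith
  qed simp
  then show ?thesis using t(2) by (simp add: numeral_2_eq_2 mult.commute)
qed

lemma power_le_exp: "(z / real n) ^ n \<le> exp z" if "0 \<le> z" "0 < n" for z :: real
proof -
  have "z / real n \<le> exp (z / real n)" using exp_ge_add_one_self[of "z / real n"] by linarith
  then have "(z / real n) ^ n \<le> exp (z / real n) ^ n" using that by (intro power_mono) auto
  also have "\<dots> = exp z" using that by (simp add: exp_of_nat_mult[symmetric])
  finally show ?thesis .
qed

lemma exp_abs_le: "exp \<bar>z\<bar> \<le> exp z + exp (- z)" for z :: real
  by (cases "0 \<le> z") auto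

context centered_walk
begin

text \<open>The change of the conditional mean of the walk of \<open>n + 1\<close> steps when its first step is revealed.\<close>
definition incr :: "nat \<Rightarrow> 'n mat \<Rightarrow> real ^ 'n \<Rightarrow> real" where
  "incr n A u = ln (norm (A *v u) / norm u) + mean n (A *v u) - mean (Suc n) u"

lemma incr_measurable [measurable]: "(\<lambda>A. incr n A u) \<in> borel_measurable \<mu>"
  unfolding incr_def by measurable

lemma incr_abs_le:
  assumes A: "A \<in> GL" and u: "u \<noteq> 0"
  shows "\<bar>incr n A u\<bar> \<le> ln (matN A) + 2 * mean_bound"
proof -
  have "A *v u \<noteq> 0" using A u by simp
  then show ?thesis
    using norm_ratio_bounds(3)[OF A u] mean_bound(2)[of "A *v u" n] mean_bound(2)[OF u, of "Suc n"]
    unfolding incr_def by linarith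
qed

lemma integrable_incr:
  assumes u: "u \<noteq> 0"
  shows "integrable \<mu> (\<lambda>A. incr n A u)"
proof (rule Bochner_Integration.integrable_bound)
  show "integrable \<mu> (\<lambda>A. ln (matN A) + 2 * mean_bound)"
    by (intro Bochner_Integration.integrable_add integrable_lnN integrable_const)
  show "AE A in \<mu>. norm (incr n A u) \<le> norm (ln (matN A) + 2 * mean_bound)"
    unfolding real_norm_def
    by (intro AE_I2 order_trans[OF incr_abs_le[OF _ u] abs_ge_self]) (simp add: space_mu)
qed measurable

lemma integrable_mean_step: "u \<noteq> 0 \<Longrightarrow> integrable \<mu> (\<lambda>A. ln (norm (A *v u) / norm u) + mean n (A *v u))"
  using Bochner_Integration.integrable_add[OF integrable_incr[of u n] integrable_const[of "mean (Suc n) u"]]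
  by (simp add: incr_def)

lemma integral_incr: "u \<noteq> 0 \<Longrightarrow> (\<integral>A. incr n A u \<partial>\<mu>) = 0"
  using integrable_mean_step[of u n] by (simp add: incr_def mean_Suc prob_space)

definition mgf_radius :: real where "mgf_radius = moment_exp / 2"

definition mgf_const :: real where "mgf_const = (4 / mgf_radius\<^sup>2) * exp (2 * moment_exp * mean_bound) * (\<integral>A. matN A powr moment_exp \<partial>\<mu>)"

lemma mgf_radius: "0 < mgf_radius" using moment_exp by (simp add: mgf_radius_def)

text \<open>The increment is centred and has an exponential moment, so the linear term of the expansion of its moment
  generating function at \<open>0\<close> vanishes.\<close>
lemma incr_mgf:
  assumes u: "u \<noteq> 0" and l: "\<bar>l\<bar> \<le> mgf_radius"
  shows "(\<integral>\<^sup>+A. ennreal (exp (l * incr n A u)) \<partial>\<mu>) \<le> ennreal (exp (mgf_const * l\<^sup>2))"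
proof -
  let ?K = "(4 / mgf_radius\<^sup>2) * exp (2 * moment_exp * mean_bound)"
  let ?g = "\<lambda>A. 1 + l * incr n A u + l\<^sup>2 * (?K * matN A powr moment_exp)"
  have pt: "exp (l * incr n A u) \<le> ?g A" if A: "A \<in> GL" for A
  proof -
    let ?D = "incr n A u"
    have "\<bar>l * ?D\<bar> \<le> mgf_radius * \<bar>?D\<bar>" using l by (simp add: abs_mult mult_right_mono)
    then have e1: "exp \<bar>l * ?D\<bar> \<le> exp (mgf_radius * \<bar>?D\<bar>)" by simp
    have "(mgf_radius * \<bar>?D\<bar> / 2)\<^sup>2 \<le> exp (mgf_radius * \<bar>?D\<bar>)"
      using power_le_exp[of "mgf_radius * \<bar>?D\<bar>" 2] mgf_radius by simp
    then have "?D\<^sup>2 \<le> (4 / mgf_radius\<^sup>2) * exp (mgf_radius * \<bar>?D\<bar>)"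
      using mgf_radius by (simp add: power_mult_distrib power_divide field_simps)
    then have "?D\<^sup>2 * exp \<bar>l * ?D\<bar> \<le> ((4 / mgf_radius\<^sup>2) * exp (mgf_radius * \<bar>?D\<bar>)) * exp (mgf_radius * \<bar>?D\<bar>)"
      using e1 by (intro mult_mono) auto
    also have "\<dots> = (4 / mgf_radius\<^sup>2) * exp (moment_exp * \<bar>?D\<bar>)"
      by (simp add: mgf_radius_def flip: exp_add)
    also have "\<dots> \<le> (4 / mgf_radius\<^sup>2) * exp (moment_exp * (ln (matN A) + 2 * mean_bound))"
      using incr_abs_le[OF A u, of n] moment_exp by (intro mult_left_mono) auto
    also have "\<dots> = ?K * matN A powr moment_exp"
      using matN_ge_1[OF A] by (simp add: powr_def ring_distribs exp_add mult_ac)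
    finally have e2: "?D\<^sup>2 * exp \<bar>l * ?D\<bar> \<le> ?K * matN A powr moment_exp" .
    have "exp (l * ?D) \<le> 1 + l * ?D + (l * ?D)\<^sup>2 * exp \<bar>l * ?D\<bar>" by (rule exp_le_quadratic)
    also have "(l * ?D)\<^sup>2 * exp \<bar>l * ?D\<bar> = l\<^sup>2 * (?D\<^sup>2 * exp \<bar>l * ?D\<bar>)" by (simp add: power_mult_distrib)
    also have "\<dots> \<le> l\<^sup>2 * (?K * matN A powr moment_exp)" by (intro mult_left_mono e2) simp
    finally show ?thesis by simp
  qed
  have gi: "integrable \<mu> ?g"
    by (intro Bochner_Integration.integrable_add integrable_const integrable_mult_right integrable_incr u integrable_moment_exp)
  have "(\<integral>\<^sup>+A. ennreal (exp (l * incr n A u)) \<partial>\<mu>) \<le> (\<integral>\<^sup>+A. ennreal (?g A) \<partial>\<mu>)"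
    by (intro nn_integral_mono ennreal_leI pt) (simp add: space_mu)
  also have "\<dots> = ennreal (\<integral>A. ?g A \<partial>\<mu>)"
  proof (rule nn_integral_eq_integral[OF gi], rule AE_I2)
    fix A assume "A \<in> space \<mu>"
    then have "A \<in> GL" by (simp add: space_mu)
    from order_trans[OF less_imp_le[OF exp_gt_zero] pt[OF this]] show "0 \<le> ?g A" .
  qed
  also have "(\<integral>A. ?g A \<partial>\<mu>) = 1 + mgf_const * l\<^sup>2"
  proof -
    have "(\<integral>A. ?g A \<partial>\<mu>) = (\<integral>A. 1 + l * incr n A u \<partial>\<mu>) + (\<integral>A. l\<^sup>2 * (?K * matN A powr moment_exp) \<partial>\<mu>)"
      by (intro Bochner_Integration.integral_add Bochner_Integration.integrable_add integrable_const integrable_mult_right integrable_incr u integrable_moment_exp)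
    also have "(\<integral>A. 1 + l * incr n A u \<partial>\<mu>) = 1"
      using integrable_incr[OF u, of n] by (simp add: integral_incr[OF u] prob_space)
    finally show ?thesis by (simp add: mgf_const_def mult_ac)
  qed
  also have "ennreal (1 + mgf_const * l\<^sup>2) \<le> ennreal (exp (mgf_const * l\<^sup>2))"
    by (intro ennreal_leI exp_ge_add_one_self)
  finally show ?thesis .
qed

lemma Sn_mgf:
  assumes u: "u \<noteq> 0" and l: "\<bar>l\<bar> \<le> mgf_radius"
  shows "(\<integral>\<^sup>+\<omega>. ennreal (exp (l * Sn u n \<omega>)) \<partial>S) \<le> ennreal (exp (l * mean n u + mgf_const * l\<^sup>2 * n))"
  using u
proof (induction n arbitrary: u)
  case 0
  then show ?case by (simp add: S.emeasure_space_1)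
next
  case (Suc n)
  have "(\<integral>\<^sup>+\<omega>. ennreal (exp (l * Sn u (Suc n) \<omega>)) \<partial>S) = (\<integral>\<^sup>+A. \<integral>\<^sup>+\<omega>. ennreal (exp (l * Sn u (Suc n) (A ## \<omega>))) \<partial>S \<partial>\<mu>)"
    by (rule nn_integral_stream_space) measurable
  also have "\<dots> \<le> (\<integral>\<^sup>+A. ennreal (exp (l * mean (Suc n) u + mgf_const * l\<^sup>2 * n)) * ennreal (exp (l * incr n A u)) \<partial>\<mu>)"
  proof (rule nn_integral_mono)
    fix A assume "A \<in> space \<mu>"
    then have A: "A \<in> GL" by (simp add: space_mu)
    let ?r = "ln (norm (A *v u) / norm u)"
    have "(\<integral>\<^sup>+\<omega>. ennreal (exp (l * Sn u (Suc n) (A ## \<omega>))) \<partial>S) = (\<integral>\<^sup>+\<omega>. ennreal (exp (l * ?r)) * ennreal (exp (l * Sn (A *v u) n \<omega>)) \<partial>S)"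
    proof (rule nn_integral_cong)
      fix \<omega> assume "\<omega> \<in> space S"
      then show "ennreal (exp (l * Sn u (Suc n) (A ## \<omega>))) = ennreal (exp (l * ?r)) * ennreal (exp (l * Sn (A *v u) n \<omega>))"
        by (simp add: Sn_Stream[OF A _ Suc.prems] distrib_left exp_add ennreal_mult)
    qed
    also have "\<dots> = ennreal (exp (l * ?r)) * (\<integral>\<^sup>+\<omega>. ennreal (exp (l * Sn (A *v u) n \<omega>)) \<partial>S)"
      by (rule nn_integral_cmult) measurable
    also have "\<dots> \<le> ennreal (exp (l * ?r)) * ennreal (exp (l * mean n (A *v u) + mgf_const * l\<^sup>2 * n))"
      using A Suc.prems by (intro mult_left_mono Suc.IH) auto
    also have "\<dots> = ennreal (exp (l * mean (Suc n) u + mgf_const * l\<^sup>2 * n)) * ennreal (exp (l * incr n A u))"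
      by (simp add: incr_def algebra_simps flip: ennreal_mult exp_add)
    finally show "(\<integral>\<^sup>+\<omega>. ennreal (exp (l * Sn u (Suc n) (A ## \<omega>))) \<partial>S) \<le> ennreal (exp (l * mean (Suc n) u + mgf_const * l\<^sup>2 * n)) * ennreal (exp (l * incr n A u))" .
  qed
  also have "\<dots> = ennreal (exp (l * mean (Suc n) u + mgf_const * l\<^sup>2 * n)) * (\<integral>\<^sup>+A. ennreal (exp (l * incr n A u)) \<partial>\<mu>)"
    by (rule nn_integral_cmult) measurable
  also have "\<dots> \<le> ennreal (exp (l * mean (Suc n) u + mgf_const * l\<^sup>2 * n)) * ennreal (exp (mgf_const * l\<^sup>2))"
    by (intro mult_left_mono incr_mgf Suc.prems l) auto
  also have "\<dots> = ennreal (exp (l * mean (Suc n) u + mgf_const * l\<^sup>2 * Suc n))"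
    by (simp add: algebra_simps flip: ennreal_mult exp_add)
  finally show ?case .
qed

definition centred_Sn :: "real ^ 'n \<Rightarrow> nat \<Rightarrow> 'n mat stream \<Rightarrow> real" where
  "centred_Sn u n \<omega> = Sn u n \<omega> - mean n u"

lemma centred_Sn_measurable [measurable]: "centred_Sn u n \<in> borel_measurable S"
  unfolding centred_Sn_def[abs_def] by measurable

lemma centred_Sn_exp:
  assumes u: "u \<noteq> 0" and l: "\<bar>l\<bar> \<le> mgf_radius"
  shows "integrable S (\<lambda>\<omega>. exp (l * centred_Sn u n \<omega>))" "(\<integral>\<omega>. exp (l * centred_Sn u n \<omega>) \<partial>S) \<le> exp (mgf_const * l\<^sup>2 * n)"
proof -
  have "(\<integral>\<^sup>+\<omega>. ennreal (exp (l * centred_Sn u n \<omega>)) \<partial>S) = (\<integral>\<^sup>+\<omega>. ennreal (exp (- l * mean n u)) * ennreal (exp (l * Sn u n \<omega>)) \<partial>S)"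
    by (simp add: centred_Sn_def algebra_simps flip: ennreal_mult exp_add)
  also have "\<dots> = ennreal (exp (- l * mean n u)) * (\<integral>\<^sup>+\<omega>. ennreal (exp (l * Sn u n \<omega>)) \<partial>S)"
    by (rule nn_integral_cmult) measurable
  also have "\<dots> \<le> ennreal (exp (- l * mean n u)) * ennreal (exp (l * mean n u + mgf_const * l\<^sup>2 * n))"
    by (intro mult_left_mono Sn_mgf u l) auto
  also have "\<dots> = ennreal (exp (mgf_const * l\<^sup>2 * n))" by (simp flip: ennreal_mult exp_add)
  finally have le: "(\<integral>\<^sup>+\<omega>. ennreal (exp (l * centred_Sn u n \<omega>)) \<partial>S) \<le> ennreal (exp (mgf_const * l\<^sup>2 * n))" .
  show i: "integrable S (\<lambda>\<omega>. exp (l * centred_Sn u n \<omega>))"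
  proof (rule integrableI_bounded)
    show "(\<integral>\<^sup>+\<omega>. ennreal (norm (exp (l * centred_Sn u n \<omega>))) \<partial>S) < \<infinity>"
      using le_less_trans[OF le ennreal_less_top] by simp
  qed measurable
  show "(\<integral>\<omega>. exp (l * centred_Sn u n \<omega>) \<partial>S) \<le> exp (mgf_const * l\<^sup>2 * n)"
    using le nn_integral_eq_integral[OF i] by simp
qed

text \<open>Moments of the centred walk are of the diffusive order: this is \<open>centred_Sn_exp\<close> with \<open>l\<close> of order \<open>1 / \<surd>n\<close>.\<close>
lemma centred_Sn_moment:
  assumes u: "u \<noteq> 0" and n: "0 < n" and k: "0 < k" "even k"
  shows "integrable S (\<lambda>\<omega>. centred_Sn u n \<omega> ^ k)"
    "(\<integral>\<omega>. centred_Sn u n \<omega> ^ k \<partial>S) \<le> 2 * exp (mgf_const * mgf_radius\<^sup>2) * (k / mgf_radius) ^ k * sqrt n ^ k"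
proof -
  let ?l = "mgf_radius / sqrt n"
  have l: "0 < ?l" "\<bar>?l\<bar> \<le> mgf_radius" "\<bar>- ?l\<bar> \<le> mgf_radius" using mgf_radius n by (auto simp: field_simps)
  have pt: "centred_Sn u n \<omega> ^ k \<le> (k / ?l) ^ k * (exp (?l * centred_Sn u n \<omega>) + exp (- ?l * centred_Sn u n \<omega>))" for \<omega>
  proof -
    let ?x = "centred_Sn u n \<omega>"
    have "(?l * \<bar>?x\<bar> / k) ^ k \<le> exp (?l * \<bar>?x\<bar>)" using l k by (intro power_le_exp) auto
    also have "\<dots> = exp \<bar>?l * ?x\<bar>" using l by (simp only: abs_mult abs_of_pos)
    also have "\<dots> \<le> exp (?l * ?x) + exp (- (?l * ?x))" by (rule exp_abs_le)
    finally have "(k / ?l) ^ k * (?l * \<bar>?x\<bar> / k) ^ k \<le> (k / ?l) ^ k * (exp (?l * ?x) + exp (- (?l * ?x)))"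
      using l by (intro mult_left_mono) auto
    moreover have "(k / ?l) ^ k * (?l * \<bar>?x\<bar> / k) ^ k = \<bar>?x\<bar> ^ k"
    proof -
      have "k / ?l * (?l * \<bar>?x\<bar> / k) = \<bar>?x\<bar>" using mgf_radius n k(1) by simp
      then show ?thesis unfolding power_mult_distrib[symmetric] by (simp only:)
    qed
    moreover have "\<bar>?x\<bar> ^ k = ?x ^ k" using k(2) by (rule power_even_abs)
    ultimately show ?thesis by simp
  qed
  let ?g = "\<lambda>\<omega>. (k / ?l) ^ k * (exp (?l * centred_Sn u n \<omega>) + exp (- ?l * centred_Sn u n \<omega>))"
  have gi: "integrable S ?g"
    by (intro integrable_mult_right Bochner_Integration.integrable_add centred_Sn_exp u l)
  have nn: "0 \<le> centred_Sn u n \<omega> ^ k" for \<omega> using k(2) by (rule zero_le_even_power)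
  show i: "integrable S (\<lambda>\<omega>. centred_Sn u n \<omega> ^ k)"
  proof (rule Bochner_Integration.integrable_bound[OF gi])
    show "AE \<omega> in S. norm (centred_Sn u n \<omega> ^ k) \<le> norm (?g \<omega>)"
      using pt nn by (intro AE_I2) (simp only: real_norm_def, metis abs_of_nonneg abs_ge_self order_trans)
  qed measurable
  have "(\<integral>\<omega>. centred_Sn u n \<omega> ^ k \<partial>S) \<le> (\<integral>\<omega>. ?g \<omega> \<partial>S)" by (intro integral_mono i gi pt)
  also have "\<dots> = (k / ?l) ^ k * ((\<integral>\<omega>. exp (?l * centred_Sn u n \<omega>) \<partial>S) + (\<integral>\<omega>. exp (- ?l * centred_Sn u n \<omega>) \<partial>S))"
    by (simp only: integral_mult_right_zero Bochner_Integration.integral_add[OF centred_Sn_exp(1)[OF u l(2)] centred_Sn_exp(1)[OF u l(3)]])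
  also have "\<dots> \<le> (k / ?l) ^ k * (exp (mgf_const * mgf_radius\<^sup>2) + exp (mgf_const * mgf_radius\<^sup>2))"
  proof (intro mult_left_mono add_mono)
    have e: "mgf_const * ?l\<^sup>2 * n = mgf_const * mgf_radius\<^sup>2" using n by (simp add: power_divide)
    show "(\<integral>\<omega>. exp (?l * centred_Sn u n \<omega>) \<partial>S) \<le> exp (mgf_const * mgf_radius\<^sup>2)"
      using centred_Sn_exp(2)[OF u l(2), of n] unfolding e .
    show "(\<integral>\<omega>. exp (- ?l * centred_Sn u n \<omega>) \<partial>S) \<le> exp (mgf_const * mgf_radius\<^sup>2)"
      using centred_Sn_exp(2)[OF u l(3), of n] unfolding power2_minus e .
  qed (use l in auto)
  also have "\<dots> = 2 * exp (mgf_const * mgf_radius\<^sup>2) * (k / mgf_radius) ^ k * sqrt n ^ k"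
    using mgf_radius n by (simp add: power_divide power_mult_distrib)
  finally show "(\<integral>\<omega>. centred_Sn u n \<omega> ^ k \<partial>S) \<le> 2 * exp (mgf_const * mgf_radius\<^sup>2) * (k / mgf_radius) ^ k * sqrt n ^ k" .
qed

lemma integrable_centred_Sn: "u \<noteq> 0 \<Longrightarrow> integrable S (centred_Sn u n)"
  unfolding centred_Sn_def[abs_def] using integrable_Sn[of u n] by simp

lemma integral_centred_Sn: "u \<noteq> 0 \<Longrightarrow> (\<integral>\<omega>. centred_Sn u n \<omega> \<partial>S) = 0"
  unfolding centred_Sn_def using integrable_Sn[of u n] by (simp add: mean_def[symmetric] S.prob_space)

lemma unifpos_step:
  obtains d p where "0 < d" "0 < p" "\<And>u. u \<noteq> 0 \<Longrightarrow> p \<le> measure \<mu> {A\<in>space \<mu>. d < ln (norm (A *v u) / norm u)}"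
proof -
  obtain d where d: "0 < d" "0 < (INF s\<in>sphere (0 :: real ^ 'n) 1. measure \<mu> {A \<in> space \<mu>. ln (norm (A *v s)) > d})"
    using unifpos unfolding uniformly_positive_def by blast
  show ?thesis
  proof (rule that[OF d])
    fix u :: "real ^ 'n" assume u: "u \<noteq> 0"
    let ?s = "(1 / norm u) *\<^sub>R u"
    have "(INF s\<in>sphere (0 :: real ^ 'n) 1. measure \<mu> {A \<in> space \<mu>. ln (norm (A *v s)) > d}) \<le> measure \<mu> {A \<in> space \<mu>. ln (norm (A *v ?s)) > d}"
      by (rule cINF_lower[OF bdd_belowI2[of _ 0]]) (use u in auto)
    then show "(INF s\<in>sphere (0 :: real ^ 'n) 1. measure \<mu> {A \<in> space \<mu>. ln (norm (A *v s)) > d}) \<le> measure \<mu> {A\<in>space \<mu>. d < ln (norm (A *v u) / norm u)}"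
      by (simp add: matrix_vector_mult_scaleR)
  qed
qed

lemma unifpos_steps:
  assumes d: "\<And>u. u \<noteq> 0 \<Longrightarrow> p \<le> measure \<mu> {A\<in>space \<mu>. d < ln (norm (A *v u) / norm u)}" and p: "0 \<le> p" and u: "u \<noteq> 0"
  shows "p ^ m \<le> S.prob {\<omega>\<in>space S. m * d \<le> Sn u m \<omega>}"
  using u
proof (induction m arbitrary: u)
  case 0
  then have "{\<omega>\<in>space S. real 0 * d \<le> Sn u 0 \<omega>} = space S" by auto
  then show ?case by (simp only: S.prob_space) simp
next
  case (Suc m)
  let ?E = "{\<omega>\<in>space S. Suc m * d \<le> Sn u (Suc m) \<omega>}"
  let ?G = "{A\<in>space \<mu>. d < ln (norm (A *v u) / norm u)}"
  have mG: "?G \<in> sets \<mu>" by measurable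
  have "ennreal (p * p ^ m) \<le> ennreal (measure \<mu> ?G * p ^ m)"
    using d[OF Suc.prems] p by (intro ennreal_leI mult_right_mono) auto
  also have "\<dots> = (\<integral>\<^sup>+A. ennreal (p ^ m) * indicator ?G A \<partial>\<mu>)"
    using mG p by (simp add: nn_integral_cmult emeasure_eq_measure ennreal_mult mult.commute)
  also have "\<dots> \<le> (\<integral>\<^sup>+A. emeasure S {\<omega>\<in>space S. A ## \<omega> \<in> ?E} \<partial>\<mu>)"
  proof (rule nn_integral_mono)
    fix A assume As: "A \<in> space \<mu>"
    then have A: "A \<in> GL" by (simp add: space_mu)
    show "ennreal (p ^ m) * indicator ?G A \<le> emeasure S {\<omega>\<in>space S. A ## \<omega> \<in> ?E}"
    proof (cases "A \<in> ?G")
      case True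
      have Au: "A *v u \<noteq> 0" using A Suc.prems by simp
      have "p ^ m \<le> S.prob {\<omega>\<in>space S. m * d \<le> Sn (A *v u) m \<omega>}" by (rule Suc.IH[OF Au])
      also have "\<dots> \<le> S.prob {\<omega>\<in>space S. A ## \<omega> \<in> ?E}"
      proof (rule S.finite_measure_mono)
        have [measurable]: "(\<lambda>\<omega>. A ## \<omega>) \<in> measurable S S" using As by measurable
        show "{\<omega>\<in>space S. A ## \<omega> \<in> ?E} \<in> sets S" by measurable
        show "{\<omega>\<in>space S. m * d \<le> Sn (A *v u) m \<omega>} \<subseteq> {\<omega>\<in>space S. A ## \<omega> \<in> ?E}"
          using True by (auto simp: Sn_Stream[OF A _ Suc.prems] Stream_space[OF A] algebra_simps)
      qed
      finally show ?thesis using True by (simp add: S.emeasure_eq_measure)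
    qed simp
  qed
  also have "\<dots> = emeasure S ?E" by (rule emeasure_stream_space[symmetric]) measurable
  finally show ?case using p by (simp add: S.emeasure_eq_measure)
qed

text \<open>The martingale increments over blocks of length \<open>m\<close> are orthogonal. Over a block the walk gains \<open>m d\<close> with
  probability at least \<open>p\<^sup>m\<close>, and \<open>m\<close> is chosen such that this exceeds what the bounded means can compensate.\<close>
lemma variance_grows:
  obtains m c where "0 < m" "0 < c" "\<And>j u. u \<noteq> 0 \<Longrightarrow> c * real j \<le> (\<integral>\<omega>. (centred_Sn u (j * m) \<omega>)\<^sup>2 \<partial>S)"
proof -
  obtain d p where dp: "0 < d" "0 < p" "\<And>u. u \<noteq> 0 \<Longrightarrow> p \<le> measure \<mu> {A\<in>space \<mu>. d < ln (norm (A *v u) / norm u)}"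
    by (rule unifpos_step, rule that)
  obtain m :: nat where m: "2 * mean_bound + 1 < m * d" using ex_less_of_nat_mult[OF dp(1)] by blast
  have m0: "0 < m" using m mean_bound(1) by (cases m) auto
  show ?thesis
  proof (rule that[OF m0, of "p ^ m"])
    show "0 < p ^ m" using dp by simp
    fix j and u :: "real ^ 'n" assume "u \<noteq> 0"
    then show "p ^ m * real j \<le> (\<integral>\<omega>. (centred_Sn u (j * m) \<omega>)\<^sup>2 \<partial>S)"
    proof (induction j arbitrary: u)
      case (Suc j)
      note u = Suc.prems
      let ?n = "j * m"
      have i2: "integrable S (\<lambda>\<omega>. (centred_Sn u (m + ?n) \<omega>)\<^sup>2)" using m0 by (intro centred_Sn_moment(1)[OF u]) auto
      have inner: "(\<integral>\<omega>'. (centred_Sn u (m + ?n) (stake m \<omega> @- \<omega>'))\<^sup>2 \<partial>S) =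
          (\<integral>\<omega>'. (centred_Sn (lprod m \<omega> *v u) ?n \<omega>')\<^sup>2 \<partial>S) + (Sn u m \<omega> + mean ?n (lprod m \<omega> *v u) - mean (m + ?n) u)\<^sup>2"
        if w: "\<omega> \<in> space S" for \<omega>
      proof -
        let ?u = "lprod m \<omega> *v u" and ?b = "Sn u m \<omega> + mean ?n (lprod m \<omega> *v u) - mean (m + ?n) u"
        have u': "?u \<noteq> 0" by (rule lprod_nz[OF w u])
        have xi: "integrable S (\<lambda>\<omega>'. (centred_Sn ?u ?n \<omega>')\<^sup>2)"
        proof (cases "?n = 0")
          case True
          have "centred_Sn ?u ?n \<omega>' = 0" for \<omega>' unfolding centred_Sn_def True using u' by simp
          then show ?thesis by simp
        next
          case False
          then show ?thesis by (intro centred_Sn_moment(1)[OF u']) auto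
        qed
        have "(\<integral>\<omega>'. (centred_Sn u (m + ?n) (stake m \<omega> @- \<omega>'))\<^sup>2 \<partial>S) = (\<integral>\<omega>'. (centred_Sn ?u ?n \<omega>')\<^sup>2 + (2 * ?b * centred_Sn ?u ?n \<omega>' + ?b\<^sup>2) \<partial>S)"
        proof (rule Bochner_Integration.integral_cong[OF refl])
          fix \<omega>' assume "\<omega>' \<in> space S"
          then have "centred_Sn u (m + ?n) (stake m \<omega> @- \<omega>') = centred_Sn ?u ?n \<omega>' + ?b"
            unfolding centred_Sn_def by (simp add: Sn_shift[OF w _ u])
          then show "(centred_Sn u (m + ?n) (stake m \<omega> @- \<omega>'))\<^sup>2 = (centred_Sn ?u ?n \<omega>')\<^sup>2 + (2 * ?b * centred_Sn ?u ?n \<omega>' + ?b\<^sup>2)"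
            by (simp add: power2_sum)
        qed
        also have "\<dots> = (\<integral>\<omega>'. (centred_Sn ?u ?n \<omega>')\<^sup>2 \<partial>S) + (\<integral>\<omega>'. 2 * ?b * centred_Sn ?u ?n \<omega>' + ?b\<^sup>2 \<partial>S)"
          by (intro Bochner_Integration.integral_add xi Bochner_Integration.integrable_add integrable_mult_right integrable_centred_Sn u' S.integrable_const)
        also have "(\<integral>\<omega>'. 2 * ?b * centred_Sn ?u ?n \<omega>' + ?b\<^sup>2 \<partial>S) = 2 * ?b * (\<integral>\<omega>'. centred_Sn ?u ?n \<omega>' \<partial>S) + ?b\<^sup>2"
          by (subst Bochner_Integration.integral_add) (auto intro!: integrable_mult_right integrable_centred_Sn u' simp: S.prob_space)
        finally show ?thesis by (simp add: integral_centred_Sn[OF u'])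
      qed
      let ?E = "{\<omega>\<in>space S. m * d \<le> Sn u m \<omega>}"
      have "p ^ m + p ^ m * real j \<le> (\<integral>\<omega>. p ^ m * real j + indicator ?E \<omega> \<partial>S)"
        using unifpos_steps[OF dp(3) less_imp_le[OF dp(2)] u, of m]
        by (subst Bochner_Integration.integral_add) (auto intro!: integrable_real_indicator simp: less_top[symmetric] S.prob_space)
      also have "\<dots> \<le> (\<integral>\<omega>. \<integral>\<omega>'. (centred_Sn u (m + ?n) (stake m \<omega> @- \<omega>'))\<^sup>2 \<partial>S \<partial>S)"
      proof (rule integral_mono)
        show "integrable S (\<lambda>\<omega>. p ^ m * real j + indicator ?E \<omega>)"
          by (intro Bochner_Integration.integrable_add S.integrable_const integrable_real_indicator) (auto simp: less_top[symmetric])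
        show "integrable S (\<lambda>\<omega>. \<integral>\<omega>'. (centred_Sn u (m + ?n) (stake m \<omega> @- \<omega>'))\<^sup>2 \<partial>S)"
          by (rule integral_shift(2)[OF i2])
        fix \<omega> assume w: "\<omega> \<in> space S"
        have u': "lprod m \<omega> *v u \<noteq> 0" by (rule lprod_nz[OF w u])
        let ?b = "Sn u m \<omega> + mean ?n (lprod m \<omega> *v u) - mean (m + ?n) u"
        have "indicator ?E \<omega> \<le> ?b\<^sup>2"
        proof (cases "\<omega> \<in> ?E")
          case True
          then have "1 \<le> ?b" using m mean_bound(2)[OF u', of ?n] mean_bound(2)[OF u, of "m + ?n"] by auto
          then have "1 \<le> ?b\<^sup>2" by (rule one_le_power)
          then show ?thesis using True by simp
        qed simp
        then show "p ^ m * real j + indicator ?E \<omega> \<le> (\<integral>\<omega>'. (centred_Sn u (m + ?n) (stake m \<omega> @- \<omega>'))\<^sup>2 \<partial>S)"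
          unfolding inner[OF w] using Suc.IH[OF u'] by linarith
      qed
      also have "\<dots> = (\<integral>\<omega>. (centred_Sn u (m + ?n) \<omega>)\<^sup>2 \<partial>S)" by (rule integral_shift(1)[OF i2, symmetric])
      finally show ?case by (simp add: algebra_simps)
    qed simp
  qed
qed

text \<open>The walk reaches \<open>-K\<close> within time of order \<open>K\<^sup>2\<close> with a fixed probability: the second and fourth
  moments bound the first absolute moment from below, and the mean is bounded.\<close>
lemma lower_tail:
  obtains p C where "0 < p" "0 \<le> C" "\<And>K::nat. \<exists>n::nat. real n \<le> C * (real K + 1)\<^sup>2 \<and> (\<forall>u. u \<noteq> 0 \<longrightarrow> p \<le> S.prob {\<omega>\<in>space S. Sn u n \<omega> \<le> - real K})"
proof -
  obtain m c where m: "0 < m" and c: "0 < c" and var: "\<And>j u. u \<noteq> 0 \<Longrightarrow> c * real j \<le> (\<integral>\<omega>. (centred_Sn u (j * m) \<omega>)\<^sup>2 \<partial>S)"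
    by (rule variance_grows, rule that)
  define c1 where "c1 = c / m"
  have c1: "0 < c1" using c m by (simp add: c1_def)
  define E0 where "E0 = 2 * exp (mgf_const * mgf_radius\<^sup>2)"
  have E0: "0 < E0" by (simp add: E0_def)
  define C2 where "C2 = E0 * (2 / mgf_radius) ^ 2"
  define C4 where "C4 = E0 * (4 / mgf_radius) ^ 4"
  have C24: "0 < C2" "0 < C4" using E0 mgf_radius by (simp_all add: C2_def C4_def)
  define a where "a = sqrt (2 * C4 / c1)"
  have a: "0 < a" "a\<^sup>2 = 2 * C4 / c1" using C24 c1 by (simp_all add: a_def)
  define c2 where "c2 = c1 / (2 * a)"
  have c2: "0 < c2" using c1 a by (simp add: c2_def)
  define b where "b = 8 * C2 / c2"
  have b: "0 < b" using C24 c2 by (simp add: b_def)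
  define p where "p = c2 / (4 * b)"
  have p: "0 < p" using b c2 by (simp add: p_def)
  have main: "p \<le> S.prob {\<omega>\<in>space S. Sn u n \<omega> \<le> - real K}"
    if n: "n = j * m" "0 < j" "8 * (real K + mean_bound) / c2 \<le> sqrt n" and u: "u \<noteq> 0" for n j K u
  proof -
    let ?X = "centred_Sn u n" and ?s = "sqrt n" and ?K = "real K + mean_bound"
    have n0: "0 < n" using n m by simp
    have s: "0 < ?s" "?s\<^sup>2 = n" using n0 by simp_all
    have i2: "integrable S (\<lambda>\<omega>. (?X \<omega>)\<^sup>2)" by (rule centred_Sn_moment(1)[OF u n0]) auto
    have i4: "integrable S (\<lambda>\<omega>. (?X \<omega>) ^ 4)" by (rule centred_Sn_moment(1)[OF u n0]) auto
    have ia: "integrable S (\<lambda>\<omega>. \<bar>?X \<omega>\<bar>)" using integrable_centred_Sn[OF u] by (rule integrable_abs)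
    have m2: "(\<integral>\<omega>. (?X \<omega>)\<^sup>2 \<partial>S) \<le> C2 * n" using centred_Sn_moment(2)[OF u n0, of 2] s by (simp add: C2_def E0_def)
    have m4: "(\<integral>\<omega>. (?X \<omega>) ^ 4 \<partial>S) \<le> C4 * (real n)\<^sup>2"
    proof -
      have "?s ^ 4 = (real n)\<^sup>2" using s(2) by (simp add: power4_eq_xxxx power2_eq_square)
      then show ?thesis using centred_Sn_moment(2)[OF u n0, of 4] by (simp add: C4_def E0_def)
    qed
    have v: "c1 * n \<le> (\<integral>\<omega>. (?X \<omega>)\<^sup>2 \<partial>S)" using var[OF u, of j] m by (simp add: n(1) c1_def)
    have first: "c2 * ?s \<le> (\<integral>\<omega>. \<bar>?X \<omega>\<bar> \<partial>S)"
    proof -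
      \<comment> \<open>The second moment is split at \<open>\<bar>x\<bar> = a \<surd>n\<close>; the part above is a small part of it by the choice
        of \<open>a\<close> and the bound on the fourth moment.\<close>
      have pt: "x\<^sup>2 \<le> a * ?s * \<bar>x\<bar> + x ^ 4 / (a\<^sup>2 * n)" for x :: real
      proof (cases "\<bar>x\<bar> \<le> a * ?s")
        case True
        have "x\<^sup>2 = \<bar>x\<bar> * \<bar>x\<bar>" by (simp add: power2_eq_square)
        also have "\<dots> \<le> a * ?s * \<bar>x\<bar>" using True by (intro mult_right_mono) auto
        finally show ?thesis by (simp add: add_increasing2)
      next
        case False
        then have "(a * ?s)\<^sup>2 \<le> \<bar>x\<bar>\<^sup>2" using a s by (intro power_mono) auto
        then have "a\<^sup>2 * n \<le> x\<^sup>2" by (simp add: power_mult_distrib)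
        then have "x\<^sup>2 * (a\<^sup>2 * n) \<le> x\<^sup>2 * x\<^sup>2" by (intro mult_left_mono) auto
        moreover have "0 < a\<^sup>2 * n" using a(1) n0 by simp
        ultimately have "x\<^sup>2 \<le> x\<^sup>2 * x\<^sup>2 / (a\<^sup>2 * n)" by (subst pos_le_divide_eq)
        then have "x\<^sup>2 \<le> x ^ 4 / (a\<^sup>2 * n)" by (simp add: power4_eq_xxxx power2_eq_square mult.assoc)
        moreover have "0 \<le> a * ?s * \<bar>x\<bar>" using a by simp
        ultimately show ?thesis by linarith
      qed
      have ii: "integrable S (\<lambda>\<omega>. a * ?s * \<bar>?X \<omega>\<bar>)" "integrable S (\<lambda>\<omega>. (?X \<omega>) ^ 4 / (a\<^sup>2 * n))"
        by (intro integrable_mult_right integrable_divide ia i4)+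
      note v
      also have "(\<integral>\<omega>. (?X \<omega>)\<^sup>2 \<partial>S) \<le> (\<integral>\<omega>. a * ?s * \<bar>?X \<omega>\<bar> + (?X \<omega>) ^ 4 / (a\<^sup>2 * n) \<partial>S)"
        by (rule integral_mono[OF i2 Bochner_Integration.integrable_add[OF ii] pt])
      also have "\<dots> = a * ?s * (\<integral>\<omega>. \<bar>?X \<omega>\<bar> \<partial>S) + (\<integral>\<omega>. (?X \<omega>) ^ 4 \<partial>S) / (a\<^sup>2 * n)"
        unfolding Bochner_Integration.integral_add[OF ii] by (simp only: integral_mult_right_zero integral_divide_zero)
      also have "(\<integral>\<omega>. (?X \<omega>) ^ 4 \<partial>S) / (a\<^sup>2 * n) \<le> C4 * (real n)\<^sup>2 / (a\<^sup>2 * n)"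
        using m4 by (intro divide_right_mono) auto
      also have "C4 * (real n)\<^sup>2 / (a\<^sup>2 * n) = c1 * n / 2"
        unfolding a(2) using c1 C24 n0 by (simp add: power2_eq_square)
      finally have "c1 * n / 2 \<le> a * ?s * (\<integral>\<omega>. \<bar>?X \<omega>\<bar> \<partial>S)" by simp
      moreover have "(a * ?s) * (c2 * ?s) = c1 * n / 2"
      proof -
        have "(a * ?s) * (c2 * ?s) = a * c2 * ?s\<^sup>2" by (simp only: power2_eq_square mult_ac)
        also have "a * c2 = c1 / 2" using a(1) by (simp add: c2_def)
        finally show ?thesis unfolding s(2) by simp
      qed
      ultimately have "(a * ?s) * (c2 * ?s) \<le> (a * ?s) * (\<integral>\<omega>. \<bar>?X \<omega>\<bar> \<partial>S)" by linarith
      then show ?thesis using a s by (subst (asm) mult_le_cancel_left_pos) auto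
    qed
    let ?E = "{\<omega>\<in>space S. ?X \<omega> < - ?K}"
    \<comment> \<open>The centred walk has mean zero, so its negative part has half of the absolute moment. The negative part
      is split at \<open>-?K\<close> and at \<open>- b \<surd>n\<close>.\<close>
    have pt: "(\<bar>?X \<omega>\<bar> - ?X \<omega>) / 2 \<le> ?K + (b * ?s * indicator ?E \<omega> + (?X \<omega>)\<^sup>2 / (b * ?s))" if w: "\<omega> \<in> space S" for \<omega>
    proof -
      let ?x = "?X \<omega>"
      have K0: "0 \<le> ?K" using mean_bound(1) by simp
      have q: "0 \<le> ?x\<^sup>2 / (b * ?s)" using b by simp
      show ?thesis
      proof (cases "?x < - ?K")
        case False
        then have "(\<bar>?x\<bar> - ?x) / 2 \<le> ?K" using K0 by (auto simp: abs_if)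
        moreover have I0: "indicator ?E \<omega> = (0::real)" using False by (simp add: indicator_def)
        ultimately show ?thesis using q unfolding I0 by linarith
      next
        case True
        then have I: "indicator ?E \<omega> = (1::real)" using w by (simp add: indicator_def)
        from True have neg: "(\<bar>?x\<bar> - ?x) / 2 = - ?x" "?x < 0" using K0 by auto
        show ?thesis
        proof (cases "- ?x \<le> b * ?s")
          case True
          then show ?thesis using neg q K0 unfolding I by linarith
        next
          case False
          then have "(- ?x) * (b * ?s) \<le> (- ?x) * (- ?x)" using neg by (intro mult_left_mono) auto
          then have "- ?x \<le> ?x\<^sup>2 / (b * ?s)" using b s by (simp add: field_simps power2_eq_square)
          moreover have "0 \<le> b * ?s * indicator ?E \<omega>" using b by simp
          ultimately show ?thesis using neg K0 by linarith
        qed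
      qed
    qed
    have xi: "integrable S (\<lambda>\<omega>. ?X \<omega>)" by (rule integrable_centred_Sn[OF u])
    have Ei: "integrable S (\<lambda>\<omega>. indicator ?E \<omega> :: real)"
      by (intro integrable_real_indicator) (auto simp: less_top[symmetric])
    have "c2 * ?s / 2 \<le> (\<integral>\<omega>. (\<bar>?X \<omega>\<bar> - ?X \<omega>) / 2 \<partial>S)"
      using first ia xi by (simp add: integral_centred_Sn[OF u])
    also have "\<dots> \<le> (\<integral>\<omega>. ?K + (b * ?s * indicator ?E \<omega> + (?X \<omega>)\<^sup>2 / (b * ?s)) \<partial>S)"
    proof (rule integral_mono[OF _ _ pt])
      show "integrable S (\<lambda>\<omega>. (\<bar>?X \<omega>\<bar> - ?X \<omega>) / 2)" using ia xi by simp
      show "integrable S (\<lambda>\<omega>. ?K + (b * ?s * indicator ?E \<omega> + (?X \<omega>)\<^sup>2 / (b * ?s)))"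
        by (intro Bochner_Integration.integrable_add S.integrable_const integrable_mult_right integrable_divide Ei i2)
    qed
    also have "\<dots> = ?K + (b * ?s * S.prob ?E + (\<integral>\<omega>. (?X \<omega>)\<^sup>2 \<partial>S) / (b * ?s))"
    proof -
      have mE: "?E \<in> sets S" by measurable
      have "(\<integral>\<omega>. ?K + (b * ?s * indicator ?E \<omega> + (?X \<omega>)\<^sup>2 / (b * ?s)) \<partial>S) =
        (\<integral>\<omega>. ?K \<partial>S) + (\<integral>\<omega>. b * ?s * indicator ?E \<omega> + (?X \<omega>)\<^sup>2 / (b * ?s) \<partial>S)"
        by (intro Bochner_Integration.integral_add Bochner_Integration.integrable_add S.integrable_const integrable_mult_right integrable_divide Ei i2)
      also have "(\<integral>\<omega>. b * ?s * indicator ?E \<omega> + (?X \<omega>)\<^sup>2 / (b * ?s) \<partial>S) = (\<integral>\<omega>. b * ?s * indicator ?E \<omega> \<partial>S) + (\<integral>\<omega>. (?X \<omega>)\<^sup>2 / (b * ?s) \<partial>S)"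
        by (intro Bochner_Integration.integral_add integrable_mult_right integrable_divide Ei i2)
      finally show ?thesis using mE by (simp add: S.prob_space)
    qed
    also have "(\<integral>\<omega>. (?X \<omega>)\<^sup>2 \<partial>S) / (b * ?s) \<le> C2 * n / (b * ?s)"
      using m2 b by (intro divide_right_mono) auto
    also have "C2 * n / (b * ?s) = c2 * ?s / 8"
    proof -
      have "C2 * n / (b * ?s) = (C2 / b) * (n / ?s)" by simp
      also have "C2 / b = c2 / 8" using C24 c2 by (simp add: b_def)
      also have "n / ?s = ?s" by (rule real_div_sqrt) simp
      finally show ?thesis by simp
    qed
    finally have 1: "c2 * ?s / 2 \<le> ?K + (b * ?s * S.prob ?E + c2 * ?s / 8)" by simp
    have 2: "?K \<le> c2 * ?s / 8" using n(3) c2 by (simp add: field_simps)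
    have "(4 * b * ?s) * (c2 / (4 * b)) = c2 * ?s" using b by simp
    also have "\<dots> \<le> 4 * (b * ?s * S.prob ?E)" using 1 2 by linarith
    finally have "(4 * b * ?s) * (c2 / (4 * b)) \<le> (4 * b * ?s) * S.prob ?E" by (simp only: mult.assoc)
    then have "p \<le> S.prob ?E" unfolding p_def using b s by (subst (asm) mult_le_cancel_left_pos) auto
    also have "\<dots> \<le> S.prob {\<omega>\<in>space S. Sn u n \<omega> \<le> - real K}"
    proof (rule S.finite_measure_mono)
      show "?E \<subseteq> {\<omega>\<in>space S. Sn u n \<omega> \<le> - real K}" using mean_bound(2)[OF u, of n] by (auto simp: centred_Sn_def abs_le_iff)
    qed measurable
    finally show ?thesis .
  qed
  define D where "D = (8 * (1 + mean_bound) / c2)\<^sup>2"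
  have D0: "0 \<le> D" by (simp add: D_def)
  show ?thesis
  proof (rule that[OF p, of "m * (D + 2)"])
    show "0 \<le> real m * (D + 2)" using D0 by simp
    fix K :: nat
    define x where "x = D * (real K + 1)\<^sup>2"
    have x0: "0 \<le> x" using D0 by (simp add: x_def)
    define j where "j = nat \<lceil>x\<rceil> + 1"
    have j: "x \<le> real j" "real j \<le> x + 2" "0 < j" using x0 unfolding j_def by linarith+
    have "8 * (real K + mean_bound) / c2 \<le> sqrt (j * m)"
    proof (rule real_le_rsqrt)
      have "8 * (real K + mean_bound) / c2 \<le> 8 * (1 + mean_bound) / c2 * (real K + 1)"
        using c2 mean_bound(1) by (simp add: field_simps)
      then have "(8 * (real K + mean_bound) / c2)\<^sup>2 \<le> (8 * (1 + mean_bound) / c2 * (real K + 1))\<^sup>2"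
        using c2 mean_bound(1) by (intro power_mono) auto
      also have "\<dots> = x" by (simp only: x_def D_def power_mult_distrib)
      also have "x \<le> real j * 1" using j by simp
      also have "\<dots> \<le> real j * real m" using m by (intro mult_left_mono) auto
      finally show "(8 * (real K + mean_bound) / c2)\<^sup>2 \<le> real (j * m)" by simp
    qed
    then have "\<forall>u. u \<noteq> 0 \<longrightarrow> p \<le> S.prob {\<omega>\<in>space S. Sn u (j * m) \<omega> \<le> - real K}"
      using main[OF refl j(3)] by blast
    moreover have "real (j * m) \<le> real m * (D + 2) * (real K + 1)\<^sup>2"
    proof -
      have "1 \<le> (real K + 1)\<^sup>2" by (rule one_le_power) simp
      then have "x + 2 \<le> (D + 2) * (real K + 1)\<^sup>2" by (simp add: x_def algebra_simps)
      then have "real j \<le> (D + 2) * (real K + 1)\<^sup>2" using j by linarith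
      then have "real m * real j \<le> real m * ((D + 2) * (real K + 1)\<^sup>2)" by (intro mult_left_mono) auto
      then show ?thesis by (simp add: mult_ac)
    qed
    ultimately show "\<exists>n::nat. real n \<le> real m * (D + 2) * (real K + 1)\<^sup>2 \<and> (\<forall>u. u \<noteq> 0 \<longrightarrow> p \<le> S.prob {\<omega>\<in>space S. Sn u n \<omega> \<le> - real K})"
      by blast
  qed
qed

end

section \<open>The killed walk\<close>

lemma summable_square_geometric:
  fixes c e :: real
  assumes e: "0 < e"
  shows "summable (\<lambda>j. c * (real j + 2)\<^sup>2 * (1 / 2 ^ j) powr e)"
proof -
  define a where "a = e * ln 2 / 2"
  have a: "0 < a" using e by (simp add: a_def)
  have bd: "norm (c * (real j + 2)\<^sup>2 * (1 / 2 ^ j) powr e) \<le> (\<bar>c\<bar> * (4 / a\<^sup>2) * exp (2 * a)) * exp (- a) ^ j" for j :: nat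
  proof -
    have "(a * (real j + 2) / 2)\<^sup>2 \<le> exp (a * (real j + 2))" using power_le_exp[of "a * (real j + 2)" 2] a by simp
    then have sq: "(real j + 2)\<^sup>2 \<le> (4 / a\<^sup>2) * exp (a * (real j + 2))"
    proof -
      have "(a * (real j + 2) / 2)\<^sup>2 = a\<^sup>2 / 4 * (real j + 2)\<^sup>2" by (simp only: power_mult_distrib power_divide) simp
      then have "(4 / a\<^sup>2) * (a\<^sup>2 / 4 * (real j + 2)\<^sup>2) \<le> (4 / a\<^sup>2) * exp (a * (real j + 2))"
        using \<open>(a * (real j + 2) / 2)\<^sup>2 \<le> exp (a * (real j + 2))\<close> by (intro mult_left_mono) auto
      then show ?thesis using a by simp
    qed
    have pw: "(1 / 2 ^ j) powr e = exp (- 2 * a * real j)"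
    proof -
      have "(1 / 2 ^ j) powr e = exp (e * ln (1 / 2 ^ j))" by (simp add: powr_def)
      also have "ln (1 / 2 ^ j :: real) = - (real j * ln 2)" by (simp add: ln_div ln_realpow)
      finally show ?thesis by (simp add: a_def mult_ac)
    qed
    have "norm (c * (real j + 2)\<^sup>2 * (1 / 2 ^ j) powr e) = \<bar>c\<bar> * ((real j + 2)\<^sup>2 * exp (- 2 * a * real j))"
      by (simp add: pw abs_mult mult.assoc)
    also have "\<dots> \<le> \<bar>c\<bar> * ((4 / a\<^sup>2) * exp (a * (real j + 2)) * exp (- 2 * a * real j))"
      by (intro mult_left_mono mult_right_mono sq) auto
    also have "exp (a * (real j + 2)) = exp (2 * a) * exp (a * real j)" by (simp add: algebra_simps flip: exp_add)
    also have "(4 / a\<^sup>2) * (exp (2 * a) * exp (a * real j)) * exp (- 2 * a * real j) = (4 / a\<^sup>2) * exp (2 * a) * exp (- a * real j)"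
      by (simp add: mult.assoc flip: exp_add)
    also have "exp (- a * real j) = exp (- a) ^ j" by (simp add: exp_of_nat_mult[symmetric] mult.commute)
    finally show ?thesis by (simp only: mult.assoc)
  qed
  have "summable (\<lambda>j. (\<bar>c\<bar> * (4 / a\<^sup>2) * exp (2 * a)) * exp (- a) ^ j)"
    using a by (intro summable_mult summable_geometric) simp
  then show ?thesis by (rule summable_comparison_test'[of _ 0]) (rule bd)
qed

context centered_walk
begin

definition alive :: "real ^ 'n \<Rightarrow> real \<Rightarrow> nat \<Rightarrow> 'n mat stream \<Rightarrow> bool" where
  "alive u y n \<omega> \<longleftrightarrow> (\<forall>k\<in>{1..n}. 0 < y + Sn u k \<omega>)"

lemma alive_0 [simp]: "alive u y 0 \<omega>" by (simp add: alive_def)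

lemma alive_Suc: "alive u y (Suc n) \<omega> \<longleftrightarrow> alive u y n \<omega> \<and> 0 < y + Sn u (Suc n) \<omega>"
  by (auto simp: alive_def le_Suc_eq)

lemma alive_mono: "n \<le> m \<Longrightarrow> alive u y m \<omega> \<Longrightarrow> alive u y n \<omega>"
  by (auto simp: alive_def)

lemma alive_mono_y: "y \<le> y' \<Longrightarrow> alive u y n \<omega> \<Longrightarrow> alive u y' n \<omega>"
  by (force simp: alive_def)

lemma alive_pos: "0 < y \<Longrightarrow> u \<noteq> 0 \<Longrightarrow> alive u y n \<omega> \<Longrightarrow> 0 < y + Sn u n \<omega>"
  by (cases n) (auto simp: alive_Suc)

lemma alive_measurable [measurable]: "Measurable.pred S (alive u y n)"
  unfolding alive_def[abs_def] by measurable

lemma alive_shift_le: "k \<le> m \<Longrightarrow> alive u y k (stake m \<omega> @- \<omega>') \<longleftrightarrow> alive u y k \<omega>"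
  by (auto simp: alive_def Sn_shift_le)

lemma alive_Stream:
  assumes "A \<in> GL" "\<omega> \<in> space S" "u \<noteq> 0"
  shows "alive u y (Suc n) (A ## \<omega>) \<longleftrightarrow> 0 < y + ln (norm (A *v u) / norm u) \<and>
    alive (A *v u) (y + ln (norm (A *v u) / norm u)) n \<omega>"
proof -
  have Au: "A *v u \<noteq> 0" using assms by simp
  have "(\<forall>k\<in>{1..Suc n}. 0 < y + Sn u k (A ## \<omega>)) \<longleftrightarrow> 0 < y + Sn u (Suc 0) (A ## \<omega>) \<and> (\<forall>k\<in>{1..n}. 0 < y + Sn u (Suc k) (A ## \<omega>))"
    (is "?L \<longleftrightarrow> ?R")
  proof
    assume R: ?R
    show ?L
    proof
      fix k assume k: "k \<in> {1..Suc n}"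
      then obtain l where l: "k = Suc l" by (cases k) auto
      show "0 < y + Sn u k (A ## \<omega>)" using R k unfolding l by (cases l) auto
    qed
  qed auto
  then show ?thesis
    unfolding alive_def using Au by (simp add: Sn_Stream[OF assms] add.assoc)
qed

definition Alive :: "real ^ 'n \<Rightarrow> real \<Rightarrow> nat \<Rightarrow> 'n mat stream set" where
  "Alive u y n = {\<omega>\<in>space S. alive u y n \<omega>}"

text \<open>The event that the exit time is \<open>k + 1\<close>.\<close>
definition Exit :: "real ^ 'n \<Rightarrow> real \<Rightarrow> nat \<Rightarrow> 'n mat stream set" where
  "Exit u y k = {\<omega>\<in>space S. alive u y k \<omega> \<and> \<not> alive u y (Suc k) \<omega>}"

lemma Alive_sets [measurable]: "Alive u y n \<in> sets S"
  unfolding Alive_def by measurable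

lemma Exit_sets [measurable]: "Exit u y n \<in> sets S"
  unfolding Exit_def by measurable

lemma Alive_split: "N \<le> N' \<Longrightarrow> indicat_real (Alive u y N) \<omega> = indicator (Alive u y N') \<omega> + (\<Sum>k\<in>{N..<N'}. indicator (Exit u y k) \<omega>)"
proof (induction N' rule: dec_induct)
  case (step n)
  have "indicat_real (Alive u y n) \<omega> = indicator (Alive u y (Suc n)) \<omega> + indicator (Exit u y n) \<omega>"
    by (auto simp: Alive_def Exit_def indicator_def alive_Suc)
  then show ?case using step by simp
qed simp

lemma integrable_ind: "E \<in> sets S \<Longrightarrow> integrable S (indicat_real E)"
  by (intro integrable_real_indicator) (auto simp: less_top[symmetric])

lemma integrable_ind_Sn:
  assumes u: "u \<noteq> 0" and E: "E \<in> sets S"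
  shows "integrable S (\<lambda>\<omega>. indicator E \<omega> * (y + Sn u n \<omega>))"
proof (rule Bochner_Integration.integrable_bound)
  show "integrable S (\<lambda>\<omega>. y + Sn u n \<omega>)" using integrable_Sn[OF u] by simp
  show "(\<lambda>\<omega>. indicator E \<omega> * (y + Sn u n \<omega>)) \<in> borel_measurable S" using E by measurable
qed (auto simp: indicator_def)

lemma prob_Exit_sum: "N \<le> N' \<Longrightarrow> (\<Sum>k\<in>{N..<N'}. S.prob (Exit u y k)) \<le> S.prob (Alive u y N)"
proof -
  assume N: "N \<le> N'"
  have "S.prob (Alive u y N) = (\<integral>\<omega>. indicator (Alive u y N') \<omega> + (\<Sum>k\<in>{N..<N'}. indicator (Exit u y k) \<omega>) \<partial>S)"
    by (subst Alive_split[OF N, symmetric]) simp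
  also have "\<dots> = S.prob (Alive u y N') + (\<Sum>k\<in>{N..<N'}. S.prob (Exit u y k))"
    by (subst Bochner_Integration.integral_add)
      (auto intro!: integrable_ind Bochner_Integration.integrable_sum simp: Bochner_Integration.integral_sum integrable_ind)
  finally show ?thesis by simp
qed

text \<open>Since \<open>mean\<close> is bounded, the walk is a martingale up to a bounded error, also on an event \<open>E\<close> decided by
  time \<open>k\<close>.\<close>
lemma integral_after:
  assumes u: "u \<noteq> 0" and E[measurable]: "E \<in> sets S"
    and dec: "\<And>\<omega> \<omega>'. \<omega> \<in> space S \<Longrightarrow> \<omega>' \<in> space S \<Longrightarrow> stake k \<omega> @- \<omega>' \<in> E \<longleftrightarrow> \<omega> \<in> E"
  shows "\<bar>(\<integral>\<omega>. indicator E \<omega> * (y + Sn u (k + n) \<omega>) \<partial>S) - (\<integral>\<omega>. indicator E \<omega> * (y + Sn u k \<omega>) \<partial>S)\<bar> \<le> mean_bound * S.prob E"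
proof -
  have i: "integrable S (\<lambda>\<omega>. indicator E \<omega> * (y + Sn u m \<omega>))" for m
    by (rule integrable_ind_Sn[OF u E])
  have "(\<integral>\<omega>. indicator E \<omega> * (y + Sn u (k + n) \<omega>) \<partial>S)
    = (\<integral>\<omega>. \<integral>\<omega>'. indicator E (stake k \<omega> @- \<omega>') * (y + Sn u (k + n) (stake k \<omega> @- \<omega>')) \<partial>S \<partial>S)"
    by (rule integral_shift(1)[OF i])
  also have "\<dots> = (\<integral>\<omega>. indicator E \<omega> * (y + Sn u k \<omega>) + indicator E \<omega> * mean n (lprod k \<omega> *v u) \<partial>S)"
  proof (rule Bochner_Integration.integral_cong[OF refl])
    fix \<omega> assume w: "\<omega> \<in> space S"
    have u': "lprod k \<omega> *v u \<noteq> 0" by (rule lprod_nz[OF w u])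
    have "(\<integral>\<omega>'. indicator E (stake k \<omega> @- \<omega>') * (y + Sn u (k + n) (stake k \<omega> @- \<omega>')) \<partial>S)
      = (\<integral>\<omega>'. indicat_real E \<omega> * (y + Sn u k \<omega>) + indicat_real E \<omega> * Sn (lprod k \<omega> *v u) n \<omega>' \<partial>S)"
    proof (rule Bochner_Integration.integral_cong[OF refl])
      fix \<omega>' assume w': "\<omega>' \<in> space S"
      have "indicat_real E (stake k \<omega> @- \<omega>') = indicator E \<omega>" using dec[OF w w'] by (simp add: indicator_def)
      then show "indicat_real E (stake k \<omega> @- \<omega>') * (y + Sn u (k + n) (stake k \<omega> @- \<omega>'))
        = indicat_real E \<omega> * (y + Sn u k \<omega>) + indicat_real E \<omega> * Sn (lprod k \<omega> *v u) n \<omega>'"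
        by (simp add: Sn_shift[OF w w' u] algebra_simps)
    qed
    also have "\<dots> = indicator E \<omega> * (y + Sn u k \<omega>) + indicator E \<omega> * mean n (lprod k \<omega> *v u)"
      using integrable_Sn[OF u', of n] by (simp add: mean_def S.prob_space)
    finally show "(\<integral>\<omega>'. indicator E (stake k \<omega> @- \<omega>') * (y + Sn u (k + n) (stake k \<omega> @- \<omega>')) \<partial>S)
      = indicator E \<omega> * (y + Sn u k \<omega>) + indicator E \<omega> * mean n (lprod k \<omega> *v u)" .
  qed
  also have "\<dots> = (\<integral>\<omega>. indicator E \<omega> * (y + Sn u k \<omega>) \<partial>S) + (\<integral>\<omega>. indicator E \<omega> * mean n (lprod k \<omega> *v u) \<partial>S)"
  proof (rule Bochner_Integration.integral_add[OF i])
    show "integrable S (\<lambda>\<omega>. indicator E \<omega> * mean n (lprod k \<omega> *v u))"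
      using mean_bound(1) mean_bound(2)[OF lprod_nz[OF _ u]]
      by (intro S.integrable_const_bound[where B=mean_bound]) (auto intro!: AE_I2 simp: indicator_def)
  qed
  finally have e: "(\<integral>\<omega>. indicator E \<omega> * (y + Sn u (k + n) \<omega>) \<partial>S) - (\<integral>\<omega>. indicator E \<omega> * (y + Sn u k \<omega>) \<partial>S)
    = (\<integral>\<omega>. indicator E \<omega> * mean n (lprod k \<omega> *v u) \<partial>S)" by simp
  have "\<bar>\<integral>\<omega>. indicator E \<omega> * mean n (lprod k \<omega> *v u) \<partial>S\<bar> \<le> (\<integral>\<omega>. \<bar>indicator E \<omega> * mean n (lprod k \<omega> *v u)\<bar> \<partial>S)"
    by (rule integral_abs_bound)
  also have "\<dots> \<le> (\<integral>\<omega>. mean_bound * indicator E \<omega> \<partial>S)"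
  proof (rule integral_mono)
    show "integrable S (\<lambda>\<omega>. \<bar>indicator E \<omega> * mean n (lprod k \<omega> *v u)\<bar>)"
      using mean_bound(1) mean_bound(2)[OF lprod_nz[OF _ u]]
      by (intro S.integrable_const_bound[where B=mean_bound]) (auto intro!: AE_I2 simp: indicator_def)
    show "integrable S (\<lambda>\<omega>. mean_bound * indicator E \<omega>)" by (intro integrable_mult_right integrable_ind E)
    show "\<bar>indicator E \<omega> * mean n (lprod k \<omega> *v u)\<bar> \<le> mean_bound * indicator E \<omega>" if "\<omega> \<in> space S" for \<omega>
      using mean_bound(2)[OF lprod_nz[OF that u]] by (simp add: indicator_def)
  qed
  also have "\<dots> = mean_bound * S.prob E" by simp
  finally show ?thesis unfolding e .
qed

text \<open>From a height at most \<open>K + 1\<close> the walk is below \<open>0\<close> after a time \<open>m\<close> of order \<open>K\<^sup>2\<close> with a fixed probability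
  (\<open>lower_tail\<close>), and then it does not survive; so \<open>expected_visits_le\<close> bounds the number of surviving visits.\<close>
lemma green_bound:
  obtains C where "0 \<le> C" "\<And>K T u y. u \<noteq> 0 \<Longrightarrow> 0 < y \<Longrightarrow>
    (\<Sum>k<T. S.prob {\<omega>\<in>space S. alive u y k \<omega> \<and> y + Sn u k \<omega> \<le> real (Suc K)}) \<le> C * (real K + 2)\<^sup>2"
proof -
  obtain p C where p: "0 < p" and C: "0 \<le> C" and low: "\<And>K::nat. \<exists>n::nat. real n \<le> C * (real K + 1)\<^sup>2 \<and> (\<forall>u. u \<noteq> 0 \<longrightarrow> p \<le> S.prob {\<omega>\<in>space S. Sn u n \<omega> \<le> - real K})"
    by (rule lower_tail, rule that)
  show ?thesis
  proof (rule that[of "C / p"])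
    show "0 \<le> C / p" using C p by simp
    fix K T :: nat and u :: "real ^ 'n" and y :: real assume u: "u \<noteq> 0" and y: "0 < y"
    obtain m where m: "real m \<le> C * (real (Suc K) + 1)\<^sup>2" "\<And>u. u \<noteq> 0 \<Longrightarrow> p \<le> S.prob {\<omega>\<in>space S. Sn u m \<omega> \<le> - real (Suc K)}"
      using low[of "Suc K"] by auto
    have m0: "m \<noteq> 0"
    proof
      assume "m = 0"
      then have "{\<omega>\<in>space S. Sn u m \<omega> \<le> - real (Suc K)} = {}" using u by auto
      then have "S.prob {\<omega>\<in>space S. Sn u m \<omega> \<le> - real (Suc K)} = 0" by (simp only: measure_empty)
      then show False using m(2)[OF u] p by linarith
    qed
    let ?A = "\<lambda>k. {\<omega>\<in>space S. alive u y k \<omega> \<and> y + Sn u k \<omega> \<le> real (Suc K)}"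
    have mA: "?A k \<in> sets S" for k by measurable
    have "(\<Sum>k<T. S.prob (?A k)) \<le> m / p"
    proof (rule expected_visits_le[OF mA _ p])
      fix k assume "k < T"
      let ?B = "space S - (\<Union>l\<in>{k + m..<T}. ?A l)"
      have mB: "?B \<in> sets S" by (intro sets.compl_sets sets.finite_UN mA) auto
      have "p * S.prob (?A k) \<le> S.prob (?A k \<inter> ?B)"
      proof (rule prob_shift_ge[OF mA mB, where m=k])
        show "stake k \<omega> @- \<omega>' \<in> ?A k" if "\<omega> \<in> ?A k" "\<omega>' \<in> space S" for \<omega> \<omega>'
          using that by (simp add: alive_shift_le Sn_shift_le shift_space)
        fix \<omega> assume wA: "\<omega> \<in> ?A k"
        then have w: "\<omega> \<in> space S" by simp
        have [measurable]: "(\<lambda>\<omega>'. stake k \<omega> @- \<omega>') \<in> measurable S S"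
          using w by (intro measurable_shift) auto
        have "p \<le> S.prob {\<omega>'\<in>space S. Sn (lprod k \<omega> *v u) m \<omega>' \<le> - real (Suc K)}" by (rule m(2)[OF lprod_nz[OF w u]])
        also have "\<dots> \<le> S.prob {\<omega>'\<in>space S. stake k \<omega> @- \<omega>' \<in> ?B}"
        proof (rule S.finite_measure_mono)
          show "{\<omega>'\<in>space S. stake k \<omega> @- \<omega>' \<in> ?B} \<in> sets S" using mB by measurable
          show "{\<omega>'\<in>space S. Sn (lprod k \<omega> *v u) m \<omega>' \<le> - real (Suc K)} \<subseteq> {\<omega>'\<in>space S. stake k \<omega> @- \<omega>' \<in> ?B}"
          proof
            fix \<omega>' assume w'A: "\<omega>' \<in> {\<omega>'\<in>space S. Sn (lprod k \<omega> *v u) m \<omega>' \<le> - real (Suc K)}"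
            then have w': "\<omega>' \<in> space S" by simp
            have dead: "y + Sn u (k + m) (stake k \<omega> @- \<omega>') \<le> 0"
              using wA w'A by (simp add: Sn_shift[OF w w' u])
            have "stake k \<omega> @- \<omega>' \<notin> ?A l" if "l \<in> {k + m..<T}" for l
            proof
              assume "stake k \<omega> @- \<omega>' \<in> ?A l"
              then have "alive u y (k + m) (stake k \<omega> @- \<omega>')" using that by (intro alive_mono[of "k + m" l]) auto
              then have "0 < y + Sn u (k + m) (stake k \<omega> @- \<omega>')" by (rule alive_pos[OF y u])
              then show False using dead by simp
            qed
            then show "\<omega>' \<in> {\<omega>'\<in>space S. stake k \<omega> @- \<omega>' \<in> ?B}" using w' shift_space[OF w w'] by simp
          qed
        qed
        finally show "p \<le> S.prob {\<omega>'\<in>space S. stake k \<omega> @- \<omega>' \<in> ?B}" .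
      qed (use p in simp)
      also have "?A k \<inter> ?B = ?A k \<inter> - (\<Union>l\<in>{k + m..<T}. ?A l)" by blast
      finally show "p * S.prob (?A k) \<le> S.prob (?A k \<inter> - (\<Union>l\<in>{k + m..<T}. ?A l))" .
    qed
    also have "\<dots> \<le> C * (real (Suc K) + 1)\<^sup>2 / p" using m(1) p by (intro divide_right_mono) auto
    also have "\<dots> = C / p * (real K + 2)\<^sup>2" by simp
    finally show "(\<Sum>k<T. S.prob (?A k)) \<le> C / p * (real K + 2)\<^sup>2" .
  qed
qed

text \<open>The overshoot at the exit time is at most the last jump minus the height before it. Large jumps
  are exponentially rare and low positions are visited rarely, so its expectation is bounded uniformly
  in the starting height.\<close>
lemma overshoot_bound:
  obtains C where "0 \<le> C" "\<And>T u y. u \<noteq> 0 \<Longrightarrow> 0 < y \<Longrightarrow>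
    (\<Sum>k<T. \<integral>\<^sup>+\<omega>. ennreal (indicator (Exit u y k) \<omega> * \<bar>y + Sn u (Suc k) \<omega>\<bar>) \<partial>S) \<le> ennreal C"
proof -
  obtain C where C: "0 \<le> C" "\<And>K T u y. u \<noteq> 0 \<Longrightarrow> 0 < y \<Longrightarrow>
    (\<Sum>k<T. S.prob {\<omega>\<in>space S. alive u y k \<omega> \<and> y + Sn u k \<omega> \<le> real (Suc K)}) \<le> C * (real K + 2)\<^sup>2"
    by (rule green_bound, rule that)
  define M where "M = (\<integral>A. matN A powr moment_exp \<partial>\<mu>)"
  have M0: "0 \<le> M" unfolding M_def by (rule integral_nonneg_AE) simp
  have M: "(\<integral>\<^sup>+A. ennreal (matN A powr moment_exp) \<partial>\<mu>) = ennreal M"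
    unfolding M_def by (rule nn_integral_eq_integral[OF integrable_moment_exp]) simp
  define R where "R = (\<Sum>j. C * (real j + 2)\<^sup>2 * (1 / 2 ^ j) powr moment_exp)"
  have R0: "0 \<le> R" unfolding R_def
    by (intro suminf_nonneg summable_square_geometric moment_exp) (simp add: C)
  show ?thesis
  proof (rule that[of "1 / moment_exp * M * R"])
    show "0 \<le> 1 / moment_exp * M * R" using moment_exp M0 R0 by simp
    fix T :: nat and u :: "real ^ 'n" and y :: real assume u: "u \<noteq> 0" and y: "0 < y"
    \<comment> \<open>For \<open>X = exp (- height)\<close> the \<open>j\<close>-th dyadic scale lies below the height \<open>j + 1\<close>, so that
      \<open>green_bound\<close> bounds the number of visits to it.\<close>
    define X where "X k \<omega> = (if alive u y k \<omega> then exp (- (y + Sn u k \<omega>)) else 0)" for k \<omega>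
    have [measurable]: "X k \<in> borel_measurable S" for k unfolding X_def[abs_def] by measurable
    have X1: "0 \<le> X k \<omega>" "X k \<omega> \<le> 1" for k \<omega>
      using alive_pos[OF y u, of k \<omega>] by (auto simp: X_def)
    have green: "(\<Sum>k<T. \<integral>\<^sup>+\<omega>. ennreal (X k \<omega> powr moment_exp) \<partial>S) \<le> ennreal R"
      unfolding R_def
    proof (rule S.dyadic_sum_bound[OF _ _ _ moment_exp(1) _ summable_square_geometric[OF moment_exp(1)]])
      fix j
      have "(\<Sum>k<T. S.prob {\<omega>\<in>space S. 1 / 2 ^ (j + 1) \<le> X k \<omega> \<and> X k \<omega> \<le> 1 / 2 ^ j}) \<le>
        (\<Sum>k<T. S.prob {\<omega>\<in>space S. alive u y k \<omega> \<and> y + Sn u k \<omega> \<le> real (Suc j)})"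
      proof (intro sum_mono S.finite_measure_mono)
        fix k
        show "{\<omega>\<in>space S. 1 / 2 ^ (j + 1) \<le> X k \<omega> \<and> X k \<omega> \<le> 1 / 2 ^ j} \<subseteq> {\<omega>\<in>space S. alive u y k \<omega> \<and> y + Sn u k \<omega> \<le> real (Suc j)}"
        proof
          fix \<omega> assume a: "\<omega> \<in> {\<omega>\<in>space S. 1 / 2 ^ (j + 1) \<le> X k \<omega> \<and> X k \<omega> \<le> 1 / 2 ^ j}"
          have pos: "0 < 1 / (2::real) ^ (j + 1)" by simp
          have al: "alive u y k \<omega>"
          proof (rule ccontr)
            assume "\<not> alive u y k \<omega>"
            then have "X k \<omega> = 0" by (simp add: X_def)
            moreover have "1 / (2::real) ^ (j + 1) \<le> X k \<omega>" using a by simp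
            ultimately show False using pos by linarith
          qed
          then have "1 / 2 ^ (j + 1) \<le> exp (- (y + Sn u k \<omega>))" using a by (simp add: X_def)
          then have "ln (1 / 2 ^ (j + 1)) \<le> - (y + Sn u k \<omega>)" using pos by (subst (asm) ln_le_cancel_iff[symmetric]) auto
          then have "y + Sn u k \<omega> \<le> - ln (1 / 2 ^ (j + 1))" by linarith
          also have "\<dots> = real (Suc j) * ln 2" by (simp add: ln_div ln_realpow del: power_Suc)
          also have "\<dots> \<le> real (Suc j) * 1" using ln_2_less_1 by (intro mult_left_mono) auto
          finally have "y + Sn u k \<omega> \<le> real (Suc j)" by simp
          then show "\<omega> \<in> {\<omega>\<in>space S. alive u y k \<omega> \<and> y + Sn u k \<omega> \<le> real (Suc j)}" using al a by simp
        qed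
      qed measurable
      also have "\<dots> \<le> C * (real j + 2)\<^sup>2" by (rule C(2)[OF u y])
      finally show "(\<Sum>k<T. S.prob {\<omega>\<in>space S. 1 / 2 ^ (j + 1) \<le> X k \<omega> \<and> X k \<omega> \<le> 1 / 2 ^ j}) \<le> C * (real j + 2)\<^sup>2" .
    qed (auto simp: X1)
    have one: "(\<integral>\<^sup>+\<omega>. ennreal (indicator (Exit u y k) \<omega> * \<bar>y + Sn u (Suc k) \<omega>\<bar>) \<partial>S)
      \<le> ennreal (1 / moment_exp * M) * (\<integral>\<^sup>+\<omega>. ennreal (X k \<omega> powr moment_exp) \<partial>S)" for k
    proof -
      have "(\<integral>\<^sup>+\<omega>. ennreal (indicator (Exit u y k) \<omega> * \<bar>y + Sn u (Suc k) \<omega>\<bar>) \<partial>S)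
        \<le> (\<integral>\<^sup>+\<omega>. ennreal (1 / moment_exp) * (ennreal (matN (\<omega> !! k) powr moment_exp) * ennreal (X k \<omega> powr moment_exp)) \<partial>S)"
      proof (rule nn_integral_mono)
        fix \<omega> assume w: "\<omega> \<in> space S"
        have "indicator (Exit u y k) \<omega> * \<bar>y + Sn u (Suc k) \<omega>\<bar> \<le> 1 / moment_exp * (matN (\<omega> !! k) powr moment_exp * X k \<omega> powr moment_exp)"
        proof (cases "\<omega> \<in> Exit u y k")
          case True
          then have al: "alive u y k \<omega>" and neg: "y + Sn u (Suc k) \<omega> \<le> 0" by (auto simp: Exit_def alive_Suc)
          let ?N = "matN (\<omega> !! k)" and ?z = "y + Sn u k \<omega>"
          have N: "1 \<le> ?N" by (rule matN_ge_1[OF snth_GL[OF w]])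
          have "\<bar>y + Sn u (Suc k) \<omega>\<bar> \<le> ln ?N - ?z"
            using neg norm_ratio_bounds(3)[OF snth_GL[OF w, of k] lprod_nz[OF w u, of k]] unfolding Sn_Suc[OF w u] by linarith
          also have "\<dots> \<le> exp (moment_exp * (ln ?N - ?z)) / moment_exp"
          proof -
            have "moment_exp * (ln ?N - ?z) \<le> exp (moment_exp * (ln ?N - ?z))"
              using exp_ge_add_one_self[of "moment_exp * (ln ?N - ?z)"] by linarith
            then show ?thesis using moment_exp by (simp add: field_simps)
          qed
          also have "exp (moment_exp * (ln ?N - ?z)) = ?N powr moment_exp * X k \<omega> powr moment_exp"
          proof -
            have "X k \<omega> powr moment_exp = exp (- (moment_exp * ?z))" using al by (simp only: X_def powr_def ln_exp if_True) (simp add: algebra_simps)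
            moreover have "?N powr moment_exp = exp (moment_exp * ln ?N)" using N by (simp add: powr_def)
            ultimately show ?thesis by (simp add: algebra_simps flip: exp_add)
          qed
          finally show ?thesis using True by simp
        next
          case False
          then show ?thesis using moment_exp by simp
        qed
        then have "ennreal (indicator (Exit u y k) \<omega> * \<bar>y + Sn u (Suc k) \<omega>\<bar>) \<le> ennreal (1 / moment_exp * (matN (\<omega> !! k) powr moment_exp * X k \<omega> powr moment_exp))"
          by (rule ennreal_leI)
        also have "\<dots> = ennreal (1 / moment_exp) * (ennreal (matN (\<omega> !! k) powr moment_exp) * ennreal (X k \<omega> powr moment_exp))"
          using moment_exp by (subst ennreal_mult) (auto simp: ennreal_mult)
        finally show "ennreal (indicator (Exit u y k) \<omega> * \<bar>y + Sn u (Suc k) \<omega>\<bar>) \<le> ennreal (1 / moment_exp) * (ennreal (matN (\<omega> !! k) powr moment_exp) * ennreal (X k \<omega> powr moment_exp))" .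
      qed
      also have "\<dots> = ennreal (1 / moment_exp) * (\<integral>\<^sup>+\<omega>. ennreal (matN (\<omega> !! k) powr moment_exp) * ennreal (X k \<omega> powr moment_exp) \<partial>S)"
        by (rule nn_integral_cmult) measurable
      also have "(\<integral>\<^sup>+\<omega>. ennreal (matN (\<omega> !! k) powr moment_exp) * ennreal (X k \<omega> powr moment_exp) \<partial>S) = ennreal M * (\<integral>\<^sup>+\<omega>. ennreal (X k \<omega> powr moment_exp) \<partial>S)"
        unfolding M[symmetric] by (rule nn_integral_indep) (measurable, simp add: X_def alive_shift_le Sn_shift_le)
      also have "ennreal (1 / moment_exp) * (ennreal M * (\<integral>\<^sup>+\<omega>. ennreal (X k \<omega> powr moment_exp) \<partial>S)) = ennreal (1 / moment_exp * M) * (\<integral>\<^sup>+\<omega>. ennreal (X k \<omega> powr moment_exp) \<partial>S)"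
        using moment_exp M0 by (simp add: ennreal_mult mult.assoc del: times_divide_eq_left)
      finally show ?thesis .
    qed
    have "(\<Sum>k<T. \<integral>\<^sup>+\<omega>. ennreal (indicator (Exit u y k) \<omega> * \<bar>y + Sn u (Suc k) \<omega>\<bar>) \<partial>S)
      \<le> ennreal (1 / moment_exp * M) * (\<Sum>k<T. \<integral>\<^sup>+\<omega>. ennreal (X k \<omega> powr moment_exp) \<partial>S)"
      unfolding sum_distrib_left by (rule sum_mono[OF one])
    also have "\<dots> \<le> ennreal (1 / moment_exp * M) * ennreal R" by (intro mult_left_mono green) auto
    also have "\<dots> = ennreal (1 / moment_exp * M * R)" using moment_exp M0 R0 by (subst ennreal_mult) auto
    finally show "(\<Sum>k<T. \<integral>\<^sup>+\<omega>. ennreal (indicator (Exit u y k) \<omega> * \<bar>y + Sn u (Suc k) \<omega>\<bar>) \<partial>S) \<le> ennreal (1 / moment_exp * M * R)" .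
  qed
qed

definition overshoot :: "real ^ 'n \<Rightarrow> real \<Rightarrow> nat \<Rightarrow> real" where
  "overshoot u y k = (\<integral>\<omega>. indicator (Exit u y k) \<omega> * \<bar>y + Sn u (Suc k) \<omega>\<bar> \<partial>S)"

lemma overshoot_nonneg: "0 \<le> overshoot u y k"
  unfolding overshoot_def by (rule integral_nonneg_AE) simp

lemma overshoot_sum:
  obtains C where "0 \<le> C" "\<And>T u y. u \<noteq> 0 \<Longrightarrow> 0 < y \<Longrightarrow> (\<Sum>k<T. overshoot u y k) \<le> C"
proof -
  obtain C where C: "0 \<le> C" "\<And>T u y. u \<noteq> 0 \<Longrightarrow> 0 < y \<Longrightarrow>
    (\<Sum>k<T. \<integral>\<^sup>+\<omega>. ennreal (indicator (Exit u y k) \<omega> * \<bar>y + Sn u (Suc k) \<omega>\<bar>) \<partial>S) \<le> ennreal C"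
    by (rule overshoot_bound, rule that)
  show ?thesis
  proof (rule that[OF C(1)])
    fix T :: nat and u :: "real ^ 'n" and y :: real assume u: "u \<noteq> 0" and y: "0 < y"
    have "(\<integral>\<^sup>+\<omega>. ennreal (indicator (Exit u y k) \<omega> * \<bar>y + Sn u (Suc k) \<omega>\<bar>) \<partial>S) = ennreal (overshoot u y k)" for k
      unfolding overshoot_def
    proof (rule nn_integral_eq_integral)
      show "integrable S (\<lambda>\<omega>. indicator (Exit u y k) \<omega> * \<bar>y + Sn u (Suc k) \<omega>\<bar>)"
        using integrable_abs[OF integrable_ind_Sn[OF u Exit_sets[of u y k], of y "Suc k"]]
        by (simp add: abs_mult)
    qed simp
    then have "ennreal (\<Sum>k<T. overshoot u y k) \<le> ennreal C"
      using C(2)[OF u y, of T] by (simp add: overshoot_nonneg)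
    then show "(\<Sum>k<T. overshoot u y k) \<le> C" using C(1) by simp
  qed
qed

definition overshoot_const :: real where
  "overshoot_const = (SOME C. 0 \<le> C \<and> (\<forall>T u y. u \<noteq> 0 \<longrightarrow> 0 < y \<longrightarrow> (\<Sum>k<T. overshoot u y k) \<le> C))"

lemma overshoot_const: "0 \<le> overshoot_const" "u \<noteq> 0 \<Longrightarrow> 0 < y \<Longrightarrow> (\<Sum>k<T. overshoot u y k) \<le> overshoot_const"
proof -
  have "\<exists>C. 0 \<le> C \<and> (\<forall>T u y. u \<noteq> 0 \<longrightarrow> 0 < y \<longrightarrow> (\<Sum>k<T. overshoot u y k) \<le> C)"
    by (rule overshoot_sum) (intro exI conjI allI impI; assumption)
  note * = someI_ex[OF this, folded overshoot_const_def]
  show "0 \<le> overshoot_const" using * by (rule conjunct1)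
  show "u \<noteq> 0 \<Longrightarrow> 0 < y \<Longrightarrow> (\<Sum>k<T. overshoot u y k) \<le> overshoot_const" using conjunct2[OF *] by simp
qed

end

section \<open>The harmonic function of the killed walk\<close>

context centered_walk
begin

definition killed_mean :: "real ^ 'n \<Rightarrow> real \<Rightarrow> nat \<Rightarrow> real" where
  "killed_mean u y n = (\<integral>\<omega>. indicator (Alive u y n) \<omega> * (y + Sn u n \<omega>) \<partial>S)"

lemma killed_mean_0: "u \<noteq> 0 \<Longrightarrow> killed_mean u y 0 = y"
  unfolding killed_mean_def
proof -
  assume u: "u \<noteq> 0"
  have "(\<integral>\<omega>. indicator (Alive u y 0) \<omega> * (y + Sn u 0 \<omega>) \<partial>S) = (\<integral>\<omega>. y \<partial>S)"
    by (rule Bochner_Integration.integral_cong) (use u in \<open>auto simp: Alive_def\<close>)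
  then show "(\<integral>\<omega>. indicator (Alive u y 0) \<omega> * (y + Sn u 0 \<omega>) \<partial>S) = y" by (simp add: S.prob_space)
qed

lemma killed_mean_nonneg: "u \<noteq> 0 \<Longrightarrow> 0 < y \<Longrightarrow> 0 \<le> killed_mean u y n"
  unfolding killed_mean_def
  by (rule integral_nonneg_AE) (auto intro!: AE_I2 simp: indicator_def Alive_def less_imp_le[OF alive_pos])

lemma killed_mean_mono:
  assumes u: "u \<noteq> 0" and y: "0 < y" "y \<le> y'"
  shows "killed_mean u y n \<le> killed_mean u y' n"
  unfolding killed_mean_def
proof (rule integral_mono)
  show "integrable S (\<lambda>\<omega>. indicator (Alive u z n) \<omega> * (z + Sn u n \<omega>))" for z by (rule integrable_ind_Sn[OF u Alive_sets])
  then show "integrable S (\<lambda>\<omega>. indicator (Alive u y' n) \<omega> * (y' + Sn u n \<omega>))" .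
  fix \<omega> assume w: "\<omega> \<in> space S"
  have y': "0 < y'" using y by simp
  show "indicator (Alive u y n) \<omega> * (y + Sn u n \<omega>) \<le> indicator (Alive u y' n) \<omega> * (y' + Sn u n \<omega>)"
    using alive_mono_y[OF y(2), of u n \<omega>] alive_pos[OF y' u, of n \<omega>] y w
    by (auto simp: indicator_def Alive_def)
qed

text \<open>Up to a multiple of the probability of surviving until \<open>N\<close>, the killed expectation grows after
  time \<open>N\<close> exactly by what the paths that exit leave below the level \<open>0\<close>.\<close>
lemma killed_mean_diff:
  assumes u: "u \<noteq> 0" and N: "N \<le> N'"
  shows "killed_mean u y N - 2 * mean_bound * S.prob (Alive u y N) \<le> killed_mean u y N'"
    "killed_mean u y N' \<le> killed_mean u y N + 2 * mean_bound * S.prob (Alive u y N) + (\<Sum>k\<in>{N..<N'}. overshoot u y k)"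
proof -
  define J where "J E m = (\<integral>\<omega>. indicator E \<omega> * (y + Sn u m \<omega>) \<partial>S)" for E m
  have i: "integrable S (\<lambda>\<omega>. indicator E \<omega> * (y + Sn u m \<omega>))" if "E \<in> sets S" for E m
    by (rule integrable_ind_Sn[OF u that])
  have "J (Alive u y N) N' = (\<integral>\<omega>. indicator (Alive u y N') \<omega> * (y + Sn u N' \<omega>) + (\<Sum>k\<in>{N..<N'}. indicator (Exit u y k) \<omega> * (y + Sn u N' \<omega>)) \<partial>S)"
    unfolding J_def Alive_split[OF N] by (simp add: distrib_right sum_distrib_right)
  also have "\<dots> = killed_mean u y N' + (\<Sum>k\<in>{N..<N'}. J (Exit u y k) N')"
    unfolding killed_mean_def J_def
    by (simp only: Bochner_Integration.integral_add[OF i[OF Alive_sets] Bochner_Integration.integrable_sum[OF i[OF Exit_sets]]]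
        Bochner_Integration.integral_sum[OF i[OF Exit_sets]])
  finally have split: "J (Alive u y N) N' = killed_mean u y N' + (\<Sum>k\<in>{N..<N'}. J (Exit u y k) N')" .
  have A: "\<bar>J (Alive u y N) N' - killed_mean u y N\<bar> \<le> mean_bound * S.prob (Alive u y N)"
    using integral_after[OF u Alive_sets[of u y N], of N y "N' - N"] N
    by (simp add: J_def killed_mean_def Alive_def alive_shift_le shift_space)
  have E: "\<bar>J (Exit u y k) N' + overshoot u y k\<bar> \<le> mean_bound * S.prob (Exit u y k)" if k: "k \<in> {N..<N'}" for k
  proof -
    have "\<bar>J (Exit u y k) N' - J (Exit u y k) (Suc k)\<bar> \<le> mean_bound * S.prob (Exit u y k)"
      using integral_after[OF u Exit_sets[of u y k], of "Suc k" y "N' - Suc k"] k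
      by (simp add: J_def Exit_def alive_shift_le shift_space del: stake.simps)
    moreover have "J (Exit u y k) (Suc k) = (\<integral>\<omega>. - (indicator (Exit u y k) \<omega> * \<bar>y + Sn u (Suc k) \<omega>\<bar>) \<partial>S)"
      unfolding J_def by (intro Bochner_Integration.integral_cong refl) (auto simp: Exit_def alive_Suc indicator_def)
    then have "J (Exit u y k) (Suc k) = - overshoot u y k" by (simp add: overshoot_def)
    ultimately show ?thesis by simp
  qed
  have "\<bar>(\<Sum>k\<in>{N..<N'}. J (Exit u y k) N') + (\<Sum>k\<in>{N..<N'}. overshoot u y k)\<bar> \<le> (\<Sum>k\<in>{N..<N'}. \<bar>J (Exit u y k) N' + overshoot u y k\<bar>)"
    unfolding sum.distrib[symmetric] by (rule sum_abs)
  also have "\<dots> \<le> (\<Sum>k\<in>{N..<N'}. mean_bound * S.prob (Exit u y k))" by (rule sum_mono[OF E])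
  also have "\<dots> \<le> mean_bound * S.prob (Alive u y N)"
    unfolding sum_distrib_left[symmetric] using mean_bound(1) by (intro mult_left_mono prob_Exit_sum[OF N]) simp
  finally have B: "\<bar>(\<Sum>k\<in>{N..<N'}. J (Exit u y k) N') + (\<Sum>k\<in>{N..<N'}. overshoot u y k)\<bar> \<le> mean_bound * S.prob (Alive u y N)" .
  have "0 \<le> (\<Sum>k\<in>{N..<N'}. overshoot u y k)" by (intro sum_nonneg overshoot_nonneg)
  then show "killed_mean u y N - 2 * mean_bound * S.prob (Alive u y N) \<le> killed_mean u y N'" using split A B unfolding abs_le_iff by linarith
  show "killed_mean u y N' \<le> killed_mean u y N + 2 * mean_bound * S.prob (Alive u y N) + (\<Sum>k\<in>{N..<N'}. overshoot u y k)"
    using split A B unfolding abs_le_iff by linarith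
qed

lemma killed_mean_bounds:
  assumes u: "u \<noteq> 0" and y: "0 < y"
  shows "y - 2 * mean_bound \<le> killed_mean u y n" "killed_mean u y n \<le> y + 2 * mean_bound + overshoot_const"
proof -
  have 1: "2 * mean_bound * S.prob (Alive u y 0) \<le> 2 * mean_bound * 1"
    using mean_bound(1) by (intro mult_left_mono) auto
  have 2: "(\<Sum>k\<in>{0..<n}. overshoot u y k) \<le> overshoot_const" using overshoot_const(2)[OF u y, of n] by (simp add: lessThan_atLeast0)
  note d = killed_mean_diff[OF u le0, where N'=n and y=y]
  show "y - 2 * mean_bound \<le> killed_mean u y n" using d(1) 1 unfolding killed_mean_0[OF u] by linarith
  show "killed_mean u y n \<le> y + 2 * mean_bound + overshoot_const" using d(2) 1 2 unfolding killed_mean_0[OF u] by linarith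
qed

text \<open>A path that survives for long is either low, which happens rarely by \<open>green_bound\<close>, or high,
  which the bound on the killed expectation makes unlikely.\<close>
lemma prob_Alive_small:
  assumes u: "u \<noteq> 0" and y: "0 < y" and e: "0 < e"
  obtains N where "S.prob (Alive u y N) < e"
proof -
  obtain D where D: "0 \<le> D" "\<And>K T u y. u \<noteq> 0 \<Longrightarrow> 0 < y \<Longrightarrow>
    (\<Sum>k<T. S.prob {\<omega>\<in>space S. alive u y k \<omega> \<and> y + Sn u k \<omega> \<le> real (Suc K)}) \<le> D * (real K + 2)\<^sup>2"
    by (rule green_bound, rule that)
  define B where "B = y + 2 * mean_bound + overshoot_const"
  obtain K :: nat where K: "2 * B / e < real K" using reals_Archimedean2 by blast
  let ?Q = "\<lambda>k. {\<omega>\<in>space S. alive u y k \<omega> \<and> y + Sn u k \<omega> \<le> real (Suc K)}"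
  obtain T :: nat where T: "2 * (D * (real K + 2)\<^sup>2) / e < real T" using reals_Archimedean2 by blast
  have "\<exists>k<T. S.prob (?Q k) < e / 2"
  proof (rule ccontr)
    assume n: "\<not> (\<exists>k<T. S.prob (?Q k) < e / 2)"
    have "real T * (e / 2) = (\<Sum>k<T. e / 2)" by simp
    also have "\<dots> \<le> (\<Sum>k<T. S.prob (?Q k))" 
    proof (rule sum_mono)
      fix k assume "k \<in> {..<T}"
      then show "e / 2 \<le> S.prob (?Q k)" using n by (meson lessThan_iff not_less)
    qed
    also have "\<dots> \<le> D * (real K + 2)\<^sup>2" by (rule D(2)[OF u y])
    finally show False using T e by (simp add: field_simps)
  qed
  then obtain k where k: "S.prob (?Q k) < e / 2" by blast
  let ?R = "{\<omega>\<in>space S. alive u y k \<omega> \<and> real (Suc K) < y + Sn u k \<omega>}"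
  have mR: "?R \<in> sets S" and mQ: "?Q k \<in> sets S" by measurable
  have "real (Suc K) * S.prob ?R = (\<integral>\<omega>. real (Suc K) * indicator ?R \<omega> \<partial>S)" using mR by simp
  also have "\<dots> \<le> killed_mean u y k" unfolding killed_mean_def
  proof (rule integral_mono[OF integrable_mult_right[OF integrable_ind[OF mR]] integrable_ind_Sn[OF u Alive_sets]])
    fix \<omega> assume w: "\<omega> \<in> space S"
    show "real (Suc K) * indicator ?R \<omega> \<le> indicator (Alive u y k) \<omega> * (y + Sn u k \<omega>)"
      using w alive_pos[OF y u, of k \<omega>] by (auto simp: indicator_def Alive_def)
  qed
  also have "\<dots> \<le> B" unfolding B_def by (rule killed_mean_bounds(2)[OF u y])
  also have "\<dots> < real (Suc K) * (e / 2)" using K e by (simp add: field_simps)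
  finally have R: "S.prob ?R < e / 2" by (subst (asm) mult_less_cancel_left_pos) auto
  have "S.prob (Alive u y k) = S.prob (?Q k \<union> ?R)" by (rule arg_cong[where f=S.prob]) (auto simp: Alive_def)
  also have "\<dots> \<le> S.prob (?Q k) + S.prob ?R" by (rule measure_Un_le[OF mQ mR])
  finally show ?thesis using k R by (intro that[of k]) linarith
qed

lemma killed_mean_convergent:
  assumes u: "u \<noteq> 0" and y: "0 < y"
  shows "convergent (killed_mean u y)"
proof -
  have "summable (overshoot u y)"
    by (rule summableI_nonneg_bounded[where x=overshoot_const]) (auto intro: overshoot_nonneg overshoot_const(2)[OF u y])
  note tail = this[unfolded summable_Cauchy]
  have "Cauchy (killed_mean u y)"
  proof (rule CauchyI')
    fix e :: real assume e: "0 < e"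
    obtain N where N: "S.prob (Alive u y N) < e / (4 * mean_bound)"
    proof (rule prob_Alive_small[OF u y])
      show "0 < e / (4 * mean_bound)" using e mean_bound(1) by simp
    qed (rule that)
    obtain N' where N': "\<And>m n. N' \<le> m \<Longrightarrow> norm (sum (overshoot u y) {m..<n}) < e / 2"
      using tail[rule_format, of "e / 2"] e by auto
    show "\<exists>M. \<forall>m\<ge>M. \<forall>n>m. dist (killed_mean u y m) (killed_mean u y n) < e"
    proof (intro exI[of _ "max N N'"] allI impI)
      fix m n assume m: "max N N' \<le> m" and n: "m < n"
      have "Alive u y m \<subseteq> Alive u y N" using m alive_mono[of N m u y] by (auto simp: Alive_def)
      then have "S.prob (Alive u y m) \<le> S.prob (Alive u y N)" by (rule S.finite_measure_mono) simp
      then have "S.prob (Alive u y m) < e / (4 * mean_bound)" using N by simp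
      then have 1: "2 * mean_bound * S.prob (Alive u y m) < e / 2" using mean_bound(1) by (simp add: field_simps)
      have 2: "sum (overshoot u y) {m..<n} < e / 2" using N'[of m n] m by simp
      have 3: "0 \<le> sum (overshoot u y) {m..<n}" by (intro sum_nonneg overshoot_nonneg)
      show "dist (killed_mean u y m) (killed_mean u y n) < e"
        using killed_mean_diff[OF u less_imp_le[OF n], of y] 1 2 3 unfolding dist_real_def abs_less_iff by linarith
    qed
  qed
  then show ?thesis by (rule Cauchy_convergent)
qed

definition V_vec :: "real ^ 'n \<Rightarrow> real \<Rightarrow> real" where
  "V_vec u y = lim (killed_mean u y)"

lemma killed_mean_tendsto: "u \<noteq> 0 \<Longrightarrow> 0 < y \<Longrightarrow> killed_mean u y \<longlonglongrightarrow> V_vec u y"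
  unfolding V_vec_def using killed_mean_convergent by (simp add: convergent_LIMSEQ_iff)

lemma V_vec_bounds:
  assumes u: "u \<noteq> 0" and y: "0 < y"
  shows "y - 2 * mean_bound \<le> V_vec u y" "V_vec u y \<le> y + 2 * mean_bound + overshoot_const" "0 \<le> V_vec u y"
  using killed_mean_bounds[OF u y] killed_mean_nonneg[OF u y] killed_mean_tendsto[OF u y]
  by (auto intro: LIMSEQ_le_const LIMSEQ_le_const2)

lemma V_vec_mono: "u \<noteq> 0 \<Longrightarrow> 0 < y \<Longrightarrow> y \<le> y' \<Longrightarrow> V_vec u y \<le> V_vec u y'"
  by (rule LIMSEQ_le[OF killed_mean_tendsto killed_mean_tendsto]) (auto intro: killed_mean_mono)

lemma V_vec_asymp:
  assumes u: "u \<noteq> 0"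
  shows "((\<lambda>y. V_vec u y / y) \<longlongrightarrow> 1) at_top"
proof (rule tendsto_sandwich)
  show "\<forall>\<^sub>F y in at_top. 1 - 2 * mean_bound * inverse y \<le> V_vec u y / y"
    using eventually_gt_at_top[of 0]
  proof eventually_elim
    case (elim y)
    have "1 - 2 * mean_bound * inverse y = (y - 2 * mean_bound) / y" using elim by (simp add: field_simps)
    also have "\<dots> \<le> V_vec u y / y" using elim by (intro divide_right_mono V_vec_bounds(1)[OF u elim]) simp
    finally show ?case .
  qed
  show "\<forall>\<^sub>F y in at_top. V_vec u y / y \<le> 1 + (2 * mean_bound + overshoot_const) * inverse y"
    using eventually_gt_at_top[of 0]
  proof eventually_elim
    case (elim y)
    have "V_vec u y / y \<le> (y + 2 * mean_bound + overshoot_const) / y" using elim by (intro divide_right_mono V_vec_bounds(2)[OF u elim]) simp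
    also have "\<dots> = 1 + (2 * mean_bound + overshoot_const) * inverse y" using elim by (simp add: field_simps)
    finally show ?case .
  qed
  have i: "(inverse \<longlongrightarrow> (0::real)) at_top" by (rule tendsto_inverse_0_at_top[OF filterlim_ident])
  show "((\<lambda>y. 1 - 2 * mean_bound * inverse y) \<longlongrightarrow> 1) at_top"
    using tendsto_diff[OF tendsto_const tendsto_mult_right_zero[OF i]] by simp
  show "((\<lambda>y. 1 + (2 * mean_bound + overshoot_const) * inverse y) \<longlongrightarrow> 1) at_top"
    using tendsto_add[OF tendsto_const tendsto_mult_right_zero[OF i]] by simp
qed

text \<open>The walk is conditioned on its first step.\<close>
lemma killed_mean_step:
  fixes y :: real
  assumes u: "u \<noteq> 0"
  defines "r \<equiv> \<lambda>A. y + ln (norm (A *v u) / norm u)"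
  shows "killed_mean u y (Suc n) = (\<integral>A. (if 0 < r A then killed_mean (A *v u) (r A) n else 0) \<partial>\<mu>)"
    "(\<lambda>A. if 0 < r A then killed_mean (A *v u) (r A) n else 0) \<in> borel_measurable \<mu>"
proof -
  let ?f = "\<lambda>\<omega>. indicator (Alive u y (Suc n)) \<omega> * (y + Sn u (Suc n) \<omega>)"
  have i: "integrable S ?f" by (rule integrable_ind_Sn[OF u Alive_sets])
  have e: "(\<integral>\<omega>. ?f (A ## \<omega>) \<partial>S) = (if 0 < r A then killed_mean (A *v u) (r A) n else 0)" if A: "A \<in> space \<mu>" for A
  proof -
    have A': "A \<in> GL" using A by (simp add: space_mu)
    have "(\<integral>\<omega>. ?f (A ## \<omega>) \<partial>S) = (\<integral>\<omega>. (if 0 < r A then indicator (Alive (A *v u) (r A) n) \<omega> * (r A + Sn (A *v u) n \<omega>) else 0) \<partial>S)"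
    proof (rule Bochner_Integration.integral_cong[OF refl])
      fix \<omega> assume w: "\<omega> \<in> space S"
      show "?f (A ## \<omega>) = (if 0 < r A then indicator (Alive (A *v u) (r A) n) \<omega> * (r A + Sn (A *v u) n \<omega>) else 0)"
        using w A' Stream_space[OF A' w]
        by (simp add: Alive_def indicator_def alive_Stream[OF A' w u] Sn_Stream[OF A' w u] r_def add.assoc)
    qed
    then show ?thesis by (simp add: killed_mean_def)
  qed
  show "killed_mean u y (Suc n) = (\<integral>A. (if 0 < r A then killed_mean (A *v u) (r A) n else 0) \<partial>\<mu>)"
    unfolding killed_mean_def integral_Stream(1)[OF i] by (intro Bochner_Integration.integral_cong refl) (simp add: e killed_mean_def)
  have "(\<lambda>A. \<integral>\<omega>. ?f (A ## \<omega>) \<partial>S) \<in> borel_measurable \<mu>" using integral_Stream(2)[OF i] by (rule borel_measurable_integrable)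
  then show "(\<lambda>A. if 0 < r A then killed_mean (A *v u) (r A) n else 0) \<in> borel_measurable \<mu>"
    by (subst measurable_cong[OF e[symmetric]])
qed

text \<open>The limit of \<open>killed_mean_step\<close>. The killed means are dominated by \<open>killed_mean_bounds\<close>, since the first step
  has a logarithmic moment.\<close>
lemma V_vec_harmonic:
  assumes u: "u \<noteq> 0" and y: "0 < y"
  defines "r \<equiv> \<lambda>A. y + ln (norm (A *v u) / norm u)"
  shows "integrable \<mu> (\<lambda>A. if 0 < r A then V_vec (A *v u) (r A) else 0)"
    "(\<integral>A. (if 0 < r A then V_vec (A *v u) (r A) else 0) \<partial>\<mu>) = V_vec u y"
proof -
  let ?f = "\<lambda>n A. if 0 < r A then killed_mean (A *v u) (r A) n else 0"
  let ?F = "\<lambda>A. if 0 < r A then V_vec (A *v u) (r A) else 0"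
  let ?w = "\<lambda>A. y + ln (matN A) + 2 * mean_bound + overshoot_const"
  have m: "?f n \<in> borel_measurable \<mu>" for n unfolding r_def by (rule killed_mean_step(2)[OF u])
  have l: "(\<lambda>n. ?f n A) \<longlonglongrightarrow> ?F A" if "A \<in> space \<mu>" for A
  proof -
    have "A *v u \<noteq> 0" using that u by (simp add: space_mu)
    then show ?thesis using killed_mean_tendsto[of "A *v u" "r A"] by simp
  qed
  have mF: "?F \<in> borel_measurable \<mu>" by (rule borel_measurable_LIMSEQ_real[OF l m])
  have w: "integrable \<mu> ?w" using integrable_lnN by simp
  have b: "norm (?f n A) \<le> ?w A" if A: "A \<in> space \<mu>" for n A
  proof -
    have A': "A \<in> GL" using A by (simp add: space_mu)
    then have Au: "A *v u \<noteq> 0" using u by simp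
    have rA: "r A \<le> y + ln (matN A)" unfolding r_def using norm_ratio_bounds(3)[OF A' u] by linarith
    show ?thesis
    proof (cases "0 < r A")
      case True
      then show ?thesis using killed_mean_bounds(2)[OF Au True, of n] killed_mean_nonneg[OF Au True, of n] rA by simp
    next
      case False
      then show ?thesis using y mean_bound(1) overshoot_const(1) lnN_nonneg[OF A'] by simp
    qed
  qed
  show "integrable \<mu> ?F"
    by (rule integrable_dominated_convergence[where s="?f", OF mF m w]) (rule AE_I2, erule l, rule AE_I2, erule b)
  have lim: "(\<lambda>n. \<integral>A. ?f n A \<partial>\<mu>) \<longlonglongrightarrow> (\<integral>A. ?F A \<partial>\<mu>)"
    by (rule integral_dominated_convergence[where s="?f", OF mF m w]) (rule AE_I2, erule l, rule AE_I2, erule b)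
  have eq: "(\<lambda>n. \<integral>A. ?f n A \<partial>\<mu>) = (\<lambda>n. killed_mean u y (Suc n))" unfolding r_def killed_mean_step(1)[OF u] by simp
  have "(\<lambda>n. killed_mean u y (Suc n)) \<longlonglongrightarrow> V_vec u y" by (rule LIMSEQ_Suc[OF killed_mean_tendsto[OF u y]])
  then show "(\<integral>A. ?F A \<partial>\<mu>) = V_vec u y" by (rule LIMSEQ_unique[OF lim[unfolded eq]])
qed

text \<open>From any height the walk climbs above \<open>2 * mean_bound\<close> with positive probability before it exits, by
  finitely many steps that each gain at least \<open>d\<close>; there the lower bound is positive.\<close>
lemma V_vec_pos:
  assumes "u \<noteq> 0" "0 < y"
  shows "0 < V_vec u y"
proof -
  obtain d p where d: "0 < d" and p: "0 < p" and step: "\<And>u. u \<noteq> 0 \<Longrightarrow> p \<le> measure \<mu> {A\<in>space \<mu>. d < ln (norm (A *v u) / norm u)}"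
    by (rule unifpos_step, rule that)
  have main: "p ^ j \<le> V_vec u y" if "u \<noteq> 0" "0 < y" "2 * mean_bound + 1 - real j * d \<le> y" for j u y
    using that
  proof (induction j arbitrary: u y)
    case 0
    then show ?case using V_vec_bounds(1)[of u y] by simp
  next
    case (Suc j)
    let ?r = "\<lambda>A. y + ln (norm (A *v u) / norm u)"
    let ?E = "{A\<in>space \<mu>. d < ln (norm (A *v u) / norm u)}"
    have mE: "?E \<in> sets \<mu>" by measurable
    have "p ^ Suc j \<le> p ^ j * measure \<mu> ?E" using step[OF Suc.prems(1)] p by (simp add: mult.commute)
    also have "\<dots> = (\<integral>A. p ^ j * indicator ?E A \<partial>\<mu>)" using mE by simp
    also have "\<dots> \<le> (\<integral>A. (if 0 < ?r A then V_vec (A *v u) (?r A) else 0) \<partial>\<mu>)"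
    proof (rule integral_mono[OF _ V_vec_harmonic(1)[OF Suc.prems(1,2)]])
      show "integrable \<mu> (\<lambda>A. p ^ j * indicator ?E A)"
        by (intro integrable_mult_right integrable_real_indicator mE) (simp add: less_top[symmetric])
      fix A assume A: "A \<in> space \<mu>"
      then have Au: "A *v u \<noteq> 0" using Suc.prems(1) by (simp add: space_mu)
      show "p ^ j * indicator ?E A \<le> (if 0 < ?r A then V_vec (A *v u) (?r A) else 0)"
      proof (cases "A \<in> ?E")
        case True
        have "d < ln (norm (A *v u) / norm u)" using True by simp
        then have r: "0 < ?r A" "2 * mean_bound + 1 - real j * d \<le> ?r A"
          using Suc.prems(2,3) d by (auto simp: algebra_simps)
        show ?thesis using Suc.IH[OF Au r] r True by simp
      next
        case False
        then have "indicator ?E A = (0::real)" by simp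
        then show ?thesis using V_vec_bounds(3)[OF Au, of "?r A"] by auto
      qed
    qed
    also have "\<dots> = V_vec u y" by (rule V_vec_harmonic(2)[OF Suc.prems(1,2)])
    finally show ?case .
  qed
  obtain j :: nat where "(2 * mean_bound + 1) / d < real j" using reals_Archimedean2 by blast
  then have "2 * mean_bound + 1 - real j * d \<le> y" using d assms(2) by (simp add: field_simps)
  then have "p ^ j \<le> V_vec u y" by (rule main[OF assms])
  then show ?thesis using p by (meson less_le_trans zero_less_power)
qed

end

section \<open>From lines to vectors\<close>

lemma space_proj_borel: "space proj_borel = (proj_space :: 'n::finite line set)"
  unfolding proj_borel_def by (rule space_measure_of) auto

lemma span_measurable: "(\<lambda>v. span {v}) \<in> measurable (restrict_space borel (- {0})) (proj_borel :: 'n::finite line measure)"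
  unfolding proj_borel_def
proof (rule measurable_measure_of)
  show "(\<lambda>v. span {v}) \<in> space (restrict_space borel (- {0})) \<rightarrow> (proj_space :: 'n line set)"
    by (auto simp: space_restrict_space proj_space_def)
  fix U :: "'n line set" assume U: "U \<in> {U. U \<subseteq> proj_space \<and> open {v. v \<noteq> 0 \<and> span {v} \<in> U}}"
  have "(\<lambda>v. span {v}) -` U \<inter> space (restrict_space borel (- {0})) = {v. v \<noteq> 0 \<and> span {v} \<in> U}"
    by (auto simp: space_restrict_space)
  moreover have "{v. v \<noteq> 0 \<and> span {v} \<in> U} \<in> sets (restrict_space borel (- {0}))"
    using U by (subst sets_restrict_space_iff) auto
  ultimately show "(\<lambda>v. span {v}) -` U \<inter> space (restrict_space borel (- {0})) \<in> sets (restrict_space borel (- {0}))" by simp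
qed auto

text \<open>A continuous function of lines is measurable: preimages of open sets are among the generators of
  \<open>proj_borel\<close>.\<close>
lemma proj_borel_measurableI:
  fixes F :: "'n::finite line \<Rightarrow> 'b::topological_space"
  assumes F: "continuous_on (- {0}) (\<lambda>v. F (span {v}))"
  shows "F \<in> borel_measurable proj_borel"
proof (rule borel_measurableI)
  fix U :: "'b set" assume U: "open U"
  let ?P = "F -` U \<inter> proj_space"
  have e: "{v. v \<noteq> 0 \<and> span {v} \<in> ?P} = (- {0}) \<inter> (\<lambda>v. F (span {v})) -` U" by (auto simp: proj_space_def)
  have "open {v. v \<noteq> 0 \<and> span {v} \<in> ?P}"
    unfolding e by (rule continuous_open_preimage[OF F _ U]) (simp add: open_Compl)
  then have "?P \<in> {U. U \<subseteq> proj_space \<and> open {v. v \<noteq> 0 \<and> span {v} \<in> U}}" by simp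
  then show "F -` U \<inter> space proj_borel \<in> sets proj_borel"
    unfolding space_proj_borel unfolding proj_borel_def by (subst sets_measure_of) (auto intro: sigma_sets.Basic)
qed

text \<open>The orthogonal projection of the \<open>i\<close>-th basis vector to a line.\<close>
definition line_col :: "'n::finite \<Rightarrow> 'n line \<Rightarrow> real ^ 'n" where
  "line_col i l = (THE w. \<forall>v\<in>l - {0}. w = (v $ i / (norm v)\<^sup>2) *\<^sub>R v)"

lemma line_col_span:
  fixes v :: "real ^ 'n::finite"
  assumes v: "v \<noteq> 0"
  shows "line_col i (span {v}) = (v $ i / (norm v)\<^sup>2) *\<^sub>R v"
  unfolding line_col_def
proof (rule the_equality)
  show "\<forall>w\<in>span {v} - {0}. (v $ i / (norm v)\<^sup>2) *\<^sub>R v = (w $ i / (norm w)\<^sup>2) *\<^sub>R w"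
  proof
    fix w assume "w \<in> span {v} - {0}"
    then obtain c where w: "w = c *\<^sub>R v" and c: "c \<noteq> 0" by (auto simp: span_singleton)
    have "c * v $ i / (c\<^sup>2 * (norm v)\<^sup>2) * c = v $ i / (norm v)\<^sup>2" using c by (simp add: power2_eq_square)
    then show "(v $ i / (norm v)\<^sup>2) *\<^sub>R v = (w $ i / (norm w)\<^sup>2) *\<^sub>R w"
      unfolding w by (simp add: power_mult_distrib)
  qed
  show "w = (v $ i / (norm v)\<^sup>2) *\<^sub>R v" if "\<forall>v\<in>span {v} - {0}. w = (v $ i / (norm v)\<^sup>2) *\<^sub>R v" for w
    using that v by (simp add: span_base)
qed

lemma line_col_measurable [measurable]: "line_col i \<in> borel_measurable proj_borel"
proof (rule proj_borel_measurableI)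
  have "continuous_on (- {0}) (\<lambda>v. (v $ i / (norm v)\<^sup>2) *\<^sub>R v)" by (intro continuous_intros) auto
  then show "continuous_on (- {0}) (\<lambda>v. line_col i (span {v}))"
    by (rule continuous_on_eq) (simp add: line_col_span)
qed

primrec line_pick :: "'n::finite list \<Rightarrow> 'n line \<Rightarrow> real ^ 'n" where
  "line_pick [] l = 0"
| "line_pick (i # is) l = (if line_col i l \<noteq> 0 then line_col i l else line_pick is l)"

lemma line_pick_measurable [measurable]: "line_pick is \<in> borel_measurable proj_borel"
  by (induction "is") (simp_all add: line_pick.simps[abs_def])

lemma line_pick_span:
  assumes v: "v \<noteq> 0" and ex: "\<exists>i\<in>set is. v $ i \<noteq> 0"
  shows "\<exists>c. c \<noteq> 0 \<and> line_pick is (span {v}) = c *\<^sub>R v"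
  using ex
proof (induction "is")
  case (Cons i "is")
  show ?case
  proof (cases "v $ i = 0")
    case True
    then show ?thesis using Cons by (simp add: line_col_span[OF v])
  next
    case False
    then show ?thesis using v by (intro exI[of _ "v $ i / (norm v)\<^sup>2"]) (simp add: line_col_span[OF v])
  qed
qed simp

text \<open>A measurable choice of a nonzero vector on every line: the first nonzero column of the orthogonal projection,
  which is a continuous function of the line.\<close>
definition line_vec :: "'n::finite line \<Rightarrow> real ^ 'n" where
  "line_vec = line_pick (SOME xs. set xs = UNIV)"

lemma line_vec_measurable [measurable]: "line_vec \<in> borel_measurable proj_borel"
  unfolding line_vec_def by simp

lemma line_vec_span:
  fixes v :: "real ^ 'n::finite"
  assumes "v \<noteq> 0"
  obtains c where "c \<noteq> 0" "line_vec (span {v}) = c *\<^sub>R v"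
proof -
  have "set (SOME xs. set xs = (UNIV :: 'n set)) = UNIV" by (rule someI_ex[OF finite_list]) simp
  moreover obtain i where "v $ i \<noteq> 0" using assms by (auto simp: vec_eq_iff)
  ultimately show ?thesis using line_pick_span[OF assms, of "SOME xs. set xs = UNIV"] that by (auto simp: line_vec_def)
qed

lemma span_scaleR_singleton:
  fixes v :: "real ^ 'n"
  assumes "c \<noteq> 0"
  shows "span {c *\<^sub>R v} = span {v}"
proof (rule span_eq[THEN iffD2], intro conjI)
  have "v = (1 / c) *\<^sub>R (c *\<^sub>R v)" using assms by simp
  then show "{v} \<subseteq> span {c *\<^sub>R v}" by (metis empty_subsetI insert_subset singletonI span_base span_scale)
qed (simp add: span_base span_scale)

lemma line_vec:
  assumes "l \<in> proj_space"
  shows "line_vec l \<noteq> 0" "span {line_vec l} = l"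
proof -
  obtain v where v: "v \<noteq> 0" "l = span {v}" using assms by (auto simp: proj_space_def)
  obtain c where "c \<noteq> 0" "line_vec (span {v}) = c *\<^sub>R v" by (rule line_vec_span[OF v(1)])
  then show "line_vec l \<noteq> 0" "span {line_vec l} = l" using v by (simp_all add: span_scaleR_singleton)
qed

context gl_walk
begin

lemma act_measurable [measurable]: "(\<lambda>(A, l). act A l) \<in> measurable (\<mu> \<Otimes>\<^sub>M proj_borel) proj_borel"
proof -
  have "(\<lambda>p. fst p *v line_vec (snd p)) \<in> measurable (\<mu> \<Otimes>\<^sub>M proj_borel) (restrict_space borel (- {0}))"
  proof (rule measurable_restrict_space2)
    show "(\<lambda>p. fst p *v line_vec (snd p)) \<in> space (\<mu> \<Otimes>\<^sub>M proj_borel) \<rightarrow> - {0}"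
      by (auto simp: space_pair_measure space_mu space_proj_borel line_vec)
  qed measurable
  then have "(\<lambda>p. span {fst p *v line_vec (snd p)}) \<in> measurable (\<mu> \<Otimes>\<^sub>M proj_borel) proj_borel"
    by (rule measurable_compose) (rule span_measurable)
  then show ?thesis
  proof (rule measurable_cong[THEN iffD1, rotated])
    fix p assume "p \<in> space (\<mu> \<Otimes>\<^sub>M (proj_borel :: 'n line measure))"
    then have "snd p \<in> proj_space" by (auto simp: space_pair_measure space_proj_borel)
    then have "span {line_vec (snd p)} = snd p" by (rule line_vec)
    then show "span {fst p *v line_vec (snd p)} = (case p of (A, l) \<Rightarrow> act A l)"
      using act_span[of "fst p" "line_vec (snd p)"] by (simp add: case_prod_beta)
  qed
qed

end

text \<open>The random walk only sees the line through a vector, so the invariant measure on lines can be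
  carried by vectors.\<close>
lemma centered_walkI:
  fixes \<mu> :: "'n::finite mat measure" and \<nu> :: "'n line measure"
  assumes prob: "borel_prob_on_GL \<mu>" and expm: "exponential_moment \<mu>" and SI: "strongly_irreducible \<mu>"
    and contr: "contracting \<mu>" and inv: "invariant_prob \<mu> \<nu>" and lyap: "lyapunov \<mu> \<nu> = 0"
    and pos: "uniformly_positive \<mu>"
  shows "centered_walk \<mu> (distr \<nu> borel line_vec)"
proof -
  interpret gl_walk \<mu> using prob unfolding borel_prob_on_GL_def by (intro gl_walk.intro gl_walk_axioms.intro) auto
  have nu: "prob_space \<nu>" and [measurable_cong]: "sets \<nu> = sets proj_borel"
    and stat: "distr (\<mu> \<Otimes>\<^sub>M \<nu>) proj_borel (\<lambda>(A, l). act A l) = \<nu>"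
    using inv by (auto simp: invariant_prob_def)
  interpret nu: prob_space \<nu> by (rule nu)
  interpret munu: pair_prob_space \<mu> \<nu> ..
  have snu: "space \<nu> = proj_space" using sets_eq_imp_space_eq[OF \<open>sets \<nu> = sets proj_borel\<close>] by (simp add: space_proj_borel)
  let ?e = "distr \<nu> borel (line_vec :: 'n line \<Rightarrow> real ^ 'n)"
  show ?thesis
  proof (intro centered_walk.intro moment_walk.intro contracting_walk.intro stationary_walk.intro
      stationary_walk_axioms.intro contracting_walk_axioms.intro moment_walk_axioms.intro centered_walk_axioms.intro)
    show "gl_walk \<mu>" ..
    show "prob_space ?e" by (rule nu.prob_space_distr) measurable
    show "sets ?e = sets borel" by simp
    show "AE x in ?e. x \<noteq> 0"
      by (subst AE_distr_iff) (auto simp: snu line_vec intro!: AE_I2)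
    fix f :: "real ^ 'n \<Rightarrow> real" and B :: real
    assume [measurable]: "f \<in> borel_measurable borel" and B: "\<And>x. \<bar>f x\<bar> \<le> B" and hom: "\<And>c x. c \<noteq> 0 \<Longrightarrow> f (c *\<^sub>R x) = f x"
    have "(\<integral>x. f x \<partial>?e) = (\<integral>l. f (line_vec l) \<partial>\<nu>)" by (rule integral_distr) measurable
    also have "\<dots> = (\<integral>p. f (line_vec (case p of (A, l) \<Rightarrow> act A l)) \<partial>(\<mu> \<Otimes>\<^sub>M \<nu>))"
      by (subst stat[symmetric], rule integral_distr) measurable
    also have "\<dots> = (\<integral>p. f (fst p *v line_vec (snd p)) \<partial>(\<mu> \<Otimes>\<^sub>M \<nu>))"
    proof (rule Bochner_Integration.integral_cong[OF refl])
      fix p assume p: "p \<in> space (\<mu> \<Otimes>\<^sub>M \<nu>)"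
      then have p1: "fst p \<in> GL" and p2: "snd p \<in> proj_space" by (auto simp: space_pair_measure space_mu snu)
      let ?v = "line_vec (snd p)"
      have nz: "fst p *v ?v \<noteq> 0" using p1 line_vec(1)[OF p2] by simp
      have e: "act (fst p) (snd p) = span {fst p *v ?v}" using act_span[of "fst p" ?v] line_vec(2)[OF p2] by simp
      obtain c where "c \<noteq> 0" "line_vec (span {fst p *v ?v}) = c *\<^sub>R (fst p *v ?v)" by (rule line_vec_span[OF nz])
      then show "f (line_vec (case p of (A, l) \<Rightarrow> act A l)) = f (fst p *v ?v)"
        by (simp add: case_prod_beta e hom)
    qed
    also have "\<dots> = (\<integral>A. \<integral>l. f (A *v line_vec l) \<partial>\<nu> \<partial>\<mu>)"
    proof -
      have "integrable (\<mu> \<Otimes>\<^sub>M \<nu>) (\<lambda>p. f (fst p *v line_vec (snd p)))"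
        by (rule munu.P.integrable_const_bound[where B=B]) (auto simp: B)
      then show ?thesis using munu.integral_fst'[of "\<lambda>p. f (fst p *v line_vec (snd p))"] by simp
    qed
    also have "\<dots> = (\<integral>A. \<integral>x. f (A *v x) \<partial>?e \<partial>\<mu>)"
      by (intro Bochner_Integration.integral_cong refl integral_distr[symmetric]) measurable
    finally show "(\<integral>x. f x \<partial>?e) = (\<integral>A. \<integral>x. f (A *v x) \<partial>?e \<partial>\<mu>)" .
  next
    have "(\<integral>x. \<integral>A. ln (norm (A *v x) / norm x) \<partial>\<mu> \<partial>?e) = (\<integral>l. \<integral>A. ln (norm (A *v line_vec l) / norm (line_vec l)) \<partial>\<mu> \<partial>\<nu>)"
      by (rule integral_distr) measurable
    also have "\<dots> = lyapunov \<mu> \<nu>"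
      unfolding lyapunov_def
    proof (intro Bochner_Integration.integral_cong refl)
      fix l A assume l: "l \<in> space \<nu>"
      then have l': "l \<in> proj_space" by (simp add: snu)
      show "ln (norm (A *v line_vec l) / norm (line_vec l)) = rho (A, l)"
        using rho_span[OF line_vec(1)[OF l'], of A] line_vec(2)[OF l'] by simp
    qed
    finally show "(\<integral>x. \<integral>A. ln (norm (A *v x) / norm x) \<partial>\<mu> \<partial>?e) = 0" using lyap by simp
  qed (rule SI contr expm pos)+
qed

section \<open>From the sequence of matrices to the space of streams\<close>

lemma (in gl_walk) distr_iid:
  fixes M :: "'w measure"
  assumes iid: "iid_with_law M g \<mu>"
  defines "X \<equiv> \<lambda>\<omega>. to_stream (\<lambda>n. g (Suc n) \<omega>)"
  shows "X \<in> measurable M S" "distr M S X = S"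
proof -
  interpret M: prob_space M using iid by (simp add: iid_with_law_def)
  have ind: "M.indep_vars (\<lambda>_. \<mu>) g {1..}" and law: "\<And>n. 1 \<le> n \<Longrightarrow> distr M \<mu> (g n) = \<mu>"
    using iid by (auto simp: iid_with_law_def)
  have g: "g n \<in> measurable M \<mu>" if "n \<in> {1..}" for n using ind that by (auto simp: M.indep_vars_def)
  then have [measurable]: "g (Suc n) \<in> measurable M \<mu>" for n by simp
  show X: "X \<in> measurable M S" unfolding X_def
    by (rule measurable_stream_space2) (simp add: to_stream_def)
  let ?Y = "\<lambda>\<omega>. \<lambda>i\<in>{1..}. g i \<omega>"
  have Y: "?Y \<in> measurable M (PiM {1..} (\<lambda>_. \<mu>))" by (rule measurable_restrict) (rule g)
  have Z: "(\<lambda>\<omega>. \<lambda>n\<in>UNIV. \<omega> (Suc n)) \<in> measurable (PiM {1..} (\<lambda>_. \<mu>)) (PiM UNIV (\<lambda>_. \<mu>))"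
    by (rule measurable_restrict) (rule measurable_component_singleton, simp)
  have "distr M (PiM {1..} (\<lambda>_. \<mu>)) ?Y = PiM {1..} (\<lambda>i. distr M \<mu> (g i))"
    using M.indep_vars_iff_distr_eq_PiM'[of "{1..}" g "\<lambda>_. \<mu>"] g ind by auto
  also have "\<dots> = PiM {1..} (\<lambda>_. \<mu>)" by (rule PiM_cong) (auto simp: law)
  finally have dY: "distr M (PiM {1..} (\<lambda>_. \<mu>)) ?Y = PiM {1..} (\<lambda>_. \<mu>)" .
  have "PiM UNIV (\<lambda>_. \<mu>) = distr (PiM {1..} (\<lambda>_. \<mu>)) (PiM UNIV (\<lambda>_. \<mu>)) (\<lambda>\<omega>. \<lambda>n\<in>UNIV. \<omega> (Suc n))"
    using distr_PiM_reindex[of "{1..}" "\<lambda>_. \<mu>" Suc UNIV] prob_space_axioms by simp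
  also have "\<dots> = distr M (PiM UNIV (\<lambda>_. \<mu>)) (\<lambda>\<omega> n. g (Suc n) \<omega>)"
    by (subst dY[symmetric], subst distr_distr[OF Z Y]) (simp add: comp_def restrict_def)
  finally have d: "PiM UNIV (\<lambda>_. \<mu>) = distr M (PiM UNIV (\<lambda>_. \<mu>)) (\<lambda>\<omega> n. g (Suc n) \<omega>)" .
  have m: "(\<lambda>\<omega> n. g (Suc n) \<omega>) \<in> measurable M (PiM UNIV (\<lambda>_. \<mu>))"
    by (rule measurable_PiM_single') (auto simp: space_PiM dest: measurable_space[OF \<open>g (Suc _) \<in> measurable M \<mu>\<close>])
  have "distr M S X = distr (distr M (PiM UNIV (\<lambda>_. \<mu>)) (\<lambda>\<omega> n. g (Suc n) \<omega>)) S to_stream"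
    by (subst distr_distr[OF measurable_to_stream m]) (simp add: comp_def X_def)
  then show "distr M S X = S" unfolding d[symmetric] by (simp only: stream_space_eq_distr[symmetric])
qed

lemma left_prod_to_stream: "left_prod h n = lprod n (to_stream (\<lambda>n. h (Suc n)))"
  by (induction n) (simp_all add: to_stream_def)

lemma exit_time_gr: "exit_time h x y > enat n \<longleftrightarrow> (\<forall>k\<in>{1..n}. 0 < y + walk h x k)"
proof -
  have "exit_time h x y > enat n \<longleftrightarrow> enat (Suc n) \<le> exit_time h x y" by (simp add: Suc_ile_eq)
  also have "\<dots> \<longleftrightarrow> (\<forall>k\<in>{k. 1 \<le> k \<and> y + walk h x k \<le> 0}. Suc n \<le> k)"
    unfolding exit_time_def by (simp add: le_INF_iff)
  also have "\<dots> \<longleftrightarrow> (\<forall>k\<in>{1..n}. 0 < y + walk h x k)" 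
    unfolding Ball_def mem_Collect_eq atLeastAtMost_iff by (metis not_less_eq_eq not_le)
  finally show ?thesis .
qed

lemma (in centered_walk) walk_Sn:
  fixes v :: "real ^ 'n"
  assumes h: "to_stream (\<lambda>n. h (Suc n)) \<in> space S" and v: "A *v v \<noteq> 0"
  shows "walk h (A, span {v}) n = Sn (A *v v) n (to_stream (\<lambda>n. h (Suc n)))"
proof (induction n)
  case 0
  then show ?case using v by (simp add: walk_def)
next
  case (Suc n)
  let ?w = "to_stream (\<lambda>n. h (Suc n))"
  have e: "chain h (A, span {v}) (Suc n) = (h (Suc n), span {lprod n ?w *v (A *v v)})"
    by (simp add: act_span left_prod_to_stream matrix_vector_mul_assoc)
  have "walk h (A, span {v}) (Suc n) = walk h (A, span {v}) n + rho (chain h (A, span {v}) (Suc n))"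
    by (simp add: walk_def)
  also have "rho (chain h (A, span {v}) (Suc n)) = ln (norm (h (Suc n) *v (lprod n ?w *v (A *v v))) / norm (lprod n ?w *v (A *v v)))"
    unfolding e by (rule rho_span[OF lprod_nz[OF h v]])
  also have "h (Suc n) = ?w !! n" by (simp add: to_stream_def)
  finally show ?case unfolding Suc Sn_Suc[OF h v] .
qed

locale iid_walk = centered_walk \<mu> \<eta> for \<mu> :: "'n::finite mat measure" and \<eta> +
  fixes M :: "'w measure" and g :: "nat \<Rightarrow> 'w \<Rightarrow> 'n mat"
  assumes iid: "iid_with_law M g \<mu>"
begin

definition X :: "'w \<Rightarrow> 'n mat stream" where
  "X \<omega> = to_stream (\<lambda>n. g (Suc n) \<omega>)"

lemma X_measurable [measurable]: "X \<in> measurable M S" and distr_X: "distr M S X = S"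
  using distr_iid[OF iid] by (simp_all add: X_def[abs_def])

lemma survives_iff:
  assumes w: "\<omega> \<in> space M" and v: "A *v v \<noteq> 0"
  shows "\<omega> \<in> survives M g (A, span {v}) y n \<longleftrightarrow> X \<omega> \<in> Alive (A *v v) y n"
    "walk (\<lambda>k. g k \<omega>) (A, span {v}) n = Sn (A *v v) n (X \<omega>)"
proof -
  have X: "X \<omega> \<in> space S" using measurable_space[OF X_measurable w] .
  show walk: "walk (\<lambda>k. g k \<omega>) (A, span {v}) n = Sn (A *v v) n (X \<omega>)" for n
    unfolding X_def by (rule walk_Sn[OF X[unfolded X_def] v])
  show "\<omega> \<in> survives M g (A, span {v}) y n \<longleftrightarrow> X \<omega> \<in> Alive (A *v v) y n"
    using w X by (simp add: survives_def exit_time_gr walk Alive_def alive_def)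
qed

lemma killed_expectation_eq:
  assumes v: "A *v v \<noteq> 0"
  shows "killed_expectation M g (A, span {v}) y = killed_mean (A *v v) y"
proof
  fix n
  have "killed_expectation M g (A, span {v}) y n = (\<integral>\<omega>. indicator (Alive (A *v v) y n) (X \<omega>) * (y + Sn (A *v v) n (X \<omega>)) \<partial>M)"
    unfolding killed_expectation_def set_lebesgue_integral_def
    by (intro Bochner_Integration.integral_cong refl) (simp add: survives_iff[OF _ v] indicator_def)
  also have "\<dots> = (\<integral>\<omega>. indicator (Alive (A *v v) y n) \<omega> * (y + Sn (A *v v) n \<omega>) \<partial>distr M S X)"
    by (rule integral_distr[symmetric]) measurable
  finally show "killed_expectation M g (A, span {v}) y n = killed_mean (A *v v) y n" by (simp only: distr_X killed_mean_def)
qed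

lemma V_eq: "A *v v \<noteq> 0 \<Longrightarrow> V M g (A, span {v}) y = V_vec (A *v v) y"
  by (simp add: V_def V_vec_def killed_expectation_eq)

lemma V_step:
  assumes v: "A *v v \<noteq> 0" and y: "0 < y"
  shows "(LINT \<omega>:survives M g (A, span {v}) y 1|M.
    V M g (chain (\<lambda>k. g k \<omega>) (A, span {v}) 1) (y + walk (\<lambda>k. g k \<omega>) (A, span {v}) 1)) = V M g (A, span {v}) y"
proof -
  let ?u = "A *v v"
  let ?r = "\<lambda>B. y + ln (norm (B *v ?u) / norm ?u)"
  let ?F = "\<lambda>B. if 0 < ?r B then V_vec (B *v ?u) (?r B) else 0"
  have law: "distr M \<mu> (g 1) = \<mu>" and g: "g 1 \<in> measurable M \<mu>"
    using iid by (auto simp: iid_with_law_def prob_space.indep_vars_def)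
  have "(LINT \<omega>:survives M g (A, span {v}) y 1|M.
    V M g (chain (\<lambda>k. g k \<omega>) (A, span {v}) 1) (y + walk (\<lambda>k. g k \<omega>) (A, span {v}) 1)) = (\<integral>\<omega>. ?F (g 1 \<omega>) \<partial>M)"
    unfolding set_lebesgue_integral_def
  proof (intro Bochner_Integration.integral_cong refl)
    fix \<omega> assume w: "\<omega> \<in> space M"
    have X: "X \<omega> \<in> space S" using measurable_space[OF X_measurable w] .
    have X0: "X \<omega> !! 0 = g 1 \<omega>" by (simp add: X_def to_stream_def)
    then have gGL: "g 1 \<omega> \<in> GL" using snth_GL[OF X, of 0] by simp
    have S1: "Sn ?u 1 (X \<omega>) = ln (norm (g 1 \<omega> *v ?u) / norm ?u)"
      using Sn_Suc[OF X v, of 0] X0 v by simp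
    have c: "chain (\<lambda>k. g k \<omega>) (A, span {v}) 1 = (g 1 \<omega>, span {?u})" by (simp add: act_span)
    have V: "V M g (g 1 \<omega>, span {?u}) z = V_vec (g 1 \<omega> *v ?u) z" for z
      using gGL v by (intro V_eq) simp
    have s: "\<omega> \<in> survives M g (A, span {v}) y 1 \<longleftrightarrow> 0 < ?r (g 1 \<omega>)"
      using X S1 by (simp add: survives_iff[OF w v] Alive_def alive_def)
    show "indicat_real (survives M g (A, span {v}) y 1) \<omega> *\<^sub>R V M g (chain (\<lambda>k. g k \<omega>) (A, span {v}) 1) (y + walk (\<lambda>k. g k \<omega>) (A, span {v}) 1)
      = ?F (g 1 \<omega>)"
      unfolding c survives_iff(2)[OF w v] S1 V using s by (simp add: indicator_def)
  qed
  also have "\<dots> = (\<integral>B. ?F B \<partial>distr M \<mu> (g 1))"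
    by (rule integral_distr[symmetric, OF g borel_measurable_integrable[OF V_vec_harmonic(1)[OF v y]]])
  also have "\<dots> = V_vec ?u y" unfolding law by (rule V_vec_harmonic(2)[OF v y])
  finally show ?thesis by (simp only: V_eq[OF v])
qed

end

theorem theorem2p2:
  fixes \<mu> :: "'n::finite mat measure"
    and \<nu> :: "'n line measure"
    and M :: "'w measure"
    and g :: "nat \<Rightarrow> 'w \<Rightarrow> 'n mat"
  assumes "borel_prob_on_GL \<mu>"
    and "exponential_moment \<mu>"
    and "strongly_irreducible \<mu>"
    and "contracting \<mu>"
    and "invariant_prob \<mu> \<nu>" and "lyapunov \<mu> \<nu> = 0"
    and "uniformly_positive \<mu>"
    and "iid_with_law M g \<mu>"
  shows
    "((\<forall>x\<in>state_space. \<forall>y>0.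
         convergent (killed_expectation M g x y) \<and> V M g x y > 0) \<and>
      (\<forall>x\<in>state_space. mono_on {0<..} (V M g x)) \<and>
      (\<exists>a>0. \<exists>c>0. \<forall>x\<in>state_space. \<forall>y>0.
         max 0 (y - a) \<le> V M g x y \<and> V M g x y \<le> c * (1 + y)) \<and>
      (\<forall>x\<in>state_space. ((\<lambda>y. V M g x y / y) \<longlongrightarrow> 1) at_top)) \<and>
     (\<forall>x\<in>state_space. \<forall>y>0.
        (LINT \<omega>:survives M g x y 1|M.
           V M g (chain (\<lambda>k. g k \<omega>) x 1) (y + walk (\<lambda>k. g k \<omega>) x 1)) = V M g x y)"
proof -
  interpret iid_walk \<mu> "distr \<nu> borel line_vec" M g
    by (intro iid_walk.intro iid_walk_axioms.intro centered_walkI assms)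
  have st: thesis
    if x: "x \<in> state_space" and *: "\<And>A v. x = (A, span {v}) \<Longrightarrow> A *v v \<noteq> 0 \<Longrightarrow> thesis"
    for x :: "'n mat \<times> 'n line" and thesis
  proof -
    obtain A v where "x = (A, span {v})" "A \<in> GL" "v \<noteq> 0"
      using x by (auto simp: state_space_def proj_space_def)
    then show thesis by (intro *[of A v]) simp_all
  qed
  let ?c = "1 + 2 * mean_bound + overshoot_const"
  have c: "1 \<le> ?c" using mean_bound(1) overshoot_const(1) by simp
  show ?thesis
  proof (intro conjI)
    show "\<forall>x\<in>state_space. \<forall>y>0. convergent (killed_expectation M g x y) \<and> V M g x y > 0"
    proof (intro ballI allI impI)
      fix x :: "'n mat \<times> 'n line" and y assume x: "x \<in> state_space" and y: "0 < (y::real)"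
      show "convergent (killed_expectation M g x y) \<and> V M g x y > 0"
        by (rule st[OF x]) (simp add: V_eq killed_expectation_eq killed_mean_convergent y V_vec_pos)
    qed
    show "\<forall>x\<in>state_space. mono_on {0<..} (V M g x)"
    proof
      fix x :: "'n mat \<times> 'n line" assume x: "x \<in> state_space"
      show "mono_on {0<..} (V M g x)"
        by (rule st[OF x]) (auto intro!: mono_onI simp: V_eq V_vec_mono)
    qed
    have "\<forall>x\<in>(state_space :: ('n mat \<times> 'n line) set). \<forall>y>0. max 0 (y - 2 * mean_bound) \<le> V M g x y \<and> V M g x y \<le> ?c * (1 + y)"
    proof (intro ballI allI impI)
      fix x :: "'n mat \<times> 'n line" and y assume x: "x \<in> state_space" and y: "0 < (y::real)"
      have "y + 2 * mean_bound + overshoot_const \<le> ?c * (1 + y)"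
        using y mean_bound(1) overshoot_const(1) by (simp add: algebra_simps)
      moreover have "y - 2 * mean_bound \<le> V M g x y \<and> V M g x y \<le> y + 2 * mean_bound + overshoot_const \<and> 0 \<le> V M g x y"
        by (rule st[OF x]) (simp add: V_eq V_vec_bounds y)
      ultimately show "max 0 (y - 2 * mean_bound) \<le> V M g x y \<and> V M g x y \<le> ?c * (1 + y)" by linarith
    qed
    then show "\<exists>a>0. \<exists>c>0. \<forall>x\<in>state_space. \<forall>y>0. max 0 (y - a) \<le> V M g x y \<and> V M g x y \<le> c * (1 + y)"
      using mean_bound(1) c by (intro exI[of _ "2 * mean_bound"] exI[of _ ?c] conjI) simp_all
    show "\<forall>x\<in>state_space. ((\<lambda>y. V M g x y / y) \<longlongrightarrow> 1) at_top"
    proof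
      fix x :: "'n mat \<times> 'n line" assume x: "x \<in> state_space"
      show "((\<lambda>y. V M g x y / y) \<longlongrightarrow> 1) at_top"
        by (rule st[OF x]) (simp add: V_eq V_vec_asymp)
    qed
    show "\<forall>x\<in>state_space. \<forall>y>0. (LINT \<omega>:survives M g x y 1|M.
      V M g (chain (\<lambda>k. g k \<omega>) x 1) (y + walk (\<lambda>k. g k \<omega>) x 1)) = V M g x y"
    proof (intro ballI allI impI)
      fix x :: "'n mat \<times> 'n line" and y assume x: "x \<in> state_space" and y: "0 < (y::real)"
      show "(LINT \<omega>:survives M g x y 1|M.
        V M g (chain (\<lambda>k. g k \<omega>) x 1) (y + walk (\<lambda>k. g k \<omega>) x 1)) = V M g x y"
        by (rule st[OF x]) (erule ssubst, rule V_step[OF _ y])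
    qed
  qed
qed

end
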